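(* Let $H$ be the Hopf algebra associated to a group datum $(G,\chi,g,1)$ of non-nilpotent type, as in the context. Let $\phi:r(H)\to G_0(H)$ be the natural ring epimorphism $[M]\mapsto\sum_{[V]}[M:V][V]$, let $\mathcal P$ be the ideal of $r(H)$ spanned by the classes of indecomposable projective $H$-modules, and let $\mathcal P^\perp=\{x\in r(H)\mid(x,y)=0\ \forall y\in\mathcal P\}$. Let $r(\Bbbk G)$ be the Green ring of the group algebra $\Bbbk G$. Then: (1) $\ker\phi=\mathcal P^\perp$, hence $G_0(H)\cong r(H)/\mathcal P^\perp$ as rings. (2) The Grothendieck ring $G_0(H)$ is isomorphic to the subring of $r(\Bbbk G)$ generated by $[V_i]$ and $(1+a+\cdots+a^{n-1})[V_j]$ for $i\in\Omega_0$ and $j\in\Omega_1$, where $a=[V_{\chi^{-1}}]$.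
   Context: $\Bbbk$ is an algebraically closed field of characteristic zero; modules are finite-dimensional left modules. Fix a finite group $G$, a $\Bbbk$-linear character $\chi$ of $G$ and a central element $g\in G$; let $n\ge 2$ be the order of $q=\chi(g)$, and assume $\chi^n=1$ and $g^n\neq 1$. $H$ is the Hopf algebra generated as an algebra by $y$ and $G$, with $\Bbbk G$ as a subalgebra and relations $y^n=g^n-1$, $yh=\chi(h)hy$ for $h\in G$; $\Delta(y)=y\otimes g+1\otimes y$, $\varepsilon(y)=0$, $S(y)=-yg^{-1}$, and the elements of $G$ are group-like. It has $\Bbbk$-basis $\{y^ih\mid h\in G,\ 0\le i\le n-1\}$. Let $\{V_i\mid i\in\Omega\}$ be a complete set of simple $\Bbbk G$-modules up to isomorphism; $g^n$ acts on $V_i$ by a scalar $\lambda_i$; $\Omega_0=\{i\mid\lambda_i=1\}$, $\Omega_1=\{i\mid\lambda_i\ne1\}$. $V_{\chi^{-1}}$ is the one-dimensional $\Bbbk G$-module with character $\chi^{-1}$. The Green ring $r(A)$ of a Hopf algebra $A$ is the abelian group generated by isomorphism classes $[M]$ of finite-dimensional $A$-modules modulo $[M\oplus N]=[M]+[N]$, with product $[M][N]=[M\otimes N]$; the Grothendieck ring $G_0(A)$ is defined in the same way but modulo all short exact sequences. $[M:V]$ is the multiplicity of the simple module $V$ in a composition series of $M$. For an $H$-module $M$, the dual $M^*=\mathrm{Hom}_\Bbbk(M,\Bbbk)$ is the $H$-module with $(hf)(v)=f(S(h)v)$. The $\mathbb Z$-bilinear form on $r(H)$ is determined by $([X],[Y])=\dim\mathrm{Hom}_H(X,Y^*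 )$; it is associative, symmetric and non-degenerate. *)

theory Defs
  imports
    "HOL-Algebra.Algebra"
    "HOL-Computational_Algebra.Polynomial"
    "HOL-Library.Poly_Mapping"
    "Jordan_Normal_Form.VS_Connect"
begin

section \<open>Finite-dimensional Hopf algebras\<close>

text \<open>
  A finite-dimensional Hopf algebra \<open>A\<close> over \<open>'k\<close> is given by its structure constants with respect
  to a basis indexed by the finite set \<open>hbasis A\<close>.  Elements of \<open>A\<close> are coefficient functions
  \<open>'b \<Rightarrow> 'k\<close> vanishing off \<open>hbasis A\<close>, elements of \<open>A \<otimes> A\<close> are coefficient functions
  \<open>'b \<times> 'b \<Rightarrow> 'k\<close>.  So \<open>hmult A a b c\<close> is the coefficient of the basis vector \<open>c\<close> in the product
  of the basis vectors \<open>a\<close> and \<open>b\<close>, and \<open>hcomult A a (p, q)\<close> is the coefficient of \<open>p \<otimes> q\<close> in the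
  coproduct of \<open>a\<close>.
\<close>

record ('b, 'k) hopf_data =
  hbasis :: "'b set"
  hmult :: "'b \<Rightarrow> 'b \<Rightarrow> 'b \<Rightarrow> 'k"
  hunit :: "'b \<Rightarrow> 'k"
  hcomult :: "'b \<Rightarrow> 'b \<times> 'b \<Rightarrow> 'k"
  hcounit :: "'b \<Rightarrow> 'k"
  hantipode :: "'b \<Rightarrow> 'b \<Rightarrow> 'k"

definition bvec :: "'b \<Rightarrow> 'b \<Rightarrow> 'k::field" where
  "bvec a = (\<lambda>c. if c = a then 1 else 0)"

definition prod_elt :: "('b, 'k::field) hopf_data \<Rightarrow> ('b \<Rightarrow> 'k) \<Rightarrow> ('b \<Rightarrow> 'k) \<Rightarrow> 'b \<Rightarrow> 'k" where
  "prod_elt A x z = (\<lambda>c. \<Sum>a\<in>hbasis A. \<Sum>b\<in>hbasis A. x a * z b * hmult A a b c)"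

fun pow_elt :: "('b, 'k::field) hopf_data \<Rightarrow> ('b \<Rightarrow> 'k) \<Rightarrow> nat \<Rightarrow> 'b \<Rightarrow> 'k" where
  "pow_elt A x 0 = hunit A"
| "pow_elt A x (Suc m) = prod_elt A x (pow_elt A x m)"

definition tensor_elt :: "('b \<Rightarrow> 'k::field) \<Rightarrow> ('b \<Rightarrow> 'k) \<Rightarrow> 'b \<times> 'b \<Rightarrow> 'k" where
  "tensor_elt x z = (\<lambda>(p, q). x p * z q)"

definition prod_tensor ::
  "('b, 'k::field) hopf_data \<Rightarrow> ('b \<times> 'b \<Rightarrow> 'k) \<Rightarrow> ('b \<times> 'b \<Rightarrow> 'k) \<Rightarrow> 'b \<times> 'b \<Rightarrow> 'k" where
  "prod_tensor A s t = (\<lambda>(c, c').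
     \<Sum>(a, a')\<in>hbasis A \<times> hbasis A. \<Sum>(b, b')\<in>hbasis A \<times> hbasis A.
       s (a, a') * t (b, b') * hmult A a b c * hmult A a' b' c')"

definition comult_elt :: "('b, 'k::field) hopf_data \<Rightarrow> ('b \<Rightarrow> 'k) \<Rightarrow> 'b \<times> 'b \<Rightarrow> 'k" where
  "comult_elt A x = (\<lambda>p. \<Sum>a\<in>hbasis A. x a * hcomult A a p)"

definition counit_elt :: "('b, 'k::field) hopf_data \<Rightarrow> ('b \<Rightarrow> 'k) \<Rightarrow> 'k" where
  "counit_elt A x = (\<Sum>a\<in>hbasis A. x a * hcounit A a)"

locale hopf_algebra =
  fixes A :: "('b, 'k::field) hopf_data"
  assumes finite_basis: "finite (hbasis A)"
    and mult_support: "\<lbrakk>a \<in> hbasis A; b \<in> hbasis A; c \<notin> hbasis A\<rbrakk> \<Longrightarrow> hmult A a b c = 0"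
    and unit_support: "c \<notin> hbasis A \<Longrightarrow> hunit A c = 0"
    and comult_support: "\<lbrakk>a \<in> hbasis A; pq \<notin> hbasis A \<times> hbasis A\<rbrakk> \<Longrightarrow> hcomult A a pq = 0"
    and antipode_support: "\<lbrakk>a \<in> hbasis A; c \<notin> hbasis A\<rbrakk> \<Longrightarrow> hantipode A a c = 0"
    and mult_assoc: "\<lbrakk>a \<in> hbasis A; b \<in> hbasis A; c \<in> hbasis A\<rbrakk> \<Longrightarrow>
      prod_elt A (hmult A a b) (bvec c) = prod_elt A (bvec a) (hmult A b c)"
    and unit_left: "a \<in> hbasis A \<Longrightarrow> prod_elt A (hunit A) (bvec a) = bvec a"
    and unit_right: "a \<in> hbasis A \<Longrightarrow> prod_elt A (bvec a) (hunit A) = bvec a"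
    and comult_coassoc: "\<lbrakk>a \<in> hbasis A; p \<in> hbasis A; q \<in> hbasis A; r \<in> hbasis A\<rbrakk> \<Longrightarrow>
      (\<Sum>s\<in>hbasis A. hcomult A a (s, r) * hcomult A s (p, q)) =
      (\<Sum>s\<in>hbasis A. hcomult A a (p, s) * hcomult A s (q, r))"
    and counit_left: "\<lbrakk>a \<in> hbasis A; c \<in> hbasis A\<rbrakk> \<Longrightarrow>
      (\<Sum>s\<in>hbasis A. hcounit A s * hcomult A a (s, c)) = bvec a c"
    and counit_right: "\<lbrakk>a \<in> hbasis A; c \<in> hbasis A\<rbrakk> \<Longrightarrow>
      (\<Sum>s\<in>hbasis A. hcomult A a (c, s) * hcounit A s) = bvec a c"
    and comult_mult: "\<lbrakk>a \<in> hbasis A; b \<in> hbasis A\<rbrakk> \<Longrightarrow>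
      comult_elt A (hmult A a b) = prod_tensor A (hcomult A a) (hcomult A b)"
    and comult_unit: "comult_elt A (hunit A) = tensor_elt (hunit A) (hunit A)"
    and counit_mult: "\<lbrakk>a \<in> hbasis A; b \<in> hbasis A\<rbrakk> \<Longrightarrow>
      counit_elt A (hmult A a b) = hcounit A a * hcounit A b"
    and counit_unit: "counit_elt A (hunit A) = 1"
    and antipode_left: "a \<in> hbasis A \<Longrightarrow>
      (\<lambda>c. \<Sum>p\<in>hbasis A. \<Sum>q\<in>hbasis A.
          hcomult A a (p, q) * prod_elt A (hantipode A p) (bvec q) c)
        = (\<lambda>c. hcounit A a * hunit A c)"
    and antipode_right: "a \<in> hbasis A \<Longrightarrow>
      (\<lambda>c. \<Sum>p\<in>hbasis A. \<Sum>q\<in>hbasis A.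
          hcomult A a (p, q) * prod_elt A (bvec p) (hantipode A q) c)
        = (\<lambda>c. hcounit A a * hunit A c)"

definition group_algebra :: "('g, 'm) monoid_scheme \<Rightarrow> ('g, 'k::field) hopf_data" where
  "group_algebra G = \<lparr>
     hbasis = carrier G,
     hmult = (\<lambda>a b. bvec (a \<otimes>\<^bsub>G\<^esub> b)),
     hunit = bvec \<one>\<^bsub>G\<^esub>,
     hcomult = (\<lambda>a. tensor_elt (bvec a) (bvec a)),
     hcounit = (\<lambda>a. 1),
     hantipode = (\<lambda>a. bvec (inv\<^bsub>G\<^esub> a))\<rparr>"


section \<open>The Hopf algebra of a group datum of non-nilpotent type\<close>

text \<open>
  The basis vector of index \<open>(i, h)\<close> is \<open>y\<^sup>i h\<close>; in particular \<open>y\<close> is the basis vector of index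
  \<open>(1, \<one>)\<close>, and \<open>h\<close> embeds into the algebra as the basis vector of index \<open>(0, h)\<close>.
\<close>

abbreviation gen_y :: "('g, 'm) monoid_scheme \<Rightarrow> nat \<times> 'g \<Rightarrow> 'k::field" where
  "gen_y G \<equiv> bvec (1, \<one>\<^bsub>G\<^esub>)"

abbreviation emb :: "'g \<Rightarrow> nat \<times> 'g \<Rightarrow> 'k::field" where
  "emb h \<equiv> bvec (0, h)"

locale group_datum =
  fixes G :: "('g, 'm) monoid_scheme" (structure)
    and \<chi> :: "'g \<Rightarrow> 'k::field"
    and g :: 'g
    and n :: nat
  assumes group_G: "group G"
    and finite_G: "finite (carrier G)"
    and char_one: "\<chi> \<one> = 1"
    and char_mult: "\<lbrakk>h \<in> carrier G; h' \<in> carrier G\<rbrakk> \<Longrightarrow> \<chi> (h \<otimes> h') = \<chi> h * \<chi> h'"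
    and g_closed: "g \<in> carrier G"
    and g_central: "h \<in> carrier G \<Longrightarrow> g \<otimes> h = h \<otimes> g"
    and n_ge_2: "2 \<le> n"
    and q_pow_n: "\<chi> g ^ n = 1"
    and q_order: "\<lbrakk>0 < m; m < n\<rbrakk> \<Longrightarrow> \<chi> g ^ m \<noteq> 1"
    and char_pow_n: "h \<in> carrier G \<Longrightarrow> \<chi> h ^ n = 1"
    and g_pow_n: "g [^] n \<noteq> \<one>"

locale group_datum_hopf =
  group_datum G \<chi> g n + hopf_algebra H
  for G :: "('g, 'm) monoid_scheme" (structure)
    and \<chi> :: "'g \<Rightarrow> 'k::field"
    and g :: 'g
    and n :: nat
    and H :: "(nat \<times> 'g, 'k) hopf_data" +
  assumes basis_H: "hbasis H = {..<n} \<times> carrier G"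
    and basis_vec: "\<lbrakk>i < n; h \<in> carrier G\<rbrakk> \<Longrightarrow>
      bvec (i, h) = prod_elt H (pow_elt H (gen_y G) i) (emb h)"
    and emb_one: "hunit H = emb \<one>"
    and emb_mult: "\<lbrakk>h \<in> carrier G; h' \<in> carrier G\<rbrakk> \<Longrightarrow>
      prod_elt H (emb h) (emb h') = emb (h \<otimes> h')"
    and rel_power: "pow_elt H (gen_y G) n = (\<lambda>b. emb (g [^] n) b - hunit H b)"
    and rel_commute: "h \<in> carrier G \<Longrightarrow>
      prod_elt H (gen_y G) (emb h) = (\<lambda>b. \<chi> h * prod_elt H (emb h) (gen_y G) b)"
    and comult_y: "hcomult H (1, \<one>) =
      (\<lambda>p. tensor_elt (gen_y G) (emb g) p + tensor_elt (hunit H) (gen_y G) p)"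
    and counit_y: "hcounit H (1, \<one>) = 0"
    and antipode_y: "hantipode H (1, \<one>) = (\<lambda>b. - prod_elt H (gen_y G) (emb (inv g)) b)"
    and comult_emb: "h \<in> carrier G \<Longrightarrow> hcomult H (0, h) = tensor_elt (emb h) (emb h)"
    and counit_emb: "h \<in> carrier G \<Longrightarrow> hcounit H (0, h) = 1"
    and antipode_emb: "h \<in> carrier G \<Longrightarrow> hantipode H (0, h) = emb (inv h)"


section \<open>Finite-dimensional modules\<close>

text \<open>
  Up to isomorphism a finite-dimensional module has underlying space \<open>'k\<^sup>d\<close>, so it is given by its
  dimension and the matrices by which the basis vectors of the algebra act on column vectors.  Only
  the matrices at indices in \<open>hbasis A\<close> matter.
\<close>

record ('b, 'k) rep =
  rdim :: nat
  ract :: "'b \<Rightarrow> 'k mat"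

definition act_elt :: "('b, 'k::field) hopf_data \<Rightarrow> ('b, 'k) rep \<Rightarrow> ('b \<Rightarrow> 'k) \<Rightarrow> 'k mat" where
  "act_elt A M x = mat (rdim M) (rdim M) (\<lambda>ij. \<Sum>b\<in>hbasis A. x b * ract M b $$ ij)"

definition is_module :: "('b, 'k::field) hopf_data \<Rightarrow> ('b, 'k) rep \<Rightarrow> bool" where
  "is_module A M \<longleftrightarrow>
     (\<forall>a\<in>hbasis A. ract M a \<in> carrier_mat (rdim M) (rdim M)) \<and>
     act_elt A M (hunit A) = 1\<^sub>m (rdim M) \<and>
     (\<forall>a\<in>hbasis A. \<forall>b\<in>hbasis A. act_elt A M (hmult A a b) = ract M a * ract M b)"

definition Hom_mod :: "('b, 'k::field) hopf_data \<Rightarrow> ('b, 'k) rep \<Rightarrow> ('b, 'k) rep \<Rightarrow> 'k mat set" where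
  "Hom_mod A M N =
     {T \<in> carrier_mat (rdim N) (rdim M). \<forall>a\<in>hbasis A. T * ract M a = ract N a * T}"

definition dim_Hom :: "('b, 'k::field) hopf_data \<Rightarrow> ('b, 'k) rep \<Rightarrow> ('b, 'k) rep \<Rightarrow> nat" where
  "dim_Hom A M N =
     vectorspace.dim class_ring ((module_mat TYPE('k) (rdim N) (rdim M))\<lparr>carrier := Hom_mod A M N\<rparr>)"

definition iso_mod :: "('b, 'k::field) hopf_data \<Rightarrow> ('b, 'k) rep \<Rightarrow> ('b, 'k) rep \<Rightarrow> bool" where
  "iso_mod A M N \<longleftrightarrow>
     (\<exists>T\<in>Hom_mod A M N. \<exists>U\<in>Hom_mod A N M. U * T = 1\<^sub>m (rdim M) \<and> T * U = 1\<^sub>m (rdim N))"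

definition inj_hom :: "'k::field mat \<Rightarrow> bool" where
  "inj_hom T \<longleftrightarrow> inj_on (\<lambda>v. T *\<^sub>v v) (carrier_vec (dim_col T))"

definition surj_hom :: "'k::field mat \<Rightarrow> bool" where
  "surj_hom T \<longleftrightarrow> (\<lambda>v. T *\<^sub>v v) ` carrier_vec (dim_col T) = carrier_vec (dim_row T)"

definition short_exact ::
  "('b, 'k::field) hopf_data \<Rightarrow> ('b, 'k) rep \<Rightarrow> ('b, 'k) rep \<Rightarrow> ('b, 'k) rep \<Rightarrow> bool" where
  "short_exact A L M N \<longleftrightarrow>
     (\<exists>S\<in>Hom_mod A L M. \<exists>T\<in>Hom_mod A M N. inj_hom S \<and> surj_hom T \<and>
        (\<lambda>v. S *\<^sub>v v) ` carrier_vec (rdim L) = {v \<in> carrier_vec (rdim M). T *\<^sub>v v = 0\<^sub>v (rdim N)})"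

definition dsum_mod :: "('b, 'k::field) rep \<Rightarrow> ('b, 'k) rep \<Rightarrow> ('b, 'k) rep" where
  "dsum_mod M N = \<lparr>
     rdim = rdim M + rdim N,
     ract = (\<lambda>a. four_block_mat (ract M a) (0\<^sub>m (rdim M) (rdim N))
                                (0\<^sub>m (rdim N) (rdim M)) (ract N a))\<rparr>"

text \<open>The basis vector \<open>e\<^sub>i \<otimes> e\<^sub>j\<close> of a tensor product with \<open>N\<close> has position \<open>i * rdim N + j\<close>.\<close>

definition tensor_mod ::
  "('b, 'k::field) hopf_data \<Rightarrow> ('b, 'k) rep \<Rightarrow> ('b, 'k) rep \<Rightarrow> ('b, 'k) rep" where
  "tensor_mod A M N = \<lparr>
     rdim = rdim M * rdim N,
     ract = (\<lambda>a. mat (rdim M * rdim N) (rdim M * rdim N) (\<lambda>(i, j).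
       \<Sum>(p, q)\<in>hbasis A \<times> hbasis A. hcomult A a (p, q) *
         ract M p $$ (i div rdim N, j div rdim N) * ract N q $$ (i mod rdim N, j mod rdim N)))\<rparr>"

definition trivial_mod :: "('b, 'k::field) hopf_data \<Rightarrow> ('b, 'k) rep" where
  "trivial_mod A = \<lparr>rdim = 1, ract = (\<lambda>a. mat 1 1 (\<lambda>_. hcounit A a))\<rparr>"

text \<open>Functionals are written as column vectors in the dual basis, hence the transpose.\<close>

definition dual_mod :: "('b, 'k::field) hopf_data \<Rightarrow> ('b, 'k) rep \<Rightarrow> ('b, 'k) rep" where
  "dual_mod A M = \<lparr>
     rdim = rdim M,
     ract = (\<lambda>a. transpose_mat (act_elt A M (hantipode A a)))\<rparr>"

definition is_submodule :: "('b, 'k::field) hopf_data \<Rightarrow> ('b, 'k) rep \<Rightarrow> 'k vec set \<Rightarrow> bool" where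
  "is_submodule A M W \<longleftrightarrow>
     subspace class_ring W (module_vec TYPE('k) (rdim M)) \<and>
     (\<forall>a\<in>hbasis A. \<forall>w\<in>W. ract M a *\<^sub>v w \<in> W)"

definition simple_mod :: "('b, 'k::field) hopf_data \<Rightarrow> ('b, 'k) rep \<Rightarrow> bool" where
  "simple_mod A M \<longleftrightarrow> is_module A M \<and> rdim M \<noteq> 0 \<and>
     (\<forall>W. is_submodule A M W \<longrightarrow> W = {0\<^sub>v (rdim M)} \<or> W = carrier_vec (rdim M))"

definition indecomposable_mod :: "('b, 'k::field) hopf_data \<Rightarrow> ('b, 'k) rep \<Rightarrow> bool" where
  "indecomposable_mod A M \<longleftrightarrow> is_module A M \<and> rdim M \<noteq> 0 \<and>
     (\<forall>L N. is_module A L \<and> is_module A N \<and> iso_mod A M (dsum_mod L N) \<longrightarrow> rdim L = 0 \<or> rdim N = 0)"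

definition projective_mod :: "('b, 'k::field) hopf_data \<Rightarrow> ('b, 'k) rep \<Rightarrow> bool" where
  "projective_mod A P \<longleftrightarrow> is_module A P \<and>
     (\<forall>M N. \<forall>T\<in>Hom_mod A M N. \<forall>U\<in>Hom_mod A P N.
        is_module A M \<and> is_module A N \<and> surj_hom T \<longrightarrow> (\<exists>V\<in>Hom_mod A P M. T * V = U))"

text \<open>
  \<open>composition_series A M Vs\<close>: there is a chain of submodules of \<open>M\<close> from \<open>M\<close> down to \<open>0\<close> whose
  successive quotients are, from the top, the simple modules \<open>Vs\<close>.
\<close>

inductive composition_series :: "('b, 'k::field) hopf_data \<Rightarrow> ('b, 'k) rep \<Rightarrow> ('b, 'k) rep list \<Rightarrow> bool"
  for A where
  zero_dim: "\<lbrakk>is_module A M; rdim M = 0\<rbrakk> \<Longrightarrow> composition_series A M []"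
| step: "\<lbrakk>is_module A M; simple_mod A V; short_exact A N M V; composition_series A N Vs\<rbrakk>
         \<Longrightarrow> composition_series A M (V # Vs)"

definition multiplicity_in :: "('b, 'k::field) hopf_data \<Rightarrow> ('b, 'k) rep \<Rightarrow> ('b, 'k) rep \<Rightarrow> nat" where
  "multiplicity_in A M V =
     length (filter (\<lambda>W. iso_mod A W V) (SOME Vs. composition_series A M Vs))"


section \<open>Green ring and Grothendieck ring\<close>

definition iso_class :: "('b, 'k::field) hopf_data \<Rightarrow> ('b, 'k) rep \<Rightarrow> ('b, 'k) rep set" where
  "iso_class A M = {N. is_module A N \<and> iso_mod A M N}"

definition iso_classes :: "('b, 'k::field) hopf_data \<Rightarrow> ('b, 'k) rep set set" where
  "iso_classes A = iso_class A ` {M. is_module A M}"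

definition simple_classes :: "('b, 'k::field) hopf_data \<Rightarrow> ('b, 'k) rep set set" where
  "simple_classes A = iso_class A ` {M. simple_mod A M}"

definition some_rep :: "('b, 'k) rep set \<Rightarrow> ('b, 'k) rep" where
  "some_rep C = (SOME M. M \<in> C)"

text \<open>The free abelian group on the isomorphism classes, with the bilinear product induced by the
  tensor product.\<close>

definition free_class_ring ::
  "('b, 'k::field) hopf_data \<Rightarrow> (('b, 'k) rep set \<Rightarrow>\<^sub>0 int) ring" where
  "free_class_ring A = \<lparr>
     carrier = {f. Poly_Mapping.keys f \<subseteq> iso_classes A},
     monoid.mult = (\<lambda>f f'. frag_extend (\<lambda>C. frag_extend (\<lambda>D.
               frag_of (iso_class A (tensor_mod A (some_rep C) (some_rep D)))) f') f),
     one = frag_of (iso_class A (trivial_mod A)),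
     ring.zero = 0,
     ring.add = (+)\<rparr>"

definition split_relations :: "('b, 'k::field) hopf_data \<Rightarrow> (('b, 'k) rep set \<Rightarrow>\<^sub>0 int) set" where
  "split_relations A = generate (add_monoid (free_class_ring A))
     {frag_of (iso_class A (dsum_mod M N)) - frag_of (iso_class A M) - frag_of (iso_class A N)
       | M N. is_module A M \<and> is_module A N}"

definition exact_relations :: "('b, 'k::field) hopf_data \<Rightarrow> (('b, 'k) rep set \<Rightarrow>\<^sub>0 int) set" where
  "exact_relations A = generate (add_monoid (free_class_ring A))
     {frag_of (iso_class A M) - frag_of (iso_class A L) - frag_of (iso_class A N)
       | L M N. is_module A L \<and> is_module A M \<and> is_module A N \<and> short_exact A L M N}"

definition green_ring ::
  "('b, 'k::field) hopf_data \<Rightarrow> (('b, 'k) rep set \<Rightarrow>\<^sub>0 int) set ring" where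
  "green_ring A = free_class_ring A Quot split_relations A"

definition grothendieck_ring ::
  "('b, 'k::field) hopf_data \<Rightarrow> (('b, 'k) rep set \<Rightarrow>\<^sub>0 int) set ring" where
  "grothendieck_ring A = free_class_ring A Quot exact_relations A"

definition green_class ::
  "('b, 'k::field) hopf_data \<Rightarrow> ('b, 'k) rep \<Rightarrow> (('b, 'k) rep set \<Rightarrow>\<^sub>0 int) set" where
  "green_class A M = split_relations A +>\<^bsub>free_class_ring A\<^esub> frag_of (iso_class A M)"

text \<open>
  The map sending \<open>[M]\<close> to the sum of all \<open>[M : V] [V]\<close>, extended additively to representatives and then to residue
  classes; the union identifies the results for all representatives of a residue class.
\<close>

definition composition_sum ::
  "('b, 'k::field) hopf_data \<Rightarrow> ('b, 'k) rep set \<Rightarrow> ('b, 'k) rep set \<Rightarrow>\<^sub>0 int" where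
  "composition_sum A C =
     (\<Sum>D\<in>{D \<in> simple_classes A. multiplicity_in A (some_rep C) (some_rep D) \<noteq> 0}.
        frag_cmul (int (multiplicity_in A (some_rep C) (some_rep D))) (frag_of D))"

definition natural_map ::
  "('b, 'k::field) hopf_data \<Rightarrow> (('b, 'k) rep set \<Rightarrow>\<^sub>0 int) set \<Rightarrow> (('b, 'k) rep set \<Rightarrow>\<^sub>0 int) set" where
  "natural_map A x =
     (\<Union>f\<in>x. exact_relations A +>\<^bsub>free_class_ring A\<^esub> frag_extend (composition_sum A) f)"

definition free_form ::
  "('b, 'k::field) hopf_data \<Rightarrow> (('b, 'k) rep set \<Rightarrow>\<^sub>0 int) \<Rightarrow> (('b, 'k) rep set \<Rightarrow>\<^sub>0 int) \<Rightarrow> int" where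
  "free_form A f f' = (\<Sum>C\<in>Poly_Mapping.keys f. \<Sum>D\<in>Poly_Mapping.keys f'.
     Poly_Mapping.lookup f C * Poly_Mapping.lookup f' D *
       int (dim_Hom A (some_rep C) (dual_mod A (some_rep D))))"

definition green_form ::
  "('b, 'k::field) hopf_data \<Rightarrow> (('b, 'k) rep set \<Rightarrow>\<^sub>0 int) set \<Rightarrow> (('b, 'k) rep set \<Rightarrow>\<^sub>0 int) set \<Rightarrow> int"
  where "green_form A x z = (THE m. \<forall>f\<in>x. \<forall>f'\<in>z. free_form A f f' = m)"

definition projective_ideal ::
  "('b, 'k::field) hopf_data \<Rightarrow> (('b, 'k) rep set \<Rightarrow>\<^sub>0 int) set set" where
  "projective_ideal A = generate (add_monoid (green_ring A))
     {green_class A P | P. indecomposable_mod A P \<and> projective_mod A P}"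

definition projective_perp ::
  "('b, 'k::field) hopf_data \<Rightarrow> (('b, 'k) rep set \<Rightarrow>\<^sub>0 int) set set" where
  "projective_perp A =
     {x \<in> carrier (green_ring A). \<forall>z\<in>projective_ideal A. green_form A x z = 0}"


section \<open>Simple modules over the group algebra\<close>

definition complete_simples ::
  "('b, 'k::field) hopf_data \<Rightarrow> 'i set \<Rightarrow> ('i \<Rightarrow> ('b, 'k) rep) \<Rightarrow> bool" where
  "complete_simples A \<Omega> V \<longleftrightarrow>
     (\<forall>i\<in>\<Omega>. simple_mod A (V i)) \<and>
     (\<forall>M. simple_mod A M \<longrightarrow> (\<exists>!i. i \<in> \<Omega> \<and> iso_mod A M (V i)))"

definition inv_char_mod :: "('g \<Rightarrow> 'k::field) \<Rightarrow> ('g, 'k) rep" where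
  "inv_char_mod \<chi> = \<lparr>rdim = 1, ract = (\<lambda>h. mat 1 1 (\<lambda>_. inverse (\<chi> h)))\<rparr>"

definition subring_generators ::
  "('g, 'm) monoid_scheme \<Rightarrow> ('g \<Rightarrow> 'k::field) \<Rightarrow> nat \<Rightarrow> 'i set \<Rightarrow> ('i \<Rightarrow> ('g, 'k) rep) \<Rightarrow> ('i \<Rightarrow> 'k) \<Rightarrow>
     (('g, 'k) rep set \<Rightarrow>\<^sub>0 int) set set" where
  "subring_generators G \<chi> n \<Omega> V lam =
     (let R = green_ring (group_algebra G);
          a = green_class (group_algebra G) (inv_char_mod \<chi>)
      in {green_class (group_algebra G) (V i) | i. i \<in> \<Omega> \<and> lam i = 1} \<union>
         {(\<Oplus>\<^bsub>R\<^esub>k\<in>{..<n}. a [^]\<^bsub>R\<^esub> k) \<otimes>\<^bsub>R\<^esub> green_class (group_algebra G) (V j)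
           | j. j \<in> \<Omega> \<and> lam j \<noteq> 1})"

end

theory Submission
  imports Defs "Jordan_Normal_Form.Gauss_Jordan_Elimination" "Jordan_Normal_Form.DL_Rank"
begin

text \<open>
  The whole argument compares \<open>H\<close> with \<open>kG\<close>.  Splitting an \<open>H\<close>-module \<open>M\<close> by the eigenvalues of \<open>g\<close>, the
  eigenvalues \<open>x\<close> with \<open>x\<^sup>n \<noteq> 1\<close> contribute a module induced from \<open>kG\<close> (there \<open>y\<close> is invertible and permutes
  the eigenspaces in cycles of length \<open>n\<close>), while on the remaining part \<open>y\<close> is nilpotent, so that up to exact
  sequences it may be replaced by \<open>0\<close>.  Hence \<open>[M]\<close> in \<open>G\<^sub>0(H)\<close> depends only on the restriction of \<open>M\<close> to \<open>G\<close>,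
  i.e. restriction embeds \<open>G\<^sub>0(H)\<close> into \<open>r(kG)\<close>.  Its image is spanned by the classes \<open>[V\<^sub>i]\<close> with
  \<open>\<lambda>\<^sub>i = 1\<close> and the restrictions \<open>(1 + a + \<cdots> + a\<^sup>n\<^sup>-\<^sup>1)[V\<^sub>j]\<close> of induced modules.

  For the perpendicular space, \<open>Hom\<^sub>H(M, (Ind U)\<^sup>*)\<close> is isomorphic to \<open>Hom\<^sub>G(M, U\<^sup>*)\<close>.  Pairing
  with the projective modules \<open>Ind U\<close> therefore determines the restriction of \<open>M\<close>, and it is additive on exact
  sequences because \<open>kG\<close> is semisimple; every projective module is a direct summand of an induced one.
\<close>

section \<open>Matrix arithmetic\<close>

text \<open>Since \<open>y g = q g y\<close>, the operator \<open>y\<close> sends the eigenspace of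
  \<open>g\<close> for \<open>x\<close> into the one for \<open>x / q\<close>, and
  \<open>y^n\<close> acts on it by the scalar \<open>x^n - 1\<close>. As \<open>q\<close> has order
  exactly \<open>n\<close>, an eigenvalue with \<open>x^n\<close> different from 1 lies in an orbit
  of \<open>n\<close> eigenvalues between which \<open>y\<close> is bijective; the eigenspace of one
  chosen member of the orbit then generates an induced module. The duals carry two obstacles. The
  antipode is prescribed on generators only, so its effect on a whole module is determined by the
  uniqueness of convolution inverses. And its square is not the identity, so transposing a map into
  a dual gives a map into the dual formed with the inverse antipode; Frobenius reciprocity is
  applied there. For a projective module that is only a summand of an induced one, exactness gives
  an inequality of Hom dimensions; adding the inequality for the complement forces equality.
  Elements of the rings are written as differences of two modules, and modules over
  \<open>kG\<close> are compared through dimensions of Hom spaces.\<close>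

lemma mat_assoc:
  "dim_col A = dim_row B \<Longrightarrow> dim_col B = dim_row C \<Longrightarrow> A * B * C = A * (B * C :: 'a::semiring_0 mat)"
  by (rule assoc_mult_mat[of _ "dim_row A" "dim_row B" _ "dim_row C" _ "dim_col C"]) auto

text \<open>This and the neighbouring laws have equations between dimensions as side conditions, not
  memberships in \<open>carrier_mat\<close>, so that rewriting can discharge them from a list of
  \<open>dim_row\<close> and \<open>dim_col\<close> facts.\<close>

lemma mat_assoc_vec:
  "dim_col A = dim_row B \<Longrightarrow> dim_col B = dim_vec v \<Longrightarrow> A * B *\<^sub>v v = A *\<^sub>v (B *\<^sub>v v :: 'a::semiring_0 vec)"
  by (rule assoc_mult_mat_vec[of _ "dim_row A" "dim_row B" _ "dim_vec v"]) auto

lemma mat_distrib_left: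
  "dim_col A = dim_row B \<Longrightarrow> dim_row B = dim_row C \<Longrightarrow> dim_col B = dim_col C \<Longrightarrow>
    A * (B + C) = A * B + A * (C :: 'a::semiring_0 mat)"
  by (rule mult_add_distrib_mat[of _ "dim_row A" "dim_row B" _ "dim_col C"]) auto

lemma mat_distrib_right:
  "dim_col A = dim_row C \<Longrightarrow> dim_row A = dim_row B \<Longrightarrow> dim_col A = dim_col B \<Longrightarrow>
    (A + B) * C = A * C + B * (C :: 'a::semiring_0 mat)"
  by (rule add_mult_distrib_mat[of _ "dim_row A" "dim_row C" _ _ "dim_col C"]) auto

lemma mat_diff_distrib_left:
  "dim_col A = dim_row B \<Longrightarrow> dim_row B = dim_row C \<Longrightarrow> dim_col B = dim_col C \<Longrightarrow>
    A * (B - C) = A * B - A * (C :: 'a::ring mat)"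
  by (rule mult_minus_distrib_mat[of _ "dim_row A" "dim_row B" _ "dim_col C"]) auto

lemma mat_diff_distrib_right:
  "dim_col A = dim_row C \<Longrightarrow> dim_row A = dim_row B \<Longrightarrow> dim_col A = dim_col B \<Longrightarrow>
    (A - B) * C = A * C - B * (C :: 'a::ring mat)"
  by (rule minus_mult_distrib_mat[of _ "dim_row A" "dim_row C" _ _ "dim_col C"]) auto

lemma mat_smult_left: "dim_col A = dim_row B \<Longrightarrow> (c \<cdot>\<^sub>m A) * B = c \<cdot>\<^sub>m (A * B :: 'a::comm_semiring_0 mat)"
  by (rule mult_smult_assoc_mat[of _ "dim_row A" "dim_col A" _ "dim_col B"]) auto

lemma mat_smult_right: "dim_col A = dim_row B \<Longrightarrow> A * (c \<cdot>\<^sub>m B) = c \<cdot>\<^sub>m (A * B :: 'a::comm_semiring_0 mat)"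
  by (rule mult_smult_distrib[of _ "dim_row A" "dim_col A" _ "dim_col B"]) auto

lemma mat_transpose_mult: "dim_col A = dim_row B \<Longrightarrow> transpose_mat (A * B) = transpose_mat B * transpose_mat (A :: 'a::comm_semiring_0 mat)"
  by (rule transpose_mult[of _ "dim_row A" "dim_col A" _ "dim_col B"]) auto

lemma mat_zero_left: "dim_row A = m \<Longrightarrow> 0\<^sub>m n m * A = 0\<^sub>m n (dim_col (A :: 'a::semiring_0 mat))"
  by (rule left_mult_zero_mat) auto

lemma mat_zero_right: "dim_col A = m \<Longrightarrow> A * 0\<^sub>m m n = 0\<^sub>m (dim_row (A :: 'a::semiring_0 mat)) n"
  by (rule right_mult_zero_mat) auto

lemma mat_add_zero_left: "dim_row A = n \<Longrightarrow> dim_col A = m \<Longrightarrow> 0\<^sub>m n m + A = (A :: 'a::monoid_add mat)"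
  by (rule left_add_zero_mat) auto

lemma mat_add_zero_right: "dim_row A = n \<Longrightarrow> dim_col A = m \<Longrightarrow> A + 0\<^sub>m n m = (A :: 'a::monoid_add mat)"
  by (rule right_add_zero_mat) auto

lemma mat_diff_zero: "dim_row A = n \<Longrightarrow> dim_col A = m \<Longrightarrow> A - 0\<^sub>m n m = (A :: 'a::group_add mat)"
  by auto

lemma mat_diff_self: "dim_row A = n \<Longrightarrow> dim_col A = m \<Longrightarrow> A - A = (0\<^sub>m n m :: 'a::group_add mat)"
  by auto

lemma mat_eq_by_vec:
  assumes "A \<in> carrier_mat n m" "B \<in> carrier_mat n m"
    and "\<And>v. v \<in> carrier_vec m \<Longrightarrow> A *\<^sub>v v = B *\<^sub>v (v :: 'a::semiring_1 vec)"
  shows "A = B"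
proof (rule mat_col_eqI)
  fix j assume "j < dim_col B"
  then have j: "j < m" using assms by auto
  have "A *\<^sub>v unit_vec m j = B *\<^sub>v unit_vec m j" by (rule assms(3)) auto
  moreover have "A *\<^sub>v unit_vec m j = col A j" "B *\<^sub>v unit_vec m j = col B j"
    using assms j by (auto intro!: eq_vecI simp: mult_mat_vec_def)
  ultimately show "col A j = col B j" by simp
qed (use assms in auto)

text \<open>Matrices of all shapes share one type, so a sum has to be told its shape; an empty sum
  is then the zero matrix of that shape.\<close>

definition msum :: "nat \<Rightarrow> nat \<Rightarrow> ('s \<Rightarrow> 'a::comm_monoid_add mat) \<Rightarrow> 's set \<Rightarrow> 'a mat" where
  "msum n m f S = mat n m (\<lambda>ij. \<Sum>s\<in>S. f s $$ ij)"

lemma msum_dim [simp]: "dim_row (msum n m f S) = n" "dim_col (msum n m f S) = m"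
  and msum_carrier [simp]: "msum n m f S \<in> carrier_mat n m"
  by (auto simp: msum_def)

lemma msum_index [simp]: "i < n \<Longrightarrow> j < m \<Longrightarrow> msum n m f S $$ (i, j) = (\<Sum>s\<in>S. f s $$ (i, j))"
  by (simp add: msum_def)

lemma msum_cong: "S = S' \<Longrightarrow> (\<And>s. s \<in> S' \<Longrightarrow> f s = f' s) \<Longrightarrow> msum n m f S = msum n m f' S'"
  by (auto simp: msum_def cong: sum.cong)

lemma msum_mult_left:
  fixes A :: "'a::semiring_0 mat"
  assumes "\<And>s. s \<in> S \<Longrightarrow> f s \<in> carrier_mat n m" "dim_col A = n"
  shows "A * msum n m f S = msum (dim_row A) m (\<lambda>s. A * f s) S"
proof (rule eq_matI)
  fix i j assume "i < dim_row (msum (dim_row A) m (\<lambda>s. A * f s) S)" "j < dim_col (msum (dim_row A) m (\<lambda>s. A * f s) S)"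
  then have ij: "i < dim_row A" "j < m" by auto
  have "(A * msum n m f S) $$ (i, j) = (\<Sum>k<n. A $$ (i, k) * (\<Sum>s\<in>S. f s $$ (k, j)))"
    using ij assms by (simp add: scalar_prod_def lessThan_atLeast0)
  also have "\<dots> = (\<Sum>s\<in>S. \<Sum>k<n. A $$ (i, k) * f s $$ (k, j))"
    by (simp add: sum_distrib_left) (rule sum.swap)
  also have "\<dots> = (\<Sum>s\<in>S. (A * f s) $$ (i, j))"
    by (rule sum.cong) (use ij assms in \<open>auto simp: scalar_prod_def lessThan_atLeast0 dest!: assms(1)\<close>)
  finally show "(A * msum n m f S) $$ (i, j) = msum (dim_row A) m (\<lambda>s. A * f s) S $$ (i, j)"
    using ij by simp
qed auto

lemma msum_mult_right:
  fixes A :: "'a::semiring_0 mat"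
  assumes "\<And>s. s \<in> S \<Longrightarrow> f s \<in> carrier_mat n m" "dim_row A = m"
  shows "msum n m f S * A = msum n (dim_col A) (\<lambda>s. f s * A) S"
proof (rule eq_matI)
  fix i j assume "i < dim_row (msum n (dim_col A) (\<lambda>s. f s * A) S)" "j < dim_col (msum n (dim_col A) (\<lambda>s. f s * A) S)"
  then have ij: "i < n" "j < dim_col A" by auto
  have "(msum n m f S * A) $$ (i, j) = (\<Sum>k<m. (\<Sum>s\<in>S. f s $$ (i, k)) * A $$ (k, j))"
    using ij assms by (simp add: scalar_prod_def lessThan_atLeast0)
  also have "\<dots> = (\<Sum>s\<in>S. \<Sum>k<m. f s $$ (i, k) * A $$ (k, j))"
    by (simp add: sum_distrib_right) (rule sum.swap)
  also have "\<dots> = (\<Sum>s\<in>S. (f s * A) $$ (i, j))"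
    by (rule sum.cong) (use ij assms in \<open>auto simp: scalar_prod_def lessThan_atLeast0 dest!: assms(1)\<close>)
  finally show "(msum n m f S * A) $$ (i, j) = msum n (dim_col A) (\<lambda>s. f s * A) S $$ (i, j)"
    using ij by simp
qed auto

lemma msum_smult:
  fixes f :: "'s \<Rightarrow> 'a::semiring_0 mat"
  assumes "\<And>s. s \<in> S \<Longrightarrow> f s \<in> carrier_mat n m"
  shows "c \<cdot>\<^sub>m msum n m f S = msum n m (\<lambda>s. c \<cdot>\<^sub>m f s) S"
  by (rule eq_matI) (auto simp: sum_distrib_left intro!: sum.cong dest!: assms)

lemma msum_delta:
  assumes "finite S" "a \<in> S" "f a \<in> carrier_mat n m" "\<And>s. s \<in> S \<Longrightarrow> s \<noteq> a \<Longrightarrow> f s = 0\<^sub>m n m"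
  shows "msum n m f S = f a"
proof (rule eq_matI)
  fix i j assume "i < dim_row (f a)" "j < dim_col (f a)"
  then have ij: "i < n" "j < m" using assms by auto
  have "(\<Sum>s\<in>S. f s $$ (i, j)) = (\<Sum>s\<in>S. if s = a then f a $$ (i, j) else 0)"
    using ij assms(4) by (auto intro!: sum.cong)
  then show "msum n m f S $$ (i, j) = f a $$ (i, j)" using ij assms(1,2) by simp
qed (use assms in auto)

lemma msum_reindex: "bij_betw h S T \<Longrightarrow> msum n m (\<lambda>s. f (h s)) S = msum n m f T"
  unfolding msum_def by (intro cong_mat refl) (rule sum.reindex_bij_betw)

lemma msum_const:
  fixes A :: "'a::semiring_1 mat"
  assumes "A \<in> carrier_mat n m"
  shows "msum n m (\<lambda>s. A) S = of_nat (card S) \<cdot>\<^sub>m A"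
  by (rule eq_matI) (use assms in auto)

text \<open>The reduced echelon form \<open>E\<close> of \<open>T\<close> has its nonzero rows on
  top. Keeping only these gives \<open>C\<close>, for which the pivot columns provide a right
  inverse; undoing the row operations gives \<open>B\<close>. Kernels, images, complements and
  one-sided inverses are all obtained from this factorization.\<close>

lemma rank_factorization:
  fixes T :: "'a::field mat"
  assumes T: "T \<in> carrier_mat n m"
  obtains r B B' C C' where "B \<in> carrier_mat n r" "B' \<in> carrier_mat r n" "C \<in> carrier_mat r m"
    "C' \<in> carrier_mat m r" "T = B * C" "B' * B = 1\<^sub>m r" "C * C' = 1\<^sub>m r"
proof -
  define E where "E = gauss_jordan_single T"
  from gauss_jordan_single[OF T, of E] E_def obtain P Q where E: "E \<in> carrier_mat n m" "row_echelon_form E"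
    and PQ: "E = P * T" "P \<in> carrier_mat n n" "Q \<in> carrier_mat n n" "P * Q = 1\<^sub>m n" "Q * P = 1\<^sub>m n"
    by auto
  from E obtain f where "pivot_fun E f m" unfolding row_echelon_form_def by auto
  note f = pivot_funD[OF _ this, of n]
  have d: "dim_row E = n" using E by auto
  define r where "r = card {i. i < n \<and> f i < m}"
  have down: "f i < m" if "Suc i < n" "f (Suc i) < m" for i
    using f(3)[OF d, of i] that by auto
  have down': "f i < m" if "i \<le> j" "j < n" "f j < m" for i j
    using that
  proof (induction j)
    case (Suc j)
    then show ?case using down[of j] by (cases "i = Suc j") auto
  qed auto
  \<comment> \<open>Pivot positions strictly increase until they reach the value \<open>m\<close>
    that marks a zero row, so the nonzero rows form an initial segment.\<close>
  have set: "{i. i < n \<and> f i < m} = {..<r}"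
  proof (cases "\<exists>i<n. \<not> f i < m")
    case False
    then have "{i. i < n \<and> f i < m} = {..<n}" by auto
    then show ?thesis by (simp add: r_def)
  next
    case True
    define k where "k = (LEAST i. i < n \<and> \<not> f i < m)"
    have k: "k < n" "\<not> f k < m" using LeastI_ex[of "\<lambda>i. i < n \<and> \<not> f i < m"] True unfolding k_def by auto
    have "f i < m" if "i < k" for i
      using not_less_Least[of i "\<lambda>i. i < n \<and> \<not> f i < m"] that k unfolding k_def[symmetric] by auto
    then have "{i. i < n \<and> f i < m} = {..<k}"
      using down'[of k] k by (auto simp: not_less[symmetric])
    then show ?thesis by (simp add: r_def)
  qed
  then have rn: "r \<le> n" and fr: "\<And>i. i < r \<Longrightarrow> f i < m" and fz: "\<And>i. i < n \<Longrightarrow> \<not> i < r \<Longrightarrow> f i = m"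
    using f(1)[OF d] by (auto simp: set_eq_iff subset_eq) (meson lessThan_iff linorder_not_le nat_less_le)+
  \<comment> \<open>\<open>J\<close> and \<open>J'\<close> include and extract the first
    \<open>r\<close> coordinates; \<open>C'\<close> selects the pivot columns.\<close>
  define J where "J = mat n r (\<lambda>(i, j). if i = j then 1 else 0 :: 'a)"
  define J' where "J' = mat r n (\<lambda>(i, j). if i = j then 1 else 0 :: 'a)"
  define C' where "C' = mat m r (\<lambda>(i, j). if i = f j then 1 else 0 :: 'a)"
  have J: "J \<in> carrier_mat n r" "J' \<in> carrier_mat r n" "C' \<in> carrier_mat m r"
    by (auto simp: J_def J'_def C'_def)
  have J'J: "J' * J = 1\<^sub>m r"
    by (rule eq_matI) (use rn in \<open>auto simp: J_def J'_def scalar_prod_def if_distrib[of "\<lambda>x. x * _"] cong: if_cong\<close>)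
  have JJ'E: "J * (J' * E) = E"
  proof (rule eq_matI)
    fix i j assume "i < dim_row E" "j < dim_col E"
    then have ij: "i < n" "j < m" using E by auto
    have J'E: "(J' * E) $$ (k, j) = E $$ (k, j)" if "k < r" for k
      using that ij rn E
      by (auto simp: J'_def scalar_prod_def if_distrib[of "\<lambda>x. x * _"] cong: if_cong)
    have "(J * (J' * E)) $$ (i, j) = (\<Sum>k<r. (if i = k then 1 else 0) * (J' * E) $$ (k, j))"
      using ij J E by (simp add: scalar_prod_def lessThan_atLeast0 J_def)
    also have "\<dots> = (if i < r then E $$ (i, j) else 0)"
      by (simp add: J'E if_distrib[of "\<lambda>x. x * _"] cong: if_cong)
    also have "\<dots> = E $$ (i, j)" using f(2)[OF d, of i j] fz[of i] ij by auto
    finally show "(J * (J' * E)) $$ (i, j) = E $$ (i, j)" .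
  qed (use J E in auto)
  have CC': "J' * E * C' = 1\<^sub>m r"
  proof (rule eq_matI)
    fix i j assume "i < dim_row (1\<^sub>m r :: 'a mat)" "j < dim_col (1\<^sub>m r :: 'a mat)"
    then have ij: "i < r" "j < r" by auto
    have J'E: "(J' * E) $$ (i, k) = E $$ (i, k)" if "k < m" for k
      using that ij rn E
      by (auto simp: J'_def scalar_prod_def if_distrib[of "\<lambda>x. x * _"] cong: if_cong)
    have "(J' * E * C') $$ (i, j) = (\<Sum>k<m. (J' * E) $$ (i, k) * (if k = f j then 1 else 0))"
      using ij J E by (simp add: scalar_prod_def lessThan_atLeast0 C'_def)
    also have "\<dots> = E $$ (i, f j)"
      using fr[OF ij(2)] by (simp add: J'E if_distrib[of "\<lambda>x. _ * x"] cong: if_cong)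
    also have "\<dots> = 1\<^sub>m r $$ (i, j)"
      using f(4)[OF d, of j] f(5)[OF d, of j i] fr[OF ij(2)] ij rn by auto
    finally show "(J' * E * C') $$ (i, j) = 1\<^sub>m r $$ (i, j)" .
  qed (use J E in auto)
  show ?thesis
  proof
    have "Q * E = T" using PQ T by (simp flip: mat_assoc)
    then show "T = Q * J * (J' * E)"
      using J E(1) PQ(2,3) JJ'E by (simp add: mat_assoc[of Q J])
    show "J' * P * (Q * J) = 1\<^sub>m r"
      using J PQ by (simp add: mat_assoc J'J flip: mat_assoc[of P Q J])
  qed (use J E PQ CC' in auto)
qed

text \<open>Once products are nested to the right, a relation \<open>A * B = C\<close> is hidden
  inside a longer chain; with the tail \<open>Z\<close> attached it can be used for rewriting
  there.\<close>

lemma mat_absorb: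
  "A * B = C \<Longrightarrow> dim_col A = dim_row B \<Longrightarrow> dim_col B = dim_row Z \<Longrightarrow> A * (B * Z) = C * (Z :: 'a::semiring_0 mat)"
  by (simp flip: mat_assoc)

lemmas mat_zero_simps = mat_zero_left mat_zero_right mat_add_zero_left mat_add_zero_right mat_diff_zero

text \<open>If one side were smaller, padding both matrices with zeros to square ones would keep
  \<open>B * A = 1\<close>. For square matrices a left inverse is a right inverse, but the padded
  product in the other order has a zero on its diagonal.\<close>

lemma invertible_imp_square:
  fixes A :: "'a::field mat"
  assumes A: "A \<in> carrier_mat n m" and B: "B \<in> carrier_mat m n"
    and AB: "A * B = 1\<^sub>m n" and BA: "B * A = 1\<^sub>m m"
  shows "n = m"
proof -
  have *: "\<not> n < m" if A: "A \<in> carrier_mat n m" and B: "B \<in> carrier_mat m n"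
    and BA: "B * A = 1\<^sub>m m" for A B :: "'a mat" and n m
  proof
    assume nm: "n < m"
    define A' where "A' = mat m m (\<lambda>(i, j). if i < n then A $$ (i, j) else 0)"
    define B' where "B' = mat m m (\<lambda>(i, j). if j < n then B $$ (i, j) else 0)"
    have c: "A' \<in> carrier_mat m m" "B' \<in> carrier_mat m m" by (auto simp: A'_def B'_def)
    have "B' * A' = B * A"
    proof (rule eq_matI)
      fix i j assume "i < dim_row (B * A)" "j < dim_col (B * A)"
      then have ij: "i < m" "j < m" using A B by auto
      have "(\<Sum>k<m. (if k < n then B $$ (i, k) else 0) * (if k < n then A $$ (k, j) else 0))
        = (\<Sum>k<n. B $$ (i, k) * A $$ (k, j))"
        by (rule sum.mono_neutral_cong_right) (use nm in auto)
      then show "(B' * A') $$ (i, j) = (B * A) $$ (i, j)"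
        using ij A B by (simp add: A'_def B'_def scalar_prod_def lessThan_atLeast0)
    qed (use A B in \<open>auto simp: A'_def B'_def\<close>)
    then have "A' * B' = 1\<^sub>m m" using mat_mult_left_right_inverse[OF c(2,1)] BA by simp
    then have "(A' * B') $$ (n, n) = 1" using nm by simp
    moreover have "(A' * B') $$ (n, n) = 0" using nm by (simp add: A'_def B'_def scalar_prod_def)
    ultimately show False by simp
  qed
  from *[OF A B BA] *[OF B A AB] show ?thesis by simp
qed

text \<open>A decomposition of \<open>k\<^sup>m\<close> into \<open>k\<^sup>l\<close> and \<open>k\<^sup>n\<close>, given by injections \<open>S\<close>, \<open>T'\<close> and projections \<open>S'\<close>, \<open>T\<close>.\<close>

definition lin_split :: "nat \<Rightarrow> nat \<Rightarrow> nat \<Rightarrow> 'a::field mat \<Rightarrow> 'a mat \<Rightarrow> 'a mat \<Rightarrow> 'a mat \<Rightarrow> bool" where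
  "lin_split l m n S S' T T' \<longleftrightarrow>
     S \<in> carrier_mat m l \<and> S' \<in> carrier_mat l m \<and> T \<in> carrier_mat n m \<and> T' \<in> carrier_mat m n \<and>
     S' * S = 1\<^sub>m l \<and> T * T' = 1\<^sub>m n \<and> T * S = 0\<^sub>m n l \<and> S' * T' = 0\<^sub>m l n \<and> S * S' + T' * T = 1\<^sub>m m"

lemma lin_splitD:
  assumes "lin_split l m n S S' T T'"
  shows "S \<in> carrier_mat m l" "S' \<in> carrier_mat l m" "T \<in> carrier_mat n m" "T' \<in> carrier_mat m n"
    "dim_row S = m" "dim_col S = l" "dim_row S' = l" "dim_col S' = m"
    "dim_row T = n" "dim_col T = m" "dim_row T' = m" "dim_col T' = n"
    "S' * S = 1\<^sub>m l" "T * T' = 1\<^sub>m n" "T * S = 0\<^sub>m n l" "S' * T' = 0\<^sub>m l n" "S * S' + T' * T = 1\<^sub>m m"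
  using assms unfolding lin_split_def by auto

lemma lin_split_sym: "lin_split l m n S S' T T' \<Longrightarrow> lin_split n m l T' T S' S"
  unfolding lin_split_def by (auto simp: comm_add_mat[of "T' * T" m m])

text \<open>Both \<open>e\<close> and \<open>1 - e\<close> are idempotent; a rank factorization of
  each one gives its image together with inclusion and projection.\<close>

lemma lin_split_idempotent:
  fixes e :: "'a::field mat"
  assumes e: "e \<in> carrier_mat m m" and ee: "e * e = e"
  obtains l n S S' T T' where "lin_split l m n S S' T T'" "S * S' = e"
proof -
  have fact: "\<exists>r B C. B \<in> carrier_mat m r \<and> C \<in> carrier_mat r m \<and> e = B * C \<and> C * B = 1\<^sub>m r"
    if e: "e \<in> carrier_mat m m" and ee: "e * e = e" for e :: "'a mat"
  proof -
    obtain r B B' C C' where B: "B \<in> carrier_mat m r" "B' \<in> carrier_mat r m" "C \<in> carrier_mat r m"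
      "C' \<in> carrier_mat m r" "e = B * C" "B' * B = 1\<^sub>m r" "C * C' = 1\<^sub>m r"
      using rank_factorization[OF e] by metis
    then have d: "dim_row B = m" "dim_col B = r" "dim_row B' = r" "dim_col B' = m"
      "dim_row C = r" "dim_col C = m" "dim_row C' = m" "dim_col C' = r" by auto
    \<comment> \<open>Cancelling \<open>B\<close> on the left and \<open>C\<close> on the right in
      \<open>B C B C = B C\<close> leaves \<open>C B = 1\<close>.\<close>
    have "B' * (e * e) * C' = B' * e * C'" using ee by simp
    then have "C * B = 1\<^sub>m r"
      using B(5) by (simp add: mat_assoc d B(7) mat_absorb[OF B(6)])
    then show ?thesis using B by auto
  qed
  obtain l S S' where S: "S \<in> carrier_mat m l" "S' \<in> carrier_mat l m" "e = S * S'" "S' * S = 1\<^sub>m l"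
    using fact[OF e ee] by metis
  define f where "f = 1\<^sub>m m - e"
  have f: "f \<in> carrier_mat m m" using e by (simp add: f_def minus_carrier_mat)
  have "f * f = f"
    using e ee by (auto simp: f_def mat_diff_distrib_left mat_diff_distrib_right)
  then obtain n T' T where T: "T' \<in> carrier_mat m n" "T \<in> carrier_mat n m" "f = T' * T" "T * T' = 1\<^sub>m n"
    using fact[OF f] by metis
  have d: "dim_row S = m" "dim_col S = l" "dim_row S' = l" "dim_col S' = m"
    "dim_row T = n" "dim_col T = m" "dim_row T' = m" "dim_col T' = n" using S T by auto
  have fS: "f * S = 0\<^sub>m m l" and S'f: "S' * f = 0\<^sub>m l m"
    using d S by (auto simp: f_def mat_diff_distrib_left mat_diff_distrib_right mat_assoc mat_absorb[OF S(4)] mat_diff_self)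
  have "T * S = T * (f * S)"
    using d by (simp add: T(3) mat_assoc mat_absorb[OF T(4)])
  then have TS: "T * S = 0\<^sub>m n l" using d by (simp add: fS mat_zero_simps)
  have "S' * T' = S' * f * T'"
    using d by (simp add: T(3) mat_assoc T(4))
  then have S'T': "S' * T' = 0\<^sub>m l n" using d by (simp add: S'f mat_zero_simps)
  have "S * S' + T' * T = 1\<^sub>m m" using e unfolding S(3)[symmetric] T(3)[symmetric] f_def by auto
  then have "lin_split l m n S S' T T'" unfolding lin_split_def using S T TS S'T' by auto
  then show thesis using that S by metis
qed

text \<open>\<open>S * S'\<close> is idempotent, and the complement that
  \<open>lin_split_idempotent\<close> finds for it is also a complement for the given pair
  \<open>S\<close>, \<open>S'\<close>, because \<open>U * U' = S * S'\<close>.\<close>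

lemma lin_split_inj:
  fixes S :: "'a::field mat"
  assumes S: "S \<in> carrier_mat m l" "S' \<in> carrier_mat l m" "S' * S = 1\<^sub>m l"
  obtains n T T' where "lin_split l m n S S' T T'"
proof -
  have d: "dim_row S = m" "dim_col S = l" "dim_row S' = l" "dim_col S' = m" using S by auto
  have e: "S * S' \<in> carrier_mat m m" "(S * S') * (S * S') = S * S'"
    using d by (auto simp: mat_assoc mat_absorb[OF S(3)])
  obtain l0 n U U' T T' where s: "lin_split l0 m n U U' T T'" "U * U' = S * S'"
    using lin_split_idempotent[OF e] by metis
  note u = lin_splitD[OF s(1)]
  have "T * S = T * (S * S') * S" using d u by (simp add: mat_assoc S(3))
  also have "\<dots> = 0\<^sub>m n l" using d u(1-12) by (simp add: mat_assoc s(2)[symmetric] mat_absorb[OF u(15)] mat_zero_simps)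
  finally have TS: "T * S = 0\<^sub>m n l" .
  have "S' * T' = S' * (S * S' * T')" using d u by (simp add: mat_assoc mat_absorb[OF S(3)])
  also have "\<dots> = 0\<^sub>m l n" using d u(1-12) by (simp add: mat_assoc s(2)[symmetric] u(16) mat_zero_simps)
  finally have S'T': "S' * T' = 0\<^sub>m l n" .
  have "lin_split l m n S S' T T'"
    unfolding lin_split_def using S u TS S'T' s(2) by auto
  then show thesis by (rule that)
qed

section \<open>The standard decomposition of a direct sum of coordinate spaces\<close>

definition dsum_in1 :: "nat \<Rightarrow> nat \<Rightarrow> 'a::field mat" where
  "dsum_in1 l n = mat (l + n) l (\<lambda>(i, j). if i = j then 1 else 0)"
definition dsum_in2 :: "nat \<Rightarrow> nat \<Rightarrow> 'a::field mat" where
  "dsum_in2 l n = mat (l + n) n (\<lambda>(i, j). if i = l + j then 1 else 0)"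
definition dsum_pr1 :: "nat \<Rightarrow> nat \<Rightarrow> 'a::field mat" where
  "dsum_pr1 l n = mat l (l + n) (\<lambda>(i, j). if i = j then 1 else 0)"
definition dsum_pr2 :: "nat \<Rightarrow> nat \<Rightarrow> 'a::field mat" where
  "dsum_pr2 l n = mat n (l + n) (\<lambda>(i, j). if j = l + i then 1 else 0)"

lemma sum_delta_mult:
  fixes f :: "nat \<Rightarrow> 'a::semiring_1"
  shows "k < n \<Longrightarrow> (\<Sum>j\<in>{0..<n}. (if k = j then 1 else 0) * f j) = f k"
    "k < n \<Longrightarrow> (\<Sum>j\<in>{0..<n}. (if j = k then 1 else 0) * f j) = f k"
    "k < n \<Longrightarrow> (\<Sum>j\<in>{0..<n}. f j * (if k = j then 1 else 0)) = f k"
    "k < n \<Longrightarrow> (\<Sum>j\<in>{0..<n}. f j * (if j = k then 1 else 0)) = f k"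
  by (simp_all add: if_distrib[of "\<lambda>x. x * _"] if_distrib[of "\<lambda>x. _ * x"] cong: if_cong)

lemma lin_split_dsum:
  "lin_split l (l + n) n (dsum_in1 l n) (dsum_pr1 l n) (dsum_pr2 l n) (dsum_in2 l n :: 'a::field mat)"
  unfolding lin_split_def
proof (intro conjI)
  show "dsum_in1 l n * dsum_pr1 l n + dsum_in2 l n * dsum_pr2 l n = (1\<^sub>m (l + n) :: 'a mat)" (is "?A + ?B = _")
  proof (rule eq_matI)
    fix i j assume "i < dim_row (1\<^sub>m (l + n) :: 'a mat)" "j < dim_col (1\<^sub>m (l + n) :: 'a mat)"
    then have ij: "i < l + n" "j < l + n" by auto
    have "?A $$ (i, j) = (if i < l \<and> i = j then 1 else 0)"
    proof (cases "i < l")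
      case True
      then show ?thesis using ij by (simp add: dsum_in1_def dsum_pr1_def scalar_prod_def sum_delta_mult)
    next
      case False
      then show ?thesis using ij by (auto simp add: dsum_in1_def dsum_pr1_def scalar_prod_def intro!: sum.neutral)
    qed
    moreover have "?B $$ (i, j) = (if \<not> i < l \<and> i = j then 1 else 0)"
    proof (cases "i < l")
      case True
      then show ?thesis using ij by (auto simp add: dsum_in2_def dsum_pr2_def scalar_prod_def intro!: sum.neutral)
    next
      case False
      then obtain k where k: "i = l + k" "k < n" using ij by (metis add_less_cancel_left le_Suc_ex linorder_not_less)
      then show ?thesis using ij by (auto simp add: dsum_in2_def dsum_pr2_def scalar_prod_def sum_delta_mult)
    qed
    ultimately show "(?A + ?B) $$ (i, j) = 1\<^sub>m (l + n) $$ (i, j)"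
      using ij by (simp add: dsum_in2_def dsum_pr2_def)
  qed (auto simp: dsum_in2_def dsum_pr2_def)
  show "dsum_pr1 l n * dsum_in1 l n = (1\<^sub>m l :: 'a mat)" "dsum_pr2 l n * dsum_in2 l n = (1\<^sub>m n :: 'a mat)"
    by (rule eq_matI;
        auto simp: dsum_in1_def dsum_in2_def dsum_pr1_def dsum_pr2_def scalar_prod_def sum_delta_mult)+
  show "dsum_pr2 l n * dsum_in1 l n = (0\<^sub>m n l :: 'a mat)" "dsum_pr1 l n * dsum_in2 l n = (0\<^sub>m l n :: 'a mat)"
    by (rule eq_matI;
        auto simp: dsum_in1_def dsum_in2_def dsum_pr1_def dsum_pr2_def scalar_prod_def intro!: sum.neutral)+
qed (auto simp: dsum_in1_def dsum_in2_def dsum_pr1_def dsum_pr2_def)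

lemmas dsum_split = lin_splitD[OF lin_split_dsum]

text \<open>Both sides agree after composition with each of the two injections. The formula lets
  \<open>dsum_mod\<close>, defined by an explicit block matrix, be treated like any other
  decomposition.\<close>

lemma four_block_diag:
  assumes "Z \<in> carrier_mat l l" "Y \<in> carrier_mat n n"
  shows "four_block_mat Z (0\<^sub>m l n) (0\<^sub>m n l) Y =
    dsum_in1 l n * Z * dsum_pr1 l n + dsum_in2 l n * Y * dsum_pr2 l n" (is "?F = ?A + ?B")
proof -
  let ?i1 = "dsum_in1 l n :: 'a mat" and ?i2 = "dsum_in2 l n :: 'a mat"
  let ?p1 = "dsum_pr1 l n :: 'a mat" and ?p2 = "dsum_pr2 l n :: 'a mat"
  have F: "?F \<in> carrier_mat (l + n) (l + n)" using assms by auto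
  have "?F * ?i1 = ?i1 * Z"
  proof (rule eq_matI)
    fix i j assume "i < dim_row (?i1 * Z)" "j < dim_col (?i1 * Z)"
    then have ij: "i < l + n" "j < l" using assms by (auto simp: dsum_split)
    have "(?F * ?i1) $$ (i, j) = ?F $$ (i, j)"
      using ij assms by (simp add: scalar_prod_def dsum_in1_def sum_delta_mult)
    moreover have "(?i1 * Z) $$ (i, j) = (if i < l then Z $$ (i, j) else 0)"
      using ij assms by (auto simp add: scalar_prod_def dsum_in1_def sum_delta_mult intro!: sum.neutral)
    ultimately show "(?F * ?i1) $$ (i, j) = (?i1 * Z) $$ (i, j)" using ij assms by auto
  qed (use assms F in \<open>auto simp: dsum_split\<close>)
  moreover have "?F * ?i2 = ?i2 * Y"
  proof (rule eq_matI)
    fix i j assume "i < dim_row (?i2 * Y)" "j < dim_col (?i2 * Y)"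
    then have ij: "i < l + n" "j < n" using assms by (auto simp: dsum_split)
    have "(?F * ?i2) $$ (i, j) = ?F $$ (i, l + j)"
      using ij assms by (simp add: scalar_prod_def dsum_in2_def sum_delta_mult)
    moreover have "(?i2 * Y) $$ (i, j) = (if i < l then 0 else Y $$ (i - l, j))"
    proof (cases "i < l")
      case False
      then obtain k where k: "i = l + k" "k < n" using ij by (metis add_less_cancel_left le_Suc_ex linorder_not_less)
      then show ?thesis using ij assms by (auto simp add: scalar_prod_def dsum_in2_def sum_delta_mult)
    qed (use ij assms in \<open>auto simp add: scalar_prod_def dsum_in2_def intro!: sum.neutral\<close>)
    ultimately show "(?F * ?i2) $$ (i, j) = (?i2 * Y) $$ (i, j)" using ij assms by auto
  qed (use assms F in \<open>auto simp: dsum_split\<close>)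
  moreover have "?F = ?F * (?i1 * ?p1 + ?i2 * ?p2)"
    unfolding dsum_split(17) by (rule right_mult_one_mat[OF F, symmetric])
  moreover have "?F * (?i1 * ?p1 + ?i2 * ?p2) = ?F * ?i1 * ?p1 + ?F * ?i2 * ?p2"
    using F assms by (simp add: mat_distrib_left mat_assoc dsum_split(1-12))
  ultimately show ?thesis by simp
qed

text \<open>Matching the given decomposition with the standard one of the same two spaces yields
  mutually inverse matrices, which must be square.\<close>

lemma lin_split_dim:
  assumes "lin_split l m n S S' T (T' :: 'a::field mat)"
  shows "m = l + n"
proof -
  note s = lin_splitD[OF assms]
  note d = dsum_split[where 'a='a and l = l and n = n]
  let ?i1 = "dsum_in1 l n :: 'a mat" and ?i2 = "dsum_in2 l n :: 'a mat"
  let ?p1 = "dsum_pr1 l n :: 'a mat" and ?p2 = "dsum_pr2 l n :: 'a mat"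
  define P where "P = S * ?p1 + T' * ?p2"
  define Q where "Q = ?i1 * S' + ?i2 * T"
  have "P \<in> carrier_mat m (l + n)" "Q \<in> carrier_mat (l + n) m"
    using s(1-12) d(1-12) by (auto simp: P_def Q_def)
  moreover have "P * Q = 1\<^sub>m m" "Q * P = 1\<^sub>m (l + n)"
    using s(17) d(17) unfolding P_def Q_def
    by (simp_all add: mat_assoc mat_distrib_left mat_distrib_right s(5-12) d(5-12) mat_zero_simps
        mat_absorb[OF s(13)] mat_absorb[OF s(14)] mat_absorb[OF s(15)] mat_absorb[OF s(16)]
        mat_absorb[OF d(13)] mat_absorb[OF d(14)] mat_absorb[OF d(15)] mat_absorb[OF d(16)])
  ultimately show ?thesis using invertible_imp_square by blast
qed

declare assoc_mult_mat [simp del] assoc_mult_mat_vec [simp del]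

section \<open>Subspaces, injections and surjections in terms of matrices\<close>

lemma (in vectorspace) subspace_finite_span:
  assumes W: "subspace K W V" and fd: fin_dim
  obtains B where "finite B" "B \<subseteq> W" "span B = W"
proof -
  have WV: "W \<subseteq> carrier V" using W by (auto simp: subspace_def submodule_def)
  \<comment> \<open>A maximal independent subset of \<open>W\<close> exists because the dimension
    bounds the size of independent sets; maximality makes it span \<open>W\<close>.\<close>
  have "\<exists>B. finite B \<and> maximal B (\<lambda>S. S \<subseteq> W \<and> lin_indpt S)"
  proof (rule maximal_exists[where B = "{}" and N = dim])
    fix S assume "S \<subseteq> W \<and> lin_indpt S"
    then show "finite S \<and> card S \<le> dim" using li_le_dim[OF fd, of S] WV by auto
  qed (auto simp: lin_dep_def)
  then obtain B where fB: "finite B" and mB: "maximal B (\<lambda>S. S \<subseteq> W \<and> lin_indpt S)" by (elim exE conjE)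
  then have B: "finite B" "B \<subseteq> W" "lin_indpt B"
    and max: "\<And>S. B \<subseteq> S \<and> S \<subseteq> W \<and> lin_indpt S \<longrightarrow> S = B"
    by (simp_all add: maximal_def)
  have "span B \<subseteq> W" using span_is_subset[OF B(2)] W by (auto simp: subspace_def)
  moreover have "w \<in> span B" if w: "w \<in> W" for w
  proof (cases "w \<in> B")
    case True
    then show ?thesis using in_own_span[of B] B WV by auto
  next
    case False
    then have "\<not> lin_indpt (B \<union> {w})" using max[of "B \<union> {w}"] w B by auto
    then show ?thesis using lin_dep_iff_in_span[of B w] B WV w False by blast
  qed
  ultimately show thesis using that[OF B(1,2)] by blast
qed

lemma (in vectorspace) subspace_fin_dim:
  assumes W: "subspace K W V" and fd: fin_dim
  shows "vectorspace.fin_dim K (V\<lparr>carrier := W\<rparr>)"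
proof -
  obtain B where B: "finite B" "B \<subseteq> W" "span B = W" using subspace_finite_span[OF assms] by metis
  interpret W: vectorspace K "V\<lparr>carrier := W\<rparr>" using subspace_is_vs[OF W] .
  have "W.span B = W" using span_li_not_depend(1)[OF B(2)] W B(3) by (auto simp: subspace_def)
  then show ?thesis unfolding W.fin_dim_def using B by auto
qed

text \<open>The columns of a finite spanning set present \<open>W\<close> as a column space, and
  rank factorization replaces that matrix by an injective one with the same image. Submodules, which
  are sets, thereby become matrices.\<close>

lemma subspace_eq_image:
  fixes W :: "'a::field vec set"
  assumes W: "subspace class_ring W (module_vec TYPE('a) d)"
  obtains r S S' where "S \<in> carrier_mat d r" "S' \<in> carrier_mat r d" "S' * S = 1\<^sub>m r"
    "W = (\<lambda>v. S *\<^sub>v v) ` carrier_vec r"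
proof -
  interpret vec_space "TYPE('a)" d .
  have WV: "W \<subseteq> carrier_vec d" using W by (auto simp: subspace_def submodule_def module_vec_def)
  obtain Z where Z: "finite Z" "Z \<subseteq> W" "span Z = W"
    by (rule subspace_finite_span[OF W fin_dim])
  obtain xs where xs: "set xs = Z" using finite_list[OF Z(1)] by blast
  define M where "M = mat_of_cols d xs"
  have M: "M \<in> carrier_mat d (length xs)" by (simp add: M_def)
  have "cols M = xs" unfolding M_def by (rule cols_mat_of_cols) (use xs Z WV in auto)
  then have WM: "W = (\<lambda>v. M *\<^sub>v v) ` carrier_vec (length xs)"
  proof -
    assume "cols M = xs"
    then have "W = {y \<in> carrier_vec (dim_row M). \<exists>x\<in>carrier_vec (dim_col M). M *\<^sub>v x = y}"
      using col_space_eq[OF M] unfolding col_space_def by (simp only: xs Z(3))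
    then show ?thesis using M by auto
  qed
  obtain r B B' C C' where f: "B \<in> carrier_mat d r" "B' \<in> carrier_mat r d" "C \<in> carrier_mat r (length xs)"
    "C' \<in> carrier_mat (length xs) r" "M = B * C" "B' * B = 1\<^sub>m r" "C * C' = 1\<^sub>m r"
    using rank_factorization[OF M] by metis
  have "(\<lambda>v. M *\<^sub>v v) ` carrier_vec (length xs) = (\<lambda>v. B *\<^sub>v v) ` carrier_vec r"
  proof (intro equalityI subsetI)
    fix w assume "w \<in> (\<lambda>v. M *\<^sub>v v) ` carrier_vec (length xs)"
    then obtain v where "v \<in> carrier_vec (length xs)" "w = M *\<^sub>v v" by auto
    then have "w = B *\<^sub>v (C *\<^sub>v v)" "C *\<^sub>v v \<in> carrier_vec r" using f by (auto simp: mat_assoc_vec)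
    then show "w \<in> (\<lambda>v. B *\<^sub>v v) ` carrier_vec r" by blast
  next
    fix w assume "w \<in> (\<lambda>v. B *\<^sub>v v) ` carrier_vec r"
    then obtain v where v: "v \<in> carrier_vec r" "w = B *\<^sub>v v" by auto
    then have "v = C *\<^sub>v (C' *\<^sub>v v)" using f by (simp flip: mat_assoc_vec)
    then have "w = M *\<^sub>v (C' *\<^sub>v v)" using v f by (simp add: mat_assoc_vec)
    then show "w \<in> (\<lambda>v. M *\<^sub>v v) ` carrier_vec (length xs)" using v f by auto
  qed
  then show thesis using that f WM by metis
qed

text \<open>In \<open>S = B * C\<close> one has \<open>S * (C' * C) = S\<close>, so injectivity
  forces \<open>C' * C = 1\<close>, and \<open>C' * B'\<close> inverts \<open>S\<close> from the
  left.\<close>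

lemma inj_hom_left_inverse:
  assumes S: "S \<in> carrier_mat m l" and inj: "inj_hom S"
  obtains S' where "S' \<in> carrier_mat l m" "S' * S = 1\<^sub>m l"
proof -
  obtain r B B' C C' where f: "B \<in> carrier_mat m r" "B' \<in> carrier_mat r m" "C \<in> carrier_mat r l"
    "C' \<in> carrier_mat l r" "S = B * C" "B' * B = 1\<^sub>m r" "C * C' = 1\<^sub>m r"
    using rank_factorization[OF S] by metis
  have "C' * C = 1\<^sub>m l"
  proof (rule mat_eq_by_vec)
    fix v :: "'a vec" assume v: "v \<in> carrier_vec l"
    have "S * (C' * C) = S"
      using f(1-4) unfolding f(5) by (simp add: mat_assoc mat_absorb[OF f(7)])
    then have eq: "S *\<^sub>v (C' * C *\<^sub>v v) = S *\<^sub>v v" using S f(3,4) v by (simp flip: mat_assoc_vec)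
    have "C' * C *\<^sub>v v = v"
    proof (rule inj_onD[OF inj[unfolded inj_hom_def] eq])
      show "C' * C *\<^sub>v v \<in> carrier_vec (dim_col S)" using S f(4) by (intro carrier_vecI) simp
    qed (use S v in simp)
    then show "C' * C *\<^sub>v v = 1\<^sub>m l *\<^sub>v v" using v by simp
  qed (use f in auto)
  moreover have "C' * B' * S = C' * C" using f(1-4) unfolding f(5) by (simp add: mat_assoc mat_absorb[OF f(6)])
  ultimately show thesis using that[of "C' * B'"] f by auto
qed

lemma left_inverse_inj_hom:
  assumes "S \<in> carrier_mat m l" "S' \<in> carrier_mat l m" "S' * S = 1\<^sub>m l"
  shows "inj_hom S"
  unfolding inj_hom_def
proof (rule inj_onI)
  fix v w assume vw: "v \<in> carrier_vec (dim_col S)" "w \<in> carrier_vec (dim_col S)" "S *\<^sub>v v = S *\<^sub>v w"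
  then have "S' * S *\<^sub>v v = S' * S *\<^sub>v w" using assms(1,2) by (simp add: mat_assoc_vec)
  then show "v = w" using assms(1) vw unfolding assms(3) by auto
qed

lemma surj_hom_iff_right_inverse:
  assumes T: "T \<in> carrier_mat n m"
  shows "surj_hom T \<longleftrightarrow> (\<exists>T'\<in>carrier_mat m n. T * T' = 1\<^sub>m n)"
proof
  assume sur: "surj_hom T"
  obtain r B B' C C' where f: "B \<in> carrier_mat n r" "B' \<in> carrier_mat r n" "C \<in> carrier_mat r m"
    "C' \<in> carrier_mat m r" "T = B * C" "B' * B = 1\<^sub>m r" "C * C' = 1\<^sub>m r"
    using rank_factorization[OF T] by metis
  have "B * B' = 1\<^sub>m n"
  proof (rule mat_eq_by_vec)
    fix w :: "'a vec" assume "w \<in> carrier_vec n"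
    then obtain v where v: "v \<in> carrier_vec m" "w = T *\<^sub>v v" using sur T unfolding surj_hom_def by auto
    then have "B * B' *\<^sub>v w = B * B' * (B * C) *\<^sub>v v" using f T by (simp add: mat_assoc_vec)
    also have "B * B' * (B * C) = T" using f(1-4) unfolding f(5) by (simp add: mat_assoc mat_absorb[OF f(6)])
    finally show "B * B' *\<^sub>v w = 1\<^sub>m n *\<^sub>v w" using v T by simp
  qed (use f in auto)
  moreover have "T * (C' * B') = B * B'" using f(1-4) unfolding f(5) by (simp add: mat_assoc mat_absorb[OF f(7)])
  ultimately show "\<exists>T'\<in>carrier_mat m n. T * T' = 1\<^sub>m n" using f by (intro bexI[of _ "C' * B'"]) auto
next
  assume "\<exists>T'\<in>carrier_mat m n. T * T' = 1\<^sub>m n"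
  then obtain T' where T': "T' \<in> carrier_mat m n" "T * T' = 1\<^sub>m n" by auto
  have "w \<in> (\<lambda>v. T *\<^sub>v v) ` carrier_vec m" if w: "w \<in> carrier_vec n" for w
  proof
    show "w = T *\<^sub>v (T' *\<^sub>v w)" using T T' w by (simp flip: mat_assoc_vec)
  qed (use T' w in auto)
  then show "surj_hom T" using T unfolding surj_hom_def by auto
qed

section \<open>Modules and homomorphisms\<close>

lemma is_module_carrier: "is_module A M \<Longrightarrow> a \<in> hbasis A \<Longrightarrow> ract M a \<in> carrier_mat (rdim M) (rdim M)"
  and is_module_dim: "is_module A M \<Longrightarrow> a \<in> hbasis A \<Longrightarrow> dim_row (ract M a) = rdim M"
    "is_module A M \<Longrightarrow> a \<in> hbasis A \<Longrightarrow> dim_col (ract M a) = rdim M"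
  by (auto simp: is_module_def)

lemma Hom_modD:
  assumes "T \<in> Hom_mod A M N"
  shows "T \<in> carrier_mat (rdim N) (rdim M)" "dim_row T = rdim N" "dim_col T = rdim M"
    "a \<in> hbasis A \<Longrightarrow> T * ract M a = ract N a * T"
  using assms by (auto simp: Hom_mod_def)

lemma Hom_modI:
  "T \<in> carrier_mat (rdim N) (rdim M) \<Longrightarrow> (\<And>a. a \<in> hbasis A \<Longrightarrow> T * ract M a = ract N a * T) \<Longrightarrow>
    T \<in> Hom_mod A M N"
  by (auto simp: Hom_mod_def)

lemma act_elt_dim [simp]: "dim_row (act_elt A M x) = rdim M" "dim_col (act_elt A M x) = rdim M"
  and act_elt_carrier [simp]: "act_elt A M x \<in> carrier_mat (rdim M) (rdim M)"
  by (auto simp: act_elt_def)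

lemma act_elt_msum:
  assumes "\<And>a. a \<in> hbasis A \<Longrightarrow> ract M a \<in> carrier_mat (rdim M) (rdim M)"
  shows "act_elt A M x = msum (rdim M) (rdim M) (\<lambda>b. x b \<cdot>\<^sub>m ract M b) (hbasis A)"
  by (rule eq_matI) (auto simp: act_elt_def intro!: sum.cong dest!: assms)

lemma Hom_mod_one: "is_module A M \<Longrightarrow> 1\<^sub>m (rdim M) \<in> Hom_mod A M M"
  by (rule Hom_modI) (auto dest: is_module_carrier)

lemma Hom_mod_zero: "is_module A M \<Longrightarrow> is_module A N \<Longrightarrow> 0\<^sub>m (rdim N) (rdim M) \<in> Hom_mod A M N"
  by (rule Hom_modI) (auto simp: mat_zero_simps is_module_dim)

lemma Hom_mod_comp:
  assumes "is_module A L" "is_module A M" "is_module A N" "S \<in> Hom_mod A L M" "T \<in> Hom_mod A M N"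
  shows "T * S \<in> Hom_mod A L N"
proof (rule Hom_modI)
  show "T * S \<in> carrier_mat (rdim N) (rdim L)" using Hom_modD(1)[OF assms(4)] Hom_modD(1)[OF assms(5)] by auto
  fix a assume a: "a \<in> hbasis A"
  note d = is_module_dim[OF assms(1) a] is_module_dim[OF assms(2) a] is_module_dim[OF assms(3) a]
    Hom_modD(2,3)[OF assms(4)] Hom_modD(2,3)[OF assms(5)]
  show "T * S * ract L a = ract N a * (T * S)"
    by (simp add: mat_assoc d Hom_modD(4)[OF assms(4) a] mat_absorb[OF Hom_modD(4)[OF assms(5) a]])
qed

lemma Hom_mod_add:
  assumes "is_module A M" "is_module A N" "S \<in> Hom_mod A M N" "T \<in> Hom_mod A M N"
  shows "S + T \<in> Hom_mod A M N"
  using assms by (intro Hom_modI)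
    (auto simp: Hom_modD(1,4)[OF assms(3)] Hom_modD(1,4)[OF assms(4)] mat_distrib_left mat_distrib_right is_module_dim Hom_modD(2,3)[OF assms(3)] Hom_modD(2,3)[OF assms(4)])

lemma Hom_mod_act_elt:
  assumes M: "is_module A M" and N: "is_module A N" and T: "T \<in> Hom_mod A M N"
  shows "T * act_elt A M x = act_elt A N x * T"
proof -
  note d = is_module_dim[OF M] is_module_dim[OF N] Hom_modD[OF T]
  have "T * act_elt A M x = msum (rdim N) (rdim M) (\<lambda>b. T * (x b \<cdot>\<^sub>m ract M b)) (hbasis A)"
    by (subst act_elt_msum, rule is_module_carrier[OF M], assumption, subst msum_mult_left)
      (auto simp: d is_module_carrier[OF M])
  also have "\<dots> = msum (rdim N) (rdim M) (\<lambda>b. (x b \<cdot>\<^sub>m ract N b) * T) (hbasis A)"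
    by (rule msum_cong) (auto simp: mat_smult_left mat_smult_right d)
  also have "\<dots> = act_elt A N x * T"
    by (subst act_elt_msum, rule is_module_carrier[OF N], assumption, subst msum_mult_right)
      (auto simp: d is_module_carrier[OF N])
  finally show ?thesis .
qed

lemma iso_mod_refl: "is_module A M \<Longrightarrow> iso_mod A M M"
  unfolding iso_mod_def by (auto intro!: bexI[OF _ Hom_mod_one])

lemma iso_mod_sym: "iso_mod A M N \<Longrightarrow> iso_mod A N M"
  unfolding iso_mod_def by blast

lemma iso_mod_trans:
  assumes "is_module A L" "is_module A M" "is_module A N" "iso_mod A L M" "iso_mod A M N"
  shows "iso_mod A L N"
proof -
  from assms(4) obtain S S' where S: "S \<in> Hom_mod A L M" "S' \<in> Hom_mod A M L" "S' * S = 1\<^sub>m (rdim L)" "S * S' = 1\<^sub>m (rdim M)"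
    unfolding iso_mod_def by auto
  from assms(5) obtain T T' where T: "T \<in> Hom_mod A M N" "T' \<in> Hom_mod A N M" "T' * T = 1\<^sub>m (rdim M)" "T * T' = 1\<^sub>m (rdim N)"
    unfolding iso_mod_def by auto
  note d = Hom_modD(2,3)[OF S(1)] Hom_modD(2,3)[OF S(2)] Hom_modD(2,3)[OF T(1)] Hom_modD(2,3)[OF T(2)]
  have "(S' * T') * (T * S) = 1\<^sub>m (rdim L)" "(T * S) * (S' * T') = 1\<^sub>m (rdim N)"
    by (simp_all add: mat_assoc d mat_absorb[OF T(3)] mat_absorb[OF S(4)] S(3) T(4))
  moreover have "T * S \<in> Hom_mod A L N" "S' * T' \<in> Hom_mod A N L"
    using Hom_mod_comp assms(1-3) S T by blast+
  ultimately show ?thesis unfolding iso_mod_def by auto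
qed

lemma iso_mod_rdim:
  assumes "iso_mod A M N" shows "rdim M = rdim N"
proof -
  from assms obtain S S' where S: "S \<in> Hom_mod A M N" "S' \<in> Hom_mod A N M" "S' * S = 1\<^sub>m (rdim M)" "S * S' = 1\<^sub>m (rdim N)"
    unfolding iso_mod_def by auto
  show ?thesis using invertible_imp_square[OF Hom_modD(1)[OF S(2)] Hom_modD(1)[OF S(1)] S(3,4)] .
qed

lemma short_exactI:
  assumes "S \<in> Hom_mod A L M" "T \<in> Hom_mod A M N" "lin_split (rdim L) (rdim M) (rdim N) S S' T T'"
  shows "short_exact A L M N"
proof -
  note s = lin_splitD[OF assms(3)]
  have "inj_hom S" by (rule left_inverse_inj_hom[OF s(1,2,13)])
  moreover have "surj_hom T" using surj_hom_iff_right_inverse[OF s(3)] s(4,14) by auto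
  moreover have "(\<lambda>v. S *\<^sub>v v) ` carrier_vec (rdim L) = {v \<in> carrier_vec (rdim M). T *\<^sub>v v = 0\<^sub>v (rdim N)}"
  proof (intro equalityI subsetI)
    fix w assume "w \<in> (\<lambda>v. S *\<^sub>v v) ` carrier_vec (rdim L)"
    then obtain v where v: "v \<in> carrier_vec (rdim L)" "w = S *\<^sub>v v" by auto
    then have "T *\<^sub>v w = 0\<^sub>m (rdim N) (rdim L) *\<^sub>v v" using s(1-12) by (simp flip: mat_assoc_vec s(15))
    then show "w \<in> {v \<in> carrier_vec (rdim M). T *\<^sub>v v = 0\<^sub>v (rdim N)}" using v s by auto
  next
    fix w assume w: "w \<in> {v \<in> carrier_vec (rdim M). T *\<^sub>v v = 0\<^sub>v (rdim N)}"
    have "w = (S * S' + T' * T) *\<^sub>v w" unfolding s(17) using w by auto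
    also have "\<dots> = S * S' *\<^sub>v w + T' * T *\<^sub>v w"
      by (rule add_mult_distrib_mat_vec) (use s w in auto)
    also have "\<dots> = S *\<^sub>v (S' *\<^sub>v w) + T' *\<^sub>v 0\<^sub>v (rdim N)" using s(5-12) w by (auto simp add: mat_assoc_vec carrier_vecD)
    also have "\<dots> = S *\<^sub>v (S' *\<^sub>v w)" using s w by auto
    finally show "w \<in> (\<lambda>v. S *\<^sub>v v) ` carrier_vec (rdim L)" using s w by auto
  qed
  ultimately show ?thesis unfolding short_exact_def using assms by blast
qed

text \<open>Together with \<open>short_exactI\<close> this replaces exactness by equations:
  \<open>S\<close> and \<open>T\<close> are module homomorphisms, while \<open>S'\<close> and
  \<open>T'\<close> are merely linear. Later arguments about exact sequences calculate with these
  four matrices.\<close>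

lemma short_exactE:
  assumes "short_exact A L M N"
  obtains S S' T T' where "S \<in> Hom_mod A L M" "T \<in> Hom_mod A M N" "lin_split (rdim L) (rdim M) (rdim N) S S' T T'"
proof -
  from assms obtain S T where S: "S \<in> Hom_mod A L M" and T: "T \<in> Hom_mod A M N"
    and inj: "inj_hom S" and sur: "surj_hom T"
    and ex: "(\<lambda>v. S *\<^sub>v v) ` carrier_vec (rdim L) = {v \<in> carrier_vec (rdim M). T *\<^sub>v v = 0\<^sub>v (rdim N)}"
    unfolding short_exact_def by auto
  obtain S' where S': "S' \<in> carrier_mat (rdim L) (rdim M)" "S' * S = 1\<^sub>m (rdim L)"
    using inj_hom_left_inverse[OF Hom_modD(1)[OF S] inj] by metis
  obtain U where U: "U \<in> carrier_mat (rdim M) (rdim N)" "T * U = 1\<^sub>m (rdim N)"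
    using sur surj_hom_iff_right_inverse[OF Hom_modD(1)[OF T]] by auto
  \<comment> \<open>Any right inverse \<open>U\<close> of \<open>T\<close> is corrected by its
    component along \<open>S\<close>. Since \<open>T * S = 0\<close> it remains a right inverse, and
    now \<open>S' * T' = 0\<close>.\<close>
  define T' where "T' = U - S * (S' * U)"
  note d = Hom_modD(1-3)[OF S] Hom_modD(1-3)[OF T]
  have d': "dim_row S' = rdim L" "dim_col S' = rdim M" "dim_row U = rdim M" "dim_col U = rdim N"
    using S' U by auto
  have TS: "T * S = 0\<^sub>m (rdim N) (rdim L)"
  proof (rule mat_eq_by_vec)
    fix v :: "'b vec" assume v: "v \<in> carrier_vec (rdim L)"
    then have "T *\<^sub>v (S *\<^sub>v v) = 0\<^sub>v (rdim N)" using ex by auto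
    then show "T * S *\<^sub>v v = 0\<^sub>m (rdim N) (rdim L) *\<^sub>v v" using v d by (auto simp add: mat_assoc_vec)
  qed (use d in auto)
  have TT': "T * T' = 1\<^sub>m (rdim N)"
    unfolding T'_def using d d'
    by (auto simp: mat_diff_distrib_left U(2) mat_absorb[OF TS] mat_zero_simps)
  have S'T': "S' * T' = 0\<^sub>m (rdim L) (rdim N)"
    unfolding T'_def using d d'
    by (auto simp: mat_diff_distrib_left mat_absorb[OF S'(2)] mat_diff_self)
  have dT': "dim_row T' = rdim M" "dim_col T' = rdim N" using d d' by (auto simp: T'_def)
  \<comment> \<open>The values of this projection lie in the kernel of \<open>T\<close>, hence by
    exactness in the image of \<open>S\<close>; this is what identifies it with
    \<open>S * S'\<close>.\<close>
  define F where "F = 1\<^sub>m (rdim M) - T' * T"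
  have dF: "dim_row F = rdim M" "dim_col F = rdim M" using d dT' by (simp_all add: F_def)
  have TF: "T * F = 0\<^sub>m (rdim N) (rdim M)"
    using d dT' by (simp add: F_def mat_diff_distrib_left mat_absorb[OF TT'] mat_diff_self)
  have "S * (S' * F) = F"
  proof (rule mat_eq_by_vec)
    fix w :: "'b vec" assume w: "w \<in> carrier_vec (rdim M)"
    have "T *\<^sub>v (F *\<^sub>v w) = T * F *\<^sub>v w" using w d dF by (simp add: mat_assoc_vec)
    also have "\<dots> = 0\<^sub>v (rdim N)" unfolding TF using w by auto
    finally have TFw: "T *\<^sub>v (F *\<^sub>v w) = 0\<^sub>v (rdim N)" .
    have "F *\<^sub>v w \<in> carrier_vec (rdim M)" by (rule carrier_vecI) (use dF in simp)
    then have "F *\<^sub>v w \<in> (\<lambda>v. S *\<^sub>v v) ` carrier_vec (rdim L)"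
      unfolding ex using TFw by blast
    then obtain v where v: "v \<in> carrier_vec (rdim L)" "F *\<^sub>v w = S *\<^sub>v v" by blast
    have "S * (S' * F) *\<^sub>v w = S *\<^sub>v (S' *\<^sub>v (F *\<^sub>v w))" using w d d' dF by (simp add: mat_assoc_vec)
    also have "\<dots> = S *\<^sub>v (S' * S *\<^sub>v v)" using v d d' by (simp add: mat_assoc_vec)
    also have "\<dots> = F *\<^sub>v w" unfolding S'(2) v(2) using v(1) by simp
    finally show "S * (S' * F) *\<^sub>v w = F *\<^sub>v w" .
  qed (use d d' dF in auto)
  moreover have "S' * F = S'"
    using d d' dT' by (simp add: F_def mat_diff_distrib_left mat_absorb[OF S'T'] mat_zero_simps)
  ultimately have "S * S' = F" by simp
  then have 1: "S * S' + T' * T = 1\<^sub>m (rdim M)" using d dT' by (auto simp: F_def)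
  have "lin_split (rdim L) (rdim M) (rdim N) S S' T T'"
    unfolding lin_split_def using d S' dT' S'(2) TT' TS S'T' 1 by auto
  then show thesis using that S T by blast
qed

text \<open>A decomposition of \<open>M\<close> as a direct sum of modules. When only
  \<open>S\<close> and \<open>T\<close> are homomorphisms, the same data describe a short exact
  sequence.\<close>

definition mod_split :: "('b, 'k::field) hopf_data \<Rightarrow> ('b, 'k) rep \<Rightarrow> ('b, 'k) rep \<Rightarrow> ('b, 'k) rep \<Rightarrow>
    'k mat \<Rightarrow> 'k mat \<Rightarrow> 'k mat \<Rightarrow> 'k mat \<Rightarrow> bool" where
  "mod_split A L M N S S' T T' \<longleftrightarrow> S \<in> Hom_mod A L M \<and> S' \<in> Hom_mod A M L \<and> T \<in> Hom_mod A M N \<and>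
     T' \<in> Hom_mod A N M \<and> lin_split (rdim L) (rdim M) (rdim N) S S' T T'"

lemma dsum_mod_act:
  assumes "is_module A M" "is_module A N" "a \<in> hbasis A"
  shows "ract (dsum_mod M N) a = dsum_in1 (rdim M) (rdim N) * ract M a * dsum_pr1 (rdim M) (rdim N) +
    dsum_in2 (rdim M) (rdim N) * ract N a * dsum_pr2 (rdim M) (rdim N)"
  unfolding dsum_mod_def using four_block_diag[OF is_module_carrier[OF assms(1,3)] is_module_carrier[OF assms(2,3)]] by simp

lemma dsum_mod_rdim [simp]: "rdim (dsum_mod M N) = rdim M + rdim N"
  by (simp add: dsum_mod_def)

text \<open>The orthogonality relations of a linear splitting make the sum of the two transported
  actions multiplicative. With the standard matrices this turns \<open>dsum_mod\<close> into a
  module and gives its splitting at once.\<close>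

lemma mod_split_transfer_module:
  assumes L: "is_module A L" and N: "is_module A N" 
    and s: "lin_split (rdim L) (rdim M) (rdim N) S S' T T'"
    and M: "\<And>a. a \<in> hbasis A \<Longrightarrow> ract M a = S * ract L a * S' + T' * ract N a * T"
  shows "is_module A M" "mod_split A L M N S S' T T'"
proof -
  note s = lin_splitD[OF s]
  note d = is_module_dim[OF L] is_module_dim[OF N] s(5-12)
  note ab = mat_absorb[OF s(13)] mat_absorb[OF s(14)] mat_absorb[OF s(15)] mat_absorb[OF s(16)]
  have c: "ract M a \<in> carrier_mat (rdim M) (rdim M)" if "a \<in> hbasis A" for a
    using that by (auto simp: M d)
  have elt: "act_elt A M x = S * act_elt A L x * S' + T' * act_elt A N x * T" for x
  proof -
    have "S * act_elt A L x * S' = msum (rdim M) (rdim M) (\<lambda>b. S * (x b \<cdot>\<^sub>m ract L b) * S') (hbasis A)"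
      by (subst act_elt_msum, rule is_module_carrier[OF L], assumption, subst msum_mult_left)
        (auto simp: d is_module_carrier[OF L] intro!: msum_mult_right[THEN trans])
    moreover have "T' * act_elt A N x * T = msum (rdim M) (rdim M) (\<lambda>b. T' * (x b \<cdot>\<^sub>m ract N b) * T) (hbasis A)"
      by (subst act_elt_msum, rule is_module_carrier[OF N], assumption, subst msum_mult_left)
        (auto simp: d is_module_carrier[OF N] intro!: msum_mult_right[THEN trans])
    moreover have "act_elt A M x = msum (rdim M) (rdim M) (\<lambda>b. S * (x b \<cdot>\<^sub>m ract L b) * S' + T' * (x b \<cdot>\<^sub>m ract N b) * T) (hbasis A)"
      by (subst act_elt_msum, rule c, assumption, rule msum_cong)
        (auto simp: M d mat_smult_left mat_smult_right intro!: add_smult_distrib_left_mat[of _ "rdim M" "rdim M"])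
    ultimately show ?thesis
      by (auto intro!: eq_matI sum.distrib simp: d)
  qed
  show "is_module A M"
    unfolding is_module_def
  proof (intro conjI ballI)
    show "act_elt A M (hunit A) = 1\<^sub>m (rdim M)"
      using L N s(17) by (simp add: elt d is_module_def)
    fix a b assume a: "a \<in> hbasis A" and b: "b \<in> hbasis A"
    then have "act_elt A L (hmult A a b) = ract L a * ract L b" "act_elt A N (hmult A a b) = ract N a * ract N b"
      using L N by (auto simp: is_module_def)
    then show "act_elt A M (hmult A a b) = ract M a * ract M b"
      using a b by (simp add: elt M mat_assoc mat_distrib_left mat_distrib_right d ab mat_zero_simps)
  qed (rule c)
  show "mod_split A L M N S S' T T'"
    unfolding mod_split_def
    using s assms(3) by (auto intro!: Hom_modI simp: M mat_assoc mat_distrib_left mat_distrib_right d ab mat_zero_simps)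
qed

lemma is_module_dsum: "is_module A M \<Longrightarrow> is_module A N \<Longrightarrow> is_module A (dsum_mod M N)"
  and mod_split_dsum: "is_module A M \<Longrightarrow> is_module A N \<Longrightarrow>
    mod_split A M (dsum_mod M N) N (dsum_in1 (rdim M) (rdim N)) (dsum_pr1 (rdim M) (rdim N))
      (dsum_pr2 (rdim M) (rdim N)) (dsum_in2 (rdim M) (rdim N))"
  using mod_split_transfer_module[of A M N "dsum_mod M N" "dsum_in1 (rdim M) (rdim N)" "dsum_pr1 (rdim M) (rdim N)"
      "dsum_pr2 (rdim M) (rdim N)" "dsum_in2 (rdim M) (rdim N)"] lin_split_dsum dsum_mod_act[of A M N]
  by auto

lemma mod_split_unique:
  assumes mods: "is_module A L" "is_module A M" "is_module A N" "is_module A M'"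
    and s: "mod_split A L M N S S' T T'" and u: "mod_split A L M' N U U' W W'"
  shows "iso_mod A M M'"
proof -
  note h = s[unfolded mod_split_def] u[unfolded mod_split_def]
  then have s: "lin_split (rdim L) (rdim M) (rdim N) S S' T T'" and u: "lin_split (rdim L) (rdim M') (rdim N) U U' W W'" by auto
  note s = lin_splitD[OF s] and u = lin_splitD[OF u]
  define P where "P = U * S' + W' * T"
  define Q where "Q = S * U' + T' * W"
  have "P \<in> Hom_mod A M M'" "Q \<in> Hom_mod A M' M" unfolding P_def Q_def
    using h mods by (auto intro!: Hom_mod_add intro: Hom_mod_comp)
  moreover have "P * Q = 1\<^sub>m (rdim M')" "Q * P = 1\<^sub>m (rdim M)"
    using s(17) u(17) unfolding P_def Q_def
    by (simp_all add: mat_assoc mat_distrib_left mat_distrib_right s(5-12) u(5-12) mat_zero_simps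
        mat_absorb[OF s(13)] mat_absorb[OF s(14)] mat_absorb[OF s(15)] mat_absorb[OF s(16)]
        mat_absorb[OF u(13)] mat_absorb[OF u(14)] mat_absorb[OF u(15)] mat_absorb[OF u(16)])
  ultimately show ?thesis unfolding iso_mod_def by blast
qed

lemma mod_split_iso_dsum:
  assumes "is_module A L" "is_module A M" "is_module A N" "mod_split A L M N S S' T T'"
  shows "iso_mod A M (dsum_mod L N)"
  using mod_split_unique[OF assms(1-3) is_module_dsum[OF assms(1,3)] assms(4) mod_split_dsum[OF assms(1,3)]] .

section \<open>Submodules, quotients and composition series\<close>

text \<open>The vanishing of \<open>T * ract M a * S\<close> says that the image of \<open>S\<close>
  is stable under the action. In the basis adapted to the splitting the action is then block
  triangular, and each of its two diagonal blocks is again a representation.\<close>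

lemma sub_quotient_module:
  fixes A :: "('b, 'k::field) hopf_data"
  assumes M: "is_module A M" and s: "lin_split l (rdim M) n S S' T T'"
    and inv: "\<And>a. a \<in> hbasis A \<Longrightarrow> T * ract M a * S = 0\<^sub>m n l"
  defines "L \<equiv> \<lparr>rdim = l, ract = (\<lambda>a. S' * ract M a * S)\<rparr>"
    and "N \<equiv> \<lparr>rdim = n, ract = (\<lambda>a. T * ract M a * T')\<rparr>"
  shows "is_module A L" "is_module A N" "S \<in> Hom_mod A L M" "T \<in> Hom_mod A M N"
proof -
  note s = lin_splitD[OF s]
  note d = is_module_dim[OF M] s(5-12)
  note ab = mat_absorb[OF s(13)] mat_absorb[OF s(14)] mat_absorb[OF s(15)] mat_absorb[OF s(16)]
  have MS: "ract M a * S = S * (S' * (ract M a * S))" if a: "a \<in> hbasis A" for a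
  proof -
    have "ract M a * S = (S * S' + T' * T) * (ract M a * S)" using a by (simp add: s(17) d)
    also have "\<dots> = S * (S' * (ract M a * S)) + T' * (T * (ract M a * S))"
      using a by (simp add: mat_distrib_right mat_assoc d)
    also have "T * (ract M a * S) = 0\<^sub>m n l" using inv[OF a] a by (simp add: mat_assoc d)
    finally show ?thesis using a by (simp add: d mat_zero_simps)
  qed
  have TM: "T * ract M a = T * (ract M a * (T' * T))" if a: "a \<in> hbasis A" for a
  proof -
    have "T * ract M a = T * ract M a * (S * S' + T' * T)" unfolding s(17)
      using a d by simp
    also have "\<dots> = T * ract M a * S * S' + T * (ract M a * (T' * T))"
      using a by (simp add: mat_distrib_left mat_assoc d)
    finally show ?thesis using a inv[OF a] by (simp add: d mat_zero_simps)
  qed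
  have cL: "ract L a \<in> carrier_mat (rdim L) (rdim L)" and cN: "ract N a \<in> carrier_mat (rdim N) (rdim N)"
    for a using s(1-4) by (auto simp: L_def N_def)
  have eL: "act_elt A L x = S' * (act_elt A M x * S)" for x
  proof -
    have "S' * (act_elt A M x * S) = msum l l (\<lambda>b. S' * ((x b \<cdot>\<^sub>m ract M b) * S)) (hbasis A)"
      by (subst act_elt_msum, rule is_module_carrier[OF M], assumption, subst msum_mult_right)
        (auto simp: d is_module_carrier[OF M] intro!: msum_mult_left[THEN trans])
    also have "\<dots> = act_elt A L x"
      by (subst act_elt_msum[OF cL], simp add: L_def)
        (auto simp: d mat_assoc mat_smult_left mat_smult_right intro!: msum_cong)
    finally show ?thesis by simp
  qed
  have eN: "act_elt A N x = T * (act_elt A M x * T')" for x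
  proof -
    have "T * (act_elt A M x * T') = msum n n (\<lambda>b. T * ((x b \<cdot>\<^sub>m ract M b) * T')) (hbasis A)"
      by (subst act_elt_msum, rule is_module_carrier[OF M], assumption, subst msum_mult_right)
        (auto simp: d is_module_carrier[OF M] intro!: msum_mult_left[THEN trans])
    also have "\<dots> = act_elt A N x"
      by (subst act_elt_msum[OF cN], simp add: N_def)
        (auto simp: d mat_assoc mat_smult_left mat_smult_right intro!: msum_cong)
    finally show ?thesis by simp
  qed
  have unit: "act_elt A M (hunit A) = 1\<^sub>m (rdim M)"
    and mult: "\<And>a b. a \<in> hbasis A \<Longrightarrow> b \<in> hbasis A \<Longrightarrow> act_elt A M (hmult A a b) = ract M a * ract M b"
    using M by (auto simp: is_module_def)
  have dL: "rdim L = l" "rdim N = n" by (simp_all add: L_def N_def)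
  show "is_module A L" unfolding is_module_def
  proof (intro conjI ballI)
    show "act_elt A L (hunit A) = 1\<^sub>m (rdim L)" by (simp add: eL unit d s(13) dL)
    fix a b assume a: "a \<in> hbasis A" and b: "b \<in> hbasis A"
    have "act_elt A L (hmult A a b) = S' * (ract M a * (ract M b * S))"
      using a b by (simp add: eL mult mat_assoc d)
    also have "\<dots> = S' * (ract M a * (S * (S' * (ract M b * S))))" using MS[OF b] by simp
    also have "\<dots> = ract L a * ract L b" using a b by (simp add: L_def mat_assoc d)
    finally show "act_elt A L (hmult A a b) = ract L a * ract L b" .
  qed (rule cL)
  show "is_module A N" unfolding is_module_def
  proof (intro conjI ballI)
    show "act_elt A N (hunit A) = 1\<^sub>m (rdim N)" by (simp add: eN unit d s(14) dL)
    fix a b assume a: "a \<in> hbasis A" and b: "b \<in> hbasis A"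
    have "act_elt A N (hmult A a b) = T * ract M a * (ract M b * T')"
      using a b by (simp add: eN mult mat_assoc d)
    also have "\<dots> = T * (ract M a * (T' * T)) * (ract M b * T')" using TM[OF a] by simp
    also have "\<dots> = ract N a * ract N b" using a b by (simp add: N_def mat_assoc d)
    finally show "act_elt A N (hmult A a b) = ract N a * ract N b" .
  qed (rule cN)
  show "S \<in> Hom_mod A L M"
  proof (rule Hom_modI)
    fix a assume a: "a \<in> hbasis A"
    show "S * ract L a = ract M a * S" using a by (simp add: L_def mat_assoc d flip: MS[OF a])
  qed (use s dL in auto)
  show "T \<in> Hom_mod A M N"
  proof (rule Hom_modI)
    fix a assume a: "a \<in> hbasis A"
    show "T * ract M a = ract N a * T" using a by (simp add: N_def mat_assoc d flip: TM[OF a])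
  qed (use s dL in auto)
qed

lemma ex_sub_quotient:
  fixes A :: "('b, 'k::field) hopf_data"
  assumes "is_module A M" "lin_split l (rdim M) n S S' T T'"
    "\<And>a. a \<in> hbasis A \<Longrightarrow> T * ract M a * S = 0\<^sub>m n l"
  obtains L N where "is_module A L" "is_module A N" "rdim L = l" "rdim N = n" "S \<in> Hom_mod A L M" "T \<in> Hom_mod A M N"
    "short_exact A L M N"
proof -
  note q = sub_quotient_module[OF assms]
  then show thesis using short_exactI[OF q(3,4)] assms(2)
    by (intro that[OF q(1,2) _ _ q(3,4)]) auto
qed

text \<open>A complement of the image of the prescribed right inverse \<open>T'\<close> provides the
  inclusion \<open>S\<close>; it is stable because \<open>T\<close> is a homomorphism that kills
  it.\<close>

lemma ex_kernel:
  assumes M: "is_module A M" and N: "is_module A N" and T: "T \<in> Hom_mod A M N"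
    and T': "T' \<in> carrier_mat (rdim M) (rdim N)" "T * T' = 1\<^sub>m (rdim N)"
  obtains K S S' where "is_module A K" "S \<in> Hom_mod A K M" "lin_split (rdim K) (rdim M) (rdim N) S S' T T'"
proof -
  obtain k S' S where "lin_split (rdim N) (rdim M) k T' T S' S"
    using lin_split_inj[OF T'(1) Hom_modD(1)[OF T] T'(2)] by metis
  then have s: "lin_split k (rdim M) (rdim N) S S' T T'" by (rule lin_split_sym)
  note l = lin_splitD[OF s]
  have "T * ract M a * S = 0\<^sub>m (rdim N) k" if a: "a \<in> hbasis A" for a
    using is_module_dim[OF M a] is_module_dim[OF N a] Hom_modD(4)[OF T a] l(5-12,15)
    by (simp add: mat_assoc mat_zero_simps)
  from sub_quotient_module(1,3)[OF M s this] show thesis using that s by fastforce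
qed

text \<open>A nonzero quotient of least dimension is simple: a proper nonzero submodule of it would
  leave a smaller nonzero quotient.\<close>

lemma ex_simple_quotient:
  fixes A :: "('b, 'k::field) hopf_data"
  assumes M: "is_module A M" "rdim M \<noteq> 0"
  obtains N V where "is_module A N" "simple_mod A V" "short_exact A N M V"
proof -
  let ?P = "\<lambda>r. r \<noteq> 0 \<and> (\<exists>V T T'. is_module A V \<and> rdim V = r \<and> T \<in> Hom_mod A M V \<and>
    T' \<in> carrier_mat (rdim M) r \<and> T * T' = 1\<^sub>m r)"
  have "?P (rdim M)"
    using M Hom_mod_one[OF M(1)] by (auto intro!: exI[of _ M] exI[of _ "1\<^sub>m (rdim M)"])
  define r where "r = (LEAST r. ?P r)"
  have "?P r" unfolding r_def by (rule LeastI) fact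
  then obtain V T T' where r: "r \<noteq> 0" and V: "is_module A V" "rdim V = r" and T: "T \<in> Hom_mod A M V"
    and T': "T' \<in> carrier_mat (rdim M) r" "T * T' = 1\<^sub>m r" by blast
  have min: "r \<le> r'" if "?P r'" for r' unfolding r_def by (rule Least_le) fact
  have "simple_mod A V"
    unfolding simple_mod_def
  proof (intro conjI allI impI)
    fix W assume W: "is_submodule A V W"
    then obtain w S S' where S: "S \<in> carrier_mat r w" "S' \<in> carrier_mat w r" "S' * S = 1\<^sub>m w"
      "W = (\<lambda>v. S *\<^sub>v v) ` carrier_vec w"
      using subspace_eq_image[of W "rdim V"] V unfolding is_submodule_def by metis
    obtain t U U' where s: "lin_split w r t S S' U U'" using lin_split_inj[OF S(1-3)] by metis
    note l = lin_splitD[OF s]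
    have inv: "U * ract V a * S = 0\<^sub>m t w" if a: "a \<in> hbasis A" for a
    proof (rule mat_eq_by_vec)
      note d = is_module_dim[OF V(1) a] V(2) l(5-12)
      fix v :: "'k vec" assume v: "v \<in> carrier_vec w"
      then have "S *\<^sub>v v \<in> W" using S by auto
      then have "ract V a *\<^sub>v (S *\<^sub>v v) \<in> W" using W a unfolding is_submodule_def by auto
      then obtain u where u: "u \<in> carrier_vec w" "ract V a *\<^sub>v (S *\<^sub>v v) = S *\<^sub>v u" using S by auto
      have "U * ract V a * S *\<^sub>v v = U *\<^sub>v (ract V a *\<^sub>v (S *\<^sub>v v))" using v by (simp add: mat_assoc_vec d)
      also have "\<dots> = U * S *\<^sub>v u" using u by (simp add: mat_assoc_vec d)
      finally show "U * ract V a * S *\<^sub>v v = 0\<^sub>m t w *\<^sub>v v" using u v l(15) by auto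
    qed (use l is_module_carrier[OF V(1) a] V(2) in auto)
    obtain V2 where V2: "is_module A V2" "rdim V2 = t" "U \<in> Hom_mod A V V2"
      using ex_sub_quotient[of A V w t S S' U U'] V s inv by metis
    note dT = Hom_modD(2,3)[OF T] V(2)
    have "U * T \<in> Hom_mod A M V2" using Hom_mod_comp[OF M(1) V(1) V2(1) T V2(3)] .
    moreover have "T' * U' \<in> carrier_mat (rdim M) t" using T' l by auto
    moreover have "U * T * (T' * U') = 1\<^sub>m t" using T' l by (simp add: mat_assoc dT mat_absorb[OF T'(2)])
    ultimately have "t = 0 \<or> r \<le> t" using V2 min[of t] by blast
    moreover have "r = w + t" using lin_split_dim[OF s] .
    ultimately have "t = 0 \<or> w = 0" by auto
    then show "W = {0\<^sub>v (rdim V)} \<or> W = carrier_vec (rdim V)"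
    proof
      assume t: "t = 0"
      then have "U' * U = 0\<^sub>m r r" using l(1-12) by (intro eq_matI) (auto simp: scalar_prod_def)
      then have SS': "S * S' = 1\<^sub>m r" using l(17) l(1,2) by auto
      have "v \<in> W" if v: "v \<in> carrier_vec r" for v
      proof -
        have "v = S * S' *\<^sub>v v" using SS' v by simp
        then have "v = S *\<^sub>v (S' *\<^sub>v v)" using l(1-12) v by (simp only: mat_assoc_vec carrier_vecD)
        then show ?thesis using S v by auto
      qed
      then show ?thesis using S V by auto
    next
      assume w: "w = 0"
      then have "S *\<^sub>v v = 0\<^sub>v r" if "v \<in> carrier_vec w" for v
        using that S by (intro eq_vecI) (auto simp: scalar_prod_def)
      then have "W = {0\<^sub>v r}" using S(4) w by (auto simp: image_def intro!: exI[of _ "0\<^sub>v 0"])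
      then show ?thesis using V by simp
    qed
  qed (use V r in auto)
  moreover obtain K S S' where K: "is_module A K" "S \<in> Hom_mod A K M" "lin_split (rdim K) (rdim M) (rdim V) S S' T T'"
    using ex_kernel[OF M(1) V(1) T] T' V(2) by metis
  ultimately show thesis using that short_exactI[OF K(2) T K(3)] K by blast
qed

lemma ex_composition_series:
  assumes "is_module A M"
  shows "\<exists>Vs. composition_series A M Vs"
  using assms
proof (induction "rdim M" arbitrary: M rule: less_induct)
  case less
  show ?case
  proof (cases "rdim M = 0")
    case True
    then show ?thesis using composition_series.zero_dim[OF less.prems] by blast
  next
    case False
    then obtain N V where N: "is_module A N" "simple_mod A V" "short_exact A N M V"
      using ex_simple_quotient[OF less.prems] by metis
    from N(3) obtain S S' T T' where "S \<in> Hom_mod A N M" "T \<in> Hom_mod A M V"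
      "lin_split (rdim N) (rdim M) (rdim V) S S' T T'" by (rule short_exactE)
    then have "rdim N < rdim M" using lin_split_dim N(2) unfolding simple_mod_def by fastforce
    then obtain Vs where "composition_series A N Vs" using less.hyps N(1) by blast
    then show ?thesis using composition_series.step[OF less.prems N(2,3)] by blast
  qed
qed

text \<open>Because \<open>e\<close> commutes with the action, both its image and the image of
  \<open>1 - e\<close> are stable. So \<open>sub_quotient_module\<close> applies to the splitting
  and to its mirror image, with the same two modules, and all four maps are homomorphisms.\<close>

lemma mod_split_idempotent:
  assumes M: "is_module A M" and e: "e \<in> Hom_mod A M M" "e * e = e"
  obtains L N S S' T T' where "is_module A L" "is_module A N" "mod_split A L M N S S' T T'" "S * S' = e"
proof -
  obtain l n S S' T T' where s: "lin_split l (rdim M) n S S' T T'" "S * S' = e"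
    using lin_split_idempotent[OF Hom_modD(1)[OF e(1)] e(2)] by metis
  note l = lin_splitD[OF s(1)]
  have S: "S = e * S" and S': "S' = S' * e"
    using l(1-12) by (simp_all add: s(2)[symmetric] mat_assoc l(13) mat_absorb[OF l(13)])
  have T: "T * e = 0\<^sub>m n (rdim M)" and T': "e * T' = 0\<^sub>m (rdim M) n"
    using l(1-12) by (simp_all add: s(2)[symmetric] mat_assoc l(16) mat_absorb[OF l(15)] mat_zero_simps)
  note de = Hom_modD(2,3)[OF e(1)]
  have i1: "T * ract M a * S = 0\<^sub>m n l" and i2: "S' * ract M a * T' = 0\<^sub>m l n" if a: "a \<in> hbasis A" for a
  proof -
    note d = is_module_dim[OF M a] l(5-12) de
    have "T * ract M a * S = T * ract M a * (e * S)" using S by simp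
    also have "\<dots> = T * (e * ract M a) * S" using d by (simp add: mat_assoc Hom_modD(4)[OF e(1) a])
    also have "\<dots> = T * e * ract M a * S" using d by (simp add: mat_assoc)
    finally show "T * ract M a * S = 0\<^sub>m n l" using d by (simp add: T mat_zero_simps)
    have "S' * ract M a * T' = S' * e * ract M a * T'" using S' by simp
    also have "\<dots> = S' * (e * ract M a) * T'" using d by (simp add: mat_assoc)
    also have "\<dots> = S' * ract M a * (e * T')" using d by (simp add: mat_assoc Hom_modD(4)[OF e(1) a])
    finally show "S' * ract M a * T' = 0\<^sub>m l n" using d by (simp add: T' mat_zero_simps)
  qed
  note q = sub_quotient_module[OF M s(1) i1] and q' = sub_quotient_module[OF M lin_split_sym[OF s(1)] i2]
  have "mod_split A \<lparr>rdim = l, ract = \<lambda>a. S' * ract M a * S\<rparr> M \<lparr>rdim = n, ract = \<lambda>a. T * ract M a * T'\<rparr> S S' T T'"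
    unfolding mod_split_def using q q' s by simp
  then show thesis using that q(1,2) s(2) by blast
qed

lemma mat_smult_smult: "a \<cdot>\<^sub>m (b \<cdot>\<^sub>m A) = (a * b :: 'a::semigroup_mult) \<cdot>\<^sub>m A"
  by (rule eq_matI) (auto simp: mult.assoc)

section \<open>Tensor products\<close>

lemma sum_div_mod:
  fixes f :: "nat \<Rightarrow> nat \<Rightarrow> 'a::comm_monoid_add"
  shows "(\<Sum>k<a * b. f (k div b) (k mod b)) = (\<Sum>p<a. \<Sum>q<b. f p q)"
proof -
  have "(\<Sum>p<a. \<Sum>q<b. f p q) = (\<Sum>(p, q)\<in>{..<a} \<times> {..<b}. f p q)"
    by (simp add: sum.cartesian_product)
  also have "\<dots> = (\<Sum>k<a * b. f (k div b) (k mod b))"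
  proof (rule sum.reindex_bij_witness[where j = "\<lambda>(p, q). p * b + q" and i = "\<lambda>k. (k div b, k mod b)"])
    fix x assume "x \<in> {..<a} \<times> {..<b}"
    then obtain p q where x: "x = (p, q)" "p < a" "q < b" by auto
    have "p * b + q < Suc p * b" using x by simp
    also have "\<dots> \<le> a * b" using x by (intro mult_right_mono) auto
    finally show "(case x of (p, q) \<Rightarrow> p * b + q) \<in> {..<a * b}" using x by simp
  qed (auto simp: less_mult_imp_div_less intro!: mod_less_divisor gr0I)
  finally show ?thesis by simp
qed

section \<open>Kronecker products\<close>

definition kron :: "'a::semiring_1 mat \<Rightarrow> 'a mat \<Rightarrow> 'a mat" where
  "kron A B = mat (dim_row A * dim_row B) (dim_col A * dim_col B)
     (\<lambda>(i, j). A $$ (i div dim_row B, j div dim_col B) * B $$ (i mod dim_row B, j mod dim_col B))"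

lemma kron_dim [simp]: "dim_row (kron A B) = dim_row A * dim_row B" "dim_col (kron A B) = dim_col A * dim_col B"
  by (simp_all add: kron_def)

lemma kron_carrier [intro]: "A \<in> carrier_mat n m \<Longrightarrow> B \<in> carrier_mat k l \<Longrightarrow> kron A B \<in> carrier_mat (n * k) (m * l)"
  by (auto simp: kron_def)

lemma kron_index: "i < dim_row A * dim_row B \<Longrightarrow> j < dim_col A * dim_col B \<Longrightarrow>
  kron A B $$ (i, j) = A $$ (i div dim_row B, j div dim_col B) * B $$ (i mod dim_row B, j mod dim_col B)"
  by (simp add: kron_def)

lemma div_mod_bounds:
  assumes "i < a * (b::nat)" shows "i div b < a" "i mod b < b"
  using assms by (auto simp: less_mult_imp_div_less intro!: mod_less_divisor gr0I)

lemma kron_mult: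
  fixes A B C D :: "'a::comm_semiring_1 mat"
  assumes "dim_col A = dim_row C" "dim_col B = dim_row D"
  shows "kron A B * kron C D = kron (A * C) (B * D)"
proof (rule eq_matI)
  fix i j assume "i < dim_row (kron (A * C) (B * D))" "j < dim_col (kron (A * C) (B * D))"
  then have ij: "i < dim_row A * dim_row B" "j < dim_col C * dim_col D" by auto
  note b = div_mod_bounds[OF ij(1)] div_mod_bounds[OF ij(2)]
  let ?b = "dim_row B" and ?d = "dim_col D"
  have "(kron A B * kron C D) $$ (i, j) =
    (\<Sum>k<dim_row C * dim_row D. A $$ (i div ?b, k div dim_row D) * B $$ (i mod ?b, k mod dim_row D) *
      (C $$ (k div dim_row D, j div ?d) * D $$ (k mod dim_row D, j mod ?d)))"
    using ij assms by (simp add: scalar_prod_def lessThan_atLeast0 kron_index)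
  also have "\<dots> = (\<Sum>p<dim_row C. \<Sum>q<dim_row D. A $$ (i div ?b, p) * B $$ (i mod ?b, q) *
      (C $$ (p, j div ?d) * D $$ (q, j mod ?d)))"
    by (rule sum_div_mod)
  also have "\<dots> = (\<Sum>p<dim_row C. A $$ (i div ?b, p) * C $$ (p, j div ?d)) * (\<Sum>q<dim_row D. B $$ (i mod ?b, q) * D $$ (q, j mod ?d))"
    by (simp add: sum_product mult_ac)
  also have "\<dots> = kron (A * C) (B * D) $$ (i, j)"
    using ij b assms by (simp add: kron_index scalar_prod_def lessThan_atLeast0)
  finally show "(kron A B * kron C D) $$ (i, j) = kron (A * C) (B * D) $$ (i, j)" .
qed auto

lemma kron_one: "kron (1\<^sub>m m) (1\<^sub>m n) = (1\<^sub>m (m * n) :: 'a::semiring_1 mat)"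
proof (rule eq_matI)
  fix i j assume "i < dim_row (1\<^sub>m (m * n) :: 'a mat)" "j < dim_col (1\<^sub>m (m * n) :: 'a mat)"
  then have ij: "i < m * n" "j < m * n" by auto
  have "i = j \<longleftrightarrow> i div n = j div n \<and> i mod n = j mod n" by (metis div_mult_mod_eq)
  then show "kron (1\<^sub>m m) (1\<^sub>m n) $$ (i, j) = (1\<^sub>m (m * n) :: 'a mat) $$ (i, j)"
    using ij div_mod_bounds[OF ij(1)] div_mod_bounds[OF ij(2)] by (simp add: kron_index)
qed auto

lemma kron_add_left:
  assumes "dim_row A = dim_row B" "dim_col A = dim_col B"
  shows "kron (A + B) C = kron A C + kron B C"
  by (rule eq_matI) (use assms in \<open>auto simp: kron_index div_mod_bounds distrib_right\<close>)

lemma kron_add_right: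
  assumes "dim_row B = dim_row C" "dim_col B = dim_col C"
  shows "kron A (B + C) = kron A B + kron A C"
  by (rule eq_matI) (use assms in \<open>auto simp: kron_index div_mod_bounds distrib_left\<close>)

lemma kron_zero_left: "kron (0\<^sub>m m n) A = 0\<^sub>m (m * dim_row A) (n * dim_col A)"
  by (rule eq_matI) (auto simp: kron_index div_mod_bounds)

lemma kron_zero_right: "kron A (0\<^sub>m m n) = 0\<^sub>m (dim_row A * m) (dim_col A * n)"
  by (rule eq_matI) (auto simp: kron_index div_mod_bounds)

lemma kron_smult_left: "kron (c \<cdot>\<^sub>m A) B = c \<cdot>\<^sub>m kron A (B :: 'a::comm_semiring_1 mat)"
  by (rule eq_matI) (auto simp: kron_index div_mod_bounds mult_ac)

lemma kron_smult_right: "kron A (c \<cdot>\<^sub>m B) = c \<cdot>\<^sub>m kron A (B :: 'a::comm_semiring_1 mat)"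
  by (rule eq_matI) (auto simp: kron_index div_mod_bounds mult_ac)

text \<open>Both sides read an index as the same three digits in mixed radix, so the product is
  associative on the nose and not only up to a permutation of the basis.\<close>

lemma kron_assoc: "kron (kron A B) C = kron A (kron B (C :: 'a::comm_semiring_1 mat))"
proof (rule eq_matI)
  fix i j assume "i < dim_row (kron A (kron B C))" "j < dim_col (kron A (kron B C))"
  then have ij: "i < dim_row A * (dim_row B * dim_row C)" "j < dim_col A * (dim_col B * dim_col C)" by auto
  then have ij': "i < dim_row A * dim_row B * dim_row C" "j < dim_col A * dim_col B * dim_col C"
    by (simp_all add: mult.assoc)
  have dm: "x div c mod b = x mod (b * c) div c" "x mod (b * c) mod c = x mod c" "x div c div b = x div (b * c)"
    for x b c :: nat
  proof -
    show "x div c mod b = x mod (b * c) div c"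
      by (cases "c = 0") (simp_all add: mod_mult2_eq mult.commute[of b c])
    show "x mod (b * c) mod c = x mod c" by (simp add: mod_mod_cancel)
    show "x div c div b = x div (b * c)" by (simp add: div_mult2_eq mult.commute[of b c])
  qed
  show "kron (kron A B) C $$ (i, j) = kron A (kron B C) $$ (i, j)"
    using ij ij' div_mod_bounds[OF ij(1)] div_mod_bounds[OF ij(2)] div_mod_bounds[OF ij'(1)] div_mod_bounds[OF ij'(2)]
    by (simp add: kron_index dm mult.assoc)
qed (auto simp: mult.assoc)

lemma kron_msum_left:
  assumes "\<And>s. s \<in> S \<Longrightarrow> f s \<in> carrier_mat n m"
  shows "kron (msum n m f S) B = msum (n * dim_row B) (m * dim_col B) (\<lambda>s. kron (f s) B) S"
  by (rule eq_matI) (auto simp: kron_index div_mod_bounds sum_distrib_right intro!: sum.cong dest!: assms)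

lemma kron_msum_right:
  assumes "\<And>s. s \<in> S \<Longrightarrow> f s \<in> carrier_mat n m"
  shows "kron B (msum n m f S) = msum (dim_row B * n) (dim_col B * m) (\<lambda>s. kron B (f s)) S"
  by (rule eq_matI) (auto simp: kron_index div_mod_bounds sum_distrib_left intro!: sum.cong dest!: assms)

lemma lin_split_kron_left:
  assumes "lin_split l m n S S' T T'"
  shows "lin_split (l * r) (m * r) (n * r) (kron S (1\<^sub>m r)) (kron S' (1\<^sub>m r)) (kron T (1\<^sub>m r)) (kron T' (1\<^sub>m r))"
proof -
  note s = lin_splitD[OF assms]
  show ?thesis unfolding lin_split_def
    using s by (auto simp: kron_mult kron_one kron_zero_left simp flip: kron_add_left)
qed

lemma lin_split_kron_right:
  assumes "lin_split l m n S S' T T'"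
  shows "lin_split (r * l) (r * m) (r * n) (kron (1\<^sub>m r) S) (kron (1\<^sub>m r) S') (kron (1\<^sub>m r) T) (kron (1\<^sub>m r) T')"
proof -
  note s = lin_splitD[OF assms]
  show ?thesis unfolding lin_split_def
    using s by (auto simp: kron_mult kron_one kron_zero_right simp flip: kron_add_right)
qed

text \<open>Records may differ at indices outside \<open>hbasis A\<close>, so modules with the same
  action need not be equal; the identity matrix still identifies them.\<close>

lemma iso_mod_by_eq:
  assumes "is_module A M" "rdim N = rdim M" "\<And>a. a \<in> hbasis A \<Longrightarrow> ract N a = ract M a"
  shows "iso_mod A M N"
proof -
  have "1\<^sub>m (rdim M) \<in> Hom_mod A M N" "1\<^sub>m (rdim M) \<in> Hom_mod A N M"
    using assms by (auto intro!: Hom_modI dest: is_module_carrier)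
  then show ?thesis unfolding iso_mod_def using assms(2) by force
qed

lemma tensor_mod_rdim [simp]: "rdim (tensor_mod A M N) = rdim M * rdim N"
  by (simp add: tensor_mod_def)

section \<open>Tensor products of modules over a Hopf algebra\<close>

context hopf_algebra
begin

lemma is_module_trivial: "is_module A (trivial_mod A)"
proof -
  have "act_elt A (trivial_mod A) x = mat 1 1 (\<lambda>_. counit_elt A x)" for x
    by (rule eq_matI) (auto simp: act_elt_def trivial_mod_def counit_elt_def)
  then show ?thesis unfolding is_module_def
    by (auto simp: trivial_mod_def counit_unit counit_mult scalar_prod_def intro!: eq_matI)
qed

text \<open>The action of an element of the tensor square of \<open>A\<close>; the action of
  \<open>A\<close> itself on the tensor product is its composite with the comultiplication.\<close>

definition act_tensor :: "('b, 'k) rep \<Rightarrow> ('b, 'k) rep \<Rightarrow> ('b \<times> 'b \<Rightarrow> 'k) \<Rightarrow> 'k mat" where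
  "act_tensor M N t = msum (rdim M * rdim N) (rdim M * rdim N)
     (\<lambda>(p, q). t (p, q) \<cdot>\<^sub>m kron (ract M p) (ract N q)) (hbasis A \<times> hbasis A)"

lemma act_tensor_index:
  assumes "is_module A M" "is_module A N" "i < rdim M * rdim N" "j < rdim M * rdim N"
  shows "act_tensor M N t $$ (i, j) = (\<Sum>p\<in>hbasis A. \<Sum>q\<in>hbasis A. t (p, q) * kron (ract M p) (ract N q) $$ (i, j))"
proof -
  have "act_tensor M N t $$ (i, j) = (\<Sum>(p, q)\<in>hbasis A \<times> hbasis A. t (p, q) * kron (ract M p) (ract N q) $$ (i, j))"
    unfolding act_tensor_def using assms by (auto simp: is_module_dim intro!: sum.cong)
  then show ?thesis by (simp add: sum.cartesian_product)
qed

lemma tensor_mod_act: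
  assumes "is_module A M" "is_module A N"
  shows "ract (tensor_mod A M N) a = act_tensor M N (hcomult A a)"
  by (rule eq_matI) (use assms in \<open>auto simp: tensor_mod_def act_tensor_def kron_index is_module_dim mult.assoc intro!: sum.cong\<close>)

lemma act_tensor_dim [simp]: "dim_row (act_tensor M N t) = rdim M * rdim N" "dim_col (act_tensor M N t) = rdim M * rdim N"
  by (simp_all add: act_tensor_def)

lemma act_tensor_tensor_elt:
  assumes M: "is_module A M" and N: "is_module A N"
  shows "act_tensor M N (tensor_elt x z) = kron (act_elt A M x) (act_elt A N z)"
proof (rule eq_matI)
  fix i j assume "i < dim_row (kron (act_elt A M x) (act_elt A N z))" "j < dim_col (kron (act_elt A M x) (act_elt A N z))"
  then have ij: "i < rdim M * rdim N" "j < rdim M * rdim N" by auto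
  note b = div_mod_bounds[OF ij(1)] div_mod_bounds[OF ij(2)]
  show "act_tensor M N (tensor_elt x z) $$ (i, j) = kron (act_elt A M x) (act_elt A N z) $$ (i, j)"
    using ij b by (auto simp add: act_tensor_index[OF M N] kron_index act_elt_def sum_product
        is_module_dim[OF M] is_module_dim[OF N] tensor_elt_def mult_ac intro!: sum.cong)
qed auto

lemma act_tensor_comult_elt:
  assumes M: "is_module A M" and N: "is_module A N"
  shows "act_tensor M N (comult_elt A x) = act_elt A (tensor_mod A M N) x"
proof (rule eq_matI)
  fix i j assume "i < dim_row (act_elt A (tensor_mod A M N) x)" "j < dim_col (act_elt A (tensor_mod A M N) x)"
  then have ij: "i < rdim M * rdim N" "j < rdim M * rdim N" by auto
  let ?K = "\<lambda>p q. kron (ract M p) (ract N q) $$ (i, j)"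
  have "act_tensor M N (comult_elt A x) $$ (i, j) =
    (\<Sum>p\<in>hbasis A. \<Sum>q\<in>hbasis A. \<Sum>a\<in>hbasis A. x a * (hcomult A a (p, q) * ?K p q))"
    by (simp add: act_tensor_index[OF M N ij] comult_elt_def sum_distrib_right mult.assoc)
  also have "\<dots> = (\<Sum>p\<in>hbasis A. \<Sum>a\<in>hbasis A. \<Sum>q\<in>hbasis A. x a * (hcomult A a (p, q) * ?K p q))"
    by (rule sum.cong[OF refl], rule sum.swap)
  also have "\<dots> = (\<Sum>a\<in>hbasis A. \<Sum>p\<in>hbasis A. \<Sum>q\<in>hbasis A. x a * (hcomult A a (p, q) * ?K p q))"
    by (rule sum.swap)
  also have "\<dots> = act_elt A (tensor_mod A M N) x $$ (i, j)"
    using ij by (simp add: act_elt_def tensor_mod_act[OF M N] act_tensor_index[OF M N ij] sum_distrib_left)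
  finally show "act_tensor M N (comult_elt A x) $$ (i, j) = act_elt A (tensor_mod A M N) x $$ (i, j)" .
qed auto

text \<open>For basis vectors this is the rule that Kronecker products multiply factorwise; the
  general case expands both elements in the basis and exchanges the sums. With
  \<open>comult_mult\<close> it yields multiplicativity of the tensor action.\<close>

lemma act_tensor_prod_tensor:
  assumes M: "is_module A M" and N: "is_module A N"
  shows "act_tensor M N (prod_tensor A s t) = act_tensor M N s * act_tensor M N t"
proof (rule eq_matI)
  let ?d = "rdim M * rdim N" and ?HH = "hbasis A \<times> hbasis A"
  fix i j assume "i < dim_row (act_tensor M N s * act_tensor M N t)" "j < dim_col (act_tensor M N s * act_tensor M N t)"
  then have ij: "i < ?d" "j < ?d" by auto
  let ?K = "\<lambda>x. kron (ract M (fst x)) (ract N (snd x))"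
  let ?m = "\<lambda>x y z. hmult A (fst x) (fst y) (fst z) * hmult A (snd x) (snd y) (snd z)"
  note d = is_module_dim[OF M] is_module_dim[OF N]
  have K: "(?K x * ?K y) $$ (i, j) = (\<Sum>z\<in>?HH. ?m x y z * ?K z $$ (i, j))" if x: "x \<in> ?HH" and y: "y \<in> ?HH" for x y
  proof -
    have "?K x * ?K y = kron (act_elt A M (hmult A (fst x) (fst y))) (act_elt A N (hmult A (snd x) (snd y)))"
      using x y M N by (auto simp: kron_mult d is_module_def)
    also have "\<dots> = act_tensor M N (tensor_elt (hmult A (fst x) (fst y)) (hmult A (snd x) (snd y)))"
      by (simp add: act_tensor_tensor_elt[OF M N])
    finally show ?thesis
      by (simp add: act_tensor_index[OF M N ij] tensor_elt_def sum.cartesian_product case_prod_beta)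
  qed
  have act: "act_tensor M N t = msum ?d ?d (\<lambda>x. t x \<cdot>\<^sub>m ?K x) ?HH" for t
    unfolding act_tensor_def by (rule msum_cong) auto
  have "act_tensor M N s * act_tensor M N t = msum ?d ?d (\<lambda>x. (s x \<cdot>\<^sub>m ?K x) * act_tensor M N t) ?HH"
    unfolding act[of s] by (subst msum_mult_right) (auto simp: d)
  also have "\<dots> = msum ?d ?d (\<lambda>x. msum ?d ?d (\<lambda>y. (s x * t y) \<cdot>\<^sub>m (?K x * ?K y)) ?HH) ?HH"
  proof (rule msum_cong[OF refl])
    fix x assume x: "x \<in> ?HH"
    show "(s x \<cdot>\<^sub>m ?K x) * act_tensor M N t = msum ?d ?d (\<lambda>y. (s x * t y) \<cdot>\<^sub>m (?K x * ?K y)) ?HH"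
      unfolding act[of t] using x
      by (subst msum_mult_left) (auto simp: d mat_smult_left mat_smult_right mat_smult_smult mult_ac intro!: msum_cong)
  qed
  finally have "(act_tensor M N s * act_tensor M N t) $$ (i, j) =
      (\<Sum>x\<in>?HH. \<Sum>y\<in>?HH. s x * t y * (?K x * ?K y) $$ (i, j))"
    using ij by (auto simp: d intro!: sum.cong)
  also have "\<dots> = (\<Sum>x\<in>?HH. \<Sum>y\<in>?HH. \<Sum>z\<in>?HH. s x * t y * (?m x y z * ?K z $$ (i, j)))"
    by (intro sum.cong refl) (simp only: K sum_distrib_left)
  also have "\<dots> = (\<Sum>x\<in>?HH. \<Sum>z\<in>?HH. \<Sum>y\<in>?HH. s x * t y * (?m x y z * ?K z $$ (i, j)))"
    by (rule sum.cong[OF refl], rule sum.swap)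
  also have "\<dots> = (\<Sum>z\<in>?HH. \<Sum>x\<in>?HH. \<Sum>y\<in>?HH. s x * t y * (?m x y z * ?K z $$ (i, j)))"
    by (rule sum.swap)
  also have "\<dots> = (\<Sum>z\<in>?HH. prod_tensor A s t z * ?K z $$ (i, j))"
    by (intro sum.cong refl) (simp add: prod_tensor_def case_prod_beta sum_distrib_right mult.assoc)
  also have "\<dots> = act_tensor M N (prod_tensor A s t) $$ (i, j)"
    by (simp add: act_tensor_index[OF M N ij] sum.cartesian_product case_prod_beta)
  finally show "act_tensor M N (prod_tensor A s t) $$ (i, j) = (act_tensor M N s * act_tensor M N t) $$ (i, j)" by simp
qed auto

lemma is_module_tensor:
  assumes M: "is_module A M" and N: "is_module A N"
  shows "is_module A (tensor_mod A M N)"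
  unfolding is_module_def
proof (intro conjI ballI)
  fix a b assume a: "a \<in> hbasis A" and b: "b \<in> hbasis A"
  show "ract (tensor_mod A M N) a \<in> carrier_mat (rdim (tensor_mod A M N)) (rdim (tensor_mod A M N))"
    by (auto simp: tensor_mod_def)
  show "act_elt A (tensor_mod A M N) (hmult A a b) = ract (tensor_mod A M N) a * ract (tensor_mod A M N) b"
    by (simp add: comult_mult[OF a b] act_tensor_prod_tensor[OF M N] tensor_mod_act[OF M N]
        flip: act_tensor_comult_elt[OF M N])
next
  have "act_elt A (tensor_mod A M N) (hunit A) = kron (act_elt A M (hunit A)) (act_elt A N (hunit A))"
    by (simp add: comult_unit act_tensor_tensor_elt[OF M N] flip: act_tensor_comult_elt[OF M N])
  then show "act_elt A (tensor_mod A M N) (hunit A) = 1\<^sub>m (rdim (tensor_mod A M N))"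
    using M N by (simp add: is_module_def kron_one)
qed

lemma Hom_mod_kron:
  assumes mods: "is_module A M" "is_module A M'" "is_module A N" "is_module A N'"
    and S: "S \<in> Hom_mod A M M'" and T: "T \<in> Hom_mod A N N'"
  shows "kron S T \<in> Hom_mod A (tensor_mod A M N) (tensor_mod A M' N')"
proof (rule Hom_modI)
  note d = mods[THEN is_module_dim(1)] mods[THEN is_module_dim(2)] Hom_modD(2,3)[OF S] Hom_modD(2,3)[OF T]
  show "kron S T \<in> carrier_mat (rdim (tensor_mod A M' N')) (rdim (tensor_mod A M N))"
    using Hom_modD(1)[OF S] Hom_modD(1)[OF T] by auto
  fix a
  have "kron S T * act_tensor M N (hcomult A a) = act_tensor M' N' (hcomult A a) * kron S T"
    unfolding act_tensor_def
    by (subst msum_mult_left, force simp: d, simp add: d, subst msum_mult_right, force simp: d, simp add: d)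
      (auto simp: d mat_smult_left mat_smult_right kron_mult Hom_modD(4)[OF S] Hom_modD(4)[OF T] intro!: msum_cong)
  then show "kron S T * ract (tensor_mod A M N) a = ract (tensor_mod A M' N') a * kron S T"
    by (simp add: tensor_mod_act mods)
qed

lemma iso_mod_tensor:
  assumes mods: "is_module A M" "is_module A M'" "is_module A N" "is_module A N'"
    and "iso_mod A M M'" "iso_mod A N N'"
  shows "iso_mod A (tensor_mod A M N) (tensor_mod A M' N')"
proof -
  from assms(5) obtain S S' where S: "S \<in> Hom_mod A M M'" "S' \<in> Hom_mod A M' M" "S' * S = 1\<^sub>m (rdim M)" "S * S' = 1\<^sub>m (rdim M')"
    unfolding iso_mod_def by auto
  from assms(6) obtain T T' where T: "T \<in> Hom_mod A N N'" "T' \<in> Hom_mod A N' N" "T' * T = 1\<^sub>m (rdim N)" "T * T' = 1\<^sub>m (rdim N')"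
    unfolding iso_mod_def by auto
  have "kron S T \<in> Hom_mod A (tensor_mod A M N) (tensor_mod A M' N')"
    "kron S' T' \<in> Hom_mod A (tensor_mod A M' N') (tensor_mod A M N)"
    using Hom_mod_kron mods S T by blast+
  moreover have "kron S' T' * kron S T = 1\<^sub>m (rdim M * rdim N)" "kron S T * kron S' T' = 1\<^sub>m (rdim M' * rdim N')"
    using S(3,4) T(3,4) Hom_modD(2,3)[OF S(1)] Hom_modD(2,3)[OF S(2)] Hom_modD(2,3)[OF T(1)] Hom_modD(2,3)[OF T(2)]
    by (simp_all add: kron_mult kron_one)
  ultimately show ?thesis unfolding iso_mod_def by auto
qed

text \<open>Over a field exactness is witnessed by a linear splitting, and a splitting stays one
  after taking Kronecker products with an identity matrix.\<close>

lemma short_exact_tensor_left: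
  assumes mods: "is_module A L" "is_module A M" "is_module A N" "is_module A P" and e: "short_exact A L M N"
  shows "short_exact A (tensor_mod A L P) (tensor_mod A M P) (tensor_mod A N P)"
proof -
  obtain S S' T T' where S: "S \<in> Hom_mod A L M" "T \<in> Hom_mod A M N"
    and s: "lin_split (rdim L) (rdim M) (rdim N) S S' T T'"
    using e by (rule short_exactE)
  show ?thesis
    using short_exactI[OF Hom_mod_kron[OF mods(1,2,4,4) S(1) Hom_mod_one[OF mods(4)]]
        Hom_mod_kron[OF mods(2,3,4,4) S(2) Hom_mod_one[OF mods(4)]]]
      lin_split_kron_left[OF s, of "rdim P"] by simp
qed

lemma short_exact_tensor_right:
  assumes mods: "is_module A L" "is_module A M" "is_module A N" "is_module A P" and e: "short_exact A L M N"
  shows "short_exact A (tensor_mod A P L) (tensor_mod A P M) (tensor_mod A P N)"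
proof -
  obtain S S' T T' where S: "S \<in> Hom_mod A L M" "T \<in> Hom_mod A M N"
    and s: "lin_split (rdim L) (rdim M) (rdim N) S S' T T'"
    using e by (rule short_exactE)
  show ?thesis
    using short_exactI[OF Hom_mod_kron[OF mods(4,4,1,2) Hom_mod_one[OF mods(4)] S(1)]
        Hom_mod_kron[OF mods(4,4,2,3) Hom_mod_one[OF mods(4)] S(2)]]
      lin_split_kron_right[OF s, of "rdim P"] by simp
qed

lemma iso_mod_tensor_dsum_left:
  assumes mods: "is_module A L" "is_module A N" "is_module A P"
  shows "iso_mod A (tensor_mod A (dsum_mod L N) P) (dsum_mod (tensor_mod A L P) (tensor_mod A N P))"
proof -
  note m = mods is_module_dsum[OF mods(1,2)] Hom_mod_one[OF mods(3)]
  note s = mod_split_dsum[OF mods(1,2), unfolded mod_split_def]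
  have "mod_split A (tensor_mod A L P) (tensor_mod A (dsum_mod L N) P) (tensor_mod A N P)
    (kron (dsum_in1 (rdim L) (rdim N)) (1\<^sub>m (rdim P))) (kron (dsum_pr1 (rdim L) (rdim N)) (1\<^sub>m (rdim P)))
    (kron (dsum_pr2 (rdim L) (rdim N)) (1\<^sub>m (rdim P))) (kron (dsum_in2 (rdim L) (rdim N)) (1\<^sub>m (rdim P)))"
    unfolding mod_split_def using s m lin_split_kron_left[of "rdim L" _ "rdim N" _ _ _ _ "rdim P"]
    by (auto intro!: Hom_mod_kron)
  then show ?thesis using mod_split_iso_dsum is_module_tensor m by blast
qed

lemma iso_mod_tensor_dsum_right:
  assumes mods: "is_module A L" "is_module A N" "is_module A P"
  shows "iso_mod A (tensor_mod A P (dsum_mod L N)) (dsum_mod (tensor_mod A P L) (tensor_mod A P N))"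
proof -
  note m = mods is_module_dsum[OF mods(1,2)] Hom_mod_one[OF mods(3)]
  note s = mod_split_dsum[OF mods(1,2), unfolded mod_split_def]
  have "mod_split A (tensor_mod A P L) (tensor_mod A P (dsum_mod L N)) (tensor_mod A P N)
    (kron (1\<^sub>m (rdim P)) (dsum_in1 (rdim L) (rdim N))) (kron (1\<^sub>m (rdim P)) (dsum_pr1 (rdim L) (rdim N)))
    (kron (1\<^sub>m (rdim P)) (dsum_pr2 (rdim L) (rdim N))) (kron (1\<^sub>m (rdim P)) (dsum_in2 (rdim L) (rdim N)))"
    unfolding mod_split_def using s m lin_split_kron_right[of "rdim L" _ "rdim N" _ _ _ _ "rdim P"]
    by (auto intro!: Hom_mod_kron)
  then show ?thesis using mod_split_iso_dsum is_module_tensor m by blast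
qed

text \<open>The two modules have the same matrices: \<open>kron_assoc\<close> matches the matrices
  and coassociativity matches their coefficients.\<close>

lemma iso_mod_tensor_assoc:
  assumes mods: "is_module A M" "is_module A N" "is_module A L"
  shows "iso_mod A (tensor_mod A (tensor_mod A M N) L) (tensor_mod A M (tensor_mod A N L))"
proof (rule iso_mod_by_eq)
  note t = is_module_tensor[OF mods(1,2)] is_module_tensor[OF mods(2,3)]
  note d = mods[THEN is_module_dim(1)] mods[THEN is_module_dim(2)]
  show "is_module A (tensor_mod A (tensor_mod A M N) L)" using is_module_tensor t mods by blast
  fix a assume a: "a \<in> hbasis A"
  let ?H = "hbasis A"
  show "ract (tensor_mod A M (tensor_mod A N L)) a = ract (tensor_mod A (tensor_mod A M N) L) a"
  proof (rule eq_matI)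
    fix i j assume "i < dim_row (ract (tensor_mod A (tensor_mod A M N) L) a)" "j < dim_col (ract (tensor_mod A (tensor_mod A M N) L) a)"
    then have ij: "i < rdim M * rdim N * rdim L" "j < rdim M * rdim N * rdim L"
      by (auto simp: tensor_mod_act[OF t(1) mods(3)])
    then have ij': "i < rdim M * (rdim N * rdim L)" "j < rdim M * (rdim N * rdim L)" by (auto simp: mult.assoc)
    let ?K = "\<lambda>p q r. kron (ract M p) (kron (ract N q) (ract L r)) $$ (i, j)"
    have 1: "kron (act_tensor M N (hcomult A s)) (ract L r) $$ (i, j) = (\<Sum>p\<in>?H. \<Sum>q\<in>?H. hcomult A s (p, q) * ?K p q r)"
      if "r \<in> ?H" for s r
    proof -
      have "kron (act_tensor M N (hcomult A s)) (ract L r) = msum (rdim M * rdim N * rdim L) (rdim M * rdim N * rdim L)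
        (\<lambda>(p, q). hcomult A s (p, q) \<cdot>\<^sub>m kron (ract M p) (kron (ract N q) (ract L r))) (?H \<times> ?H)"
        unfolding act_tensor_def using that
        by (subst kron_msum_left) (auto simp: d kron_smult_left kron_assoc case_prod_beta intro!: msum_cong)
      then show ?thesis using ij that by (auto simp: sum.cartesian_product d mult.assoc intro!: sum.cong)
    qed
    have 2: "kron (ract M p) (act_tensor N L (hcomult A s)) $$ (i, j) = (\<Sum>q\<in>?H. \<Sum>r\<in>?H. hcomult A s (q, r) * ?K p q r)"
      if "p \<in> ?H" for s p
    proof -
      have "kron (ract M p) (act_tensor N L (hcomult A s)) = msum (rdim M * (rdim N * rdim L)) (rdim M * (rdim N * rdim L))
        (\<lambda>(q, r). hcomult A s (q, r) \<cdot>\<^sub>m kron (ract M p) (kron (ract N q) (ract L r))) (?H \<times> ?H)"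
        unfolding act_tensor_def using that
        by (subst kron_msum_right) (auto simp: d kron_smult_right case_prod_beta intro!: msum_cong)
      then show ?thesis using ij' that by (auto simp: sum.cartesian_product d intro!: sum.cong)
    qed
    have "ract (tensor_mod A (tensor_mod A M N) L) a $$ (i, j) =
      (\<Sum>s\<in>?H. \<Sum>r\<in>?H. \<Sum>p\<in>?H. \<Sum>q\<in>?H. hcomult A a (s, r) * hcomult A s (p, q) * ?K p q r)"
      using ij by (simp add: tensor_mod_act[OF t(1) mods(3)] act_tensor_index[OF t(1) mods(3)] tensor_mod_act[OF mods(1,2)] 1 sum_distrib_left mult.assoc)
    also have "\<dots> = (\<Sum>p\<in>?H. \<Sum>q\<in>?H. \<Sum>r\<in>?H. (\<Sum>s\<in>?H. hcomult A a (s, r) * hcomult A s (p, q)) * ?K p q r)"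
    proof -
      have "(\<Sum>s\<in>?H. \<Sum>r\<in>?H. \<Sum>p\<in>?H. \<Sum>q\<in>?H. f s r p q) = (\<Sum>p\<in>?H. \<Sum>q\<in>?H. \<Sum>r\<in>?H. \<Sum>s\<in>?H. f s r p q)"
        for f :: "'b \<Rightarrow> 'b \<Rightarrow> 'b \<Rightarrow> 'b \<Rightarrow> 'k"
        by (simp add: sum.cartesian_product)
          (rule sum.reindex_bij_witness[where i = "\<lambda>(p, q, r, s). (s, r, p, q)" and j = "\<lambda>(s, r, p, q). (p, q, r, s)"]; auto)
      then show ?thesis by (simp add: sum_distrib_right)
    qed
    also have "\<dots> = (\<Sum>p\<in>?H. \<Sum>q\<in>?H. \<Sum>r\<in>?H. (\<Sum>s\<in>?H. hcomult A a (p, s) * hcomult A s (q, r)) * ?K p q r)"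
      by (intro sum.cong refl) (simp add: comult_coassoc[OF a])
    also have "\<dots> = (\<Sum>p\<in>?H. \<Sum>s\<in>?H. \<Sum>q\<in>?H. \<Sum>r\<in>?H. hcomult A a (p, s) * hcomult A s (q, r) * ?K p q r)"
    proof -
      have "(\<Sum>p\<in>?H. \<Sum>q\<in>?H. \<Sum>r\<in>?H. \<Sum>s\<in>?H. f s r p q) = (\<Sum>p\<in>?H. \<Sum>s\<in>?H. \<Sum>q\<in>?H. \<Sum>r\<in>?H. f s r p q)"
        for f :: "'b \<Rightarrow> 'b \<Rightarrow> 'b \<Rightarrow> 'b \<Rightarrow> 'k"
        by (simp add: sum.cartesian_product)
          (rule sum.reindex_bij_witness[where i = "\<lambda>(p, s, q, r). (p, q, r, s)" and j = "\<lambda>(p, q, r, s). (p, s, q, r)"]; auto)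
      then show ?thesis by (simp add: sum_distrib_right)
    qed
    also have "\<dots> = ract (tensor_mod A M (tensor_mod A N L)) a $$ (i, j)"
      using ij' by (simp add: tensor_mod_act[OF mods(1) t(2)] act_tensor_index[OF mods(1) t(2)] tensor_mod_act[OF mods(2,3)] 2 sum_distrib_left mult.assoc)
    finally show "ract (tensor_mod A M (tensor_mod A N L)) a $$ (i, j) = ract (tensor_mod A (tensor_mod A M N) L) a $$ (i, j)" by simp
  qed (auto simp: tensor_mod_def mult.assoc)
qed (simp add: mult.assoc)

lemma iso_mod_tensor_trivial_left:
  assumes M: "is_module A M"
  shows "iso_mod A M (tensor_mod A (trivial_mod A) M)"
proof (rule iso_mod_by_eq[OF M])
  show rd: "rdim (tensor_mod A (trivial_mod A) M) = rdim M" by (simp add: trivial_mod_def)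
  fix a assume a: "a \<in> hbasis A"
  show "ract (tensor_mod A (trivial_mod A) M) a = ract M a"
  proof (rule eq_matI)
    fix i j assume "i < dim_row (ract M a)" "j < dim_col (ract M a)"
    then have ij: "i < rdim M" "j < rdim M" using M a by (auto simp: is_module_dim)
    have "ract (tensor_mod A (trivial_mod A) M) a $$ (i, j) =
      (\<Sum>p\<in>hbasis A. \<Sum>q\<in>hbasis A. hcounit A p * hcomult A a (p, q) * ract M q $$ (i, j))"
      using ij by (simp add: tensor_mod_def trivial_mod_def sum.cartesian_product mult_ac)
    also have "\<dots> = (\<Sum>q\<in>hbasis A. \<Sum>p\<in>hbasis A. hcounit A p * hcomult A a (p, q) * ract M q $$ (i, j))"
      by (rule sum.swap)
    also have "\<dots> = (\<Sum>q\<in>hbasis A. bvec a q * ract M q $$ (i, j))"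
      by (intro sum.cong refl) (simp add: counit_left[OF a] flip: sum_distrib_right)
    also have "\<dots> = ract M a $$ (i, j)"
      using a finite_basis by (simp add: bvec_def if_distrib[of "\<lambda>x. x * _"] cong: if_cong)
    finally show "ract (tensor_mod A (trivial_mod A) M) a $$ (i, j) = ract M a $$ (i, j)" .
  qed (use M a rd in \<open>auto simp: is_module_dim tensor_mod_def\<close>)
qed

lemma iso_mod_tensor_trivial_right:
  assumes M: "is_module A M"
  shows "iso_mod A M (tensor_mod A M (trivial_mod A))"
proof (rule iso_mod_by_eq[OF M])
  show rd: "rdim (tensor_mod A M (trivial_mod A)) = rdim M" by (simp add: trivial_mod_def)
  fix a assume a: "a \<in> hbasis A"
  show "ract (tensor_mod A M (trivial_mod A)) a = ract M a"
  proof (rule eq_matI)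
    fix i j assume "i < dim_row (ract M a)" "j < dim_col (ract M a)"
    then have ij: "i < rdim M" "j < rdim M" using M a by (auto simp: is_module_dim)
    have "ract (tensor_mod A M (trivial_mod A)) a $$ (i, j) =
      (\<Sum>p\<in>hbasis A. \<Sum>q\<in>hbasis A. hcomult A a (p, q) * hcounit A q * ract M p $$ (i, j))"
      using ij by (simp add: tensor_mod_def trivial_mod_def sum.cartesian_product mult_ac)
    also have "\<dots> = (\<Sum>p\<in>hbasis A. bvec a p * ract M p $$ (i, j))"
      by (intro sum.cong refl) (simp add: counit_right[OF a] flip: sum_distrib_right)
    also have "\<dots> = ract M a $$ (i, j)"
      using a finite_basis by (simp add: bvec_def if_distrib[of "\<lambda>x. x * _"] cong: if_cong)
    finally show "ract (tensor_mod A M (trivial_mod A)) a $$ (i, j) = ract M a $$ (i, j)" .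
  qed (use M a rd in \<open>auto simp: is_module_dim tensor_mod_def\<close>)
qed

end

section \<open>The Green ring and the Grothendieck ring\<close>

lemma frag_extend_add_fun: "frag_extend (\<lambda>x. f x + h x) c = frag_extend f c + frag_extend h c"
  by (simp add: frag_extend_def frag_cmul_distrib2 sum.distrib)

lemma frag_extend_diff_fun: "frag_extend (\<lambda>x. f x - h x) c = frag_extend f c - frag_extend h c"
proof -
  have "frag_extend (\<lambda>x. f x - h x) c + frag_extend h c = frag_extend f c"
    by (simp flip: frag_extend_add_fun)
  then show ?thesis by (simp add: eq_diff_eq)
qed

lemma frag_extend_zero_fun [simp]: "frag_extend (\<lambda>x. 0) c = 0"
  by (simp add: frag_extend_eq_0)

lemma keys_diff_subset: "Poly_Mapping.keys a \<subseteq> S \<Longrightarrow> Poly_Mapping.keys b \<subseteq> S \<Longrightarrow> Poly_Mapping.keys (a - b :: 'a \<Rightarrow>\<^sub>0 int) \<subseteq> S"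
  using keys_diff[of a b] by blast

lemma keys_add_subset: "Poly_Mapping.keys a \<subseteq> S \<Longrightarrow> Poly_Mapping.keys b \<subseteq> S \<Longrightarrow> Poly_Mapping.keys (a + b :: 'a \<Rightarrow>\<^sub>0 int) \<subseteq> S"
  using keys_add[of a b] by blast

lemma iso_class_eqI:
  assumes "is_module A M" "is_module A N" "iso_mod A M N"
  shows "iso_class A M = iso_class A N"
  unfolding iso_class_def using iso_mod_trans iso_mod_sym assms by blast

lemma iso_class_eq_iff:
  assumes "is_module A M" "is_module A N"
  shows "iso_class A M = iso_class A N \<longleftrightarrow> iso_mod A M N"
  using iso_class_eqI[OF assms] iso_mod_refl[OF assms(2)] assms(2) unfolding iso_class_def by blast

lemma iso_class_in [simp]: "is_module A M \<Longrightarrow> iso_class A M \<in> iso_classes A"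
  by (simp add: iso_classes_def)

lemma some_rep:
  assumes "is_module A M"
  shows "is_module A (some_rep (iso_class A M))" "iso_mod A M (some_rep (iso_class A M))"
proof -
  have "M \<in> iso_class A M" using assms iso_mod_refl by (simp add: iso_class_def)
  then have "some_rep (iso_class A M) \<in> iso_class A M" unfolding some_rep_def by (rule someI)
  then show "is_module A (some_rep (iso_class A M))" "iso_mod A M (some_rep (iso_class A M))"
    by (simp_all add: iso_class_def)
qed

lemma some_rep_class:
  assumes "C \<in> iso_classes A"
  shows "is_module A (some_rep C)" "iso_class A (some_rep C) = C"
proof -
  obtain M where M: "is_module A M" "C = iso_class A M" using assms by (auto simp: iso_classes_def)
  then show "is_module A (some_rep C)" using some_rep(1)[OF M(1)] by simp
  then show "iso_class A (some_rep C) = C"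
    using iso_class_eqI[OF M(1) _ some_rep(2)[OF M(1)]] M by simp
qed

lemma free_carrier: "f \<in> carrier (free_class_ring A) \<longleftrightarrow> Poly_Mapping.keys f \<subseteq> iso_classes A"
  by (simp add: free_class_ring_def)

lemma free_carrier_of [simp]: "is_module A M \<Longrightarrow> frag_of (iso_class A M) \<in> carrier (free_class_ring A)"
  by (simp add: free_carrier)

lemma free_carrier_diff: "a \<in> carrier (free_class_ring A) \<Longrightarrow> b \<in> carrier (free_class_ring A) \<Longrightarrow> a - b \<in> carrier (free_class_ring A)"
  and free_carrier_add: "a \<in> carrier (free_class_ring A) \<Longrightarrow> b \<in> carrier (free_class_ring A) \<Longrightarrow> a + b \<in> carrier (free_class_ring A)"
  by (simp_all add: free_carrier keys_diff_subset keys_add_subset)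

lemma free_zero: "\<zero>\<^bsub>free_class_ring A\<^esub> = 0" and free_add: "a \<oplus>\<^bsub>free_class_ring A\<^esub> b = a + b"
  and free_one: "\<one>\<^bsub>free_class_ring A\<^esub> = frag_of (iso_class A (trivial_mod A))"
  by (simp_all add: free_class_ring_def)

lemma free_class_induct [consumes 1, case_names zero cls diff]:
  assumes "f \<in> carrier (free_class_ring A)"
    and "P 0" "\<And>M. is_module A M \<Longrightarrow> P (frag_of (iso_class A M))" "\<And>a b. P a \<Longrightarrow> P b \<Longrightarrow> P (a - b)"
  shows "P f"
  using assms(1) unfolding free_carrier
  by (induction rule: frag_induction) (use assms(2-4) in \<open>auto simp: iso_classes_def\<close>)

lemma free_mult_def: "monoid.mult (free_class_ring A) f f' = frag_extend (\<lambda>C. frag_extend (\<lambda>D.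
      frag_of (iso_class A (tensor_mod A (some_rep C) (some_rep D)))) f') f"
  by (simp add: free_class_ring_def)

lemma free_mult_linear:
  "monoid.mult (free_class_ring A) 0 f = 0" "monoid.mult (free_class_ring A) f 0 = 0"
  "monoid.mult (free_class_ring A) (a - b) f = monoid.mult (free_class_ring A) a f - monoid.mult (free_class_ring A) b f"
  "monoid.mult (free_class_ring A) f (a - b) = monoid.mult (free_class_ring A) f a - monoid.mult (free_class_ring A) f b"
  "monoid.mult (free_class_ring A) (a + b) f = monoid.mult (free_class_ring A) a f + monoid.mult (free_class_ring A) b f"
  "monoid.mult (free_class_ring A) f (a + b) = monoid.mult (free_class_ring A) f a + monoid.mult (free_class_ring A) f b"
  by (simp_all add: free_mult_def frag_extend_diff frag_extend_diff_fun frag_extend_add frag_extend_add_fun)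

lemma abelian_group_free: "abelian_group (free_class_ring A)"
proof (rule abelian_groupI, unfold free_zero free_add)
  fix x assume x: "x \<in> carrier (free_class_ring A)"
  show "\<exists>y\<in>carrier (free_class_ring A). y + x = 0"
    by (rule bexI[of _ "- x"]) (use x in \<open>auto simp: free_carrier\<close>)
qed (simp_all add: free_carrier_add add_ac, simp add: free_carrier)

context hopf_algebra
begin

abbreviation "F \<equiv> free_class_ring A"

text \<open>The product is defined through chosen representatives; \<open>iso_mod_tensor\<close>
  removes the dependence on the choice.\<close>

lemma free_mult_class:
  assumes M: "is_module A M" and N: "is_module A N"
  shows "frag_of (iso_class A M) \<otimes>\<^bsub>F\<^esub> frag_of (iso_class A N) = frag_of (iso_class A (tensor_mod A M N))"
proof -
  have "iso_mod A (tensor_mod A M N) (tensor_mod A (some_rep (iso_class A M)) (some_rep (iso_class A N)))"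
    by (rule iso_mod_tensor) (use M N some_rep in auto)
  then show ?thesis
    unfolding free_mult_def frag_extend_of
    using iso_class_eqI[OF is_module_tensor[OF M N] is_module_tensor[OF some_rep(1)[OF M] some_rep(1)[OF N]]] by simp
qed

lemma free_mult_closed: "x \<in> carrier F \<Longrightarrow> y \<in> carrier F \<Longrightarrow> x \<otimes>\<^bsub>F\<^esub> y \<in> carrier F"
proof (induction x rule: free_class_induct)
  case (cls M)
  from cls(2) show ?case
    by (induction y rule: free_class_induct)
      (use cls in \<open>auto simp: free_mult_linear free_mult_class is_module_tensor free_carrier_diff\<close>, simp add: free_carrier)
qed (auto simp: free_mult_linear free_carrier_diff, simp add: free_carrier)

lemma free_mult_assoc:
  assumes "x \<in> carrier F" "y \<in> carrier F" "z \<in> carrier F"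
  shows "x \<otimes>\<^bsub>F\<^esub> y \<otimes>\<^bsub>F\<^esub> z = x \<otimes>\<^bsub>F\<^esub> (y \<otimes>\<^bsub>F\<^esub> z)"
  using assms(1)
proof (induction x rule: free_class_induct)
  case (cls M)
  from assms(2) show ?case
  proof (induction y rule: free_class_induct)
    case (cls N)
    from assms(3) show ?case
    proof (induction z rule: free_class_induct)
      case (cls L)
      then show ?case using \<open>is_module A M\<close> \<open>is_module A N\<close>
        iso_class_eqI[OF _ _ iso_mod_tensor_assoc[OF \<open>is_module A M\<close> \<open>is_module A N\<close> cls]]
        by (simp add: free_mult_class is_module_tensor)
    qed (simp_all add: free_mult_linear)
  qed (simp_all add: free_mult_linear)
qed (simp_all add: free_mult_linear)

lemma ring_free: "ring F"
proof (rule ringI[OF abelian_group_free])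
  show "monoid F"
  proof (rule monoidI)
    fix x assume "x \<in> carrier F"
    then show "\<one>\<^bsub>F\<^esub> \<otimes>\<^bsub>F\<^esub> x = x"
    proof (induction x rule: free_class_induct)
      case (cls M)
      show ?case unfolding free_one
        using iso_class_eqI[OF cls is_module_tensor[OF is_module_trivial cls] iso_mod_tensor_trivial_left[OF cls], symmetric]
        by (simp add: free_mult_class is_module_trivial cls)
    qed (simp_all add: free_mult_linear)
  next
    fix x assume "x \<in> carrier F"
    then show "x \<otimes>\<^bsub>F\<^esub> \<one>\<^bsub>F\<^esub> = x"
    proof (induction x rule: free_class_induct)
      case (cls M)
      show ?case unfolding free_one
        using iso_class_eqI[OF cls is_module_tensor[OF cls is_module_trivial] iso_mod_tensor_trivial_right[OF cls], symmetric]
        by (simp add: free_mult_class is_module_trivial cls)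
    qed (simp_all add: free_mult_linear)
  qed (simp_all add: free_mult_closed free_mult_assoc free_one is_module_trivial)
qed (simp_all add: free_mult_linear free_add)

end

sublocale hopf_algebra \<subseteq> F: ring "free_class_ring A"
  by (rule ring_free)

section \<open>The ideals of relations in the free ring\<close>

context hopf_algebra
begin

lemma F_inv: "x \<in> carrier F \<Longrightarrow> \<ominus>\<^bsub>F\<^esub> x = - x"
  by (rule F.minus_equality) (auto simp: free_zero free_add free_carrier)

lemma F_minus: "x \<in> carrier F \<Longrightarrow> y \<in> carrier F \<Longrightarrow> x \<ominus>\<^bsub>F\<^esub> y = x - y"
  by (simp add: a_minus_def F_inv free_add)

text \<open>Inverses and sums in the generated subgroup are both expressed by differences,
  \<open>0 - h\<close> and \<open>a - (0 - b)\<close>, so closure under differences is the only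
  additive case.\<close>

lemma generate_induct [consumes 2, case_names zero gen diff]:
  assumes "f \<in> generate (add_monoid F) Y" "Y \<subseteq> carrier F"
    and "P 0" "\<And>y. y \<in> Y \<Longrightarrow> P y" "\<And>a b. a \<in> carrier F \<Longrightarrow> b \<in> carrier F \<Longrightarrow> P a \<Longrightarrow> P b \<Longrightarrow> P (a - b)"
  shows "P f"
proof -
  have zero: "0 \<in> carrier F" by (simp add: free_carrier)
  have "f \<in> carrier F \<and> P f" using assms(1)
  proof (induction rule: generate.induct)
    case one
    then show ?case using assms(3) zero by (simp add: free_zero)
  next
    case (incl h)
    then show ?case using assms(2,4) by auto
  next
    case (inv h)
    then have h: "h \<in> carrier F" using assms(2) by auto
    have "P (0 - h)" using assms(5)[of 0 h] assms(3) assms(4)[OF inv] h zero by simp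
    moreover have "0 - h \<in> carrier F" using h zero free_carrier_diff by blast
    moreover have "inv\<^bsub>add_monoid F\<^esub> h = 0 - h" using F_inv[OF h] by (simp add: a_inv_def)
    ultimately show ?case by simp
  next
    case (eng a b)
    have "P (0 - b)" using assms(5)[of 0 b] assms(3) eng zero by simp
    moreover have "0 - b \<in> carrier F" using eng zero free_carrier_diff by blast
    ultimately have "P (a - (0 - b))" using assms(5)[of a "0 - b"] eng by simp
    then show ?case using eng by (simp add: free_carrier_add free_add)
  qed
  then show ?thesis by simp
qed

lemma generate_closed:
  assumes "Y \<subseteq> carrier F"
  shows "0 \<in> generate (add_monoid F) Y" "\<And>y. y \<in> Y \<Longrightarrow> y \<in> generate (add_monoid F) Y"
    "\<And>a b. a \<in> generate (add_monoid F) Y \<Longrightarrow> b \<in> generate (add_monoid F) Y \<Longrightarrow> a + b \<in> generate (add_monoid F) Y"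
    "\<And>a b. a \<in> generate (add_monoid F) Y \<Longrightarrow> b \<in> generate (add_monoid F) Y \<Longrightarrow> a - b \<in> generate (add_monoid F) Y"
    "generate (add_monoid F) Y \<subseteq> carrier F"
proof -
  show sub: "generate (add_monoid F) Y \<subseteq> carrier F"
    using F.add.generate_incl[of Y] assms by simp
  have "\<one>\<^bsub>add_monoid F\<^esub> = 0" by (simp add: free_zero)
  then show "0 \<in> generate (add_monoid F) Y" using generate.one[of "add_monoid F" Y] by (simp only:)
  show "y \<in> generate (add_monoid F) Y" if "y \<in> Y" for y using that by (rule generate.incl)
  show add: "a + b \<in> generate (add_monoid F) Y"
    if "a \<in> generate (add_monoid F) Y" "b \<in> generate (add_monoid F) Y" for a b
  proof -
    have "a \<otimes>\<^bsub>add_monoid F\<^esub> b = a + b" by (simp add: free_add)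
    then show ?thesis using generate.eng[OF that] by (simp only:)
  qed
  show "a - b \<in> generate (add_monoid F) Y"
    if a: "a \<in> generate (add_monoid F) Y" and b: "b \<in> generate (add_monoid F) Y" for a b
  proof -
    have "b \<in> carrier F" using b sub by blast
    then have "\<ominus>\<^bsub>F\<^esub> b = - b" by (rule F_inv)
    then have "- b \<in> generate (add_monoid F) Y"
      using F.add.generate_m_inv_closed[of Y b] b assms by simp
    from add[OF a this] show ?thesis by simp
  qed
qed

text \<open>By bilinearity, absorption has to be verified only for a generator times a single class,
  on either side.\<close>

lemma ideal_generate:
  assumes Y: "Y \<subseteq> carrier F"
    and left: "\<And>y M. y \<in> Y \<Longrightarrow> is_module A M \<Longrightarrow> frag_of (iso_class A M) \<otimes>\<^bsub>F\<^esub> y \<in> generate (add_monoid F) Y"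
    and right: "\<And>y M. y \<in> Y \<Longrightarrow> is_module A M \<Longrightarrow> y \<otimes>\<^bsub>F\<^esub> frag_of (iso_class A M) \<in> generate (add_monoid F) Y"
  shows "ideal (generate (add_monoid F) Y) F"
proof -
  define I where "I = generate (add_monoid F) Y"
  note g = generate_closed[OF Y, folded I_def] and lr = left[folded I_def] right[folded I_def]
  have "ideal I F"
  proof (rule idealI[OF ring_free])
    show "subgroup I (add_monoid F)"
      using F.add.generate_is_subgroup[of Y] Y by (simp add: I_def)
    show "x \<otimes>\<^bsub>F\<^esub> a \<in> I" "a \<otimes>\<^bsub>F\<^esub> x \<in> I" if a: "a \<in> I" and x: "x \<in> carrier F" for a x
    proof -
      from a[unfolded I_def] Y have "x \<otimes>\<^bsub>F\<^esub> a \<in> I \<and> a \<otimes>\<^bsub>F\<^esub> x \<in> I"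
      proof (induction a rule: generate_induct)
        case (gen y)
        from x show ?case
          by (induction x rule: free_class_induct) (auto simp: free_mult_linear g lr[OF gen])
      qed (auto simp: free_mult_linear g)
      then show "x \<otimes>\<^bsub>F\<^esub> a \<in> I" "a \<otimes>\<^bsub>F\<^esub> x \<in> I" by auto
    qed
  qed
  then show ?thesis by (simp add: I_def)
qed

abbreviation "split_gens \<equiv> {frag_of (iso_class A (dsum_mod M N)) - frag_of (iso_class A M) - frag_of (iso_class A N)
       | M N. is_module A M \<and> is_module A N}"

abbreviation "exact_gens \<equiv> {frag_of (iso_class A M) - frag_of (iso_class A L) - frag_of (iso_class A N)
       | L M N. is_module A L \<and> is_module A M \<and> is_module A N \<and> short_exact A L M N}"

lemma split_gens_carrier: "split_gens \<subseteq> carrier F" and exact_gens_carrier: "exact_gens \<subseteq> carrier F"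
  by (auto intro!: free_carrier_diff simp: is_module_dsum)

lemmas split_closed = generate_closed[OF split_gens_carrier, folded split_relations_def]
lemmas exact_closed = generate_closed[OF exact_gens_carrier, folded exact_relations_def]

lemma split_relation:
  assumes "is_module A M" "is_module A N" "is_module A L" "iso_mod A L (dsum_mod M N)"
  shows "frag_of (iso_class A L) - frag_of (iso_class A M) - frag_of (iso_class A N) \<in> split_relations A"
  using split_closed(2)[of "frag_of (iso_class A (dsum_mod M N)) - frag_of (iso_class A M) - frag_of (iso_class A N)"]
    iso_class_eqI[OF assms(3) is_module_dsum[OF assms(1,2)] assms(4)] assms by auto

lemma exact_relation:
  assumes "is_module A L" "is_module A M" "is_module A N" "short_exact A L M N"
  shows "frag_of (iso_class A M) - frag_of (iso_class A L) - frag_of (iso_class A N) \<in> exact_relations A"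
  by (rule exact_closed(2)) (use assms in blast)

lemma split_ideal: "ideal (split_relations A) F"
  unfolding split_relations_def
proof (rule ideal_generate[OF split_gens_carrier], fold split_relations_def)
  fix y P assume "y \<in> split_gens" and P: "is_module A P"
  then obtain M N where M: "is_module A M" and N: "is_module A N"
    and y: "y = frag_of (iso_class A (dsum_mod M N)) - frag_of (iso_class A M) - frag_of (iso_class A N)" by auto
  note m = M N P is_module_dsum is_module_tensor
  show "frag_of (iso_class A P) \<otimes>\<^bsub>F\<^esub> y \<in> split_relations A"
    unfolding y using split_relation[OF _ _ _ iso_mod_tensor_dsum_right[OF M N P]]
    by (simp add: free_mult_linear free_mult_class m)
  show "y \<otimes>\<^bsub>F\<^esub> frag_of (iso_class A P) \<in> split_relations A"
    unfolding y using split_relation[OF _ _ _ iso_mod_tensor_dsum_left[OF M N P]]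
    by (simp add: free_mult_linear free_mult_class m)
qed

lemma exact_ideal: "ideal (exact_relations A) F"
  unfolding exact_relations_def
proof (rule ideal_generate[OF exact_gens_carrier], fold exact_relations_def)
  fix y P assume "y \<in> exact_gens" and P: "is_module A P"
  then obtain L M N where m: "is_module A L" "is_module A M" "is_module A N" "is_module A P" and e: "short_exact A L M N"
    and y: "y = frag_of (iso_class A M) - frag_of (iso_class A L) - frag_of (iso_class A N)" by auto
  show "frag_of (iso_class A P) \<otimes>\<^bsub>F\<^esub> y \<in> exact_relations A"
    unfolding y using exact_relation[OF _ _ _ short_exact_tensor_right[OF m e]]
    by (simp add: free_mult_linear free_mult_class m is_module_tensor)
  show "y \<otimes>\<^bsub>F\<^esub> frag_of (iso_class A P) \<in> exact_relations A"
    unfolding y using exact_relation[OF _ _ _ short_exact_tensor_left[OF m e]]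
    by (simp add: free_mult_linear free_mult_class m is_module_tensor)
qed

end

lemma short_exact_dsum:
  assumes "is_module A M" "is_module A N"
  shows "short_exact A M (dsum_mod M N) N"
  using mod_split_dsum[OF assms] unfolding mod_split_def by (auto intro: short_exactI)

context hopf_algebra
begin

lemma split_subset_exact: "split_relations A \<subseteq> exact_relations A"
proof
  fix f assume "f \<in> split_relations A"
  then show "f \<in> exact_relations A" unfolding split_relations_def using split_gens_carrier
  proof (induction f rule: generate_induct)
    case (gen y)
    then obtain M N where M: "is_module A M" and N: "is_module A N"
      and y: "y = frag_of (iso_class A (dsum_mod M N)) - frag_of (iso_class A M) - frag_of (iso_class A N)" by auto
    show ?case using exact_relation[OF M is_module_dsum[OF M N] N short_exact_dsum[OF M N]] unfolding y .
  qed (auto simp: exact_closed)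
qed

lemma composition_series_class:
  assumes "composition_series A M Vs"
  shows "is_module A M" "\<forall>V\<in>set Vs. simple_mod A V"
    "frag_of (iso_class A M) - (\<Sum>V\<leftarrow>Vs. frag_of (iso_class A V)) \<in> exact_relations A"
proof -
  have "is_module A M \<and> (\<forall>V\<in>set Vs. simple_mod A V) \<and>
    frag_of (iso_class A M) - (\<Sum>V\<leftarrow>Vs. frag_of (iso_class A V)) \<in> exact_relations A"
    using assms
  proof (induction rule: composition_series.induct)
    case (zero_dim M)
    \<comment> \<open>A zero module is an extension of itself by itself, so
      \<open>[M] - [M] - [M]\<close> is a relation. In the free group the class of a zero module is
      not zero, and this relation kills it.\<close>
    have "mod_split A M M M (1\<^sub>m 0) (1\<^sub>m 0) (1\<^sub>m 0) (1\<^sub>m 0)"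
      unfolding mod_split_def lin_split_def using Hom_mod_one[OF zero_dim(1)] zero_dim(2)
      by (auto intro!: eq_matI)
    then have "short_exact A M M M" unfolding mod_split_def by (auto intro: short_exactI)
    from exact_relation[OF zero_dim(1,1,1) this] have "- frag_of (iso_class A M) \<in> exact_relations A" by simp
    from exact_closed(4)[OF exact_closed(1) this] zero_dim(1) show ?case by simp
  next
    case (step M V N Vs)
    then have V: "is_module A V" by (simp add: simple_mod_def)
    have "(frag_of (iso_class A M) - frag_of (iso_class A N) - frag_of (iso_class A V)) +
      (frag_of (iso_class A N) - (\<Sum>V\<leftarrow>Vs. frag_of (iso_class A V))) \<in> exact_relations A"
      using step exact_relation[OF _ _ V step(3)] by (intro exact_closed(3)) auto
    then show ?case using step by (simp add: algebra_simps)
  qed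
  then show "is_module A M" "\<forall>V\<in>set Vs. simple_mod A V"
    "frag_of (iso_class A M) - (\<Sum>V\<leftarrow>Vs. frag_of (iso_class A V)) \<in> exact_relations A" by auto
qed

text \<open>All multiplicities are counted in one and the same chosen series. Grouping the members
  of that list by isomorphism class gives back the plain sum over the list.\<close>

lemma composition_sum_list:
  assumes Vs: "Vs = (SOME Vs. composition_series A (some_rep C) Vs)" and simple: "\<forall>V\<in>set Vs. simple_mod A V"
  shows "composition_sum A C = (\<Sum>V\<leftarrow>Vs. frag_of (iso_class A V))"
proof -
  let ?m = "\<lambda>D. length (filter (\<lambda>W. iso_mod A W (some_rep D)) Vs)"
  have mult: "multiplicity_in A (some_rep C) (some_rep D) = ?m D" for D
    by (simp add: multiplicity_in_def Vs)
  let ?S = "{D \<in> simple_classes A. ?m D \<noteq> 0}"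
  have m: "?m D = length (filter (\<lambda>W. iso_class A W = D) Vs)" if "D \<in> simple_classes A" for D
  proof -
    have "D \<in> iso_classes A" using that by (auto simp: simple_classes_def iso_classes_def simple_mod_def)
    note D = some_rep_class[OF this]
    have "iso_mod A W (some_rep D) \<longleftrightarrow> iso_class A W = D" if "W \<in> set Vs" for W
      using simple that iso_class_eq_iff[of A W "some_rep D"] D by (simp add: simple_mod_def)
    then have "filter (\<lambda>W. iso_mod A W (some_rep D)) Vs = filter (\<lambda>W. iso_class A W = D) Vs"
      by (rule filter_cong[OF refl])
    then show ?thesis by simp
  qed
  have cl: "\<forall>V\<in>set Vs. iso_class A V \<in> simple_classes A"
    using simple by (auto simp: simple_classes_def)
  have fin: "?S \<subseteq> iso_class A ` set Vs"
  proof
    fix D assume "D \<in> ?S"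
    then have "filter (\<lambda>W. iso_class A W = D) Vs \<noteq> []" using m[of D] by auto
    then show "D \<in> iso_class A ` set Vs" unfolding filter_empty_conv by blast
  qed
  have "composition_sum A C = (\<Sum>D\<in>?S. frag_cmul (int (?m D)) (frag_of D))"
    by (simp add: composition_sum_def mult)
  also have "\<dots> = (\<Sum>D\<in>iso_class A ` set Vs. frag_cmul (int (?m D)) (frag_of D))"
    by (rule sum.mono_neutral_left) (use fin cl in \<open>auto simp: frag_cmul_zero\<close>)
  also have "\<dots> = (\<Sum>D\<in>iso_class A ` set Vs. frag_cmul (int (length (filter (\<lambda>W. iso_class A W = D) Vs))) (frag_of D))"
    using cl m by (intro sum.cong) auto
  also have "\<dots> = (\<Sum>V\<leftarrow>Vs. frag_of (iso_class A V))"
  proof -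
    have "(\<Sum>D\<in>T. frag_cmul (int (length (filter (\<lambda>W. iso_class A W = D) Vs))) (frag_of D)) =
      (\<Sum>V\<leftarrow>Vs. frag_of (iso_class A V))" if "finite T" "iso_class A ` set Vs \<subseteq> T" for T and Vs :: "('b, 'k) rep list"
      using that(2)
    proof (induction Vs)
      case (Cons W Vs)
      have "(\<Sum>D\<in>T. frag_cmul (int (length (filter (\<lambda>W. iso_class A W = D) (W # Vs)))) (frag_of D)) =
        (\<Sum>D\<in>T. (if D = iso_class A W then frag_of D else 0) + frag_cmul (int (length (filter (\<lambda>W. iso_class A W = D) Vs))) (frag_of D))"
        by (intro sum.cong refl) (auto simp: frag_cmul_distrib)
      also have "\<dots> = frag_of (iso_class A W) + (\<Sum>V\<leftarrow>Vs. frag_of (iso_class A V))"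
        using Cons that(1) by (simp add: sum.distrib)
      finally show ?case by simp
    qed simp
    then show ?thesis by simp
  qed
  finally show ?thesis .
qed

lemma composition_sum_class:
  assumes "C \<in> iso_classes A"
  shows "frag_of C - composition_sum A C \<in> exact_relations A" "composition_sum A C \<in> carrier F"
proof -
  note C = some_rep_class[OF assms]
  let ?Vs = "SOME Vs. composition_series A (some_rep C) Vs"
  have "composition_series A (some_rep C) ?Vs"
    using ex_composition_series[OF C(1)] by (rule someI_ex)
  note c = composition_series_class[OF this]
  then show "frag_of C - composition_sum A C \<in> exact_relations A"
    using composition_sum_list[OF refl c(2)] C(2) by simp
  then have "frag_of C - (frag_of C - composition_sum A C) \<in> carrier F"
    by (rule free_carrier_diff[OF _ subsetD[OF exact_closed(5)], rotated]) (use assms in \<open>simp add: free_carrier\<close>)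
  then show "composition_sum A C \<in> carrier F" by simp
qed

lemma composition_sum_extend:
  assumes "f \<in> carrier F"
  shows "f - frag_extend (composition_sum A) f \<in> exact_relations A" "frag_extend (composition_sum A) f \<in> carrier F"
proof -
  show "f - frag_extend (composition_sum A) f \<in> exact_relations A" using assms
  proof (induction f rule: free_class_induct)
    case (cls M)
    then show ?case by (simp add: composition_sum_class)
  next
    case (diff a b)
    from exact_closed(4)[OF this] show ?case by (simp add: frag_extend_diff algebra_simps)
  qed (simp add: exact_closed)
  then have "f - (f - frag_extend (composition_sum A) f) \<in> carrier F"
    by (rule free_carrier_diff[OF assms subsetD[OF exact_closed(5)]])
  then show "frag_extend (composition_sum A) f \<in> carrier F" by simp
qed

end

sublocale hopf_algebra \<subseteq> Sp: ideal "split_relations A" "free_class_ring A" by (rule split_ideal)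
sublocale hopf_algebra \<subseteq> Ex: ideal "exact_relations A" "free_class_ring A" by (rule exact_ideal)

section \<open>The natural map between the two quotients of the free ring\<close>

context hopf_algebra
begin

abbreviation "scos f \<equiv> split_relations A +>\<^bsub>F\<^esub> f"
abbreviation "ecos f \<equiv> exact_relations A +>\<^bsub>F\<^esub> f"

lemma cos_eq_iff:
  assumes "f \<in> carrier F" "f' \<in> carrier F"
  shows "scos f = scos f' \<longleftrightarrow> f - f' \<in> split_relations A" "ecos f = ecos f' \<longleftrightarrow> f - f' \<in> exact_relations A"
  using F.quotient_eq_iff_same_a_r_cos[OF split_ideal assms] F.quotient_eq_iff_same_a_r_cos[OF exact_ideal assms]
  unfolding F_minus[OF assms] by auto

lemma carrier_green: "carrier (green_ring A) = scos ` carrier F"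
  and carrier_grothendieck: "carrier (grothendieck_ring A) = ecos ` carrier F"
  unfolding green_ring_def grothendieck_ring_def FactRing_def A_RCOSETS_def' by auto

lemma mem_scos: "f' \<in> scos f \<longleftrightarrow> f' - f \<in> split_relations A"
  by (auto simp: a_r_coset_def' image_iff free_add) (metis diff_add_cancel)

text \<open>Modulo exact relations every element equals its composition sum, and split relations are
  exact. Hence all members of the union coincide, and the natural map is the passage from the
  smaller ideal of relations to the larger one.\<close>

lemma natural_map_cos:
  assumes f: "f \<in> carrier F"
  shows "natural_map A (scos f) = ecos f"
proof -
  have "ecos (frag_extend (composition_sum A) f') = ecos f" if "f' \<in> scos f" for f'
  proof -
    have 1: "f' - f \<in> split_relations A" using that mem_scos by simp
    then have "f' - f + f \<in> carrier F" using split_closed(5) f by (meson free_carrier_add subsetD)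
    then have f': "f' \<in> carrier F" by simp
    have "(f' - f) - (f' - frag_extend (composition_sum A) f') \<in> exact_relations A"
      by (rule exact_closed(4)[OF subsetD[OF split_subset_exact 1] composition_sum_extend(1)[OF f']])
    then show ?thesis using cos_eq_iff(2)[OF composition_sum_extend(2)[OF f'] f] by simp
  qed
  moreover have "f \<in> scos f" by (simp add: mem_scos split_closed)
  ultimately show ?thesis unfolding natural_map_def by auto
qed

lemma ring_green: "ring (green_ring A)" and ring_grothendieck: "ring (grothendieck_ring A)"
  unfolding green_ring_def grothendieck_ring_def by (rule Sp.quotient_is_ring, rule Ex.quotient_is_ring)

lemma scos_hom: "scos \<in> Ring.ring_hom F (green_ring A)" and ecos_hom: "ecos \<in> Ring.ring_hom F (grothendieck_ring A)"
  unfolding green_ring_def grothendieck_ring_def by (rule Sp.rcos_ring_hom, rule Ex.rcos_ring_hom)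

lemma natural_map_hom: "natural_map A \<in> Ring.ring_hom (green_ring A) (grothendieck_ring A)"
proof (rule ring_hom_memI)
  fix x assume "x \<in> carrier (green_ring A)"
  then show "natural_map A x \<in> carrier (grothendieck_ring A)"
    by (auto simp: carrier_green carrier_grothendieck natural_map_cos)
next
  fix x y assume "x \<in> carrier (green_ring A)" "y \<in> carrier (green_ring A)"
  then obtain f f' where f: "f \<in> carrier F" "f' \<in> carrier F" "x = scos f" "y = scos f'"
    by (auto simp: carrier_green)
  note c = F.m_closed[OF f(1,2)] F.a_closed[OF f(1,2)]
  show "natural_map A (x \<otimes>\<^bsub>green_ring A\<^esub> y) = natural_map A x \<otimes>\<^bsub>grothendieck_ring A\<^esub> natural_map A y"
    unfolding f(3,4) ring_hom_mult[OF scos_hom f(1,2), symmetric]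
    by (simp only: natural_map_cos f(1,2) c ring_hom_mult[OF ecos_hom f(1,2)])
  show "natural_map A (x \<oplus>\<^bsub>green_ring A\<^esub> y) = natural_map A x \<oplus>\<^bsub>grothendieck_ring A\<^esub> natural_map A y"
    unfolding f(3,4) ring_hom_add[OF scos_hom f(1,2), symmetric]
    by (simp only: natural_map_cos f(1,2) c ring_hom_add[OF ecos_hom f(1,2)])
next
  show "natural_map A \<one>\<^bsub>green_ring A\<^esub> = \<one>\<^bsub>grothendieck_ring A\<^esub>"
    unfolding ring_hom_one[OF scos_hom, symmetric] ring_hom_one[OF ecos_hom, symmetric]
    by (rule natural_map_cos) simp
qed

lemma natural_map_surj: "natural_map A ` carrier (green_ring A) = carrier (grothendieck_ring A)"
  by (auto simp: carrier_green carrier_grothendieck natural_map_cos image_image)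

lemma zero_grothendieck: "\<zero>\<^bsub>grothendieck_ring A\<^esub> = ecos 0"
  unfolding ring_hom_zero[OF ecos_hom ring_free ring_grothendieck, symmetric] by (simp add: free_zero)

text \<open>After this description of the kernel, what remains for the first claim is to compare
  \<open>exact_relations\<close> with the orthogonality conditions.\<close>

lemma natural_map_kernel:
  "a_kernel (green_ring A) (grothendieck_ring A) (natural_map A) = scos ` exact_relations A"
proof -
  have "natural_map A (scos f) = ecos 0 \<longleftrightarrow> f \<in> exact_relations A" if "f \<in> carrier F" for f
    using that cos_eq_iff(2)[OF that, of 0] by (simp add: natural_map_cos free_carrier)
  then have "{x \<in> scos ` carrier F. natural_map A x = ecos 0} = scos ` exact_relations A"
    using exact_closed(5) by blast
  then show ?thesis by (simp add: a_kernel_def' carrier_green zero_grothendieck)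
qed

lemma grothendieck_iso_quotient:
  "ideal (scos ` exact_relations A) (green_ring A)"
  "is_ring_iso (grothendieck_ring A) (green_ring A Quot (scos ` exact_relations A))"
proof -
  interpret h: ring_hom_ring "green_ring A" "grothendieck_ring A" "natural_map A"
    by (rule ring_hom_ringI2[OF ring_green ring_grothendieck natural_map_hom])
  show "ideal (scos ` exact_relations A) (green_ring A)"
    using h.kernel_is_ideal by (simp add: natural_map_kernel)
  show "is_ring_iso (grothendieck_ring A) (green_ring A Quot (scos ` exact_relations A))"
    using h.FactRing_iso_set[OF natural_map_surj] ring_iso_set_sym[OF ideal.quotient_is_ring[OF h.kernel_is_ideal]]
    by (auto simp: is_ring_iso_def natural_map_kernel)
qed

end

section \<open>Dimensions of spaces of homomorphisms\<close>

definition mat_subspace :: "nat \<Rightarrow> nat \<Rightarrow> 'a::field mat set \<Rightarrow> bool" where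
  "mat_subspace n m S \<longleftrightarrow> S \<subseteq> carrier_mat n m \<and> 0\<^sub>m n m \<in> S \<and> (\<forall>x\<in>S. \<forall>y\<in>S. x + y \<in> S) \<and>
     (\<forall>c. \<forall>x\<in>S. c \<cdot>\<^sub>m x \<in> S)"

abbreviation mat_vs :: "nat \<Rightarrow> nat \<Rightarrow> 'a::field mat set \<Rightarrow> ('a, 'a mat) module" where
  "mat_vs n m S \<equiv> (module_mat TYPE('a) n m)\<lparr>carrier := S\<rparr>"

abbreviation mat_dim :: "nat \<Rightarrow> nat \<Rightarrow> 'a::field mat set \<Rightarrow> nat" where
  "mat_dim n m S \<equiv> vectorspace.dim class_ring (mat_vs n m S)"

definition mat_linear :: "('a::field mat \<Rightarrow> 'a mat) \<Rightarrow> 'a mat set \<Rightarrow> 'a mat set \<Rightarrow> bool" where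
  "mat_linear f S S' \<longleftrightarrow> (\<forall>x\<in>S. f x \<in> S') \<and> (\<forall>x\<in>S. \<forall>y\<in>S. f (x + y) = f x + f y) \<and> (\<forall>c. \<forall>x\<in>S. f (c \<cdot>\<^sub>m x) = c \<cdot>\<^sub>m f x)"

lemma mat_subspace_iff: "mat_subspace n m S \<longleftrightarrow> subspace class_ring S (module_mat TYPE('a::field) n m)"
proof -
  interpret vectorspace "class_ring :: 'a ring" "module_mat TYPE('a) n m" by (rule matrix_vs)
  have "vectorspace (class_ring :: 'a ring) (module_mat TYPE('a) n m)" "module (class_ring :: 'a ring) (module_mat TYPE('a) n m)" ..
  then show ?thesis
    unfolding mat_subspace_def subspace_def submodule_def by (auto simp: matrix_vs_simps)
qed

text \<open>The matrices are the image of a coordinate space under reading a vector row by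
  row.\<close>

lemma mat_fin_dim: "vectorspace.fin_dim class_ring (module_mat TYPE('a::field) n m)"
proof -
  let ?f = "\<lambda>v :: 'a vec. mat n m (\<lambda>(i, j). v $ (i * m + j))"
  interpret V: vec_space "TYPE('a)" "n * m" .
  interpret W: vectorspace "class_ring :: 'a ring" "module_mat TYPE('a) n m" by (rule matrix_vs)
  have b: "i * m + j < n * m" if "i < n" "j < m" for i j
  proof -
    have "i * m + j < Suc i * m" using that by simp
    also have "\<dots> \<le> n * m" using that by (intro mult_right_mono) auto
    finally show ?thesis .
  qed
  interpret linear_map "class_ring :: 'a ring" "module_vec TYPE('a) (n * m)" "module_mat TYPE('a) n m" ?f
  proof unfold_locales
    show "?f \<in> module_hom class_ring (module_vec TYPE('a) (n * m)) (module_mat TYPE('a) n m)"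
      unfolding module_hom_def by (auto simp: matrix_vs_simps module_vec_simps b class_ring_simps intro!: eq_matI)
  qed
  have "M \<in> ?f ` carrier_vec (n * m)" if M: "M \<in> carrier_mat n m" for M
  proof
    show "M = ?f (vec (n * m) (\<lambda>k. M $$ (k div m, k mod m)))"
      using M b by (intro eq_matI) (auto simp: div_mod_bounds)
  qed simp
  then have "?f ` carrier (module_vec TYPE('a) (n * m)) = carrier (module_mat TYPE('a) n m)"
    by (auto simp: matrix_vs_simps module_vec_simps)
  then show ?thesis by (rule surj_fin_dim[OF V.fin_dim])
qed

lemma mat_subspace_vs:
  assumes "mat_subspace n m (S :: 'a::field mat set)"
  shows "vectorspace class_ring (mat_vs n m S)" "vectorspace.fin_dim class_ring (mat_vs n m S)"
proof -
  interpret vectorspace "class_ring :: 'a ring" "module_mat TYPE('a) n m" by (rule matrix_vs)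
  have s: "subspace class_ring S (module_mat TYPE('a) n m)" using assms by (simp add: mat_subspace_iff)
  show "vectorspace class_ring (mat_vs n m S)" by (rule subspace_is_vs[OF s])
  show "vectorspace.fin_dim class_ring (mat_vs n m S)" by (rule subspace_fin_dim[OF s mat_fin_dim])
qed

lemma mat_linear_map:
  assumes S: "mat_subspace n m S" and S': "mat_subspace n' m' S'" and f: "mat_linear f S S'"
  shows "linear_map class_ring (mat_vs n m S) (mat_vs n' m' S') f"
proof -
  interpret V: vectorspace class_ring "mat_vs n m S" by (rule mat_subspace_vs[OF S])
  interpret W: vectorspace class_ring "mat_vs n' m' S'" by (rule mat_subspace_vs[OF S'])
  show ?thesis
  proof unfold_locales
    show "f \<in> module_hom class_ring (mat_vs n m S) (mat_vs n' m' S')"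
      using f unfolding module_hom_def mat_linear_def by (auto simp: matrix_vs_simps)
  qed
qed

lemma mat_dim_mono:
  assumes S: "mat_subspace n m S" and T: "mat_subspace n m T" and "T \<subseteq> S"
  shows "mat_dim n m T \<le> mat_dim n m (S :: 'a::field mat set)"
proof -
  interpret M: vectorspace "class_ring :: 'a ring" "module_mat TYPE('a) n m" by (rule matrix_vs)
  interpret V: vectorspace class_ring "mat_vs n m S" by (rule mat_subspace_vs[OF S])
  have "subspace class_ring T (mat_vs n m S)"
    using M.nested_subspaces[of S T] S T assms(3) by (simp add: mat_subspace_iff)
  from V.subspace_dim[OF this mat_subspace_vs(2)[OF S]] mat_subspace_vs(2)[OF T]
  show ?thesis by simp
qed

lemma mat_linear_image:
  assumes S: "mat_subspace n m S" and S': "mat_subspace n' m' S'" and f: "mat_linear f S S'"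
  shows "mat_subspace n' m' (f ` S)"
proof -
  have 0: "0\<^sub>m n m \<in> S" using S by (simp add: mat_subspace_def)
  then have c: "f (0\<^sub>m n m) \<in> carrier_mat n' m'" using S' f by (auto simp: mat_subspace_def mat_linear_def)
  have "f (0 \<cdot>\<^sub>m 0\<^sub>m n m) = 0 \<cdot>\<^sub>m f (0\<^sub>m n m)" using f 0 unfolding mat_linear_def by blast
  moreover have "0 \<cdot>\<^sub>m f (0\<^sub>m n m) = 0\<^sub>m n' m'" using c by (intro eq_matI) auto
  ultimately have z: "f (0\<^sub>m n m) = 0\<^sub>m n' m'" by simp
  have "x + y \<in> f ` S" if "x \<in> f ` S" "y \<in> f ` S" for x y
    using that S f unfolding mat_subspace_def mat_linear_def by (metis (no_types, lifting) image_iff)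
  moreover have "c \<cdot>\<^sub>m x \<in> f ` S" if "x \<in> f ` S" for c x
    using that S f unfolding mat_subspace_def mat_linear_def by (metis (no_types, lifting) image_iff)
  moreover have "f ` S \<subseteq> carrier_mat n' m'" using S' f unfolding mat_subspace_def mat_linear_def by auto
  moreover have "0\<^sub>m n' m' \<in> f ` S" using z[symmetric] S unfolding mat_subspace_def by auto
  ultimately show ?thesis unfolding mat_subspace_def by blast
qed

lemma mat_rank_nullity:
  assumes S: "mat_subspace n m S" and S': "mat_subspace n' m' S'" and f: "mat_linear f S S'"
  shows "mat_dim n' m' (f ` S) + mat_dim n m {x \<in> S. f x = 0\<^sub>m n' m'} = mat_dim n m S"
proof -
  interpret linear_map class_ring "mat_vs n m S" "mat_vs n' m' S'" f by (rule mat_linear_map[OF assms])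
  show ?thesis using rank_nullity[OF mat_subspace_vs(2)[OF S]]
    by (simp add: im_def ker_def matrix_vs_simps)
qed

lemma mat_dim_injective:
  assumes S: "mat_subspace n m S" and S': "mat_subspace n' m' S'" and f: "mat_linear f S S'" and i: "inj_on f S"
  shows "mat_dim n' m' (f ` S) = mat_dim n m S"
proof -
  note I = mat_linear_image[OF S S' f]
  have "mat_linear f S (f ` S)" using f by (auto simp: mat_linear_def)
  then interpret linear_map class_ring "mat_vs n m S" "mat_vs n' m' (f ` S)" f by (rule mat_linear_map[OF S I])
  show ?thesis using dim_eq[OF mat_subspace_vs(2)[OF S]] i by simp
qed

text \<open>Rank-nullity for a left exact sequence of matrix spaces. The inequality is what remains
  when the last map is not known to be onto; it is used for duals of projective modules.\<close>

lemma mat_dim_exact: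
  assumes S1: "mat_subspace n1 m1 S1" and S: "mat_subspace n m S" and S2: "mat_subspace n2 m2 S2"
    and f: "mat_linear f S S2" and h: "mat_linear h S1 S" "inj_on h S1"
    and ex: "h ` S1 = {x \<in> S. f x = 0\<^sub>m n2 m2}"
  shows "mat_dim n m S \<le> mat_dim n1 m1 S1 + mat_dim n2 m2 S2"
    "f ` S = S2 \<Longrightarrow> mat_dim n m S = mat_dim n1 m1 S1 + mat_dim n2 m2 S2"
proof -
  have 1: "mat_dim n m S = mat_dim n1 m1 S1 + mat_dim n2 m2 (f ` S)"
    using mat_rank_nullity[OF S S2 f] mat_dim_injective[OF S1 S h] by (simp add: ex)
  have "f ` S \<subseteq> S2" using f by (auto simp: mat_linear_def)
  from mat_dim_mono[OF S2 mat_linear_image[OF S S2 f] this] 1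
  show "mat_dim n m S \<le> mat_dim n1 m1 S1 + mat_dim n2 m2 S2" by simp
  show "f ` S = S2 \<Longrightarrow> mat_dim n m S = mat_dim n1 m1 S1 + mat_dim n2 m2 S2" using 1 by simp
qed

text \<open>Rank-nullity for the identity on the zero space reads \<open>d + d = d\<close>.\<close>

lemma mat_dim_zero: "mat_dim n m {0\<^sub>m n m :: 'a::field mat} = 0"
proof -
  let ?Z = "{0\<^sub>m n m :: 'a mat}"
  have S: "mat_subspace n m ?Z" by (auto simp: mat_subspace_def)
  have "mat_linear (\<lambda>x. x) ?Z ?Z" by (auto simp: mat_linear_def)
  from mat_rank_nullity[OF S S this] have "mat_dim n m ?Z + mat_dim n m {x \<in> ?Z. x = 0\<^sub>m n m} = mat_dim n m ?Z" by simp
  moreover have "{x \<in> ?Z. x = 0\<^sub>m n m} = ?Z" by auto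
  ultimately show ?thesis by simp
qed

lemma mat_dim_pos:
  assumes S: "mat_subspace n m S" and x: "x \<in> S" "x \<noteq> 0\<^sub>m n m"
  shows "mat_dim n m S \<noteq> 0"
proof
  assume 0: "mat_dim n m S = 0"
  interpret vectorspace class_ring "mat_vs n m S" by (rule mat_subspace_vs[OF S])
  obtain B where B: "finite B" "basis B" using finite_basis_exists[OF mat_subspace_vs(2)[OF S]] by blast
  then have "card B = 0" using dim_basis[of B] 0 by simp
  then have "span {} = S" using B by (auto simp: basis_def)
  then show False using x span_empty by (auto simp: matrix_vs_simps)
qed

text \<open>Square matrices of the right size suffice for \<open>Hom_mod\<close> to be a vector
  space. Every \<open>dual_mod\<close> meets this condition by construction, so Hom spaces into
  duals can be measured before duals are studied as modules.\<close>

definition rep_dims :: "('b, 'k::field) hopf_data \<Rightarrow> ('b, 'k) rep \<Rightarrow> bool" where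
  "rep_dims A M \<longleftrightarrow> (\<forall>a\<in>hbasis A. ract M a \<in> carrier_mat (rdim M) (rdim M))"

lemma rep_dims_module: "is_module A M \<Longrightarrow> rep_dims A M"
  by (simp add: rep_dims_def is_module_def)

lemma rep_dims_dim: "rep_dims A M \<Longrightarrow> a \<in> hbasis A \<Longrightarrow> dim_row (ract M a) = rdim M"
    "rep_dims A M \<Longrightarrow> a \<in> hbasis A \<Longrightarrow> dim_col (ract M a) = rdim M"
  by (auto simp: rep_dims_def)

lemma rep_dims_dual [simp]: "rep_dims A (dual_mod A M)"
  by (simp add: rep_dims_def dual_mod_def)

lemma Hom_subspace:
  assumes M: "rep_dims A M" and N: "rep_dims A N"
  shows "mat_subspace (rdim N) (rdim M) (Hom_mod A M N)"
  unfolding mat_subspace_def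
proof (intro conjI ballI allI)
  show "0\<^sub>m (rdim N) (rdim M) \<in> Hom_mod A M N"
    by (rule Hom_modI) (auto simp: mat_zero_simps rep_dims_dim[OF M] rep_dims_dim[OF N])
  fix x y assume x: "x \<in> Hom_mod A M N" and y: "y \<in> Hom_mod A M N"
  note d = rep_dims_dim[OF M] rep_dims_dim[OF N] Hom_modD(1-3)[OF x] Hom_modD(1-3)[OF y]
  show "x + y \<in> Hom_mod A M N"
    by (rule Hom_modI) (auto simp: d mat_distrib_left mat_distrib_right Hom_modD(4)[OF x] Hom_modD(4)[OF y])
next
  fix c x assume x: "x \<in> Hom_mod A M N"
  note d = rep_dims_dim[OF M] rep_dims_dim[OF N] Hom_modD(1-3)[OF x]
  show "c \<cdot>\<^sub>m x \<in> Hom_mod A M N"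
    by (rule Hom_modI) (auto simp: d mat_smult_left mat_smult_right Hom_modD(4)[OF x])
qed (auto simp: Hom_mod_def)

lemma Hom_comp:
  assumes "rep_dims A L" "rep_dims A M" "rep_dims A N" and S: "S \<in> Hom_mod A L M" and T: "T \<in> Hom_mod A M N"
  shows "T * S \<in> Hom_mod A L N"
proof (rule Hom_modI)
  show "T * S \<in> carrier_mat (rdim N) (rdim L)" using Hom_modD(1)[OF S] Hom_modD(1)[OF T] by auto
  fix a assume a: "a \<in> hbasis A"
  note d = rep_dims_dim[OF assms(1) a] rep_dims_dim[OF assms(2) a] rep_dims_dim[OF assms(3) a]
    Hom_modD(2,3)[OF S] Hom_modD(2,3)[OF T]
  show "T * S * ract L a = ract N a * (T * S)"
    by (simp add: mat_assoc d Hom_modD(4)[OF S a] mat_absorb[OF Hom_modD(4)[OF T a]])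
qed

lemma mat_linear_mult_left:
  assumes "U \<in> carrier_mat k n" "S \<subseteq> carrier_mat n m" "\<And>x. x \<in> S \<Longrightarrow> U * x \<in> S'"
  shows "mat_linear (\<lambda>x. U * x) S S'"
  using assms unfolding mat_linear_def
  by (auto simp: mult_add_distrib_mat[of U k n _ m] subset_eq intro!: mult_smult_distrib[of U k n _ m])

lemma mat_linear_mult_right:
  assumes "U \<in> carrier_mat m k" "S \<subseteq> carrier_mat n m" "\<And>x. x \<in> S \<Longrightarrow> x * U \<in> S'"
  shows "mat_linear (\<lambda>x. x * U) S S'"
  using assms unfolding mat_linear_def
  by (auto simp: add_mult_distrib_mat[of _ n m _ U k] subset_eq intro!: mult_smult_assoc_mat[of _ n m U k])

lemma dim_Hom_split_right:
  assumes M: "rep_dims A M" and L: "rep_dims A L" and N: "rep_dims A N" and P: "rep_dims A P"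
    and s: "mod_split A L P N S S' T T'"
  shows "dim_Hom A M P = dim_Hom A M L + dim_Hom A M N"
proof -
  note h = s[unfolded mod_split_def]
  then have h: "S \<in> Hom_mod A L P" "S' \<in> Hom_mod A P L" "T \<in> Hom_mod A P N" "T' \<in> Hom_mod A N P"
    and s: "lin_split (rdim L) (rdim P) (rdim N) S S' T T'" by auto
  note s = lin_splitD[OF s]
  note c = Hom_comp[OF M L P _ h(1)] Hom_comp[OF M P L _ h(2)] Hom_comp[OF M P N _ h(3)] Hom_comp[OF M N P _ h(4)]
  have sub: "Hom_mod A M Q \<subseteq> carrier_mat (rdim Q) (rdim M)" for Q by (auto simp: Hom_mod_def)
  note d = s(5-12) Hom_modD(2,3)
  show ?thesis unfolding dim_Hom_def
  proof (rule mat_dim_exact(2)[OF Hom_subspace[OF M L] Hom_subspace[OF M P] Hom_subspace[OF M N]])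
    show "mat_linear (\<lambda>x. T * x) (Hom_mod A M P) (Hom_mod A M N)"
      by (rule mat_linear_mult_left[OF s(3) sub]) (rule c)
    show "mat_linear (\<lambda>x. S * x) (Hom_mod A M L) (Hom_mod A M P)"
      by (rule mat_linear_mult_left[OF s(1) sub]) (rule c)
    have SS: "S' * (S * x) = x" if "x \<in> Hom_mod A M L" for x
      using Hom_modD(2)[OF that] by (simp add: mat_absorb[OF s(13)] s(5-12))
    show "inj_on (\<lambda>x. S * x) (Hom_mod A M L)"
      by (rule inj_on_inverseI[where g = "\<lambda>x. S' * x"]) (rule SS)
    show "(\<lambda>x. S * x) ` Hom_mod A M L = {x \<in> Hom_mod A M P. T * x = 0\<^sub>m (rdim N) (rdim M)}"
    proof (intro equalityI subsetI)
      fix y assume "y \<in> (\<lambda>x. S * x) ` Hom_mod A M L"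
      then obtain x where x: "x \<in> Hom_mod A M L" "y = S * x" by auto
      then show "y \<in> {x \<in> Hom_mod A M P. T * x = 0\<^sub>m (rdim N) (rdim M)}"
        using c(1) Hom_modD(2,3)[OF x(1)] by (simp add: mat_absorb[OF s(15)] s(5-12) mat_zero_simps)
    next
      fix y assume "y \<in> {x \<in> Hom_mod A M P. T * x = 0\<^sub>m (rdim N) (rdim M)}"
      then have y: "y \<in> Hom_mod A M P" "T * y = 0\<^sub>m (rdim N) (rdim M)" by auto
      note dy = Hom_modD(2,3)[OF y(1)]
      have "y = (S * S' + T' * T) * y" unfolding s(17) using dy by simp
      also have "\<dots> = S * (S' * y)"
        using dy by (simp add: mat_distrib_right mat_assoc y(2) s(5-12) mat_zero_simps)
      finally show "y \<in> (\<lambda>x. S * x) ` Hom_mod A M L" using c(2)[OF y(1)] by blast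
    qed
    show "(\<lambda>x. T * x) ` Hom_mod A M P = Hom_mod A M N"
    proof (intro equalityI subsetI)
      fix y assume y: "y \<in> Hom_mod A M N"
      then have "y = T * (T' * y)" using Hom_modD(2)[OF y] by (simp add: mat_absorb[OF s(14)] s(5-12))
      then show "y \<in> (\<lambda>x. T * x) ` Hom_mod A M P" using c(4)[OF y] by blast
    qed (use c(3) in auto)
  qed
qed

text \<open>Maps into \<open>P\<close> form a left exact functor, which gives the inequality. A
  retraction of \<open>S\<close> by a homomorphism makes restriction along \<open>S\<close> onto,
  which gives the equality.\<close>

lemma dim_Hom_exact:
  assumes mods: "rep_dims A L" "rep_dims A M" "rep_dims A N" and P: "rep_dims A P"
    and S: "S \<in> Hom_mod A L M" and T: "T \<in> Hom_mod A M N"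
    and s: "lin_split (rdim L) (rdim M) (rdim N) S S' T T'"
  shows "dim_Hom A M P \<le> dim_Hom A L P + dim_Hom A N P"
    "S' \<in> Hom_mod A M L \<Longrightarrow> dim_Hom A M P = dim_Hom A L P + dim_Hom A N P"
proof -
  note s = lin_splitD[OF s]
  note c = Hom_comp[OF mods(1,2) P S] Hom_comp[OF mods(2,3) P T]
  have sub: "Hom_mod A Q P \<subseteq> carrier_mat (rdim P) (rdim Q)" for Q by (auto simp: Hom_mod_def)
  have 1: "mat_linear (\<lambda>x. x * S) (Hom_mod A M P) (Hom_mod A L P)"
    by (rule mat_linear_mult_right[OF s(1) sub]) (rule c)
  have 2: "mat_linear (\<lambda>x. x * T) (Hom_mod A N P) (Hom_mod A M P)"
    by (rule mat_linear_mult_right[OF s(3) sub]) (rule c)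
  have TT: "x * T * T' = x" if "x \<in> Hom_mod A N P" for x
    using Hom_modD(3)[OF that] by (simp add: mat_assoc s(5-12,14))
  have 3: "inj_on (\<lambda>x. x * T) (Hom_mod A N P)"
    by (rule inj_on_inverseI[where g = "\<lambda>x. x * T'"]) (rule TT)
  have 4: "(\<lambda>x. x * T) ` Hom_mod A N P = {x \<in> Hom_mod A M P. x * S = 0\<^sub>m (rdim P) (rdim L)}"
  proof (intro equalityI subsetI)
    fix y assume "y \<in> (\<lambda>x. x * T) ` Hom_mod A N P"
    then obtain x where x: "x \<in> Hom_mod A N P" "y = x * T" by auto
    then show "y \<in> {x \<in> Hom_mod A M P. x * S = 0\<^sub>m (rdim P) (rdim L)}"
      using c(2) Hom_modD(2,3)[OF x(1)] by (simp add: mat_assoc s(5-12,15) mat_zero_simps)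
  next
    fix y assume "y \<in> {x \<in> Hom_mod A M P. x * S = 0\<^sub>m (rdim P) (rdim L)}"
    then have y: "y \<in> Hom_mod A M P" "y * S = 0\<^sub>m (rdim P) (rdim L)" by auto
    note dy = Hom_modD(2,3)[OF y(1)]
    have "y = y * (S * S' + T' * T)" unfolding s(17) using dy by simp
    also have "\<dots> = y * S * S' + y * (T' * T)" using dy by (simp add: mat_distrib_left mat_assoc s(5-12))
    also have "\<dots> = y * T' * T" using dy by (simp add: y(2) s(5-12) mat_zero_simps mat_assoc)
    finally have yT: "y * T' * T = y" by simp
    \<comment> \<open>\<open>T'\<close> is only linear, yet this composite is a homomorphism:
      \<open>y\<close> factors through \<open>T\<close> by the previous equation, and
      \<open>T\<close> can be cancelled since it has a right inverse.\<close>
    have "y * T' \<in> Hom_mod A N P"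
    proof (rule Hom_modI)
      show "y * T' \<in> carrier_mat (rdim P) (rdim N)" using dy s(5-12) by (intro carrier_matI) auto
      fix a assume a: "a \<in> hbasis A"
      note d = dy s(5-12) rep_dims_dim[OF mods(2) a] rep_dims_dim[OF mods(3) a] rep_dims_dim[OF P a]
      have "y * T' * ract N a = y * T' * ract N a * (T * T')" unfolding s(14) using d by simp
      also have "\<dots> = y * T' * (ract N a * T) * T'" using d by (simp add: mat_assoc)
      also have "\<dots> = y * T' * T * ract M a * T'" using d by (simp add: mat_assoc Hom_modD(4)[OF T a])
      also have "\<dots> = ract P a * (y * T')" unfolding yT using d by (simp add: mat_assoc Hom_modD(4)[OF y(1) a])
      finally show "y * T' * ract N a = ract P a * (y * T')" .
    qed
    then show "y \<in> (\<lambda>x. x * T) ` Hom_mod A N P" using yT by (intro image_eqI[of _ _ "y * T'"]) auto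
  qed
  note ex = mat_dim_exact[OF Hom_subspace[OF mods(3) P] Hom_subspace[OF mods(2) P] Hom_subspace[OF mods(1) P] 1 2 3 4]
  show "dim_Hom A M P \<le> dim_Hom A L P + dim_Hom A N P" using ex(1) unfolding dim_Hom_def by simp
  assume S': "S' \<in> Hom_mod A M L"
  have "(\<lambda>x. x * S) ` Hom_mod A M P = Hom_mod A L P"
  proof (intro equalityI subsetI)
    fix y assume y: "y \<in> Hom_mod A L P"
    then have "y = y * S' * S" using Hom_modD(3)[OF y] by (simp add: mat_assoc s(5-13))
    then show "y \<in> (\<lambda>x. x * S) ` Hom_mod A M P" using Hom_comp[OF mods(2,1) P S' y] by blast
  qed (use c(1) in auto)
  from ex(2)[OF this] show "dim_Hom A M P = dim_Hom A L P + dim_Hom A N P" unfolding dim_Hom_def by simp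
qed

text \<open>An isomorphism is viewed as a split exact sequence whose third term \<open>Z\<close> has
  dimension zero.\<close>

lemma dim_Hom_iso_left:
  assumes mods: "rep_dims A M" "rep_dims A M'" and P: "rep_dims A P" and iso: "iso_mod A M M'"
  shows "dim_Hom A M P = dim_Hom A M' P"
proof -
  from iso obtain S S' where S: "S \<in> Hom_mod A M M'" "S' \<in> Hom_mod A M' M" "S' * S = 1\<^sub>m (rdim M)" "S * S' = 1\<^sub>m (rdim M')"
    unfolding iso_mod_def by auto
  define Z where "Z = \<lparr>rdim = 0, ract = (\<lambda>a :: 'a. 0\<^sub>m 0 0 :: 'b mat)\<rparr>"
  have Z: "rep_dims A Z" by (simp add: rep_dims_def Z_def)
  have "0\<^sub>m (rdim P) 0 = x" if "x \<in> Hom_mod A Z P" for x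
    using Hom_modD(1)[OF that] by (auto simp: Z_def intro!: eq_matI)
  then have "Hom_mod A Z P = {0\<^sub>m (rdim P) 0}"
    using Hom_subspace[OF Z P] by (auto simp: mat_subspace_def Z_def)
  then have 0: "dim_Hom A Z P = 0" by (simp add: dim_Hom_def Z_def mat_dim_zero)
  have "lin_split (rdim M) (rdim M') (rdim Z) S S' (0\<^sub>m 0 (rdim M')) (0\<^sub>m (rdim M') 0)"
    unfolding lin_split_def using S Hom_modD(1-3)[OF S(1)] Hom_modD(1-3)[OF S(2)]
    by (auto simp: Z_def mat_zero_simps intro!: eq_matI)
  moreover have "0\<^sub>m 0 (rdim M') \<in> Hom_mod A M' Z"
    by (rule Hom_modI) (use mods(2) in \<open>auto simp: Z_def mat_zero_simps rep_dims_dim\<close>)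
  ultimately show ?thesis using dim_Hom_exact(2)[OF mods Z P S(1) _ _ S(2)] 0 by simp
qed

lemma Hom_dual:
  assumes M: "is_module A M" and N: "is_module A N" and T: "T \<in> Hom_mod A M N"
  shows "transpose_mat T \<in> Hom_mod A (dual_mod A N) (dual_mod A M)"
proof (rule Hom_modI)
  fix a
  show "transpose_mat T * ract (dual_mod A N) a = ract (dual_mod A M) a * transpose_mat T"
    using Hom_mod_act_elt[OF M N T, of "hantipode A a"] Hom_modD(2,3)[OF T]
    by (simp add: dual_mod_def flip: mat_transpose_mult)
qed (use Hom_modD(1)[OF T] in \<open>auto simp: dual_mod_def\<close>)

lemma dual_mod_rdim [simp]: "rdim (dual_mod A M) = rdim M"
  by (simp add: dual_mod_def)

lemma iso_mod_dual:
  assumes M: "is_module A M" and N: "is_module A N" and iso: "iso_mod A M N"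
  shows "iso_mod A (dual_mod A M) (dual_mod A N)"
proof -
  from iso obtain S S' where S: "S \<in> Hom_mod A M N" "S' \<in> Hom_mod A N M" "S' * S = 1\<^sub>m (rdim M)" "S * S' = 1\<^sub>m (rdim N)"
    unfolding iso_mod_def by auto
  note d = Hom_modD(2,3)[OF S(1)] Hom_modD(2,3)[OF S(2)]
  have "transpose_mat S * transpose_mat S' = 1\<^sub>m (rdim M)" "transpose_mat S' * transpose_mat S = 1\<^sub>m (rdim N)"
    using S(3,4) d by (simp_all flip: mat_transpose_mult)
  then show ?thesis unfolding iso_mod_def using Hom_dual[OF M N S(1)] Hom_dual[OF N M S(2)] by auto
qed

lemma lin_split_transpose:
  assumes "lin_split l m n S S' T T'"
  shows "lin_split l m n (transpose_mat S') (transpose_mat S) (transpose_mat T') (transpose_mat T)"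
proof -
  note s = lin_splitD[OF assms]
  have "transpose_mat (S * S' + T' * T) = 1\<^sub>m m" using s(17) by simp
  then show ?thesis unfolding lin_split_def using s(1-16)
    by (simp add: transpose_add[of _ m m] zero_transpose_mat flip: mat_transpose_mult)
qed

lemma mod_split_dual:
  assumes "is_module A L" "is_module A M" "is_module A N" "mod_split A L M N S S' T T'"
  shows "mod_split A (dual_mod A L) (dual_mod A M) (dual_mod A N)
    (transpose_mat S') (transpose_mat S) (transpose_mat T') (transpose_mat T)"
  using assms Hom_dual lin_split_transpose unfolding mod_split_def by (metis dual_mod_rdim)

lemma iso_dim_Hom_right:
  assumes M: "rep_dims A M" and "rep_dims A P" "rep_dims A P'" and iso: "iso_mod A P P'"
  shows "dim_Hom A M P = dim_Hom A M P'"
proof -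
  from iso obtain S S' where S: "S \<in> Hom_mod A P P'" "S' \<in> Hom_mod A P' P" "S' * S = 1\<^sub>m (rdim P)" "S * S' = 1\<^sub>m (rdim P')"
    unfolding iso_mod_def by auto
  define Z where "Z = \<lparr>rdim = 0, ract = (\<lambda>a :: 'a. 0\<^sub>m 0 0 :: 'b mat)\<rparr>"
  have Z: "rep_dims A Z" by (simp add: rep_dims_def Z_def)
  have "0\<^sub>m 0 (rdim M) = x" if "x \<in> Hom_mod A M Z" for x
    using Hom_modD(1)[OF that] by (auto simp: Z_def intro!: eq_matI)
  then have "Hom_mod A M Z = {0\<^sub>m 0 (rdim M)}"
    using Hom_subspace[OF M Z] by (auto simp: mat_subspace_def Z_def)
  then have 0: "dim_Hom A M Z = 0" by (simp add: dim_Hom_def Z_def mat_dim_zero)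
  have "lin_split (rdim P) (rdim P') (rdim Z) S S' (0\<^sub>m 0 (rdim P')) (0\<^sub>m (rdim P') 0)"
    unfolding lin_split_def using S Hom_modD(1-3)[OF S(1)] Hom_modD(1-3)[OF S(2)]
    by (auto simp: Z_def mat_zero_simps intro!: eq_matI)
  moreover have "0\<^sub>m 0 (rdim P') \<in> Hom_mod A P' Z" "0\<^sub>m (rdim P') 0 \<in> Hom_mod A Z P'"
    using assms(2,3) by (auto simp: Z_def mat_zero_simps rep_dims_dim intro!: Hom_modI)
  ultimately show ?thesis using dim_Hom_split_right[OF M assms(2) Z assms(3), of S S'] S 0
    unfolding mod_split_def by simp
qed

section \<open>The bilinear form on the free ring and on the Green ring\<close>

definition frag_eval :: "('a \<Rightarrow> int) \<Rightarrow> ('a \<Rightarrow>\<^sub>0 int) \<Rightarrow> int" where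
  "frag_eval h f = (\<Sum>x\<in>Poly_Mapping.keys f. Poly_Mapping.lookup f x * h x)"

lemma frag_eval_superset: "finite S \<Longrightarrow> Poly_Mapping.keys f \<subseteq> S \<Longrightarrow> frag_eval h f = (\<Sum>x\<in>S. Poly_Mapping.lookup f x * h x)"
  unfolding frag_eval_def by (rule sum.mono_neutral_left) (auto simp: in_keys_iff)

lemma frag_eval_of [simp]: "frag_eval h (frag_of x) = h x"
  by (simp add: frag_eval_def)

lemma frag_eval_zero [simp]: "frag_eval h 0 = 0"
  by (simp add: frag_eval_def)

lemma frag_eval_diff: "frag_eval h (a - b) = frag_eval h a - frag_eval h b"
proof -
  let ?S = "Poly_Mapping.keys a \<union> Poly_Mapping.keys b"
  have "frag_eval h (a - b) = (\<Sum>x\<in>?S. Poly_Mapping.lookup (a - b) x * h x)"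
    by (rule frag_eval_superset) (auto dest: subsetD[OF keys_diff])
  also have "\<dots> = (\<Sum>x\<in>?S. Poly_Mapping.lookup a x * h x) - (\<Sum>x\<in>?S. Poly_Mapping.lookup b x * h x)"
    by (simp add: lookup_minus left_diff_distrib sum_subtractf)
  finally show ?thesis by (simp add: frag_eval_superset[of ?S a] frag_eval_superset[of ?S b])
qed

lemma frag_eval_diff_fun: "frag_eval (\<lambda>x. h x - k x) f = frag_eval h f - frag_eval k f"
  by (simp add: frag_eval_def right_diff_distrib sum_subtractf)

lemma free_form_eval:
  "free_form A f f' = frag_eval (\<lambda>C. frag_eval (\<lambda>D. int (dim_Hom A (some_rep C) (dual_mod A (some_rep D)))) f') f"
  by (simp add: free_form_def frag_eval_def sum_distrib_left mult.assoc)

lemma free_form_diff_left: "free_form A (a - b) f = free_form A a f - free_form A b f"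
  and free_form_diff_right: "free_form A f (a - b) = free_form A f a - free_form A f b"
  and free_form_zero [simp]: "free_form A 0 f = 0" "free_form A f 0 = 0"
  by (simp_all add: free_form_eval frag_eval_diff frag_eval_diff_fun) (simp add: frag_eval_def)

lemma free_form_minus_right: "free_form A f (- a) = - free_form A f a"
  using free_form_diff_right[of A f 0 a] by simp

lemma free_form_class:
  assumes M: "is_module A M" and N: "is_module A N"
  shows "free_form A (frag_of (iso_class A M)) (frag_of (iso_class A N)) = int (dim_Hom A M (dual_mod A N))"
proof -
  note m = some_rep[OF M] some_rep[OF N]
  have "dim_Hom A (some_rep (iso_class A M)) (dual_mod A (some_rep (iso_class A N))) = dim_Hom A M (dual_mod A (some_rep (iso_class A N)))"
    by (rule dim_Hom_iso_left) (use m M in \<open>auto intro: rep_dims_module iso_mod_sym\<close>)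
  also have "\<dots> = dim_Hom A M (dual_mod A N)"
    by (rule iso_dim_Hom_right) (use m M N in \<open>auto intro!: rep_dims_module iso_mod_dual intro: iso_mod_sym\<close>)
  finally show ?thesis by (simp add: free_form_eval)
qed

context hopf_algebra
begin

lemma free_form_split:
  assumes f: "f \<in> split_relations A" and f': "f' \<in> carrier F"
  shows "free_form A f f' = 0" "free_form A f' f = 0"
proof -
  have "free_form A f f' = 0 \<and> free_form A f' f = 0"
    using f split_gens_carrier unfolding split_relations_def
  proof (induction f rule: generate_induct)
    case (gen y)
    then obtain M N where M: "is_module A M" and N: "is_module A N"
      and y: "y = frag_of (iso_class A (dsum_mod M N)) - frag_of (iso_class A M) - frag_of (iso_class A N)" by auto
    note mods = M is_module_dsum[OF M N] N
    note s = mod_split_dsum[OF M N]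
    note s' = s[unfolded mod_split_def]
    from f' show ?case
    proof (induction f' rule: free_class_induct)
      case (cls P)
      have "dim_Hom A (dsum_mod M N) (dual_mod A P) = dim_Hom A M (dual_mod A P) + dim_Hom A N (dual_mod A P)"
        by (rule dim_Hom_exact(2)[OF mods[THEN rep_dims_module]]) (use s' in auto)
      moreover have "dim_Hom A P (dual_mod A (dsum_mod M N)) = dim_Hom A P (dual_mod A M) + dim_Hom A P (dual_mod A N)"
        by (rule dim_Hom_split_right[OF rep_dims_module[OF cls] _ _ _ mod_split_dual[OF mods s]]) simp_all
      ultimately show ?case unfolding y
        by (simp add: free_form_diff_left free_form_diff_right free_form_class mods cls)
    qed (simp_all add: free_form_diff_left free_form_diff_right)
  qed (simp_all add: free_form_diff_left free_form_diff_right)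
  then show "free_form A f f' = 0" "free_form A f' f = 0" by auto
qed

lemma mem_scos_carrier: "f \<in> carrier F \<Longrightarrow> f' \<in> scos f \<Longrightarrow> f' \<in> carrier F"
  using free_carrier_add[of "f' - f" A f] split_closed(5) by (auto simp: mem_scos)

text \<open>The form on the free ring vanishes on split relations in either argument, so it takes a
  single value on a pair of cosets and the description operator picks that value.\<close>

lemma green_form_cos:
  assumes f: "f \<in> carrier F" and k: "k \<in> carrier F"
  shows "green_form A (scos f) (scos k) = free_form A f k"
proof -
  have "free_form A f' k' = free_form A f k" if "f' \<in> scos f" "k' \<in> scos k" for f' k'
  proof -
    have "free_form A (f' - f) k' = 0" "free_form A f (k' - k) = 0"
      using free_form_split that mem_scos_carrier[OF k that(2)] f by (auto simp: mem_scos)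
    then show ?thesis by (simp add: free_form_diff_left free_form_diff_right)
  qed
  then have all: "\<forall>f'\<in>scos f. \<forall>k'\<in>scos k. free_form A f' k' = free_form A f k" by blast
  have mem: "f \<in> scos f" "k \<in> scos k" by (simp_all add: mem_scos split_closed)
  show ?thesis unfolding green_form_def
  proof (rule the_equality)
    show "\<forall>f'\<in>scos f. \<forall>k'\<in>scos k. free_form A f' k' = free_form A f k" by (rule all)
    fix m assume "\<forall>f'\<in>scos f. \<forall>k'\<in>scos k. free_form A f' k' = m"
    from bspec[OF bspec[OF this mem(1)] mem(2)] show "m = free_form A f k" by simp
  qed
qed

lemma green_class_cos: "green_class A M = scos (frag_of (iso_class A M))"
  by (simp add: green_class_def)

text \<open>By additivity of the form in its second argument, orthogonality to the whole ideal is
  orthogonality to each of its generators.\<close>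

lemma projective_perp_cos:
  assumes f: "f \<in> carrier F"
  shows "scos f \<in> projective_perp A \<longleftrightarrow>
    (\<forall>P. indecomposable_mod A P \<and> projective_mod A P \<longrightarrow> free_form A f (frag_of (iso_class A P)) = 0)"
proof -
  let ?Y = "{green_class A P | P. indecomposable_mod A P \<and> projective_mod A P}"
  interpret R: ring "green_ring A" by (rule ring_green)
  have Y: "?Y \<subseteq> carrier (green_ring A)"
    by (auto simp: green_class_cos carrier_green projective_mod_def)
  have z: "\<exists>k\<in>carrier F. z = scos k \<and> free_form A f k = 0"
    if z: "z \<in> projective_ideal A"
      and *: "\<forall>P. indecomposable_mod A P \<and> projective_mod A P \<longrightarrow> free_form A f (frag_of (iso_class A P)) = 0" for z
    using z unfolding projective_ideal_def
  proof (induction rule: generate.induct)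
    case one
    have "\<zero>\<^bsub>green_ring A\<^esub> = scos 0"
      using ring_hom_zero[OF scos_hom ring_free ring_green] by (simp add: free_zero)
    then show ?case by (intro bexI[of _ 0]) (auto simp: free_carrier)
  next
    case (incl h)
    then show ?case using * by (auto simp: green_class_cos projective_mod_def)
  next
    case (inv h)
    then obtain P where P: "indecomposable_mod A P" "projective_mod A P" "h = scos (frag_of (iso_class A P))"
      by (auto simp: green_class_cos)
    let ?p = "frag_of (iso_class A P)"
    have p: "?p \<in> carrier F" using P(2) by (simp add: projective_mod_def)
    interpret h: ring_hom_ring F "green_ring A" scos
      by (rule ring_hom_ringI2[OF ring_free ring_green scos_hom])
    have "inv\<^bsub>add_monoid (green_ring A)\<^esub> h = scos (\<ominus>\<^bsub>F\<^esub> ?p)"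
      using h.hom_a_inv[OF p] by (simp add: P(3) a_inv_def)
    also have "\<dots> = scos (0 - ?p)" using F_inv[OF p] by simp
    finally show ?case using * P p
      by (intro bexI[of _ "0 - ?p"]) (auto simp: free_form_minus_right free_carrier)
  next
    case (eng a b)
    then obtain k k' where k: "k \<in> carrier F" "a = scos k" "free_form A f k = 0"
      "k' \<in> carrier F" "b = scos k'" "free_form A f k' = 0" by auto
    have "free_form A f (k - (0 - k')) = 0" using k by (simp only: free_form_diff_right free_form_zero)
    then show ?case using k ring_hom_add[OF scos_hom k(1,4)]
      by (intro bexI[of _ "k + k'"]) (auto simp: free_add free_carrier_add)
  qed
  show ?thesis
  proof
    assume "scos f \<in> projective_perp A"
    then have *: "green_form A (scos f) z = 0" if "z \<in> projective_ideal A" for z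
      using that by (simp add: projective_perp_def)
    show "\<forall>P. indecomposable_mod A P \<and> projective_mod A P \<longrightarrow> free_form A f (frag_of (iso_class A P)) = 0"
    proof (intro allI impI)
      fix P assume P: "indecomposable_mod A P \<and> projective_mod A P"
      then have "green_class A P \<in> projective_ideal A"
        unfolding projective_ideal_def by (intro generate.incl) auto
      from *[OF this] P show "free_form A f (frag_of (iso_class A P)) = 0"
        by (simp add: green_class_cos green_form_cos f projective_mod_def)
    qed
  next
    assume "\<forall>P. indecomposable_mod A P \<and> projective_mod A P \<longrightarrow> free_form A f (frag_of (iso_class A P)) = 0"
    then have "green_form A (scos f) z = 0" if "z \<in> projective_ideal A" for z
      using z[OF that] green_form_cos[OF f] by auto
    then show "scos f \<in> projective_perp A"
      using f by (auto simp: projective_perp_def carrier_green)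
  qed
qed

end

lemma act_elt_bvec:
  assumes "finite (hbasis A)" "a \<in> hbasis A" "ract M a \<in> carrier_mat (rdim M) (rdim M)"
  shows "act_elt A M (bvec a) = ract M a"
  by (rule eq_matI) (use assms in \<open>auto simp: act_elt_def bvec_def if_distrib[of "\<lambda>x. x * _"] cong: if_cong\<close>)

lemma one_mat_eq_zero_iff: "1\<^sub>m n = (0\<^sub>m n n :: 'a::zero_neq_one mat) \<longleftrightarrow> n = 0"
proof
  assume "1\<^sub>m n = (0\<^sub>m n n :: 'a mat)"
  then have "(1\<^sub>m n :: 'a mat) $$ (0, 0) = 0\<^sub>m n n $$ (0, 0)" by (rule arg_cong)
  then show "n = 0" by (cases "n = 0") auto
qed (auto intro!: eq_matI)

text \<open>\<open>T' * T = 1 - S * S'\<close> commutes with the action. As \<open>T\<close> is a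
  homomorphism with right inverse \<open>T'\<close>, this carries over to \<open>T'\<close>
  itself.\<close>

lemma lin_split_fourth_hom:
  assumes mods: "is_module A L" "is_module A M" "is_module A N"
    and S: "S \<in> Hom_mod A L M" "S' \<in> Hom_mod A M L" and T: "T \<in> Hom_mod A M N"
    and s: "lin_split (rdim L) (rdim M) (rdim N) S S' T T'"
  shows "mod_split A L M N S S' T T'"
proof -
  note l = lin_splitD[OF s]
  have "T' \<in> Hom_mod A N M"
  proof (rule Hom_modI)
    fix a assume a: "a \<in> hbasis A"
    note d = is_module_dim[OF mods(1) a] is_module_dim[OF mods(2) a] is_module_dim[OF mods(3) a] l(5-12)
    have TT: "T' * T = 1\<^sub>m (rdim M) - S * S'"
    proof -
      have "T' * T = (S * S' + T' * T) - S * S'" using d by (intro eq_matI) auto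
      then show ?thesis unfolding l(17) .
    qed
    have SS: "S * S' \<in> Hom_mod A M M" by (rule Hom_mod_comp[OF mods(2,1,2) S(2,1)])
    have "T' * ract N a = T' * (ract N a * T) * T'" using d by (simp add: mat_assoc l(14))
    also have "\<dots> = T' * T * ract M a * T'" using d by (simp add: mat_assoc Hom_modD(4)[OF T a])
    also have "T' * T * ract M a = ract M a * (T' * T)"
      unfolding TT using Hom_modD(4)[OF SS a] d by (simp add: mat_diff_distrib_left mat_diff_distrib_right)
    also have "ract M a * (T' * T) * T' = ract M a * T'" using d by (simp add: mat_assoc l(14))
    finally show "T' * ract N a = ract M a * T'" .
  qed (use l in auto)
  then show ?thesis unfolding mod_split_def using S T s by blast
qed

lemma iso_mod_dsum:
  assumes mods: "is_module A M" "is_module A M'" "is_module A N" "is_module A N'"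
    and "iso_mod A M M'" "iso_mod A N N'"
  shows "iso_mod A (dsum_mod M N) (dsum_mod M' N')"
proof -
  from assms(5) obtain S S' where S: "S \<in> Hom_mod A M M'" "S' \<in> Hom_mod A M' M" "S' * S = 1\<^sub>m (rdim M)" "S * S' = 1\<^sub>m (rdim M')"
    unfolding iso_mod_def by auto
  from assms(6) obtain T T' where T: "T \<in> Hom_mod A N N'" "T' \<in> Hom_mod A N' N" "T' * T = 1\<^sub>m (rdim N)" "T * T' = 1\<^sub>m (rdim N')"
    unfolding iso_mod_def by auto
  let ?i = "dsum_in1 (rdim M) (rdim N)" and ?p = "dsum_pr1 (rdim M) (rdim N)"
  let ?j = "dsum_in2 (rdim M) (rdim N)" and ?r = "dsum_pr2 (rdim M) (rdim N)"
  note s = mod_split_dsum[OF mods(1,3), unfolded mod_split_def]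
  note d = dsum_split[where 'a = 'b and l = "rdim M" and n = "rdim N"]
    Hom_modD(2,3)[OF S(1)] Hom_modD(2,3)[OF S(2)] Hom_modD(2,3)[OF T(1)] Hom_modD(2,3)[OF T(2)]
  note D = is_module_dsum[OF mods(1,3)]
  have "?i * S' * (S * ?p) = ?i * ?p" "?j * T' * (T * ?r) = ?j * ?r"
    using d by (simp_all add: mat_assoc mat_absorb[OF S(3)] mat_absorb[OF T(3)])
  then have "mod_split A M' (dsum_mod M N) N' (?i * S') (S * ?p) (T * ?r) (?j * T')"
    unfolding mod_split_def lin_split_def
    using d s S T Hom_mod_comp[OF mods(2,1) D S(2)] Hom_mod_comp[OF D mods(1,2) _ S(1)]
      Hom_mod_comp[OF mods(4,3) D T(2)] Hom_mod_comp[OF D mods(3,4) _ T(1)]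
    by (auto simp: mat_assoc mat_absorb[OF d(13)] mat_absorb[OF d(14)] mat_absorb[OF d(15)] mat_absorb[OF d(16)] mat_zero_simps)
  from mod_split_iso_dsum[OF mods(2) D mods(4) this] show ?thesis .
qed

text \<open>The image \<open>I\<close> of \<open>T\<close> appears twice: as a submodule of
  \<open>M\<close> with quotient \<open>K\<close>, and as a quotient of \<open>B\<close> with kernel
  \<open>K'\<close>. In \<open>iso_of_dim_Hom\<close> it is the common part that two modules are
  compared along.\<close>

lemma image_module:
  fixes A :: "('b, 'k::field) hopf_data"
  assumes B: "is_module A B" and M: "is_module A M" and T: "T \<in> Hom_mod A B M" "T \<noteq> 0\<^sub>m (rdim M) (rdim B)"
  obtains I K K' where "is_module A I" "rdim I \<noteq> 0" "is_module A K" "is_module A K'"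
    "short_exact A I M K" "short_exact A K' B I"
proof -
  obtain r P P' Q Q' where f: "P \<in> carrier_mat (rdim M) r" "P' \<in> carrier_mat r (rdim M)" "Q \<in> carrier_mat r (rdim B)"
    "Q' \<in> carrier_mat (rdim B) r" "T = P * Q" "P' * P = 1\<^sub>m r" "Q * Q' = 1\<^sub>m r"
    using rank_factorization[OF Hom_modD(1)[OF T(1)]] by metis
  obtain n U U' where s: "lin_split r (rdim M) n P P' U U'" using lin_split_inj[OF f(1,2,6)] by metis
  note l = lin_splitD[OF s]
  have dQ: "dim_row Q = r" "dim_col Q = rdim B" "dim_row Q' = rdim B" "dim_col Q' = r" using f by auto
  note d = is_module_dim[OF B] is_module_dim[OF M] l(5-12) dQ
  \<comment> \<open>As \<open>P = T * Q'\<close>, the action on the image of \<open>P\<close> can be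
    computed in \<open>B\<close>, so that image is stable.\<close>
  have MP: "ract M a * P = P * (Q * (ract B a * Q'))" if a: "a \<in> hbasis A" for a
  proof -
    have "ract M a * P = ract M a * (P * Q) * Q'" using a d by (simp add: mat_assoc f(7))
    also have "\<dots> = P * Q * ract B a * Q'" using a d Hom_modD(4)[OF T(1) a] by (simp add: mat_assoc flip: f(5))
    finally show ?thesis using a d by (simp add: mat_assoc)
  qed
  have inv: "U * ract M a * P = 0\<^sub>m n r" if a: "a \<in> hbasis A" for a
    using a d by (simp add: mat_assoc MP[OF a] mat_absorb[OF l(15)] mat_zero_simps)
  define I where "I = \<lparr>rdim = r, ract = (\<lambda>a. P' * ract M a * P)\<rparr>"
  define K where "K = \<lparr>rdim = n, ract = (\<lambda>a. U * ract M a * U')\<rparr>"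
  note q = sub_quotient_module[OF M s inv, folded I_def K_def]
  have dI: "rdim I = r" "rdim K = n" by (simp_all add: I_def K_def)
  have "short_exact A I M K" using short_exactI[OF q(3,4)] s dI by simp
  moreover have Q: "Q \<in> Hom_mod A B I"
  proof (rule Hom_modI)
    fix a assume a: "a \<in> hbasis A"
    have "Q * ract B a = P' * (P * Q * ract B a)" using a d by (simp add: mat_assoc mat_absorb[OF f(6)])
    also have "P * Q * ract B a = ract M a * (P * Q)" using Hom_modD(4)[OF T(1) a] f(5) by simp
    finally show "Q * ract B a = ract I a * Q" using a d by (simp add: I_def mat_assoc)
  qed (use f dI in auto)
  moreover obtain K' V V' where K': "is_module A K'" "V \<in> Hom_mod A K' B" "lin_split (rdim K') (rdim B) (rdim I) V V' Q Q'"
    using ex_kernel[OF B q(1) Q] f dI by metis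
  moreover have "r \<noteq> 0"
  proof
    assume "r = 0"
    then have "T = 0\<^sub>m (rdim M) (rdim B)" unfolding f(5) using f by (intro eq_matI) (auto simp: scalar_prod_def)
    then show False using T by simp
  qed
  ultimately show thesis using that[OF q(1) _ q(2) K'(1)] short_exactI[OF K'(2) Q K'(3)] dI by auto
qed

context hopf_algebra
begin

text \<open>Positive and negative terms are collected into one module each. Membership of a ring
  element in an ideal then becomes a statement about two modules.\<close>

lemma free_difference:
  assumes "f \<in> carrier F"
  obtains M N where "is_module A M" "is_module A N"
    "f - (frag_of (iso_class A M) - frag_of (iso_class A N)) \<in> split_relations A"
proof -
  have "\<exists>M N. is_module A M \<and> is_module A N \<and> f - (frag_of (iso_class A M) - frag_of (iso_class A N)) \<in> split_relations A"
    using assms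
  proof (induction f rule: free_class_induct)
    case zero
    show ?case using is_module_trivial split_closed(1) by (intro exI[of _ "trivial_mod A"]) simp
  next
    case (cls M)
    let ?t = "trivial_mod A"
    note D = is_module_dsum[OF cls is_module_trivial]
    \<comment> \<open>\<open>[M] = [M + t] - [t]\<close>, where \<open>t\<close> is the trivial
      module.\<close>
    have "0 - (frag_of (iso_class A (dsum_mod M ?t)) - frag_of (iso_class A M) - frag_of (iso_class A ?t)) \<in> split_relations A"
      by (rule split_closed(4)[OF split_closed(1) split_relation[OF cls is_module_trivial D iso_mod_refl[OF D]]])
    then show ?case using D is_module_trivial by (intro exI[of _ "dsum_mod M ?t"] exI[of _ ?t]) (simp add: algebra_simps)
  next
    case (diff a b)
    then obtain M N M' N' where m: "is_module A M" "is_module A N" "is_module A M'" "is_module A N'"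
      and a: "a - (frag_of (iso_class A M) - frag_of (iso_class A N)) \<in> split_relations A"
      and b: "b - (frag_of (iso_class A M') - frag_of (iso_class A N')) \<in> split_relations A" by auto
    note D = is_module_dsum[OF m(1,4)] is_module_dsum[OF m(2,3)]
    have 1: "frag_of (iso_class A (dsum_mod M N')) - frag_of (iso_class A M) - frag_of (iso_class A N') \<in> split_relations A"
      by (rule split_relation[OF m(1,4) D(1) iso_mod_refl[OF D(1)]])
    have 2: "frag_of (iso_class A (dsum_mod N M')) - frag_of (iso_class A N) - frag_of (iso_class A M') \<in> split_relations A"
      by (rule split_relation[OF m(2,3) D(2) iso_mod_refl[OF D(2)]])
    from split_closed(4)[OF split_closed(4)[OF a b] split_closed(4)[OF 1 2]]
    show ?case using D by (intro exI[of _ "dsum_mod M N'"] exI[of _ "dsum_mod N M'"]) (simp add: algebra_simps)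
  qed
  then show thesis using that by blast
qed

end

lemma bvec_simps [simp]: "bvec a a = 1" "a \<noteq> c \<Longrightarrow> bvec a c = 0"
  by (auto simp: bvec_def)

lemma sum_bvec:
  assumes "finite S" "a \<in> S"
  shows "(\<Sum>b\<in>S. bvec a b * f b) = f a" "(\<Sum>b\<in>S. f b * bvec a b) = f a"
  using assms by (simp_all add: bvec_def if_distrib[of "\<lambda>x. x * _"] if_distrib[of "\<lambda>x. _ * x"] cong: if_cong)

lemma prod_elt_bvec:
  assumes "finite (hbasis A)" "a \<in> hbasis A" "b \<in> hbasis A"
  shows "prod_elt A (bvec a) (bvec b) = hmult A a b"
proof
  fix c
  have "prod_elt A (bvec a) (bvec b) c = (\<Sum>x\<in>hbasis A. bvec a x * (\<Sum>y\<in>hbasis A. bvec b y * hmult A x y c))"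
    by (simp add: prod_elt_def sum_distrib_left mult.assoc)
  then show "prod_elt A (bvec a) (bvec b) c = hmult A a b c" by (simp add: sum_bvec assms)
qed

lemma sum_prod_bvec:
  assumes "finite S" "a \<in> S" "b \<in> S"
  shows "(\<Sum>(x, y)\<in>S \<times> S. tensor_elt (bvec a) (bvec b) (x, y) * f x y) = f a b"
proof -
  have "(\<Sum>(x, y)\<in>S \<times> S. tensor_elt (bvec a) (bvec b) (x, y) * f x y) = (\<Sum>x\<in>S. bvec a x * (\<Sum>y\<in>S. bvec b y * f x y))"
    by (simp add: sum.cartesian_product[symmetric] tensor_elt_def sum_distrib_left mult.assoc)
  then show ?thesis by (simp add: sum_bvec assms)
qed

section \<open>Semisimplicity of the group algebra\<close>

locale fin_group = group G for G (structure) +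
  assumes finite_carrier: "finite (carrier G)"
begin

abbreviation KG :: "('a, 'k::field) hopf_data" where "KG \<equiv> group_algebra G"

lemma KG_simps [simp]: "hbasis KG = carrier G" "hmult KG a b = bvec (a \<otimes> b)" "hunit KG = bvec \<one>"
  "hcomult KG a = tensor_elt (bvec a) (bvec a)" "hcounit KG a = 1" "hantipode KG a = bvec (inv a)"
  by (simp_all add: group_algebra_def)

lemma prod_elt_KG: "a \<in> carrier G \<Longrightarrow> b \<in> carrier G \<Longrightarrow> prod_elt KG (bvec a) (bvec b) = bvec (a \<otimes> b)"
  by (subst prod_elt_bvec) (simp_all add: finite_carrier)

lemma hopf_algebra_KG: "hopf_algebra (KG :: ('a, 'k::field) hopf_data)"
proof
  let ?A = "KG :: ('a, 'k) hopf_data"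
  note fin = finite_carrier
  show "finite (hbasis ?A)" using fin by simp
  show "hmult ?A a b c = 0" if "a \<in> hbasis ?A" "b \<in> hbasis ?A" "c \<notin> hbasis ?A" for a b c
    using that by (auto simp: bvec_def)
  show "hunit ?A c = 0" if "c \<notin> hbasis ?A" for c using that by (auto simp: bvec_def)
  show "hcomult ?A a pq = 0" if "a \<in> hbasis ?A" "pq \<notin> hbasis ?A \<times> hbasis ?A" for a pq
    using that by (auto simp: bvec_def tensor_elt_def split: prod.splits)
  show "hantipode ?A a c = 0" if "a \<in> hbasis ?A" "c \<notin> hbasis ?A" for a c
    using that by (auto simp: bvec_def)
  show "prod_elt ?A (hmult ?A a b) (bvec c) = prod_elt ?A (bvec a) (hmult ?A b c)"
    if "a \<in> hbasis ?A" "b \<in> hbasis ?A" "c \<in> hbasis ?A" for a b c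
    using that by (simp add: prod_elt_KG m_assoc)
  show "prod_elt ?A (hunit ?A) (bvec a) = bvec a" "prod_elt ?A (bvec a) (hunit ?A) = bvec a" if "a \<in> hbasis ?A" for a
    using that by (simp_all add: prod_elt_KG)
  show "(\<Sum>s\<in>hbasis ?A. hcomult ?A a (s, r) * hcomult ?A s (p, q)) = (\<Sum>s\<in>hbasis ?A. hcomult ?A a (p, s) * hcomult ?A s (q, r))"
    if "a \<in> hbasis ?A" "p \<in> hbasis ?A" "q \<in> hbasis ?A" "r \<in> hbasis ?A" for a p q r
  proof -
    have "(\<Sum>s\<in>carrier G. bvec a s * (bvec a r * (bvec s p * bvec s q))) = (bvec a r * (bvec a p * bvec a q) :: 'k)"
      by (rule sum_bvec) (use that fin in auto)
    moreover have "(\<Sum>s\<in>carrier G. bvec a s * (bvec a p * (bvec s q * bvec s r))) = (bvec a p * (bvec a q * bvec a r) :: 'k)"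
      by (rule sum_bvec) (use that fin in auto)
    ultimately show ?thesis using that by (simp add: tensor_elt_def mult_ac)
  qed
  show "(\<Sum>s\<in>hbasis ?A. hcounit ?A s * hcomult ?A a (s, c)) = bvec a c"
    "(\<Sum>s\<in>hbasis ?A. hcomult ?A a (c, s) * hcounit ?A s) = bvec a c"
    if "a \<in> hbasis ?A" "c \<in> hbasis ?A" for a c
    using that sum_bvec(1)[OF fin, of a "\<lambda>_. bvec a c"] sum_bvec(2)[OF fin, of a "\<lambda>_. bvec a c"] by (simp_all add: tensor_elt_def)
  have comult: "comult_elt ?A (bvec a) = tensor_elt (bvec a) (bvec a)" if "a \<in> carrier G" for a
    using that fin by (auto simp: comult_elt_def sum_bvec)
  show "comult_elt ?A (hmult ?A a b) = prod_tensor ?A (hcomult ?A a) (hcomult ?A b)"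
    if a: "a \<in> hbasis ?A" and b: "b \<in> hbasis ?A" for a b
  proof
    fix cc :: "'a \<times> 'a"
    obtain c c' where cc: "cc = (c, c')" by (cases cc)
    have "prod_tensor ?A (hcomult ?A a) (hcomult ?A b) (c, c') =
      (\<Sum>(x, x')\<in>carrier G \<times> carrier G. tensor_elt (bvec a) (bvec a) (x, x') *
        (\<Sum>(y, y')\<in>carrier G \<times> carrier G. tensor_elt (bvec b) (bvec b) (y, y') * (bvec (x \<otimes> y) c * bvec (x' \<otimes> y') c')))"
      by (simp add: prod_tensor_def case_prod_beta sum_distrib_left mult.assoc)
    also have "\<dots> = bvec (a \<otimes> b) c * bvec (a \<otimes> b) c'"
      using a b fin by (simp add: sum_prod_bvec)
    finally show "comult_elt ?A (hmult ?A a b) cc = prod_tensor ?A (hcomult ?A a) (hcomult ?A b) cc"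
      using a b by (simp add: comult cc) (simp add: tensor_elt_def)
  qed
  show "comult_elt ?A (hunit ?A) = tensor_elt (hunit ?A) (hunit ?A)" by (simp add: comult)
  show "counit_elt ?A (hmult ?A a b) = hcounit ?A a * hcounit ?A b" if "a \<in> hbasis ?A" "b \<in> hbasis ?A" for a b
    using that sum_bvec(1)[OF fin, of "a \<otimes> b" "\<lambda>_. 1"] by (simp add: counit_elt_def)
  show "counit_elt ?A (hunit ?A) = 1"
    using sum_bvec(1)[OF fin, of \<one> "\<lambda>_. 1"] by (simp add: counit_elt_def)
  show "(\<lambda>c. \<Sum>p\<in>hbasis ?A. \<Sum>q\<in>hbasis ?A. hcomult ?A a (p, q) * prod_elt ?A (hantipode ?A p) (bvec q) c) = (\<lambda>c. hcounit ?A a * hunit ?A c)"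
    "(\<lambda>c. \<Sum>p\<in>hbasis ?A. \<Sum>q\<in>hbasis ?A. hcomult ?A a (p, q) * prod_elt ?A (bvec p) (hantipode ?A q) c) = (\<lambda>c. hcounit ?A a * hunit ?A c)"
    if "a \<in> hbasis ?A" for a
    using that sum_prod_bvec[OF fin, of a a "\<lambda>p q. bvec (inv p \<otimes> q) c :: 'k" for c]
      sum_prod_bvec[OF fin, of a a "\<lambda>p q. bvec (p \<otimes> inv q) c :: 'k" for c]
    by (simp_all add: sum.cartesian_product prod_elt_KG)
qed

sublocale KG: hopf_algebra KG by (rule hopf_algebra_KG)

lemma is_module_KG:
  "is_module KG M \<longleftrightarrow> (\<forall>a\<in>carrier G. ract M a \<in> carrier_mat (rdim M) (rdim M)) \<and> ract M \<one> = 1\<^sub>m (rdim M) \<and>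
    (\<forall>a\<in>carrier G. \<forall>b\<in>carrier G. ract M (a \<otimes> b) = ract M a * ract M b)"
proof (cases "\<forall>a\<in>carrier G. ract M a \<in> carrier_mat (rdim M) (rdim M)")
  case True
  then have "act_elt KG M (bvec a) = ract M a" if "a \<in> carrier G" for a
    using act_elt_bvec[of KG a M] that finite_carrier by simp
  then show ?thesis using True by (auto simp: is_module_def)
qed (auto simp: is_module_def)

lemma KG_moduleD:
  assumes "is_module KG M"
  shows "a \<in> carrier G \<Longrightarrow> ract M a \<in> carrier_mat (rdim M) (rdim M)"
    "a \<in> carrier G \<Longrightarrow> dim_row (ract M a) = rdim M" "a \<in> carrier G \<Longrightarrow> dim_col (ract M a) = rdim M"
    "ract M \<one> = 1\<^sub>m (rdim M)"
    "a \<in> carrier G \<Longrightarrow> b \<in> carrier G \<Longrightarrow> ract M a * ract M b = ract M (a \<otimes> b)"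
  using assms unfolding is_module_KG by auto

lemma tensor_mod_KG:
  assumes "is_module KG M" "is_module KG N" "a \<in> carrier G"
  shows "ract (tensor_mod KG M N) a = kron (ract M a) (ract N a)"
proof -
  have "ract (tensor_mod KG M N) a = KG.act_tensor M N (tensor_elt (bvec a) (bvec a))"
    using KG.tensor_mod_act[OF assms(1,2), of a] by simp
  also have "\<dots> = kron (ract M a) (ract N a)"
    using assms finite_carrier
    by (simp add: KG.act_tensor_tensor_elt act_elt_bvec KG_moduleD)
  finally show ?thesis .
qed

text \<open>Averaging the linear left inverse \<open>U\<close> over the group gives a left inverse
  commuting with the group; division by the group order is possible in characteristic zero. The
  right inverse of \<open>T\<close> is then adapted to it.\<close>

lemma maschke:
  fixes L M N :: "('a, 'k::field_char_0) rep"
  assumes mods: "is_module KG L" "is_module KG M" "is_module KG N"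
    and S: "S \<in> Hom_mod KG L M" and T: "T \<in> Hom_mod KG M N" and s: "lin_split (rdim L) (rdim M) (rdim N) S U T T'"
  obtains S' R where "mod_split KG L M N S S' T R"
proof -
  note l = lin_splitD[OF s]
  let ?n = "of_nat (card (carrier G)) :: 'k"
  have n: "?n \<noteq> 0" using finite_carrier by (auto simp: card_eq_0_iff)
  define S' where "S' = inverse ?n \<cdot>\<^sub>m msum (rdim L) (rdim M) (\<lambda>h. ract L h * (U * ract M (inv h))) (carrier G)"
  note dL = KG_moduleD[OF mods(1)] and dM = KG_moduleD[OF mods(2)] and dN = KG_moduleD[OF mods(3)]
  have dS': "dim_row S' = rdim L" "dim_col S' = rdim M" by (simp_all add: S'_def)
  have hom: "S' \<in> Hom_mod KG M L"
  proof (rule Hom_modI)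
    fix a assume "a \<in> hbasis (KG :: ('a, 'k) hopf_data)"
    then have a: "a \<in> carrier G" by simp
    have "msum (rdim L) (rdim M) (\<lambda>h. ract L h * (U * ract M (inv h))) (carrier G) * ract M a =
      msum (rdim L) (rdim M) (\<lambda>h. ract L h * (U * ract M (inv h \<otimes> a))) (carrier G)"
      by (subst msum_mult_right) (use a in \<open>auto simp: dL dM l(5-12) mat_assoc intro!: msum_cong\<close>)
    \<comment> \<open>Translating the summation variable by \<open>a\<close> moves the group element
      from the right of the average to its left.\<close>
    also have "\<dots> = msum (rdim L) (rdim M) (\<lambda>h. ract L (a \<otimes> h) * (U * ract M (inv (a \<otimes> h) \<otimes> a))) (carrier G)"
      by (rule msum_reindex[symmetric], rule bij_betwI[where g = "\<lambda>h. inv a \<otimes> h"])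
        (use a in \<open>auto simp flip: m_assoc\<close>)
    also have "\<dots> = msum (rdim L) (rdim M) (\<lambda>h. ract L a * (ract L h * (U * ract M (inv h)))) (carrier G)"
    proof (rule msum_cong[OF refl])
      fix h assume h: "h \<in> carrier G"
      have "inv (a \<otimes> h) \<otimes> a = inv h" using a h by (simp add: inv_mult_group m_assoc)
      then show "ract L (a \<otimes> h) * (U * ract M (inv (a \<otimes> h) \<otimes> a)) = ract L a * (ract L h * (U * ract M (inv h)))"
        using a h by (simp add: dL(2,3) dM(2,3) l(5-12) mat_assoc flip: dL(5))
    qed
    also have "\<dots> = ract L a * msum (rdim L) (rdim M) (\<lambda>h. ract L h * (U * ract M (inv h))) (carrier G)"
      by (subst msum_mult_left) (use a in \<open>auto simp: dL dM l(5-12)\<close>)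
    finally show "S' * ract M a = ract L a * S'"
      using a by (simp add: S'_def mat_smult_left mat_smult_right dL dM)
  qed (use dS' in auto)
  have S'S: "S' * S = 1\<^sub>m (rdim L)"
  proof -
    have "msum (rdim L) (rdim M) (\<lambda>h. ract L h * (U * ract M (inv h))) (carrier G) * S =
      msum (rdim L) (rdim L) (\<lambda>h. 1\<^sub>m (rdim L)) (carrier G)"
    proof (subst msum_mult_right)
      show "msum (rdim L) (dim_col S) (\<lambda>h. ract L h * (U * ract M (inv h)) * S) (carrier G) = msum (rdim L) (rdim L) (\<lambda>h. 1\<^sub>m (rdim L)) (carrier G)"
        unfolding l(6)
      proof (rule msum_cong[OF refl])
        fix h assume h: "h \<in> carrier G"
        have "ract M (inv h) * S = S * ract L (inv h)" using Hom_modD(4)[OF S, of "inv h"] h by simp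
        then have "ract L h * (U * ract M (inv h)) * S = ract L h * ract L (inv h)"
          using h by (simp add: mat_assoc dL(2,3) dM(2,3) l(5-12) mat_absorb[OF l(13)])
        then show "ract L h * (U * ract M (inv h)) * S = 1\<^sub>m (rdim L)" using h by (simp add: dL)
      qed
    qed (use l in \<open>auto simp: dL dM\<close>)
    then show ?thesis using n by (simp add: S'_def mat_smult_left l(5-12) msum_const[of _ "rdim L" "rdim L"] mat_smult_smult) (auto intro!: eq_matI)
  qed
  \<comment> \<open>The component of \<open>T'\<close> along \<open>S\<close> is removed, so that
    \<open>S' * W = 0\<close> while \<open>T * W\<close> stays the identity.\<close>
  define W where "W = T' - S * (S' * T')"
  note d = l(5-12) dS'
  have c: "W \<in> carrier_mat (rdim M) (rdim N)" using d by (auto simp: W_def)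
  have TW: "T * W = 1\<^sub>m (rdim N)"
    unfolding W_def using d by (simp add: mat_diff_distrib_left l(14) mat_absorb[OF l(15)] mat_zero_simps)
  have S'W: "S' * W = 0\<^sub>m (rdim L) (rdim N)"
    unfolding W_def using d by (simp add: mat_diff_distrib_left mat_absorb[OF S'S] mat_diff_self)
  have SU: "T' * T = 1\<^sub>m (rdim M) - S * U"
  proof -
    have "T' * T = (S * U + T' * T) - S * U" using d by (intro eq_matI) auto
    then show ?thesis unfolding l(17) .
  qed
  have "S * S' + W * T = S * S' + (T' * T - S * (S' * (T' * T)))"
    unfolding W_def using d by (simp add: mat_diff_distrib_right mat_assoc)
  also have "S * (S' * (T' * T)) = S * S' - S * U"
    unfolding SU using d by (simp add: mat_diff_distrib_left mat_absorb[OF S'S])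
  also have "S * S' + (T' * T - (S * S' - S * U)) = S * U + T' * T" using d by (intro eq_matI) auto
  finally have sum: "S * S' + W * T = 1\<^sub>m (rdim M)" unfolding l(17) .
  have "lin_split (rdim L) (rdim M) (rdim N) S S' T W"
    unfolding lin_split_def using l dS' c S'S TW S'W sum by auto
  from lin_split_fourth_hom[OF mods S hom T this] show thesis by (rule that)
qed

lemma dim_Hom_zero_iff:
  assumes "is_module KG M" "is_module KG N"
  shows "dim_Hom KG M N = 0 \<longleftrightarrow> Hom_mod KG M N = {0\<^sub>m (rdim N) (rdim M)}"
proof -
  have s: "mat_subspace (rdim N) (rdim M) (Hom_mod KG M N)"
    by (rule Hom_subspace) (use assms in \<open>auto intro: rep_dims_module\<close>)
  then have z: "0\<^sub>m (rdim N) (rdim M) \<in> Hom_mod KG M N" by (simp add: mat_subspace_def)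
  show ?thesis
  proof
    assume 0: "dim_Hom KG M N = 0"
    have "x = 0\<^sub>m (rdim N) (rdim M)" if "x \<in> Hom_mod KG M N" for x
      using mat_dim_pos[OF s that] 0 unfolding dim_Hom_def by blast
    then show "Hom_mod KG M N = {0\<^sub>m (rdim N) (rdim M)}" using z by blast
  next
    assume "Hom_mod KG M N = {0\<^sub>m (rdim N) (rdim M)}"
    then show "dim_Hom KG M N = 0" by (simp add: dim_Hom_def mat_dim_zero)
  qed
qed

lemma dim_Hom_KG_exact:
  fixes L M N :: "('a, 'k::field_char_0) rep"
  assumes mods: "is_module KG L" "is_module KG M" "is_module KG N" and e: "short_exact KG L M N" and P: "rep_dims KG P"
  shows "dim_Hom KG M P = dim_Hom KG L P + dim_Hom KG N P"
proof -
  obtain S S' T T' where "mod_split KG L M N S S' T T'" by (rule short_exactE[OF e]) (rule maschke[OF mods])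
  then show ?thesis
    using dim_Hom_exact(2)[OF mods[THEN rep_dims_module] P] unfolding mod_split_def by blast
qed

text \<open>Induction by cancelling a common summand. If \<open>M\<close> is nonzero, so is
  \<open>Hom(M, M)\<close>, hence \<open>Hom(N, M)\<close>; by semisimplicity the image of a nonzero
  map is a summand of both modules, and the complements again have equal Hom dimensions.\<close>

lemma iso_of_dim_Hom:
  fixes M N :: "('a, 'k::field_char_0) rep"
  assumes "is_module KG M" "is_module KG N"
    and "\<And>W. is_module KG W \<Longrightarrow> dim_Hom KG M W = dim_Hom KG N W"
  shows "iso_mod KG M N"
  using assms
proof (induction "rdim M" arbitrary: M N rule: less_induct)
  case less
  note M = less.prems(1) and N = less.prems(2) and eq = less.prems(3)
  show ?case
  proof (cases "rdim M = 0")
    \<comment> \<open>With \<open>M\<close> zero the hypothesis for the test module \<open>N\<close>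
      makes \<open>Hom(N, N)\<close> zero, so the identity of \<open>N\<close> is zero.\<close>
    case True
    have "x = 0\<^sub>m (rdim N) (rdim M)" if "x \<in> Hom_mod KG M N" for x
      using Hom_modD(1)[OF that] True by (auto intro!: eq_matI)
    then have "Hom_mod KG M N = {0\<^sub>m (rdim N) (rdim M)}" using Hom_mod_zero[OF M N] by blast
    then have "dim_Hom KG N N = 0" using dim_Hom_zero_iff[OF M N] eq[OF N] by simp
    then have "1\<^sub>m (rdim N) = (0\<^sub>m (rdim N) (rdim N) :: 'k mat)" using dim_Hom_zero_iff[OF N N] Hom_mod_one[OF N] by auto
    then have N0: "rdim N = 0" by (simp add: one_mat_eq_zero_iff)
    have "0\<^sub>m 0 0 \<in> Hom_mod KG M N" "0\<^sub>m 0 0 \<in> Hom_mod KG N M"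
      using Hom_mod_zero[OF M N] Hom_mod_zero[OF N M] True N0 by auto
    moreover have "0\<^sub>m 0 0 * 0\<^sub>m 0 0 = (1\<^sub>m 0 :: 'k mat)" by (intro eq_matI) auto
    ultimately show ?thesis unfolding iso_mod_def True N0 by blast
  next
    \<comment> \<open>The hypothesis is now used for the test module \<open>M\<close>.\<close>
    case False
    then have "1\<^sub>m (rdim M) \<noteq> (0\<^sub>m (rdim M) (rdim M) :: 'k mat)" by (simp add: one_mat_eq_zero_iff)
    then have "dim_Hom KG M M \<noteq> 0" using dim_Hom_zero_iff[OF M M] Hom_mod_one[OF M] by auto
    then have ne: "Hom_mod KG N M \<noteq> {0\<^sub>m (rdim M) (rdim N)}" using eq[OF M] dim_Hom_zero_iff[OF N M] by simp
    have "\<exists>T\<in>Hom_mod KG N M. T \<noteq> 0\<^sub>m (rdim M) (rdim N)"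
    proof (rule ccontr)
      assume "\<not> ?thesis"
      then have "Hom_mod KG N M \<subseteq> {0\<^sub>m (rdim M) (rdim N)}" by auto
      then show False using ne Hom_mod_zero[OF N M] by auto
    qed
    then obtain T where T: "T \<in> Hom_mod KG N M" "T \<noteq> 0\<^sub>m (rdim M) (rdim N)" by auto
    obtain I K K' where I: "is_module KG I" "rdim I \<noteq> 0" and K: "is_module KG K" "is_module KG K'"
      and e: "short_exact KG I M K" "short_exact KG K' N I"
      by (rule image_module[OF N M T])
    have dK: "dim_Hom KG K W = dim_Hom KG K' W" if W: "is_module KG W" for W
      using eq[OF W] dim_Hom_KG_exact[OF I(1) M K(1) e(1) rep_dims_module[OF W]]
        dim_Hom_KG_exact[OF K(2) N I(1) e(2) rep_dims_module[OF W]] by simp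
    obtain S S' U U' where s: "mod_split KG I M K S S' U U'" by (rule short_exactE[OF e(1)]) (rule maschke[OF I(1) M K(1)])
    obtain P P' Q Q' where p: "mod_split KG K' N I P P' Q Q'" by (rule short_exactE[OF e(2)]) (rule maschke[OF K(2) N I(1)])
    have p': "mod_split KG I N K' Q' Q P' P" using p lin_split_sym unfolding mod_split_def by blast
    have "rdim K < rdim M" using s lin_split_dim I(2) unfolding mod_split_def by fastforce
    then have KK: "iso_mod KG K K'" using less.hyps K dK by blast
    note DM = is_module_dsum[OF I(1) K(1)] and DN = is_module_dsum[OF I(1) K(2)]
    have "iso_mod KG M (dsum_mod I K)" by (rule mod_split_iso_dsum[OF I(1) M K(1) s])
    moreover have "iso_mod KG (dsum_mod I K) (dsum_mod I K')"
      by (rule iso_mod_dsum[OF I(1) I(1) K iso_mod_refl[OF I(1)] KK])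
    moreover have "iso_mod KG (dsum_mod I K') N"
      by (rule iso_mod_sym, rule mod_split_iso_dsum[OF I(1) N K(2) p'])
    ultimately show ?thesis using iso_mod_trans M N DM DN by blast
  qed
qed

lemma KG_exact_subset_split: "exact_relations (KG :: ('a, 'k::field_char_0) hopf_data) \<subseteq> split_relations KG"
proof
  let ?A = "KG :: ('a, 'k) hopf_data"
  fix f assume "f \<in> exact_relations ?A"
  then show "f \<in> split_relations ?A" unfolding exact_relations_def using KG.exact_gens_carrier
  proof (induction f rule: KG.generate_induct)
    case (gen y)
    then obtain L M N where m: "is_module ?A L" "is_module ?A M" "is_module ?A N" and e: "short_exact ?A L M N"
      and y: "y = frag_of (iso_class ?A M) - frag_of (iso_class ?A L) - frag_of (iso_class ?A N)" by auto
    obtain S S' T T' where "mod_split ?A L M N S S' T T'" by (rule short_exactE[OF e]) (rule maschke[OF m])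
    from KG.split_relation[OF m(1,3,2) mod_split_iso_dsum[OF m this]] show ?case unfolding y .
  qed (simp_all add: KG.split_closed)
qed

end

declare One_nat_def [simp del]

section \<open>Powers of matrices and the action of arbitrary elements\<close>

lemma mat_smult_one: "1 \<cdot>\<^sub>m A = (A :: 'a::semiring_1 mat)"
  by (rule eq_matI) auto

text \<open>New factors enter on the left, in step with the recursion of
  \<open>pow_elt\<close>.\<close>

primrec mat_lpow :: "'a::semiring_1 mat \<Rightarrow> nat \<Rightarrow> 'a mat" where
  "mat_lpow A 0 = 1\<^sub>m (dim_row A)"
| "mat_lpow A (Suc k) = A * mat_lpow A k"

lemma mat_lpow_dim [simp]: "dim_row (mat_lpow A k) = dim_row A" "dim_row A = dim_col A \<Longrightarrow> dim_col (mat_lpow A k) = dim_row A"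
  by (induction k) auto

lemma mat_lpow_one [simp]: "dim_row A = dim_col A \<Longrightarrow> mat_lpow A 1 = A"
  by (simp add: One_nat_def)

lemma mat_lpow_comm: "dim_row A = dim_col A \<Longrightarrow> mat_lpow A k * A = A * mat_lpow A k"
  by (induction k) (auto simp: mat_assoc)

lemma mat_lpow_add: "dim_row A = dim_col A \<Longrightarrow> mat_lpow A (j + k) = mat_lpow A j * mat_lpow A k"
  by (induction j) (auto simp: mat_assoc)

lemma mat_lpow_intertwine:
  assumes "T * A = B * T" "dim_row A = dim_col A" "dim_row B = dim_col B" "dim_col T = dim_row A" "dim_row T = dim_row B"
  shows "T * mat_lpow A k = mat_lpow B k * T"
proof (induction k)
  case (Suc k)
  have "T * mat_lpow A (Suc k) = B * (T * mat_lpow A k)" using assms by (simp add: mat_absorb[OF assms(1)] mat_assoc)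
  also have "\<dots> = mat_lpow B (Suc k) * T" using assms by (simp add: Suc mat_assoc)
  finally show ?case .
qed (use assms in auto)

lemma act_elt_index: "i < rdim M \<Longrightarrow> j < rdim M \<Longrightarrow> act_elt A M x $$ (i, j) = (\<Sum>b\<in>hbasis A. x b * ract M b $$ (i, j))"
  by (simp add: act_elt_def)

lemma act_elt_diff: "act_elt A M (\<lambda>b. x b - z b) = act_elt A M x - act_elt A M z"
  by (rule eq_matI) (auto simp: act_elt_index left_diff_distrib sum_subtractf)

lemma act_elt_smult: "act_elt A M (\<lambda>b. c * x b) = c \<cdot>\<^sub>m act_elt A M x"
  by (rule eq_matI) (auto simp: act_elt_index sum_distrib_left mult.assoc)

lemma act_elt_prod:
  assumes "rep_dims A M"
  shows "act_elt A M (prod_elt A x z) = msum (rdim M) (rdim M) (\<lambda>a. msum (rdim M) (rdim M)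
    (\<lambda>b. (x a * z b) \<cdot>\<^sub>m act_elt A M (hmult A a b)) (hbasis A)) (hbasis A)"
proof (rule eq_matI)
  let ?H = "hbasis A"
  fix i j assume "i < dim_row (msum (rdim M) (rdim M) (\<lambda>a. msum (rdim M) (rdim M)
    (\<lambda>b. (x a * z b) \<cdot>\<^sub>m act_elt A M (hmult A a b)) ?H) ?H)"
    "j < dim_col (msum (rdim M) (rdim M) (\<lambda>a. msum (rdim M) (rdim M)
    (\<lambda>b. (x a * z b) \<cdot>\<^sub>m act_elt A M (hmult A a b)) ?H) ?H)"
  then have ij: "i < rdim M" "j < rdim M" by auto
  let ?m = "\<lambda>c. ract M c $$ (i, j)"
  have "act_elt A M (prod_elt A x z) $$ (i, j) = (\<Sum>c\<in>?H. \<Sum>a\<in>?H. \<Sum>b\<in>?H. x a * z b * (hmult A a b c * ?m c))"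
    using ij by (simp add: act_elt_index prod_elt_def sum_distrib_right mult.assoc)
  also have "\<dots> = (\<Sum>a\<in>?H. \<Sum>c\<in>?H. \<Sum>b\<in>?H. x a * z b * (hmult A a b c * ?m c))" by (rule sum.swap)
  also have "\<dots> = (\<Sum>a\<in>?H. \<Sum>b\<in>?H. \<Sum>c\<in>?H. x a * z b * (hmult A a b c * ?m c))"
    by (rule sum.cong[OF refl], rule sum.swap)
  also have "\<dots> = msum (rdim M) (rdim M) (\<lambda>a. msum (rdim M) (rdim M)
    (\<lambda>b. (x a * z b) \<cdot>\<^sub>m act_elt A M (hmult A a b)) ?H) ?H $$ (i, j)"
    using ij by (simp add: act_elt_index sum_distrib_left)
  finally show "act_elt A M (prod_elt A x z) $$ (i, j) = msum (rdim M) (rdim M) (\<lambda>a. msum (rdim M) (rdim M)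
    (\<lambda>b. (x a * z b) \<cdot>\<^sub>m act_elt A M (hmult A a b)) ?H) ?H $$ (i, j)" .
qed auto

lemma act_elt_mult_expand:
  assumes "rep_dims A M"
  shows "act_elt A M x * act_elt A M z = msum (rdim M) (rdim M) (\<lambda>a. msum (rdim M) (rdim M)
    (\<lambda>b. (x a * z b) \<cdot>\<^sub>m (ract M a * ract M b)) (hbasis A)) (hbasis A)"
proof -
  let ?d = "rdim M" and ?H = "hbasis A"
  note d = rep_dims_dim[OF assms] and c = assms[unfolded rep_dims_def, rule_format]
  have "act_elt A M x * act_elt A M z = msum ?d ?d (\<lambda>a. (x a \<cdot>\<^sub>m ract M a) * act_elt A M z) ?H"
    by (subst act_elt_msum[OF c, where x = x], assumption, subst msum_mult_right) (auto simp: d c)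
  also have "\<dots> = msum ?d ?d (\<lambda>a. msum ?d ?d (\<lambda>b. (x a * z b) \<cdot>\<^sub>m (ract M a * ract M b)) ?H) ?H"
  proof (rule msum_cong[OF refl])
    fix a assume a: "a \<in> ?H"
    show "(x a \<cdot>\<^sub>m ract M a) * act_elt A M z = msum ?d ?d (\<lambda>b. (x a * z b) \<cdot>\<^sub>m (ract M a * ract M b)) ?H"
      by (subst act_elt_msum[OF c], assumption, subst msum_mult_left)
        (auto simp: a d c mat_smult_left mat_smult_right mat_smult_smult mult.commute intro!: msum_cong)
  qed
  finally show ?thesis .
qed

lemma act_elt_mult:
  assumes M: "is_module A M"
  shows "act_elt A M (prod_elt A x z) = act_elt A M x * act_elt A M z"
  unfolding act_elt_prod[OF rep_dims_module[OF M]] act_elt_mult_expand[OF rep_dims_module[OF M]]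
  by (intro msum_cong refl) (use M in \<open>simp add: is_module_def\<close>)

lemma prod_elt_smult: "prod_elt A (\<lambda>b. c * x b) z = (\<lambda>b. c * prod_elt A x z b)"
    "prod_elt A x (\<lambda>b. c * z b) = (\<lambda>b. c * prod_elt A x z b)"
  by (auto simp: prod_elt_def sum_distrib_left mult_ac)

lemma prod_elt_diff: "prod_elt A (\<lambda>b. x b - x' b) z = (\<lambda>b. prod_elt A x z b - prod_elt A x' z b)"
  by (auto simp: prod_elt_def left_diff_distrib sum_subtractf)

context hopf_algebra
begin

lemma prod_elt_assoc: "prod_elt A (prod_elt A x z) w = prod_elt A x (prod_elt A z w)"
proof
  fix d
  let ?H = "hbasis A"
  have as: "(\<Sum>e\<in>?H. hmult A a b e * hmult A e c d) = (\<Sum>e\<in>?H. hmult A b c e * hmult A a e d)"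
    if "a \<in> ?H" "b \<in> ?H" "c \<in> ?H" for a b c
  proof -
    have "prod_elt A (hmult A a b) (bvec c) d = (\<Sum>e\<in>?H. hmult A a b e * hmult A e c d)"
      unfolding prod_elt_def using that(3) finite_basis
      by (intro sum.cong refl) (simp add: bvec_def if_distrib[of "\<lambda>x. _ * x * _"] if_distrib[of "\<lambda>x. x * _"] if_distrib[of "\<lambda>x. _ * x"] cong: if_cong)
    moreover have "prod_elt A (bvec a) (hmult A b c) d = (\<Sum>x\<in>?H. bvec a x * (\<Sum>e\<in>?H. hmult A b c e * hmult A x e d))"
      unfolding prod_elt_def by (simp add: sum_distrib_left mult.assoc)
    moreover have "(\<Sum>x\<in>?H. bvec a x * (\<Sum>e\<in>?H. hmult A b c e * hmult A x e d)) = (\<Sum>e\<in>?H. hmult A b c e * hmult A a e d)"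
      by (rule sum_bvec(1)[OF finite_basis that(1)])
    ultimately show ?thesis using fun_cong[OF mult_assoc[OF that], of d] by (simp only:)
  qed
  have r: "(\<Sum>e\<in>?H. \<Sum>c\<in>?H. \<Sum>a\<in>?H. \<Sum>b\<in>?H. f e c a b) = (\<Sum>a\<in>?H. \<Sum>b\<in>?H. \<Sum>c\<in>?H. \<Sum>e\<in>?H. f e c a b)"
    for f :: "'b \<Rightarrow> 'b \<Rightarrow> 'b \<Rightarrow> 'b \<Rightarrow> 'k"
    by (simp add: sum.cartesian_product)
      (rule sum.reindex_bij_witness[where i = "\<lambda>(a, b, c, e). (e, c, a, b)" and j = "\<lambda>(e, c, a, b). (a, b, c, e)"]; auto)
  have r': "(\<Sum>a\<in>?H. \<Sum>e\<in>?H. \<Sum>b\<in>?H. \<Sum>c\<in>?H. f e c a b) = (\<Sum>a\<in>?H. \<Sum>b\<in>?H. \<Sum>c\<in>?H. \<Sum>e\<in>?H. f e c a b)"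
    for f :: "'b \<Rightarrow> 'b \<Rightarrow> 'b \<Rightarrow> 'b \<Rightarrow> 'k"
    by (simp add: sum.cartesian_product)
      (rule sum.reindex_bij_witness[where i = "\<lambda>(a, b, c, e). (a, e, b, c)" and j = "\<lambda>(a, e, b, c). (a, b, c, e)"]; auto)
  have "prod_elt A (prod_elt A x z) w d = (\<Sum>e\<in>?H. \<Sum>c\<in>?H. \<Sum>a\<in>?H. \<Sum>b\<in>?H. x a * z b * w c * (hmult A a b e * hmult A e c d))"
    by (simp add: prod_elt_def sum_distrib_left sum_distrib_right mult_ac)
  also have "\<dots> = (\<Sum>a\<in>?H. \<Sum>b\<in>?H. \<Sum>c\<in>?H. x a * z b * w c * (\<Sum>e\<in>?H. hmult A a b e * hmult A e c d))"
    by (simp only: sum_distrib_left) (rule r)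
  also have "\<dots> = (\<Sum>a\<in>?H. \<Sum>b\<in>?H. \<Sum>c\<in>?H. x a * z b * w c * (\<Sum>e\<in>?H. hmult A b c e * hmult A a e d))"
    by (intro sum.cong refl) (simp only: as)
  also have "\<dots> = (\<Sum>a\<in>?H. \<Sum>e\<in>?H. \<Sum>b\<in>?H. \<Sum>c\<in>?H. x a * z b * w c * (hmult A b c e * hmult A a e d))"
    by (simp only: sum_distrib_left) (rule r'[symmetric])
  also have "\<dots> = prod_elt A x (prod_elt A z w) d"
    by (simp add: prod_elt_def sum_distrib_left sum_distrib_right mult_ac)
  finally show "prod_elt A (prod_elt A x z) w d = prod_elt A x (prod_elt A z w) d" .
qed

text \<open>By linearity in the right factor, an element acts multiplicatively as soon as it does so
  against basis vectors. This is how the module axioms are transferred from generators in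
  \<open>is_module_y_mod\<close>.\<close>

lemma act_elt_mult_by_basis:
  assumes M: "rep_dims A M" and b: "\<And>b. b \<in> hbasis A \<Longrightarrow> act_elt A M (prod_elt A x (bvec b)) = act_elt A M x * ract M b"
  shows "act_elt A M (prod_elt A x z) = act_elt A M x * act_elt A M z"
proof -
  let ?d = "rdim M" and ?H = "hbasis A"
  note c = M[unfolded rep_dims_def, rule_format]
  have "act_elt A M x * act_elt A M z = msum ?d ?d (\<lambda>b. z b \<cdot>\<^sub>m act_elt A M (prod_elt A x (bvec b))) ?H"
    by (subst act_elt_msum[OF c, where x = z], assumption, subst msum_mult_left)
      (auto simp: c rep_dims_dim[OF M] b mat_smult_right intro!: msum_cong)
  also have "\<dots> = act_elt A M (prod_elt A x z)"
  proof (rule eq_matI)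
    fix i j assume "i < dim_row (act_elt A M (prod_elt A x z))" "j < dim_col (act_elt A M (prod_elt A x z))"
    then have ij: "i < ?d" "j < ?d" by auto
    have px: "prod_elt A x z e = (\<Sum>b\<in>?H. z b * prod_elt A x (bvec b) e)" for e
    proof -
      have "(\<Sum>b\<in>?H. z b * prod_elt A x (bvec b) e) = (\<Sum>b\<in>?H. \<Sum>a\<in>?H. \<Sum>c\<in>?H. z b * (x a * bvec b c * hmult A a c e))"
        by (simp add: prod_elt_def sum_distrib_left)
      also have "\<dots> = (\<Sum>a\<in>?H. \<Sum>b\<in>?H. \<Sum>c\<in>?H. z b * (x a * bvec b c * hmult A a c e))" by (rule sum.swap)
      also have "\<dots> = (\<Sum>a\<in>?H. \<Sum>b\<in>?H. \<Sum>c\<in>?H. bvec b c * (z b * x a * hmult A a c e))" by (simp add: mult_ac)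
      also have "\<dots> = (\<Sum>a\<in>?H. \<Sum>b\<in>?H. z b * x a * hmult A a b e)"
        by (intro sum.cong refl) (simp add: sum_bvec(1)[OF finite_basis])
      finally show ?thesis by (simp add: prod_elt_def mult_ac)
    qed
    have "msum ?d ?d (\<lambda>b. z b \<cdot>\<^sub>m act_elt A M (prod_elt A x (bvec b))) ?H $$ (i, j) =
      (\<Sum>b\<in>?H. \<Sum>e\<in>?H. z b * prod_elt A x (bvec b) e * ract M e $$ (i, j))"
      using ij by (simp add: act_elt_index sum_distrib_left mult.assoc)
    also have "\<dots> = (\<Sum>e\<in>?H. \<Sum>b\<in>?H. z b * prod_elt A x (bvec b) e * ract M e $$ (i, j))" by (rule sum.swap)
    also have "\<dots> = act_elt A M (prod_elt A x z) $$ (i, j)"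
      using ij by (simp add: act_elt_index px sum_distrib_right)
    finally show "msum ?d ?d (\<lambda>b. z b \<cdot>\<^sub>m act_elt A M (prod_elt A x (bvec b))) ?H $$ (i, j) = act_elt A M (prod_elt A x z) $$ (i, j)" .
  qed auto
  finally show ?thesis by simp
qed

end

sublocale group_datum \<subseteq> fin_group G
  by (intro fin_group.intro fin_group_axioms.intro group_G finite_G)

section \<open>Restriction to the group algebra\<close>

definition res_mod :: "(nat \<times> 'g, 'k) rep \<Rightarrow> ('g, 'k) rep" where
  "res_mod M = \<lparr>rdim = rdim M, ract = (\<lambda>h. ract M (0, h))\<rparr>"

lemma res_mod_simps [simp]: "rdim (res_mod M) = rdim M" "ract (res_mod M) h = ract M (0, h)"
  by (simp_all add: res_mod_def)

text \<open>A module over \<open>H\<close> is given by its restriction \<open>W\<close> and the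
  matrix \<open>Y\<close> of \<open>y\<close>. The exponent 0 is treated apart so that
  \<open>res_mod\<close> returns \<open>W\<close> literally, also at indices outside the
  group.\<close>

definition y_mod :: "('g, 'k::field) rep \<Rightarrow> 'k mat \<Rightarrow> (nat \<times> 'g, 'k) rep" where
  "y_mod W Y = \<lparr>rdim = rdim W, ract = (\<lambda>(i, h). if i = 0 then ract W h else mat_lpow Y i * ract W h)\<rparr>"

lemma y_mod_rdim [simp]: "rdim (y_mod W Y) = rdim W"
  by (simp add: y_mod_def)

lemma res_y_mod [simp]: "res_mod (y_mod W Y) = W"
  by (simp add: res_mod_def y_mod_def)

lemma (in group_datum) char_nonzero: "h \<in> carrier G \<Longrightarrow> \<chi> h \<noteq> 0"
  using char_pow_n n_ge_2 by (metis not_numeral_le_zero power_0_left zero_neq_one)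

section \<open>Modules over the Hopf algebra as group modules with an operator for
  \<open>y\<close>\<close>

context group_datum_hopf
begin

abbreviation "ya M \<equiv> ract M (1, \<one>)"

lemma basis_mem: "(i, h) \<in> hbasis H \<longleftrightarrow> i < n \<and> h \<in> carrier G"
  by (auto simp: basis_H)

lemma gen_mem [simp]: "(1, \<one>) \<in> hbasis H" "h \<in> carrier G \<Longrightarrow> (0, h) \<in> hbasis H"
  using n_ge_2 by (auto simp: basis_H)

lemma H_module_dims:
  assumes "is_module H M"
  shows "dim_row (ya M) = rdim M" "dim_col (ya M) = rdim M"
    "h \<in> carrier G \<Longrightarrow> dim_row (ract M (0, h)) = rdim M" "h \<in> carrier G \<Longrightarrow> dim_col (ract M (0, h)) = rdim M"
  using assms by (simp_all add: is_module_dim)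

lemma H_module_act_bvec: "is_module H M \<Longrightarrow> a \<in> hbasis H \<Longrightarrow> act_elt H M (bvec a) = ract M a"
  by (rule act_elt_bvec[OF finite_basis]) (auto dest: is_module_carrier)

lemma H_module_one: "is_module H M \<Longrightarrow> ract M (0, \<one>) = 1\<^sub>m (rdim M)"
  using H_module_act_bvec[of M "(0, \<one>)"] emb_one by (simp add: is_module_def)

lemma H_module_res:
  assumes M: "is_module H M" shows "is_module KG (res_mod M)"
  unfolding is_module_KG
proof (intro conjI ballI)
  show "ract (res_mod M) \<one> = 1\<^sub>m (rdim (res_mod M))" using H_module_one[OF M] by simp
  fix a b assume a: "a \<in> carrier G" and b: "b \<in> carrier G"
  show "ract (res_mod M) (a \<otimes> b) = ract (res_mod M) a * ract (res_mod M) b"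
    using act_elt_mult[OF M, of "emb a" "emb b"] a b
    by (simp add: emb_mult H_module_act_bvec[OF M])
qed (use M is_module_carrier in force)

lemma H_module_pow:
  assumes M: "is_module H M" shows "act_elt H M (pow_elt H (gen_y G) i) = mat_lpow (ya M) i"
proof (induction i)
  case 0
  then show ?case using M by (simp add: is_module_def is_module_dim)
next
  case (Suc i)
  then show ?case by (simp add: act_elt_mult[OF M] H_module_act_bvec[OF M])
qed

lemma H_module_act:
  assumes M: "is_module H M" and "i < n" "h \<in> carrier G"
  shows "ract M (i, h) = mat_lpow (ya M) i * ract M (0, h)"
  using H_module_act_bvec[OF M, of "(i, h)"] assms(2,3)
  by (simp add: basis_vec[OF assms(2,3)] act_elt_mult[OF M] H_module_pow[OF M] H_module_act_bvec[OF M] basis_mem)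

lemma H_module_commute:
  assumes M: "is_module H M" and h: "h \<in> carrier G"
  shows "ya M * ract M (0, h) = \<chi> h \<cdot>\<^sub>m (ract M (0, h) * ya M)"
  using arg_cong[OF rel_commute[OF h], of "act_elt H M"] h
  by (simp add: act_elt_smult act_elt_mult[OF M] H_module_act_bvec[OF M])

lemma H_module_pow_n:
  assumes M: "is_module H M"
  shows "mat_lpow (ya M) n = ract M (0, g [^] n) - 1\<^sub>m (rdim M)"
  using H_module_pow[OF M, of n] M g_closed
  by (simp add: rel_power act_elt_diff H_module_act_bvec[OF M] is_module_def)

lemma emb_pow_commute:
  assumes h: "h \<in> carrier G"
  shows "prod_elt H (emb h) (pow_elt H (gen_y G) j) = (\<lambda>b. inverse (\<chi> h) ^ j * prod_elt H (pow_elt H (gen_y G) j) (emb h) b)"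
proof (induction j)
  case 0
  then show ?case using h unit_left[of "(0, h)"] unit_right[of "(0, h)"] by simp
next
  case (Suc j)
  have c: "prod_elt H (emb h) (gen_y G) = (\<lambda>b. inverse (\<chi> h) * prod_elt H (gen_y G) (emb h) b)"
    using rel_commute[OF h] char_nonzero[OF h] by (auto simp: fun_eq_iff)
  have "prod_elt H (emb h) (pow_elt H (gen_y G) (Suc j)) = prod_elt H (prod_elt H (emb h) (gen_y G)) (pow_elt H (gen_y G) j)"
    by (simp add: prod_elt_assoc)
  also have "\<dots> = (\<lambda>b. inverse (\<chi> h) * prod_elt H (gen_y G) (prod_elt H (emb h) (pow_elt H (gen_y G) j)) b)"
    by (simp add: c prod_elt_smult prod_elt_assoc)
  also have "\<dots> = (\<lambda>b. inverse (\<chi> h) ^ Suc j * prod_elt H (pow_elt H (gen_y G) (Suc j)) (emb h) b)"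
    by (simp add: Suc prod_elt_smult prod_elt_assoc mult.assoc)
  finally show ?case .
qed

text \<open>The generators and relations of \<open>H\<close> are enough: left multiplication by
  \<open>y\<close> and by a group element is followed on the basis \<open>y^j h\<close>, and then
  composed to left multiplication by every basis vector.\<close>

lemma is_module_y_mod:
  assumes W: "is_module KG W" and Y: "Y \<in> carrier_mat (rdim W) (rdim W)"
    and comm: "\<And>h. h \<in> carrier G \<Longrightarrow> Y * ract W h = \<chi> h \<cdot>\<^sub>m (ract W h * Y)"
    and pow: "mat_lpow Y n = ract W (g [^] n) - 1\<^sub>m (rdim W)"
  shows "is_module H (y_mod W Y)" "ya (y_mod W Y) = Y"
proof -
  let ?M = "y_mod W Y"
  note dW = KG_moduleD[OF W]
  have dY: "dim_row Y = rdim W" "dim_col Y = rdim W" using Y by auto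
  have act: "ract ?M (i, h) = mat_lpow Y i * ract W h" if "h \<in> carrier G" for i h
    using that by (simp add: y_mod_def dY dW)
  have ya: "ya ?M = Y" using act[of \<one> 1] dW(4) dY by simp
  then show "ya ?M = Y" .
  have dims: "rep_dims H ?M"
    unfolding rep_dims_def
  proof
    fix a assume "a \<in> hbasis H"
    then obtain i h where a: "a = (i, h)" "i < n" "h \<in> carrier G" by (auto simp: basis_H)
    then show "ract ?M a \<in> carrier_mat (rdim ?M) (rdim ?M)" by (intro carrier_matI) (simp_all add: act dY dW)
  qed
  note c = dims[unfolded rep_dims_def, rule_format]
  have b: "act_elt H ?M (bvec a) = ract ?M a" if "a \<in> hbasis H" for a
    by (rule act_elt_bvec[OF finite_basis that c[OF that]])
  have emb: "act_elt H ?M (emb h) = ract W h" if "h \<in> carrier G" for h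
    using b[of "(0, h)"] that by (simp add: act dY dW)
  have one: "act_elt H ?M (hunit H) = 1\<^sub>m (rdim W)" using emb[of \<one>] dW(4) by (simp add: emb_one)
  have ey: "act_elt H ?M (gen_y G) = Y" using b[of "(1, \<one>)"] ya by simp
  have commj: "ract W h * mat_lpow Y j = inverse (\<chi> h) ^ j \<cdot>\<^sub>m (mat_lpow Y j * ract W h)" if h: "h \<in> carrier G" for h j
  proof (induction j)
    case 0
    then show ?case using h by (auto simp: dY dW)
  next
    case (Suc j)
    have hY: "ract W h * Y = inverse (\<chi> h) \<cdot>\<^sub>m (Y * ract W h)"
      using comm[OF h] char_nonzero[OF h] by (simp add: mat_smult_smult mat_smult_one)
    have "ract W h * mat_lpow Y (Suc j) = (inverse (\<chi> h) \<cdot>\<^sub>m (Y * ract W h)) * mat_lpow Y j"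
      using h by (simp add: dY dW mat_assoc flip: hY)
    also have "\<dots> = inverse (\<chi> h) \<cdot>\<^sub>m (Y * (inverse (\<chi> h) ^ j \<cdot>\<^sub>m (mat_lpow Y j * ract W h)))"
      using h by (simp add: dY dW mat_assoc mat_smult_left Suc)
    also have "\<dots> = inverse (\<chi> h) ^ Suc j \<cdot>\<^sub>m (mat_lpow Y (Suc j) * ract W h)"
      using h by (simp add: dY dW mat_assoc mat_smult_right mat_smult_smult)
    finally show ?case .
  qed
  have "act_elt H ?M (prod_elt H (gen_y G) z) = act_elt H ?M (gen_y G) * act_elt H ?M z" for z
  proof (rule act_elt_mult_by_basis[OF dims])
    fix a assume "a \<in> hbasis H"
    then obtain j h where a: "a = (j, h)" "j < n" "h \<in> carrier G" by (auto simp: basis_H)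
    have p: "prod_elt H (gen_y G) (bvec a) = prod_elt H (pow_elt H (gen_y G) (Suc j)) (emb h)"
      unfolding a(1) basis_vec[OF a(2,3)] by (simp add: prod_elt_assoc)
    show "act_elt H ?M (prod_elt H (gen_y G) (bvec a)) = act_elt H ?M (gen_y G) * ract ?M a"
    proof (cases "Suc j < n")
      case True
      then have "prod_elt H (gen_y G) (bvec a) = bvec (Suc j, h)" unfolding p using basis_vec[OF True a(3)] by simp
      then show ?thesis using a True b[of "(Suc j, h)"]
        by (simp add: act ey basis_mem mat_assoc dY dW)
    next
      \<comment> \<open>Here multiplication by \<open>y\<close> leaves the range of exponents and
        \<open>y^n\<close> has to be replaced by \<open>g^n - 1\<close>.\<close>
      case False
      then have n: "Suc j = n" using a by simp
      have "prod_elt H (gen_y G) (bvec a) = (\<lambda>b. emb (g [^] n \<otimes> h) b - emb h b)"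
        unfolding p n rel_power using a(3) g_closed unit_left[of "(0, h)"] by (simp add: prod_elt_diff emb_mult)
      then have "act_elt H ?M (prod_elt H (gen_y G) (bvec a)) = ract W (g [^] n \<otimes> h) - ract W h"
        using a(3) g_closed by (simp add: act_elt_diff emb)
      also have "\<dots> = (ract W (g [^] n) - 1\<^sub>m (rdim W)) * ract W h"
        using a(3) g_closed by (simp add: mat_diff_distrib_right dW)
      also have "ract W (g [^] n) - 1\<^sub>m (rdim W) = Y * mat_lpow Y j"
        using pow unfolding n[symmetric] by simp
      also have "Y * mat_lpow Y j * ract W h = act_elt H ?M (gen_y G) * ract ?M a"
        using a(3) by (simp add: a(1) act ey mat_assoc dY dW)
      finally show ?thesis .
    qed
  qed
  then have good_y: "act_elt H ?M (prod_elt H (gen_y G) z) = Y * act_elt H ?M z" for z unfolding ey .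
  have "act_elt H ?M (prod_elt H (emb h) z) = act_elt H ?M (emb h) * act_elt H ?M z" if h: "h \<in> carrier G" for h z
  proof (rule act_elt_mult_by_basis[OF dims])
    fix a assume "a \<in> hbasis H"
    then obtain j k where a: "a = (j, k)" "j < n" "k \<in> carrier G" by (auto simp: basis_H)
    have "prod_elt H (emb h) (bvec a) = prod_elt H (prod_elt H (emb h) (pow_elt H (gen_y G) j)) (emb k)"
      unfolding a(1) basis_vec[OF a(2,3)] by (simp add: prod_elt_assoc)
    also have "\<dots> = (\<lambda>b. inverse (\<chi> h) ^ j * bvec (j, h \<otimes> k) b)"
      unfolding emb_pow_commute[OF h] using h a basis_vec[OF a(2), of "h \<otimes> k"] by (simp add: prod_elt_smult prod_elt_assoc emb_mult)
    finally have "act_elt H ?M (prod_elt H (emb h) (bvec a)) = inverse (\<chi> h) ^ j \<cdot>\<^sub>m ract ?M (j, h \<otimes> k)"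
      using h a b[of "(j, h \<otimes> k)"] by (simp add: act_elt_smult basis_mem)
    also have "\<dots> = (inverse (\<chi> h) ^ j \<cdot>\<^sub>m (mat_lpow Y j * ract W h)) * ract W k"
      using h a by (simp add: act dW(1-3) dY mat_smult_left mat_assoc flip: dW(5))
    also have "\<dots> = act_elt H ?M (emb h) * ract ?M a"
      using h a by (simp add: act emb[OF h] dW(1-3) dY mat_assoc flip: commj)
    finally show "act_elt H ?M (prod_elt H (emb h) (bvec a)) = act_elt H ?M (emb h) * ract ?M a" .
  qed
  then have good_h: "act_elt H ?M (prod_elt H (emb h) z) = ract W h * act_elt H ?M z" if h: "h \<in> carrier G" for h z
    using h by (simp add: emb)
  have good_pow: "act_elt H ?M (prod_elt H (pow_elt H (gen_y G) i) z) = mat_lpow Y i * act_elt H ?M z" for i z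
  proof (induction i arbitrary: z)
    case 0
    have "act_elt H ?M (prod_elt H (hunit H) z) = act_elt H ?M z"
      unfolding emb_one using good_h[of \<one> z] dW(4) by simp
    then show ?case by (simp add: dY)
  next
    case (Suc i)
    then show ?case by (simp add: prod_elt_assoc good_y mat_assoc dY)
  qed
  show "is_module H ?M"
    unfolding is_module_def
  proof (intro conjI ballI)
    show "act_elt H ?M (hunit H) = 1\<^sub>m (rdim ?M)" using one by simp
    fix a a' assume "a \<in> hbasis H" and a': "a' \<in> hbasis H"
    then obtain i h where a: "a = (i, h)" "i < n" "h \<in> carrier G" by (auto simp: basis_H)
    have "hmult H a a' = prod_elt H (prod_elt H (pow_elt H (gen_y G) i) (emb h)) (bvec a')"
      using prod_elt_bvec[OF finite_basis, of a a'] a a' basis_vec[OF a(2,3)] by (simp add: basis_mem)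
    also have "\<dots> = prod_elt H (pow_elt H (gen_y G) i) (prod_elt H (emb h) (bvec a'))" by (rule prod_elt_assoc)
    finally show "act_elt H ?M (hmult H a a') = ract ?M a * ract ?M a'"
      using a by (simp add: good_pow good_h act b[OF a'] mat_assoc dY dW rep_dims_dim[OF dims a'])
  qed (rule c)
qed

text \<open>Every basis vector is a power of \<open>y\<close> times a group element, so commuting
  with these generators suffices.\<close>

lemma Hom_H_iff:
  assumes M: "is_module H M" and N: "is_module H N"
  shows "T \<in> Hom_mod H M N \<longleftrightarrow> T \<in> Hom_mod KG (res_mod M) (res_mod N) \<and> T * ya M = ya N * T"
proof
  assume T: "T \<in> Hom_mod H M N"
  have "T \<in> Hom_mod KG (res_mod M) (res_mod N)"
    by (rule Hom_modI) (use Hom_modD(1)[OF T] Hom_modD(4)[OF T] in auto)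
  then show "T \<in> Hom_mod KG (res_mod M) (res_mod N) \<and> T * ya M = ya N * T"
    using Hom_modD(4)[OF T, of "(1, \<one>)"] by simp
next
  assume "T \<in> Hom_mod KG (res_mod M) (res_mod N) \<and> T * ya M = ya N * T"
  then have T: "T \<in> Hom_mod KG (res_mod M) (res_mod N)" and y: "T * ya M = ya N * T" by auto
  show "T \<in> Hom_mod H M N"
  proof (rule Hom_modI)
    show "T \<in> carrier_mat (rdim N) (rdim M)" using Hom_modD(1)[OF T] by simp
    fix a assume "a \<in> hbasis H"
    then obtain i h where a: "a = (i, h)" "i < n" "h \<in> carrier G" by (auto simp: basis_H)
    note d = H_module_dims[OF M] H_module_dims[OF N] Hom_modD(2,3)[OF T]
    have Th: "T * ract M (0, h) = ract N (0, h) * T" using Hom_modD(4)[OF T, of h] a by simp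
    have Ty: "T * mat_lpow (ya M) i = mat_lpow (ya N) i * T"
      by (rule mat_lpow_intertwine[OF y]) (use d in auto)
    show "T * ract M a = ract N a * T"
      unfolding a(1) H_module_act[OF M a(2,3)] H_module_act[OF N a(2,3)]
      using a(3) d by (simp add: mat_assoc Th mat_absorb[OF Ty])
  qed
qed

lemma res_Hom: "is_module H M \<Longrightarrow> is_module H N \<Longrightarrow> T \<in> Hom_mod H M N \<Longrightarrow> T \<in> Hom_mod KG (res_mod M) (res_mod N)"
  using Hom_H_iff by blast

lemma res_iso: "is_module H M \<Longrightarrow> is_module H N \<Longrightarrow> iso_mod H M N \<Longrightarrow> iso_mod KG (res_mod M) (res_mod N)"
  unfolding iso_mod_def using res_Hom by (metis res_mod_simps(1))

lemma res_short_exact: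
  assumes mods: "is_module H L" "is_module H M" "is_module H N" and e: "short_exact H L M N"
  shows "short_exact KG (res_mod L) (res_mod M) (res_mod N)"
proof -
  obtain S S' T T' where S: "S \<in> Hom_mod H L M" and T: "T \<in> Hom_mod H M N"
    and s: "lin_split (rdim L) (rdim M) (rdim N) S S' T T'" using e by (rule short_exactE)
  show ?thesis using short_exactI[OF res_Hom[OF mods(1,2) S] res_Hom[OF mods(2,3) T]] s by simp
qed

lemma res_tensor:
  assumes M: "is_module H M" and N: "is_module H N"
  shows "iso_mod KG (res_mod (tensor_mod H M N)) (tensor_mod KG (res_mod M) (res_mod N))"
proof (rule iso_mod_by_eq[OF H_module_res[OF is_module_tensor[OF M N]]])
  fix h assume "h \<in> hbasis (KG :: ('g, 'k) hopf_data)"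
  then have h: "h \<in> carrier G" by simp
  have "ract (res_mod (tensor_mod H M N)) h = act_tensor M N (tensor_elt (emb h) (emb h))"
    using h by (simp add: tensor_mod_act[OF M N] comult_emb)
  also have "\<dots> = kron (ract M (0, h)) (ract N (0, h))"
    using h by (simp add: act_tensor_tensor_elt[OF M N] H_module_act_bvec M N)
  finally show "ract (tensor_mod KG (res_mod M) (res_mod N)) h = ract (res_mod (tensor_mod H M N)) h"
    using tensor_mod_KG[OF H_module_res[OF M] H_module_res[OF N] h] by simp
qed simp

lemma res_trivial: "iso_mod KG (res_mod (trivial_mod H)) (trivial_mod KG)"
proof (rule iso_mod_by_eq[OF H_module_res[OF is_module_trivial]])
  show "rdim (trivial_mod KG) = rdim (res_mod (trivial_mod H))" by (simp add: trivial_mod_def)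
  show "ract (trivial_mod KG) h = ract (res_mod (trivial_mod H)) h" if "h \<in> hbasis KG" for h
    using that by (simp add: trivial_mod_def counit_emb)
qed

definition res_class :: "((nat \<times> 'g, 'k) rep set \<Rightarrow>\<^sub>0 int) \<Rightarrow> (('g, 'k) rep set \<Rightarrow>\<^sub>0 int)" where
  "res_class = frag_extend (\<lambda>C. frag_of (iso_class KG (res_mod (some_rep C))))"

lemma res_class_diff: "res_class (a - b) = res_class a - res_class b"
  and res_class_add: "res_class (a + b) = res_class a + res_class b"
  and res_class_zero [simp]: "res_class 0 = 0"
  by (simp_all add: res_class_def frag_extend_diff frag_extend_add)

lemma res_class_of:
  assumes M: "is_module H M"
  shows "res_class (frag_of (iso_class H M)) = frag_of (iso_class KG (res_mod M))"
  using iso_class_eqI[OF H_module_res[OF M] H_module_res[OF some_rep(1)[OF M]] res_iso[OF M some_rep[OF M]]]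
  by (simp add: res_class_def)

lemma res_class_closed: "f \<in> carrier F \<Longrightarrow> res_class f \<in> carrier KG.F"
proof (induction f rule: free_class_induct)
  case zero
  show ?case by (simp add: free_carrier)
next
  case (cls M)
  then show ?case by (simp add: res_class_of H_module_res)
next
  case (diff a b)
  then show ?case by (simp add: res_class_diff free_carrier_diff)
qed

lemma res_class_mult:
  assumes "f \<in> carrier F" "f' \<in> carrier F"
  shows "res_class (f \<otimes>\<^bsub>F\<^esub> f') = res_class f \<otimes>\<^bsub>KG.F\<^esub> res_class f'"
  using assms(1)
proof (induction f rule: free_class_induct)
  case (cls M)
  from assms(2) show ?case
  proof (induction f' rule: free_class_induct)
    case (cls N)
    note m = \<open>is_module H M\<close> \<open>is_module H N\<close>
    show ?case
      using iso_class_eqI[OF H_module_res[OF is_module_tensor[OF m]] KG.is_module_tensor[OF H_module_res[OF m(1)] H_module_res[OF m(2)]] res_tensor[OF m]]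
      by (simp add: free_mult_class m res_class_of is_module_tensor KG.free_mult_class H_module_res)
  qed (simp_all add: free_mult_linear res_class_diff)
qed (simp_all add: free_mult_linear res_class_diff)

lemma res_class_hom: "res_class \<in> Ring.ring_hom F KG.F"
proof (rule ring_hom_memI)
  show "res_class \<one>\<^bsub>F\<^esub> = \<one>\<^bsub>KG.F\<^esub>"
    using iso_class_eqI[OF H_module_res[OF is_module_trivial] KG.is_module_trivial res_trivial]
    by (simp add: free_one res_class_of is_module_trivial)
qed (simp_all add: res_class_closed res_class_mult res_class_add free_add)

end

lemma (in group_datum_hopf) res_class_exact:
  assumes "f \<in> exact_relations H"
  shows "res_class f \<in> exact_relations KG"
  using assms exact_gens_carrier unfolding exact_relations_def[of H]
proof (induction f rule: generate_induct)
  case (gen y)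
  then obtain L M N where m: "is_module H L" "is_module H M" "is_module H N" and e: "short_exact H L M N"
    and y: "y = frag_of (iso_class H M) - frag_of (iso_class H L) - frag_of (iso_class H N)" by auto
  show ?case unfolding y res_class_diff res_class_of[OF m(1)] res_class_of[OF m(2)] res_class_of[OF m(3)]
    by (rule KG.exact_relation[OF m[THEN H_module_res] res_short_exact[OF m e]])
qed (simp_all add: KG.exact_closed res_class_diff)

section \<open>Eigenspaces of the central element\<close>

text \<open>The polynomial \<open>X^N - 1\<close> splits into linear factors, so it has
  \<open>N\<close> roots with multiplicity, and it is separable in characteristic zero.\<close>

lemma card_roots_of_unity:
  assumes "N > 0"
  shows "finite {x :: 'a::{alg_closed_field, field_char_0}. x ^ N = 1}" "card {x :: 'a. x ^ N = 1} = N"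
proof -
  define p :: "'a poly" where "p = monom 1 N - 1"
  have eval: "poly p x = x ^ N - 1" for x by (simp add: p_def poly_monom)
  have "degree (monom 1 N + (- 1 :: 'a poly)) = N"
    using assms by (subst degree_add_eq_left) (simp_all add: degree_monom_eq)
  then have deg: "degree p = N" by (simp add: p_def)
  then have p0: "p \<noteq> 0" using assms by auto
  have roots: "{x. x ^ N = 1} = {x. poly p x = 0}" by (simp add: eval)
  show "finite {x :: 'a. x ^ N = 1}" unfolding roots by (rule poly_roots_finite[OF p0])
  obtain A where A: "size A = degree p" "p = Polynomial.smult (Polynomial.lead_coeff p) (\<Prod>x\<in>#A. [:-x, 1:])"
    using alg_closed_imp_factorization[OF p0] by blast
  have "proots (\<Prod>x\<in>#B. [:-x, 1:]) = (B :: 'a multiset)" for B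
  proof (induction B)
    case (add x B)
    have "(\<Prod>x\<in>#B. [:-x, 1:]) \<noteq> 0" by (auto simp: prod_mset_zero_iff)
    then have "proots ([:-x, 1:] * (\<Prod>x\<in>#B. [:-x, 1:])) = proots [:-x, 1:] + proots (\<Prod>x\<in>#B. [:-x, 1:])"
      by (intro proots_mult) auto
    then show ?case by (simp add: add)
  qed simp
  then have "proots p = A" using p0 A(2) proots_smult[of "Polynomial.lead_coeff p"] by (metis leading_coeff_0_iff)
  then have size: "size (proots p) = N" using A(1) deg by simp
  \<comment> \<open>The derivative \<open>N X^(N-1)\<close> vanishes at most at zero, which is not a
    root.\<close>
  have "\<not> (poly p a = 0 \<and> poly (pderiv p) a = 0)" for a
    using assms by (auto simp: eval p_def pderiv_diff pderiv_monom poly_monom power_0_left)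
  then have rs: "rsquarefree p" by (simp add: rsquarefree_roots)
  have "size (proots p) = (\<Sum>x\<in>{x. poly p x = 0}. order x p)"
    using p0 by (simp add: size_multiset_overloaded_eq)
  also have "\<dots> = (\<Sum>x\<in>{x. poly p x = 0}. 1)"
    by (intro sum.cong refl) (use rsquarefree_root_order[OF rs _ p0] in auto)
  finally show "card {x :: 'a. x ^ N = 1} = N" using size roots by simp
qed

lemma card_roots_of_unity_le:
  assumes "0 < k"
  shows "card {x :: 'a::field. x ^ k = 1} \<le> k"
proof -
  define p :: "'a poly" where "p = monom 1 k - 1"
  have eval: "poly p x = x ^ k - 1" for x by (simp add: p_def poly_monom)
  have "degree (monom 1 k + (- 1 :: 'a poly)) = k"
    using assms by (subst degree_add_eq_left) (simp_all add: degree_monom_eq)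
  then have deg: "degree p = k" by (simp add: p_def)
  then have p0: "p \<noteq> 0" using assms by auto
  have "{x. x ^ k = 1} = {x. poly p x = 0}" by (simp add: eval)
  then show ?thesis using card_poly_roots_bound[OF p0] deg by simp
qed

text \<open>For \<open>k\<close> different from 0 there is a root \<open>z\<close> with
  \<open>z^k\<close> different from 1, because \<open>X^k - 1\<close> has at most \<open>k\<close>
  roots and \<open>k < N\<close>. Multiplying all roots by \<open>z\<close> permutes them but scales
  the sum by a factor other than 1, so the sum vanishes.\<close>

lemma sum_roots_of_unity:
  assumes "k < N"
  shows "(\<Sum>x\<in>{x :: 'a::{alg_closed_field, field_char_0}. x ^ N = 1}. inverse x ^ k) = (if k = 0 then of_nat N else 0)"
proof (cases "k = 0")
  case True
  then show ?thesis using card_roots_of_unity(2)[where 'a = 'a, of N] assms by simp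
next
  case False
  let ?R = "{x :: 'a. x ^ N = 1}"
  note fin = card_roots_of_unity[where 'a = 'a, of N]
  have "\<not> ?R \<subseteq> {x. x ^ k = 1}"
  proof
    assume "?R \<subseteq> {x. x ^ k = 1}"
    moreover have "finite {x :: 'a. x ^ k = 1}" using card_roots_of_unity(1)[of k] False by simp
    ultimately have "N \<le> k" using card_mono[of "{x :: 'a. x ^ k = 1}" ?R] fin assms card_roots_of_unity_le[of k, where 'a = 'a] False by auto
    then show False using assms by simp
  qed
  then obtain z where z: "z ^ N = 1" "z ^ k \<noteq> (1 :: 'a)" by auto
  then have z0: "z \<noteq> 0" using assms by (metis power_0_left zero_neq_one not_less_zero)
  have "(\<Sum>x\<in>?R. inverse x ^ k) = (\<Sum>x\<in>?R. inverse (z * x) ^ k)"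
    by (rule sum.reindex_bij_witness[where i = "\<lambda>x. z * x" and j = "\<lambda>x. x / z"])
      (use z z0 in \<open>auto simp: power_mult_distrib power_divide\<close>)
  also have "\<dots> = inverse z ^ k * (\<Sum>x\<in>?R. inverse x ^ k)"
    by (simp add: power_mult_distrib sum_distrib_left)
  finally have "(1 - inverse z ^ k) * (\<Sum>x\<in>?R. inverse x ^ k) = 0" by (simp add: algebra_simps)
  moreover have "inverse z ^ k \<noteq> 1" using z by (simp add: power_inverse)
  ultimately show ?thesis using False by simp
qed

lemma msum_scalar: "A \<in> carrier_mat n m \<Longrightarrow> msum n m (\<lambda>s. c s \<cdot>\<^sub>m A) S = (\<Sum>s\<in>S. c s) \<cdot>\<^sub>m (A :: 'a::semiring_0 mat)"
  by (rule eq_matI) (auto simp: sum_distrib_right)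

lemma mat_smult_zero: "c \<cdot>\<^sub>m 0\<^sub>m n m = (0\<^sub>m n m :: 'a::mult_zero mat)" "A \<in> carrier_mat n m \<Longrightarrow> 0 \<cdot>\<^sub>m A = (0\<^sub>m n m :: 'a mat)"
  by (auto intro!: eq_matI)

section \<open>Eigenprojections of \<open>g\<close> and functional calculus\<close>

locale group_datum_closed = group_datum_hopf G \<chi> g n H
  for G :: "('g, 'm) monoid_scheme" (structure)
    and \<chi> :: "'g \<Rightarrow> 'k::{alg_closed_field, field_char_0}"
    and g :: 'g
    and n :: nat
    and H :: "(nat \<times> 'g, 'k) hopf_data"
begin

abbreviation "N \<equiv> Coset.order G"
abbreviation "q \<equiv> \<chi> g"
abbreviation "roots \<equiv> {x :: 'k. x ^ N = 1}"

lemma N_pos: "N > 0"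
  using finite_carrier order_gt_0_iff_finite by blast

lemma g_N: "g [^] N = \<one>"
  by (rule pow_order_eq_1[OF g_closed])

lemma char_pow: "\<chi> (g [^] k) = q ^ k"
  by (induction k) (simp_all add: char_one char_mult g_closed)

lemma q_N: "q ^ N = 1"
  using char_pow[of N] by (simp add: g_N char_one)

lemma q_nonzero: "q \<noteq> 0"
  by (rule char_nonzero[OF g_closed])

lemma root_nonzero: "x \<in> roots \<Longrightarrow> x \<noteq> 0"
  using N_pos by (cases "x = 0") (simp_all add: power_0_left)

lemma g_pow_commute: "h \<in> carrier G \<Longrightarrow> g [^] (k::nat) \<otimes> h = h \<otimes> g [^] k"
proof (induction k)
  case (Suc k)
  then have "g [^] Suc k \<otimes> h = g [^] k \<otimes> (h \<otimes> g)" by (simp add: m_assoc g_closed g_central)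
  also have "\<dots> = (h \<otimes> g [^] k) \<otimes> g" using Suc by (simp add: g_closed flip: m_assoc)
  also have "\<dots> = h \<otimes> g [^] Suc k" using Suc.prems by (simp add: m_assoc g_closed)
  finally show ?case .
qed simp

text \<open>The projection to the eigenspace of \<open>g\<close> for \<open>x\<close>, by Fourier
  inversion for the relation \<open>g^N = 1\<close>. Since \<open>N\<close> is the order of the
  group and not of \<open>g\<close>, some of these projections can be zero.\<close>

definition g_proj :: "('g, 'k) rep \<Rightarrow> 'k \<Rightarrow> 'k mat" where
  "g_proj W x = msum (rdim W) (rdim W) (\<lambda>k. (inverse x ^ k / of_nat N) \<cdot>\<^sub>m ract W (g [^] k)) {..<N}"

text \<open>The functional calculus of the diagonalisable operator \<open>g\<close> on \<open>W\<close>.\<close>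

definition g_fun :: "('g, 'k) rep \<Rightarrow> ('k \<Rightarrow> 'k) \<Rightarrow> 'k mat" where
  "g_fun W f = msum (rdim W) (rdim W) (\<lambda>x. f x \<cdot>\<^sub>m g_proj W x) roots"

lemma g_proj_dim [simp]: "dim_row (g_proj W x) = rdim W" "dim_col (g_proj W x) = rdim W" "g_proj W x \<in> carrier_mat (rdim W) (rdim W)"
  and g_fun_dim [simp]: "dim_row (g_fun W f) = rdim W" "dim_col (g_fun W f) = rdim W" "g_fun W f \<in> carrier_mat (rdim W) (rdim W)"
  by (simp_all add: g_proj_def g_fun_def)

lemma g_proj_eigen:
  assumes W: "is_module KG W" and x: "x \<in> roots"
  shows "ract W g * g_proj W x = x \<cdot>\<^sub>m g_proj W x"
proof -
  let ?d = "rdim W"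
  let ?F = "\<lambda>k. (inverse x ^ k / of_nat N) \<cdot>\<^sub>m ract W (g [^] k)"
  note dW = KG_moduleD[OF W]
  have gk: "g [^] (k::nat) \<in> carrier G" for k by (simp add: g_closed)
  have "ract W g * g_proj W x = msum ?d ?d (\<lambda>k. ract W g * ?F k) {..<N}"
    unfolding g_proj_def by (subst msum_mult_left) (auto simp: dW g_closed)
  also have "\<dots> = msum ?d ?d (\<lambda>k. x \<cdot>\<^sub>m ?F (Suc k)) {..<N}"
  proof (rule msum_cong[OF refl])
    fix k
    have "ract W g * ?F k = (inverse x ^ k / of_nat N) \<cdot>\<^sub>m ract W (g [^] Suc k)"
      using gk by (simp add: mat_smult_right dW g_closed g_pow_commute[symmetric])
    then show "ract W g * ?F k = x \<cdot>\<^sub>m ?F (Suc k)"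
      using root_nonzero[OF x] by (simp add: mat_smult_smult flip: mult.assoc)
  qed
  also have "\<dots> = x \<cdot>\<^sub>m msum ?d ?d (\<lambda>k. ?F (Suc k)) {..<N}"
    by (subst msum_smult) (auto simp: dW g_closed)
  \<comment> \<open>The shift of the index only exchanges the term at 0 for the term at
    \<open>N\<close>, and these agree because \<open>x^N = 1\<close> and
    \<open>g^N = 1\<close>.\<close>
  also have "msum ?d ?d (\<lambda>k. ?F (Suc k)) {..<N} = msum ?d ?d ?F {..<N}"
  proof (rule eq_matI)
    fix i j assume "i < dim_row (msum ?d ?d ?F {..<N})" "j < dim_col (msum ?d ?d ?F {..<N})"
    then have ij: "i < ?d" "j < ?d" by auto
    have "?F N = ?F 0" using x by (simp add: g_N power_inverse)
    then have "(\<Sum>k<N. ?F (Suc k) $$ (i, j)) = (\<Sum>k<N. ?F k $$ (i, j))"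
      using sum.lessThan_Suc_shift[of "\<lambda>k. ?F k $$ (i, j)" N] sum.lessThan_Suc[of "\<lambda>k. ?F k $$ (i, j)" N]
      by (metis (no_types, lifting) add.commute add_left_cancel)
    then show "msum ?d ?d (\<lambda>k. ?F (Suc k)) {..<N} $$ (i, j) = msum ?d ?d ?F {..<N} $$ (i, j)" using ij by simp
  qed auto
  finally show ?thesis by (simp add: g_proj_def)
qed

lemma g_proj_eigen_pow:
  assumes W: "is_module KG W" and x: "x \<in> roots"
  shows "ract W (g [^] k) * g_proj W x = x ^ k \<cdot>\<^sub>m g_proj W x"
proof (induction k)
  case 0
  then show ?case using KG_moduleD(4)[OF W] by (simp add: mat_smult_one)
next
  case (Suc k)
  have gk: "g [^] k \<in> carrier G" by (simp add: g_closed)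
  note dW = KG_moduleD[OF W]
  have "ract W (g [^] Suc k) * g_proj W x = ract W (g [^] k) * (ract W g * g_proj W x)"
    using gk by (simp add: dW(2,3) g_closed flip: dW(5) mat_assoc)
  also have "\<dots> = x ^ Suc k \<cdot>\<^sub>m g_proj W x"
    using gk by (simp add: g_proj_eigen[OF W x] mat_smult_right dW Suc mat_smult_smult mult.commute)
  finally show ?case .
qed

lemma g_proj_mult:
  assumes W: "is_module KG W" and x: "x \<in> roots" and z: "z \<in> roots"
  shows "g_proj W z * g_proj W x = (if z = x then g_proj W x else 0\<^sub>m (rdim W) (rdim W))"
proof -
  note dW = KG_moduleD[OF W]
  have "g_proj W z * g_proj W x = msum (rdim W) (rdim W) (\<lambda>k. ((inverse z * x) ^ k / of_nat N) \<cdot>\<^sub>m g_proj W x) {..<N}"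
    unfolding g_proj_def[of W z]
    by (subst msum_mult_right)
      (auto simp: dW g_closed mat_smult_left g_proj_eigen_pow[OF W x] mat_smult_smult power_mult_distrib intro!: msum_cong)
  also have "\<dots> = ((\<Sum>k<N. (inverse z * x) ^ k) / of_nat N) \<cdot>\<^sub>m g_proj W x"
    by (subst msum_scalar) (simp_all add: sum_divide_distrib)
  also have "(\<Sum>k<N. (inverse z * x) ^ k) = (if z = x then of_nat N else 0)"
  proof (cases "z = x")
    case True
    then show ?thesis using root_nonzero[OF x] by simp
  next
    case False
    then have "inverse z * x \<noteq> 1" using root_nonzero[OF z] by (auto simp: field_simps)
    moreover have "(inverse z * x) ^ N = 1" using x z by (simp add: power_mult_distrib power_inverse)
    ultimately show ?thesis using False geometric_sum[of "inverse z * x" N] by simp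
  qed
  finally show ?thesis using N_pos by (auto simp: mat_smult_one mat_smult_zero)
qed

lemma g_proj_sum:
  assumes W: "is_module KG W"
  shows "msum (rdim W) (rdim W) (g_proj W) roots = 1\<^sub>m (rdim W)"
proof (rule eq_matI)
  note dW = KG_moduleD[OF W]
  fix i j assume "i < dim_row (1\<^sub>m (rdim W) :: 'k mat)" "j < dim_col (1\<^sub>m (rdim W) :: 'k mat)"
  then have ij: "i < rdim W" "j < rdim W" by auto
  have "msum (rdim W) (rdim W) (g_proj W) roots $$ (i, j) =
    (\<Sum>x\<in>roots. \<Sum>k<N. inverse x ^ k * (ract W (g [^] k) $$ (i, j) / of_nat N))"
    using ij by (simp add: g_proj_def dW g_closed)
  also have "\<dots> = (\<Sum>k<N. \<Sum>x\<in>roots. inverse x ^ k * (ract W (g [^] k) $$ (i, j) / of_nat N))"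
    by (rule sum.swap)
  also have "\<dots> = (\<Sum>k<N. (if k = 0 then of_nat N else 0) * (ract W (g [^] k) $$ (i, j) / of_nat N))"
    by (intro sum.cong refl, subst sum_distrib_right[symmetric], subst sum_roots_of_unity) auto
  also have "\<dots> = (\<Sum>k<N. if k = 0 then ract W \<one> $$ (i, j) else 0)"
    using N_pos by (intro sum.cong) auto
  also have "\<dots> = ract W \<one> $$ (i, j)" using N_pos by simp
  finally show "msum (rdim W) (rdim W) (g_proj W) roots $$ (i, j) = 1\<^sub>m (rdim W) $$ (i, j)"
    using dW(4) ij by simp
qed auto

lemma finite_roots: "finite roots"
  by (rule card_roots_of_unity(1)[OF N_pos])

lemma g_fun_proj:
  assumes W: "is_module KG W" and x: "x \<in> roots"
  shows "g_fun W f * g_proj W x = f x \<cdot>\<^sub>m g_proj W x"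
proof -
  have "g_fun W f * g_proj W x = msum (rdim W) (rdim W) (\<lambda>z. (f z \<cdot>\<^sub>m g_proj W z) * g_proj W x) roots"
    unfolding g_fun_def by (subst msum_mult_right) auto
  also have "\<dots> = (f x \<cdot>\<^sub>m g_proj W x) * g_proj W x"
    by (rule msum_delta) (use x finite_roots g_proj_mult[OF W x] in \<open>auto simp: mat_smult_left mat_smult_zero\<close>)
  finally show ?thesis using g_proj_mult[OF W x x] by (simp add: mat_smult_left)
qed

lemma g_fun_mult:
  assumes W: "is_module KG W"
  shows "g_fun W f * g_fun W h = g_fun W (\<lambda>x. f x * h x)"
proof -
  have "g_fun W f * g_fun W h = msum (rdim W) (rdim W) (\<lambda>x. g_fun W f * (h x \<cdot>\<^sub>m g_proj W x)) roots"
    unfolding g_fun_def[of W h] by (subst msum_mult_left) auto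
  also have "\<dots> = g_fun W (\<lambda>x. f x * h x)"
    unfolding g_fun_def[of W "\<lambda>x. f x * h x"]
    by (rule msum_cong) (auto simp: mat_smult_right g_fun_proj[OF W] mat_smult_smult mult.commute)
  finally show ?thesis .
qed

lemma g_fun_one: "is_module KG W \<Longrightarrow> g_fun W (\<lambda>x. 1) = 1\<^sub>m (rdim W)"
  using g_proj_sum[of W] by (simp add: g_fun_def mat_smult_one)

lemma g_fun_cong: "(\<And>x. x \<in> roots \<Longrightarrow> f x = h x) \<Longrightarrow> g_fun W f = g_fun W h"
  by (auto simp: g_fun_def intro!: msum_cong)

lemma g_fun_zero: "g_fun W (\<lambda>x. 0) = 0\<^sub>m (rdim W) (rdim W)"
  by (rule eq_matI) (auto simp: g_fun_def)

lemma g_fun_add: "g_fun W (\<lambda>x. f x + h x) = g_fun W f + g_fun W h"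
  by (rule eq_matI) (auto simp: g_fun_def distrib_right sum.distrib)

lemma g_fun_diff: "g_fun W (\<lambda>x. f x - h x) = g_fun W f - g_fun W h"
  by (rule eq_matI) (auto simp: g_fun_def left_diff_distrib sum_subtractf)

lemma g_fun_sum: "msum (rdim W) (rdim W) (\<lambda>k. g_fun W (f k)) S = g_fun W (\<lambda>x. \<Sum>k\<in>S. f k x)"
  by (rule eq_matI) (auto simp: g_fun_def sum_distrib_right intro: sum.swap)

lemma g_fun_pow:
  assumes W: "is_module KG W"
  shows "ract W (g [^] k) = g_fun W (\<lambda>x. x ^ k)"
proof -
  note dW = KG_moduleD[OF W]
  have gk: "g [^] k \<in> carrier G" by (simp add: g_closed)
  have "ract W (g [^] k) = ract W (g [^] k) * msum (rdim W) (rdim W) (g_proj W) roots"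
    unfolding g_proj_sum[OF W] using gk by (simp add: dW)
  also have "\<dots> = msum (rdim W) (rdim W) (\<lambda>x. ract W (g [^] k) * g_proj W x) roots"
    using gk by (subst msum_mult_left) (auto simp: dW)
  also have "\<dots> = g_fun W (\<lambda>x. x ^ k)"
    unfolding g_fun_def by (rule msum_cong) (auto simp: g_proj_eigen_pow[OF W])
  finally show ?thesis .
qed

text \<open>The commutation rule says that \<open>T\<close> sends the eigenspace for
  \<open>c * x\<close> to the one for \<open>x\<close>. It is applied with \<open>c = 1\<close> to
  homomorphisms and group elements, and with \<open>c = q\<close> to \<open>y\<close>.\<close>

lemma g_fun_intertwine:
  assumes W: "is_module KG W" and W': "is_module KG W'" and T: "T \<in> carrier_mat (rdim W') (rdim W)"
    and c: "c \<in> roots" and *: "\<And>k. T * ract W (g [^] k) = c ^ k \<cdot>\<^sub>m (ract W' (g [^] k) * T)"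
  shows "T * g_fun W f = g_fun W' (\<lambda>x. f (c * x)) * T"
proof -
  note dW = KG_moduleD[OF W] and dW' = KG_moduleD[OF W']
  have dT: "dim_row T = rdim W'" "dim_col T = rdim W" using T by auto
  note c0 = root_nonzero[OF c]
  have proj: "T * g_proj W (c * x) = g_proj W' x * T" if "x \<in> roots" for x
  proof -
    have "T * g_proj W (c * x) = msum (rdim W') (rdim W)
      (\<lambda>k. (inverse (c * x) ^ k / of_nat N) \<cdot>\<^sub>m (c ^ k \<cdot>\<^sub>m (ract W' (g [^] k) * T))) {..<N}"
      unfolding g_proj_def by (subst msum_mult_left) (auto simp: dT dW g_closed mat_smult_right * intro!: msum_cong)
    also have "\<dots> = msum (rdim W') (rdim W) (\<lambda>k. ((inverse x ^ k / of_nat N) \<cdot>\<^sub>m ract W' (g [^] k)) * T) {..<N}"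
      using c0 by (auto simp: mat_smult_smult mat_smult_left dW' dT g_closed power_mult_distrib power_inverse intro!: msum_cong)
    also have "\<dots> = g_proj W' x * T"
      unfolding g_proj_def by (subst msum_mult_right) (auto simp: dT dW' g_closed)
    finally show ?thesis .
  qed
  have bij: "bij_betw (\<lambda>x. c * x) roots roots"
    by (rule bij_betwI[where g = "\<lambda>x. x / c"]) (use c c0 in \<open>auto simp: power_mult_distrib power_divide\<close>)
  have "T * g_fun W f = msum (rdim W') (rdim W) (\<lambda>x. T * (f x \<cdot>\<^sub>m g_proj W x)) roots"
    unfolding g_fun_def by (subst msum_mult_left) (auto simp: dT)
  also have "\<dots> = msum (rdim W') (rdim W) (\<lambda>x. T * (f (c * x) \<cdot>\<^sub>m g_proj W (c * x))) roots"
    by (rule msum_reindex[OF bij, symmetric])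
  also have "\<dots> = msum (rdim W') (rdim W) (\<lambda>x. (f (c * x) \<cdot>\<^sub>m g_proj W' x) * T) roots"
    by (rule msum_cong) (auto simp: mat_smult_left mat_smult_right dT proj)
  also have "\<dots> = g_fun W' (\<lambda>x. f (c * x)) * T"
    unfolding g_fun_def by (subst msum_mult_right) (auto simp: dT)
  finally show ?thesis .
qed

lemma g_fun_Hom:
  assumes W: "is_module KG W" and W': "is_module KG W'" and T: "T \<in> Hom_mod KG W W'"
  shows "T * g_fun W f = g_fun W' f * T"
  using g_fun_intertwine[OF W W' Hom_modD(1)[OF T], of 1 f] Hom_modD(4)[OF T] g_closed
  by (simp add: mat_smult_one)

lemma g_fun_in_Hom:
  assumes W: "is_module KG W"
  shows "g_fun W f \<in> Hom_mod KG W W"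
proof (rule Hom_modI)
  fix h assume "h \<in> hbasis (KG :: ('g, 'k) hopf_data)"
  then have h: "h \<in> carrier G" by simp
  note dW = KG_moduleD[OF W]
  have "ract W h * g_fun W f = g_fun W (\<lambda>x. f (1 * x)) * ract W h"
    by (rule g_fun_intertwine[OF W W])
      (use h in \<open>auto simp: dW(1) g_closed mat_smult_one dW(5) g_pow_commute\<close>)
  then show "g_fun W f * ract W h = ract W h * g_fun W f" by simp
qed simp

lemma g_fun_y:
  assumes M: "is_module H M"
  shows "ya M * g_fun (res_mod M) f = g_fun (res_mod M) (\<lambda>x. f (q * x)) * ya M"
proof (rule g_fun_intertwine[OF H_module_res[OF M] H_module_res[OF M]])
  fix k
  show "ya M * ract (res_mod M) (g [^] k) = q ^ k \<cdot>\<^sub>m (ract (res_mod M) (g [^] k) * ya M)"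
    using H_module_commute[OF M, of "g [^] k"] g_closed by (simp add: char_pow)
qed (use M q_N in \<open>auto simp: is_module_carrier\<close>)

end

section \<open>Induced modules\<close>

lemma kron_one_left: "kron (1\<^sub>m 1) A = (A :: 'a::semiring_1 mat)"
proof (rule eq_matI)
  fix i j assume ij: "i < dim_row A" "j < dim_col A"
  then show "kron (1\<^sub>m 1) A $$ (i, j) = A $$ (i, j)" by (simp add: kron_index)
qed auto

text \<open>A unit vector tensored with an identity matrix: the inclusion of the block of index
  \<open>l\<close> among \<open>n\<close> blocks of length \<open>d\<close>, in the basis order of
  \<open>tensor_mod\<close>.\<close>

definition block_in :: "nat \<Rightarrow> nat \<Rightarrow> nat \<Rightarrow> 'a::field mat" where
  "block_in n d l = kron (mat n 1 (\<lambda>(i, j). if i = l then 1 else 0)) (1\<^sub>m d)"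

definition block_pr :: "nat \<Rightarrow> nat \<Rightarrow> nat \<Rightarrow> 'a::field mat" where
  "block_pr n d l = kron (mat 1 n (\<lambda>(i, j). if j = l then 1 else 0)) (1\<^sub>m d)"

lemma block_dim [simp]: "dim_row (block_in n d l) = n * d" "dim_col (block_in n d l) = d"
  "dim_row (block_pr n d l) = d" "dim_col (block_pr n d l) = n * d"
  by (simp_all add: block_in_def block_pr_def)

lemma block_pr_in:
  assumes "k < n" "l < n"
  shows "block_pr n d k * block_in n d l = (if k = l then 1\<^sub>m d else 0\<^sub>m d d :: 'a::field mat)"
proof -
  have "mat 1 n (\<lambda>(i, j). if j = k then 1 else 0) * mat n 1 (\<lambda>(i, j). if i = l then 1 else 0) =
    (if k = l then 1\<^sub>m 1 else 0\<^sub>m 1 1 :: 'a mat)"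
    using assms by (intro eq_matI) (auto simp: scalar_prod_def sum_delta_mult)
  then show ?thesis
    unfolding block_in_def block_pr_def by (subst kron_mult) (simp_all add: kron_one kron_zero_left)
qed

lemma block_sum: "msum (n * d) (n * d) (\<lambda>l. block_in n d l * block_pr n d l) {..<n} = (1\<^sub>m (n * d) :: 'a::field mat)"
proof -
  let ?E = "\<lambda>l. mat n 1 (\<lambda>(i, j). if i = l then 1 else 0) * mat 1 n (\<lambda>(i, j). if j = l then 1 else 0) :: 'a mat"
  have "msum (n * d) (n * d) (\<lambda>l. block_in n d l * block_pr n d l) {..<n} = msum (n * d) (n * d) (\<lambda>l. kron (?E l) (1\<^sub>m d)) {..<n}"
    by (rule msum_cong[OF refl]) (simp add: block_in_def block_pr_def kron_mult)
  also have "\<dots> = kron (msum n n ?E {..<n}) (1\<^sub>m d)"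
    using kron_msum_left[of "{..<n}" ?E n n "1\<^sub>m d", OF mult_carrier_mat[of _ n 1]] by simp
  also have "msum n n ?E {..<n} = 1\<^sub>m n"
  proof (rule eq_matI)
    fix i j assume "i < dim_row (1\<^sub>m n :: 'a mat)" "j < dim_col (1\<^sub>m n :: 'a mat)"
    then have ij: "i < n" "j < n" by auto
    have "?E l $$ (i, j) = (if i = l then (if j = l then 1 else 0) else 0)" for l
      using ij by (simp add: scalar_prod_def)
    then show "msum n n ?E {..<n} $$ (i, j) = (1\<^sub>m n :: 'a mat) $$ (i, j)" using ij by simp
  qed auto
  finally show ?thesis by (simp add: kron_one)
qed

definition block_row :: "nat \<Rightarrow> nat \<Rightarrow> nat \<Rightarrow> (nat \<Rightarrow> 'a::field mat) \<Rightarrow> 'a mat" where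
  "block_row n d k f = msum k (n * d) (\<lambda>l. f l * block_pr n d l) {..<n}"

definition block_col :: "nat \<Rightarrow> nat \<Rightarrow> nat \<Rightarrow> (nat \<Rightarrow> 'a::field mat) \<Rightarrow> 'a mat" where
  "block_col n d k f = msum (n * d) k (\<lambda>l. block_in n d l * f l) {..<n}"

lemma block_row_dim [simp]: "dim_row (block_row n d k f) = k" "dim_col (block_row n d k f) = n * d"
  and block_col_dim [simp]: "dim_row (block_col n d k f) = n * d" "dim_col (block_col n d k f) = k"
  by (simp_all add: block_row_def block_col_def)

lemma block_row_in:
  assumes f: "\<And>l. l < n \<Longrightarrow> f l \<in> carrier_mat k d" and l: "l < n"
  shows "block_row n d k f * block_in n d l = f l"
proof -
  have df: "dim_row (f i) = k" "dim_col (f i) = d" if "i < n" for i using f[OF that] by auto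
  have "block_row n d k f * block_in n d l = msum k d (\<lambda>i. f i * block_pr n d i * block_in n d l) {..<n}"
    unfolding block_row_def by (subst msum_mult_right) (auto simp: df)
  also have "\<dots> = f l * block_pr n d l * block_in n d l"
    by (rule msum_delta) (use l in \<open>auto simp: df mat_assoc block_pr_in mat_zero_simps\<close>)
  finally show ?thesis using l by (simp add: mat_assoc df block_pr_in)
qed

lemma block_pr_col:
  assumes f: "\<And>l. l < n \<Longrightarrow> f l \<in> carrier_mat d k" and l: "l < n"
  shows "block_pr n d l * block_col n d k f = f l"
proof -
  have df: "dim_row (f i) = d" "dim_col (f i) = k" if "i < n" for i using f[OF that] by auto
  have "block_pr n d l * block_col n d k f = msum d k (\<lambda>i. block_pr n d l * (block_in n d i * f i)) {..<n}"
    unfolding block_col_def by (subst msum_mult_left) (auto simp: df)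
  also have "\<dots> = block_pr n d l * (block_in n d l * f l)"
  proof (rule msum_delta)
    fix s assume s: "s \<in> {..<n}" "s \<noteq> l"
    then have "block_pr n d l * block_in n d s = (0\<^sub>m d d :: 'a mat)" using l by (simp add: block_pr_in)
    from mat_absorb[OF this, of "f s"] s show "block_pr n d l * (block_in n d s * f s) = 0\<^sub>m d k"
      by (simp add: df mat_zero_simps)
  qed (use l in \<open>auto simp: df\<close>)
  also have "\<dots> = f l" using l mat_absorb[OF block_pr_in[OF l l, where d = d], where Z = "f l"] by (simp add: df)
  finally show ?thesis .
qed

lemma block_eqI:
  fixes A B :: "'a::field mat"
  assumes "dim_row A = dim_row B" "dim_col A = n * d" "dim_col B = n * d"
    and "\<And>l. l < n \<Longrightarrow> A * block_in n d l = B * block_in n d l"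
  shows "A = B"
proof -
  have *: "A = msum (dim_row A) (n * d) (\<lambda>l. A * block_in n d l * block_pr n d l) {..<n}" if "dim_col A = n * d" for A :: "'a mat"
  proof -
    have "A = A * msum (n * d) (n * d) (\<lambda>l. block_in n d l * block_pr n d l) {..<n}" using that by (simp add: block_sum)
    also have "\<dots> = msum (dim_row A) (n * d) (\<lambda>l. A * block_in n d l * block_pr n d l) {..<n}"
      using that by (subst msum_mult_left) (auto simp: mat_assoc)
    finally show ?thesis .
  qed
  have "A = msum (dim_row B) (n * d) (\<lambda>l. A * block_in n d l * block_pr n d l) {..<n}" using *[OF assms(2)] assms(1) by simp
  also have "\<dots> = msum (dim_row B) (n * d) (\<lambda>l. B * block_in n d l * block_pr n d l) {..<n}"
    by (rule msum_cong) (simp_all add: assms(4))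
  also have "\<dots> = B" by (rule *[OF assms(3), symmetric])
  finally show ?thesis .
qed

lemma block_eqI_left:
  fixes A B :: "'a::field mat"
  assumes "dim_row A = n * d" "dim_row B = n * d" "dim_col A = dim_col B"
    and "\<And>l. l < n \<Longrightarrow> block_pr n d l * A = block_pr n d l * B"
  shows "A = B"
proof -
  have *: "A = msum (n * d) (dim_col A) (\<lambda>l. block_in n d l * (block_pr n d l * A)) {..<n}" if "dim_row A = n * d" for A :: "'a mat"
  proof -
    have "A = msum (n * d) (n * d) (\<lambda>l. block_in n d l * block_pr n d l) {..<n} * A" using that by (simp add: block_sum)
    also have "\<dots> = msum (n * d) (dim_col A) (\<lambda>l. block_in n d l * (block_pr n d l * A)) {..<n}"
      using that by (subst msum_mult_right) (auto simp: mat_assoc)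
    finally show ?thesis .
  qed
  have "A = msum (n * d) (dim_col B) (\<lambda>l. block_in n d l * (block_pr n d l * A)) {..<n}" using *[OF assms(1)] assms(3) by simp
  also have "\<dots> = msum (n * d) (dim_col B) (\<lambda>l. block_in n d l * (block_pr n d l * B)) {..<n}"
    by (rule msum_cong) (simp_all add: assms(4))
  also have "\<dots> = B" by (rule *[OF assms(2), symmetric])
  finally show ?thesis .
qed

section \<open>Induced modules and their universal property\<close>

context group_datum_hopf
begin

text \<open>Its class is the factor \<open>1 + a + \<cdots> + a\<^sup>n\<^sup>-\<^sup>1\<close> of the generators.\<close>

definition char_mod :: "('g, 'k) rep" where
  "char_mod = \<lparr>rdim = n, ract = (\<lambda>h. mat n n (\<lambda>(i, j). if i = j then inverse (\<chi> h) ^ i else 0))\<rparr>"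

text \<open>Left multiplication by \<open>y\<close>: it raises the exponent of a block by one, and
  from the last block it returns to block 0 through \<open>y^n = g^n - 1\<close>.\<close>

definition ind_y :: "('g, 'k) rep \<Rightarrow> 'k mat" where
  "ind_y U = block_row n (rdim U) (n * rdim U) (\<lambda>l. if Suc l < n then block_in n (rdim U) (Suc l)
     else block_in n (rdim U) 0 * (ract U (g [^] n) - 1\<^sub>m (rdim U)))"

text \<open>The induced module \<open>H \<otimes> U\<close> over \<open>kG\<close>; the block of index \<open>l\<close> is \<open>y\<^sup>l \<otimes> U\<close>.\<close>

definition ind_mod :: "('g, 'k) rep \<Rightarrow> (nat \<times> 'g, 'k) rep" where
  "ind_mod U = y_mod (tensor_mod KG char_mod U) (ind_y U)"

lemma char_mod_rdim [simp]: "rdim char_mod = n"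
  by (simp add: char_mod_def)

lemma is_module_char_mod: "is_module KG char_mod"
  unfolding is_module_KG
proof (intro conjI ballI)
  fix a b assume a: "a \<in> carrier G" and b: "b \<in> carrier G"
  show "ract char_mod (a \<otimes> b) = ract char_mod a * ract char_mod b"
  proof (rule eq_matI)
    fix i j assume "i < dim_row (ract char_mod a * ract char_mod b)" "j < dim_col (ract char_mod a * ract char_mod b)"
    then have ij: "i < n" "j < n" by (auto simp: char_mod_def)
    have "(ract char_mod a * ract char_mod b) $$ (i, j) = (\<Sum>k\<in>{0..<n}. (if i = k then inverse (\<chi> a) ^ i * (if k = j then inverse (\<chi> b) ^ k else 0) else 0))"
      using ij by (simp add: char_mod_def scalar_prod_def if_distrib[of "\<lambda>x. x * _"] cong: if_cong)
    also have "\<dots> = (if i = j then inverse (\<chi> a) ^ i * inverse (\<chi> b) ^ i else 0)" using ij by simp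
    finally show "ract char_mod (a \<otimes> b) $$ (i, j) = (ract char_mod a * ract char_mod b) $$ (i, j)"
      using ij a b by (simp add: char_mod_def char_mult power_mult_distrib)
  qed (auto simp: char_mod_def)
qed (auto simp: char_mod_def char_one intro!: eq_matI)

lemma res_ind [simp]: "res_mod (ind_mod U) = tensor_mod KG char_mod U"
  by (simp add: ind_mod_def)

lemma ind_rdim [simp]: "rdim (ind_mod U) = n * rdim U"
  by (simp add: ind_mod_def)

text \<open>The relation \<open>h y^l = \<chi>(h)^(-l) y^l h\<close>, read on the block of
  \<open>y^l\<close>.\<close>

lemma ind_act_block:
  assumes U: "is_module KG U" and h: "h \<in> carrier G" and l: "l < n"
  shows "ract (tensor_mod KG char_mod U) h * block_in n (rdim U) l = inverse (\<chi> h) ^ l \<cdot>\<^sub>m (block_in n (rdim U) l * ract U h)"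
proof -
  note dU = KG_moduleD[OF U]
  let ?c = "mat n 1 (\<lambda>(i, j). if i = l then 1 else 0) :: 'k mat"
  have dc: "dim_row (ract char_mod h) = n" "dim_col (ract char_mod h) = n" by (simp_all add: char_mod_def)
  have "ract char_mod h * ?c = inverse (\<chi> h) ^ l \<cdot>\<^sub>m ?c"
  proof (rule eq_matI)
    fix i j assume "i < dim_row (inverse (\<chi> h) ^ l \<cdot>\<^sub>m ?c)" "j < dim_col (inverse (\<chi> h) ^ l \<cdot>\<^sub>m ?c)"
    then have ij: "i < n" "j < 1" by auto
    then show "(ract char_mod h * ?c) $$ (i, j) = (inverse (\<chi> h) ^ l \<cdot>\<^sub>m ?c) $$ (i, j)"
      using l by (simp add: char_mod_def scalar_prod_def sum_delta_mult)
  qed (auto simp: dc)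
  then have "kron (ract char_mod h) (ract U h) * kron ?c (1\<^sub>m (rdim U)) = inverse (\<chi> h) ^ l \<cdot>\<^sub>m kron ?c (ract U h)"
    using h by (simp add: kron_mult dc dU kron_smult_left)
  moreover have "kron ?c (ract U h) = kron ?c (1\<^sub>m (rdim U)) * kron (1\<^sub>m 1) (ract U h)"
    using h by (subst kron_mult) (simp_all add: dU)
  ultimately show ?thesis
    using tensor_mod_KG[OF is_module_char_mod U h] by (simp add: block_in_def kron_one_left)
qed

lemma g_n_closed [simp]: "g [^] n \<in> carrier G"
  by (simp add: g_closed)

lemma g_n_central: "h \<in> carrier G \<Longrightarrow> g [^] n \<otimes> h = h \<otimes> g [^] n"
proof -
  assume h: "h \<in> carrier G"
  have "g [^] k \<otimes> h = h \<otimes> g [^] k" for k :: nat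
  proof (induction k)
    case (Suc k)
    have "g [^] Suc k \<otimes> h = g [^] k \<otimes> (h \<otimes> g)" using h by (simp add: m_assoc g_closed g_central)
    also have "\<dots> = (h \<otimes> g [^] k) \<otimes> g" using Suc h by (simp add: g_closed flip: m_assoc)
    also have "\<dots> = h \<otimes> g [^] Suc k" using h by (simp add: m_assoc g_closed)
    finally show ?case .
  qed (use h in simp)
  then show ?thesis .
qed

lemma char_g_n: "\<chi> (g [^] n) = 1"
proof -
  have "\<chi> (g [^] k) = \<chi> g ^ k" for k :: nat
    by (induction k) (simp_all add: char_one char_mult g_closed)
  then show ?thesis by (simp add: q_pow_n)
qed

lemma ind_y_dim [simp]: "dim_row (ind_y U) = n * rdim U" "dim_col (ind_y U) = n * rdim U"
  by (simp_all add: ind_y_def)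

lemma ind_y_block:
  assumes U: "is_module KG U" and l: "l < n"
  shows "ind_y U * block_in n (rdim U) l = (if Suc l < n then block_in n (rdim U) (Suc l)
     else block_in n (rdim U) 0 * (ract U (g [^] n) - 1\<^sub>m (rdim U)))"
  unfolding ind_y_def
  by (rule block_row_in[OF _ l]) (use KG_moduleD(2,3)[OF U, of "g [^] n"] in \<open>auto intro!: carrier_matI\<close>)

lemma ind_y_pow_block:
  assumes U: "is_module KG U" and l: "l < n"
  shows "mat_lpow (ind_y U) l * block_in n (rdim U) 0 = block_in n (rdim U) l"
  using l
proof (induction l)
  case (Suc l)
  have "mat_lpow (ind_y U) (Suc l) * block_in n (rdim U) 0 = ind_y U * block_in n (rdim U) l"
    using Suc by (simp add: mat_assoc)
  then show ?case using ind_y_block[OF U, of l] Suc.prems by simp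
qed simp

lemma is_module_ind:
  assumes U: "is_module KG U"
  shows "is_module H (ind_mod U)" "ya (ind_mod U) = ind_y U"
proof -
  let ?W = "tensor_mod KG char_mod U" and ?d = "rdim U" and ?Y = "ind_y U"
  let ?C = "ract U (g [^] n) - 1\<^sub>m ?d" and ?in = "\<lambda>l. block_in n ?d l :: 'k mat"
  note dU = KG_moduleD[OF U]
  have W: "is_module KG ?W" by (rule KG.is_module_tensor[OF is_module_char_mod U])
  note dW = KG_moduleD[OF W]
  have dC: "dim_row ?C = ?d" "dim_col ?C = ?d" by (simp_all add: dU)
  have comm: "?Y * ract ?W h = \<chi> h \<cdot>\<^sub>m (ract ?W h * ?Y)" if h: "h \<in> carrier G" for h
  proof (rule block_eqI[where n = n and d = ?d])
    note c0 = char_nonzero[OF h]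
    fix l assume l: "l < n"
    have "?Y * ract ?W h * ?in l = inverse (\<chi> h) ^ l \<cdot>\<^sub>m (?Y * ?in l * ract U h)"
      using h by (simp add: mat_assoc dW dU ind_act_block[OF U h l] mat_smult_right)
    also have "\<dots> = \<chi> h \<cdot>\<^sub>m (ract ?W h * (?Y * ?in l))"
    proof (cases "Suc l < n")
      case True
      then show ?thesis using c0
        by (simp add: ind_y_block[OF U l] ind_act_block[OF U h True] mat_smult_smult flip: mult.assoc)
    next
      case False
      then have n: "n = Suc l" using l by simp
      have CU: "?C * ract U h = ract U h * ?C"
        using h by (simp add: dU mat_diff_distrib_left mat_diff_distrib_right g_n_central)
      \<comment> \<open>At the return from the last block the twists are off by \<open>n\<close>
        powers of \<open>\<chi> h\<close>, which is where \<open>\<chi>^n = 1\<close>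
        enters.\<close>
      have ch: "inverse (\<chi> h) ^ l = \<chi> h"
        using char_pow_n[OF h] c0 by (simp add: n power_inverse field_simps)
      have n0: "0 < n" using n by simp
      have "ract ?W h * (?in 0 * ?C) = ?in 0 * (ract U h * ?C)"
        using ind_act_block[OF U h n0] h
          mat_absorb[OF ind_act_block[OF U h n0], of ?C] by (simp add: dW dU dC mat_smult_one mat_assoc)
      then show ?thesis using False h
        by (simp add: ind_y_block[OF U l] ch dU dC mat_assoc CU)
    qed
    finally show "?Y * ract ?W h * ?in l = \<chi> h \<cdot>\<^sub>m (ract ?W h * ?Y) * ?in l"
      using h by (simp add: mat_assoc dW mat_smult_left)
  qed (use h in \<open>auto simp: dW\<close>)
  have pow: "mat_lpow ?Y n = ract ?W (g [^] n) - 1\<^sub>m (rdim ?W)"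
  proof (rule block_eqI[where n = n and d = ?d])
    fix l assume l: "l < n"
    obtain m where m: "Suc m = n" using l by (cases n) auto
    then have mn: "m < n" "\<not> Suc m < n" by auto
    have "mat_lpow ?Y (Suc m) * ?in 0 = ?Y * ?in m"
      using ind_y_pow_block[OF U mn(1)] by (simp add: mat_assoc)
    then have n0: "mat_lpow ?Y n * ?in 0 = ?in 0 * ?C" using ind_y_block[OF U mn(1)] mn(2) unfolding m by simp
    \<comment> \<open>Block \<open>l\<close> is \<open>y^l\<close> applied to block 0, and powers of
      \<open>y\<close> commute; so the value of \<open>y^n\<close> on block 0 decides all
      blocks.\<close>
    have "mat_lpow ?Y n * ?in l = mat_lpow ?Y n * mat_lpow ?Y l * ?in 0"
      by (simp add: mat_assoc ind_y_pow_block[OF U l])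
    also have "mat_lpow ?Y n * mat_lpow ?Y l = mat_lpow ?Y l * mat_lpow ?Y n"
      by (simp add: add.commute flip: mat_lpow_add)
    also have "mat_lpow ?Y l * mat_lpow ?Y n * ?in 0 = ?in l * ?C"
      using mat_absorb[OF ind_y_pow_block[OF U l], of ?C] by (simp add: mat_assoc n0 dC)
    also have "\<dots> = (ract ?W (g [^] n) - 1\<^sub>m (rdim ?W)) * ?in l"
      using ind_act_block[OF U g_n_closed l]
      by (simp add: char_g_n mat_smult_one dU dW mat_diff_distrib_left mat_diff_distrib_right)
    finally show "mat_lpow ?Y n * ?in l = (ract ?W (g [^] n) - 1\<^sub>m (rdim ?W)) * ?in l" .
  qed (auto simp: dW)
  show "is_module H (ind_mod U)" "ya (ind_mod U) = ind_y U"
    unfolding ind_mod_def by (rule is_module_y_mod[OF W _ comm pow]; auto intro!: carrier_matI)+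
qed

lemma lpow_commute:
  assumes M: "is_module H M" and h: "h \<in> carrier G"
  shows "mat_lpow (ya M) l * ract M (0, h) = \<chi> h ^ l \<cdot>\<^sub>m (ract M (0, h) * mat_lpow (ya M) l)"
proof (induction l)
  case 0
  then show ?case using H_module_dims[OF M] h by (simp add: mat_smult_one)
next
  case (Suc l)
  note d = H_module_dims[OF M]
  have "mat_lpow (ya M) (Suc l) * ract M (0, h) = \<chi> h ^ l \<cdot>\<^sub>m (ya M * ract M (0, h) * mat_lpow (ya M) l)"
    using h by (simp add: mat_assoc d Suc mat_smult_right)
  then show ?case using h by (simp add: H_module_commute[OF M h] mat_smult_left mat_smult_smult d mat_assoc mult.commute)
qed

text \<open>The extension of a map \<open>T\<close> from \<open>U\<close> to \<open>M\<close> that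
  sends \<open>y^l\<close> tensor \<open>u\<close> to \<open>y^l T u\<close>; its values on block 0
  are those of \<open>T\<close>.\<close>

definition ind_map :: "(nat \<times> 'g, 'k) rep \<Rightarrow> nat \<Rightarrow> 'k mat \<Rightarrow> 'k mat" where
  "ind_map M d T = block_row n d (rdim M) (\<lambda>l. mat_lpow (ya M) l * T)"

lemma ind_map_block:
  assumes M: "is_module H M" and T: "T \<in> carrier_mat (rdim M) d" and l: "l < n"
  shows "ind_map M d T * block_in n d l = mat_lpow (ya M) l * T"
  unfolding ind_map_def by (rule block_row_in[OF _ l]) (use T H_module_dims[OF M] in \<open>auto intro!: carrier_matI\<close>)

text \<open>The existence half of Frobenius reciprocity. Compatibility with group elements holds
  blockwise by the twisted commutation of \<open>y^l\<close> with \<open>h\<close>.\<close>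

lemma ind_map_Hom:
  assumes M: "is_module H M" and U: "is_module KG U" and T: "T \<in> Hom_mod KG U (res_mod M)"
  shows "ind_map M (rdim U) T \<in> Hom_mod H (ind_mod U) M"
proof -
  let ?d = "rdim U" and ?W = "tensor_mod KG char_mod U" and ?P = "ind_map M (rdim U) T"
  let ?in = "\<lambda>l. block_in n ?d l :: 'k mat"
  note dM = H_module_dims[OF M] and dU = KG_moduleD[OF U]
  have W: "is_module KG ?W" by (rule KG.is_module_tensor[OF is_module_char_mod U])
  note dW = KG_moduleD[OF W]
  have Tc: "T \<in> carrier_mat (rdim M) ?d" and dT: "dim_row T = rdim M" "dim_col T = ?d"
    using Hom_modD(1-3)[OF T] by auto
  have dP: "dim_row ?P = rdim M" "dim_col ?P = n * ?d" by (simp_all add: ind_map_def)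
  have TU: "T * ract U h = ract M (0, h) * T" if "h \<in> carrier G" for h using Hom_modD(4)[OF T, of h] that by simp
  note Pin = ind_map_block[OF M Tc]
  have "?P \<in> Hom_mod KG ?W (res_mod M)"
  proof (rule Hom_modI)
    fix h assume "h \<in> hbasis (KG :: ('g, 'k) hopf_data)"
    then have h: "h \<in> carrier G" by simp
    show "?P * ract ?W h = ract (res_mod M) h * ?P"
    proof (rule block_eqI[where n = n and d = ?d])
      fix l assume l: "l < n"
      have "?P * ract ?W h * ?in l = inverse (\<chi> h) ^ l \<cdot>\<^sub>m (?P * ?in l * ract U h)"
        using h by (simp add: mat_assoc dP dW dU ind_act_block[OF U h l] mat_smult_right)
      also have "\<dots> = inverse (\<chi> h) ^ l \<cdot>\<^sub>m (mat_lpow (ya M) l * ract M (0, h) * T)"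
        using h by (simp add: Pin[OF l] mat_assoc dM dT dU TU)
      also have "\<dots> = ract M (0, h) * (?P * ?in l)"
        using h char_nonzero[OF h]
        by (simp add: lpow_commute[OF M h] Pin[OF l] mat_smult_left mat_smult_smult dM dT mat_assoc mat_smult_one flip: power_mult_distrib)
      finally show "?P * ract ?W h * ?in l = ract (res_mod M) h * ?P * ?in l"
        using h by (simp add: mat_assoc dP dM)
    qed (use h in \<open>auto simp: dP dW dM\<close>)
  qed (use dP in \<open>auto intro!: carrier_matI\<close>)
  moreover have "?P * ind_y U = ya M * ?P"
  proof (rule block_eqI[where n = n and d = ?d])
    fix l assume l: "l < n"
    have "?P * ind_y U * ?in l = ?P * (ind_y U * ?in l)" by (simp add: mat_assoc dP)
    also have "\<dots> = mat_lpow (ya M) (Suc l) * T"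
    proof (cases "Suc l < n")
      case True
      then show ?thesis using Pin[OF True] by (simp add: ind_y_block[OF U l])
    next
      \<comment> \<open>At the last block both sides are \<open>(g^n - 1) T\<close>: on the left by
        definition of \<open>ind_y\<close>, on the right by the relation for \<open>y^n\<close> in
        \<open>M\<close>.\<close>
      case False
      then have n: "Suc l = n" using l by simp
      have n0: "0 < n" using l by simp
      have "?P * (?in 0 * (ract U (g [^] n) - 1\<^sub>m ?d)) = T * (ract U (g [^] n) - 1\<^sub>m ?d)"
        using mat_absorb[OF Pin[OF n0], of "ract U (g [^] n) - 1\<^sub>m ?d"] by (simp add: dP dU dM dT)
      also have "\<dots> = mat_lpow (ya M) n * T"
        by (simp add: H_module_pow_n[OF M] mat_diff_distrib_left mat_diff_distrib_right dT dU dM TU)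
      finally show ?thesis using False n by (simp add: ind_y_block[OF U l] del: mat_lpow.simps)
    qed
    finally show "?P * ind_y U * ?in l = ya M * ?P * ?in l"
      by (simp add: mat_assoc dP dM dT Pin[OF l])
  qed (auto simp: dP dM)
  ultimately show ?thesis
    using Hom_H_iff[OF is_module_ind(1)[OF U] M] is_module_ind(2)[OF U] by simp
qed

end

section \<open>Reduction of modules modulo exact sequences\<close>

lemma block_row_col:
  assumes f: "\<And>l. l < n \<Longrightarrow> f l \<in> carrier_mat k d" and h: "\<And>l. l < n \<Longrightarrow> h l \<in> carrier_mat d j"
  shows "block_row n d k f * block_col n d j h = msum k j (\<lambda>l. f l * h l) {..<n}"
proof -
  have dh: "dim_row (h i) = d" "dim_col (h i) = j" if "i < n" for i using h[OF that] by auto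
  have "block_row n d k f * block_col n d j h = msum k j (\<lambda>l. block_row n d k f * (block_in n d l * h l)) {..<n}"
    unfolding block_col_def by (subst msum_mult_left) (auto simp: dh intro!: carrier_matI)
  also have "\<dots> = msum k j (\<lambda>l. f l * h l) {..<n}"
  proof (rule msum_cong[OF refl])
    fix l assume l: "l \<in> {..<n}"
    then show "block_row n d k f * (block_in n d l * h l) = f l * h l"
      using mat_absorb[OF block_row_in[where n = n and f = f and k = k and d = d and l = l, OF f], where Z = "h l"] by (auto simp: dh)
  qed
  finally show ?thesis .
qed

lemma mat_lpow_zero: "0 < k \<Longrightarrow> mat_lpow (0\<^sub>m d d) k = 0\<^sub>m d d"
  by (cases k) (simp_all add: mat_zero_simps)

context group_datum_hopf
begin

abbreviation "infl_mod W \<equiv> y_mod W (0\<^sub>m (rdim W) (rdim W))"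

lemma is_module_infl:
  assumes W: "is_module KG W" and "ract W (g [^] n) = 1\<^sub>m (rdim W)"
  shows "is_module H (infl_mod W)" "ya (infl_mod W) = 0\<^sub>m (rdim W) (rdim W)"
proof -
  have "0\<^sub>m (rdim W) (rdim W) * ract W h = \<chi> h \<cdot>\<^sub>m (ract W h * 0\<^sub>m (rdim W) (rdim W))" if "h \<in> carrier G" for h
    using KG_moduleD[OF W] that by (simp add: mat_zero_simps mat_smult_zero)
  moreover have "mat_lpow (0\<^sub>m (rdim W) (rdim W)) n = ract W (g [^] n) - 1\<^sub>m (rdim W)"
    unfolding assms(2) using n_ge_2 by (simp add: mat_lpow_zero mat_diff_self[of _ "rdim W" "rdim W"])
  ultimately show "is_module H (infl_mod W)" "ya (infl_mod W) = 0\<^sub>m (rdim W) (rdim W)"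
    using is_module_y_mod[OF W, of "0\<^sub>m (rdim W) (rdim W)"] by auto
qed

text \<open>Here \<open>y^n = 0\<close>, so a nonzero \<open>y\<close> has a kernel that is neither
  zero nor everything, and it is a submodule because \<open>y\<close> commutes with the group up to
  scalars. Both \<open>M\<close> and the module with \<open>y\<close> replaced by 0 are extensions
  of the corresponding pieces, to which the induction applies.\<close>

lemma infl_res_exact:
  assumes "is_module H M" "ract M (0, g [^] n) = 1\<^sub>m (rdim M)"
  shows "frag_of (iso_class H M) - frag_of (iso_class H (infl_mod (res_mod M))) \<in> exact_relations H"
  using assms
proof (induction "rdim M" arbitrary: M rule: less_induct)
  case less
  note M = less.prems(1) and gM = less.prems(2)
  note dM = H_module_dims[OF M]
  have infl: "is_module H (infl_mod (res_mod M))" if "is_module H M" "ract M (0, g [^] n) = 1\<^sub>m (rdim M)" for M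
    using is_module_infl(1)[OF H_module_res[OF that(1)]] that(2) by simp
  have yinfl: "ya (infl_mod (res_mod M)) = 0\<^sub>m (rdim M) (rdim M)" if "is_module H M" "ract M (0, g [^] n) = 1\<^sub>m (rdim M)" for M
    using is_module_infl(2)[OF H_module_res[OF that(1)]] that(2) by simp
  show ?case
  proof (cases "ya M = 0\<^sub>m (rdim M) (rdim M)")
    case True
    have "iso_mod H M (infl_mod (res_mod M))"
    proof (rule iso_mod_by_eq[OF M])
      fix a assume "a \<in> hbasis H"
      then obtain i h where a: "a = (i, h)" "i < n" "h \<in> carrier G" by (auto simp: basis_H)
      show "ract (infl_mod (res_mod M)) a = ract M a"
        unfolding a(1) H_module_act[OF M a(2,3)] True using a dM by (simp add: y_mod_def)
    qed simp
    from iso_class_eqI[OF M infl[OF M gM] this] show ?thesis using exact_closed(1) by simp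
  next
    case False
    let ?d = "rdim M" and ?Y = "ya M"
    have Yc: "?Y \<in> carrier_mat ?d ?d" using dM by (intro carrier_matI)
    obtain r B B' C C' where f: "B \<in> carrier_mat ?d r" "B' \<in> carrier_mat r ?d" "C \<in> carrier_mat r ?d"
      "C' \<in> carrier_mat ?d r" "?Y = B * C" "B' * B = 1\<^sub>m r" "C * C' = 1\<^sub>m r"
      using rank_factorization[OF Yc] by metis
    obtain k S' S where "lin_split r ?d k C' C S' S" using lin_split_inj[OF f(4,3,7)] by metis
    then have s: "lin_split k ?d r S S' C C'" by (rule lin_split_sym)
    note l = lin_splitD[OF s]
    have dB: "dim_row B = ?d" "dim_col B = r" "dim_row B' = r" "dim_col B' = ?d" using f by auto
    have YS: "?Y * S = 0\<^sub>m ?d k" unfolding f(5) using dB l(5-12) by (simp add: mat_assoc l(15) mat_zero_simps)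
    \<comment> \<open>\<open>C\<close> and \<open>y\<close> have the same kernel, so the splitting
      by \<open>C\<close> has the kernel of \<open>y\<close> as its submodule.\<close>
    have CB: "C = B' * ?Y" unfolding f(5) using l(5-12) dB by (simp add: mat_absorb[OF f(6)])
    have YhS: "?Y * (ract M (0, h) * S) = 0\<^sub>m ?d k" if h: "h \<in> carrier G" for h
    proof -
      have "?Y * (ract M (0, h) * S) = \<chi> h \<cdot>\<^sub>m (ract M (0, h) * (?Y * S))"
        using mat_absorb[OF H_module_commute[OF M h], of S] h dM l(5-12) by (simp add: mat_assoc mat_smult_left)
      then show ?thesis using h dM by (simp add: YS mat_zero_simps mat_smult_zero)
    qed
    have inv: "C * ract M a * S = 0\<^sub>m r k" if aH: "a \<in> hbasis H" for a
    proof -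
      obtain i h where a: "a = (i, h)" "i < n" "h \<in> carrier G" using aH by (auto simp: basis_H)
      have "C * ract M a * S = B' * (mat_lpow ?Y i * (?Y * (ract M (0, h) * S)))"
        unfolding a(1) H_module_act[OF M a(2,3)] CB
        using a dM dB l(5-12) by (simp add: mat_assoc mat_absorb[OF mat_lpow_comm[of ?Y i]])
      then show ?thesis using a dM dB by (simp add: YhS mat_zero_simps)
    qed
    obtain L Q where L: "is_module H L" "is_module H Q" "rdim L = k" "rdim Q = r" "S \<in> Hom_mod H L M" "C \<in> Hom_mod H M Q"
      and e: "short_exact H L M Q" using ex_sub_quotient[OF M s inv] by metis
    have gL: "ract L (0, g [^] n) = 1\<^sub>m (rdim L)"
    proof -
      have "S * ract L (0, g [^] n) = S" using Hom_modD(4)[OF L(5), of "(0, g [^] n)"] gM l(5-12) by simp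
      then have "S' * (S * ract L (0, g [^] n)) = 1\<^sub>m k" using l(13) by simp
      then show ?thesis using mat_absorb[OF l(13), of "ract L (0, g [^] n)"] l(5-12) H_module_dims(3,4)[OF L(1), of "g [^] n"] L(3) by simp
    qed
    have gQ: "ract Q (0, g [^] n) = 1\<^sub>m (rdim Q)"
    proof -
      have "ract Q (0, g [^] n) * C = C" using Hom_modD(4)[OF L(6), of "(0, g [^] n)"] gM l(5-12) by simp
      then have "ract Q (0, g [^] n) * C * C' = 1\<^sub>m r" using l(14) by simp
      then show ?thesis using l(5-12,14) H_module_dims(3,4)[OF L(2), of "g [^] n"] L(4) by (simp add: mat_assoc)
    qed
    have d: "?d = k + r" by (rule lin_split_dim[OF s])
    have r0: "r \<noteq> 0"
    proof
      assume "r = 0"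
      then have "?Y = 0\<^sub>m ?d ?d" unfolding f(5) using f(1,3) by (intro eq_matI) (auto simp: scalar_prod_def)
      then show False using False by simp
    qed
    have k0: "k \<noteq> 0"
    proof
      assume "k = 0"
      then have "S * S' = 0\<^sub>m ?d ?d" using l(1,2) by (intro eq_matI) (auto simp: scalar_prod_def)
      then have C'C: "C' * C = 1\<^sub>m ?d" using l(17) l(5-12) by (simp add: mat_add_zero_left)
      \<comment> \<open>A trivial kernel would make \<open>y\<close> left invertible. Cancelling
        \<open>y\<close> repeatedly, starting from \<open>y^n = 0\<close>, would then give
        \<open>y^0 = 0\<close>.\<close>
      have inverse: "C' * B' * ?Y = 1\<^sub>m ?d"
        using C'C dB l(5-12) dM by (simp add: mat_assoc flip: CB)
      have "mat_lpow ?Y j = 0\<^sub>m ?d ?d" if "j \<le> n" for j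
        using that
      proof (induction rule: inc_induct)
        case base
        show ?case using H_module_pow_n[OF M] gM by (simp add: mat_diff_self[of _ ?d ?d])
      next
        case (step j)
        have "mat_lpow ?Y j = C' * B' * (?Y * mat_lpow ?Y j)"
          using mat_absorb[OF inverse, of "mat_lpow ?Y j"] dM dB l(5-12) by simp
        also have "\<dots> = 0\<^sub>m ?d ?d" using step.IH l(5-12) dB by (simp add: mat_zero_simps)
        finally show ?case .
      qed
      from this[of 0] have "?d = 0" using dM by (simp add: one_mat_eq_zero_iff)
      then show False using d r0 by simp
    qed
    \<comment> \<open>The same matrices remain homomorphisms after \<open>y\<close> is replaced by
      0, which gives the parallel exact sequence.\<close>
    have hom: "T \<in> Hom_mod H (infl_mod (res_mod P)) (infl_mod (res_mod P'))"
      if "is_module H P" "is_module H P'" "ract P (0, g [^] n) = 1\<^sub>m (rdim P)" "ract P' (0, g [^] n) = 1\<^sub>m (rdim P')" "T \<in> Hom_mod H P P'"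
      for T P P'
      using Hom_H_iff[OF infl[OF that(1,3)] infl[OF that(2,4)]] res_Hom[OF that(1,2,5)] yinfl[OF that(1,3)] yinfl[OF that(2,4)]
        Hom_modD(2,3)[OF that(5)] by (simp add: mat_zero_simps)
    have "short_exact H (infl_mod (res_mod L)) (infl_mod (res_mod M)) (infl_mod (res_mod Q))"
      using short_exactI[OF hom[OF L(1) M gL gM L(5)] hom[OF M L(2) gM gQ L(6)]] s L(3,4) by simp
    note x = exact_relation[OF infl[OF L(1) gL] infl[OF M gM] infl[OF L(2) gQ] this]
    note y = exact_relation[OF L(1) M L(2) e]
    have IL: "frag_of (iso_class H L) - frag_of (iso_class H (infl_mod (res_mod L))) \<in> exact_relations H"
      by (rule less.hyps[OF _ L(1) gL]) (use d L(3) r0 in simp)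
    have IQ: "frag_of (iso_class H Q) - frag_of (iso_class H (infl_mod (res_mod Q))) \<in> exact_relations H"
      by (rule less.hyps[OF _ L(2) gQ]) (use d L(4) k0 in simp)
    from exact_closed(3)[OF exact_closed(4)[OF y x] exact_closed(3)[OF IL IQ]]
    show ?thesis by (simp add: algebra_simps)
  qed
qed

end

section \<open>Splitting a module by the eigenvalues of \<open>g\<close>\<close>

context group_datum_closed
begin

text \<open>For a function \<open>f\<close> with values 0 and 1, \<open>L\<close> is the sum of the
  eigenspaces of \<open>g\<close> on which \<open>f\<close> is 1, with inclusion \<open>S\<close>
  and projection \<open>S'\<close>.\<close>

definition idem_split :: "('g, 'k) rep \<Rightarrow> ('k \<Rightarrow> 'k) \<Rightarrow> ('g, 'k) rep \<Rightarrow> 'k mat \<Rightarrow> 'k mat \<Rightarrow> bool" where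
  "idem_split W f L S S' \<longleftrightarrow> is_module KG L \<and> S \<in> Hom_mod KG L W \<and> S' \<in> Hom_mod KG W L \<and>
     S' * S = 1\<^sub>m (rdim L) \<and> S * S' = g_fun W f"

lemma ex_idem_split:
  assumes W: "is_module KG W" and f: "\<And>x. f x * f x = f x"
  obtains L S S' where "idem_split W f L S S'"
proof -
  have "g_fun W f * g_fun W f = g_fun W f" by (simp add: g_fun_mult[OF W] f)
  from mod_split_idempotent[OF W g_fun_in_Hom[OF W] this] obtain L K S S' T T' where
    "is_module KG L" "is_module KG K" "mod_split KG L W K S S' T T'" "S * S' = g_fun W f" .
  then have "idem_split W f L S S'"
    unfolding idem_split_def mod_split_def by (auto dest: lin_splitD)
  then show thesis by (rule that)
qed

text \<open>Two modules with isomorphic restrictions can be split with literally the same pieces;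
  this is how \<open>exact_of_res_iso\<close> compares them.\<close>

lemma idem_split_transport:
  assumes W: "is_module KG W" and W': "is_module KG W'" and s: "idem_split W f L S S'"
    and T: "T \<in> Hom_mod KG W W'" and T': "T' \<in> Hom_mod KG W' W" and inv: "T' * T = 1\<^sub>m (rdim W)" "T * T' = 1\<^sub>m (rdim W')"
  shows "idem_split W' f L (T * S) (S' * T')"
proof -
  note s = s[unfolded idem_split_def]
  then have L: "is_module KG L" and S: "S \<in> Hom_mod KG L W" "S' \<in> Hom_mod KG W L" by auto
  note d = Hom_modD(2,3)[OF S(1)] Hom_modD(2,3)[OF S(2)] Hom_modD(2,3)[OF T] Hom_modD(2,3)[OF T']
  have "T * S * (S' * T') = T * (S * S') * T'" using d by (simp add: mat_assoc)
  also have "\<dots> = g_fun W' f * (T * T')" using s d by (simp add: g_fun_Hom[OF W W' T] mat_assoc)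
  finally have "T * S * (S' * T') = g_fun W' f" using inv by simp
  moreover have "S' * T' * (T * S) = 1\<^sub>m (rdim L)" using s d by (simp add: mat_assoc mat_absorb[OF inv(1)])
  ultimately show ?thesis unfolding idem_split_def
    using L Hom_mod_comp[OF L W W' S(1) T] Hom_mod_comp[OF W' W L T' S(2)] by simp
qed

text \<open>\<open>unip\<close> and \<open>nunip\<close> are the indicators of the eigenvalues of
  \<open>g\<close> where \<open>y^n = g^n - 1\<close> vanishes or is invertible;
  \<open>nunip_inv\<close> inverts \<open>x^n - 1\<close> on the latter and is 0 on the
  former.\<close>

definition unip :: "'k \<Rightarrow> 'k" where "unip x = (if x ^ n = 1 then 1 else 0)"
definition nunip :: "'k \<Rightarrow> 'k" where "nunip x = (if x ^ n = 1 then 0 else 1)"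
definition nunip_inv :: "'k \<Rightarrow> 'k" where "nunip_inv x = (if x ^ n = 1 then 0 else inverse (x ^ n - 1))"

text \<open>The indicator function of a set of representatives of the eigenvalues \<open>x\<close> of \<open>g\<close> with
  \<open>x\<^sup>n \<noteq> 1\<close> modulo multiplication by \<open>q\<close>; two eigenvalues are equivalent iff their \<open>n\<close>-th powers agree.\<close>

definition orbit_rep :: "'k \<Rightarrow> 'k" where
  "orbit_rep x = (if x ^ n \<noteq> 1 \<and> x = (SOME v. v ^ n = x ^ n) then 1 else 0)"

lemma q_pow_inj: "i < n \<Longrightarrow> j < n \<Longrightarrow> q ^ i = q ^ j \<Longrightarrow> i = j"
proof -
  have *: "\<not> i < j" if "i < n" "j < n" "q ^ i = q ^ j" for i j
  proof
    assume ij: "i < j"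
    then have "q ^ j = q ^ i * q ^ (j - i)" by (simp flip: power_add)
    then have "q ^ (j - i) = 1" using that(3) q_nonzero by simp
    then show False using q_order[of "j - i"] ij that(2) by simp
  qed
  show "i < n \<Longrightarrow> j < n \<Longrightarrow> q ^ i = q ^ j \<Longrightarrow> i = j" using *[of i j] *[of j i] by auto
qed

lemma q_scale_n: "(q ^ k * x) ^ n = x ^ n"
proof -
  have "(q ^ k) ^ n = 1" by (metis mult.commute power_mult power_one q_pow_n)
  then show ?thesis by (simp add: power_mult_distrib)
qed

lemma orbit_rep_unique:
  assumes "x \<noteq> 0" "q ^ k \<noteq> 1"
  shows "orbit_rep x * orbit_rep (q ^ k * x) = 0"
  using assms by (auto simp: orbit_rep_def q_scale_n)

lemma nth_roots_of_unity: "{v. v ^ n = 1} = (\<lambda>k. q ^ k) ` {..<n}"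
proof (rule sym, rule card_subset_eq)
  have n: "n > 0" using n_ge_2 by simp
  show "finite {v :: 'k. v ^ n = 1}" by (rule card_roots_of_unity(1)[OF n])
  show "(\<lambda>k. q ^ k) ` {..<n} \<subseteq> {v. v ^ n = 1}" using q_scale_n[of _ 1] by auto
  have "inj_on (\<lambda>k. q ^ k) {..<n}" using q_pow_inj by (auto intro!: inj_onI)
  then show "card ((\<lambda>k. q ^ k) ` {..<n}) = card {v :: 'k. v ^ n = 1}"
    using card_roots_of_unity(2)[OF n, where 'a = 'k] by (simp add: card_image)
qed

text \<open>The chosen representative \<open>v\<close> and \<open>x\<close> have the same
  \<open>n\<close>-th power, so \<open>v / x\<close> is a power of \<open>q\<close> with a unique
  exponent below \<open>n\<close>. Exactly one summand is therefore 1.\<close>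

lemma orbit_rep_sum:
  assumes x: "x \<noteq> 0"
  shows "(\<Sum>k<n. orbit_rep (q ^ k * x)) = nunip x"
proof (cases "x ^ n = 1")
  case True
  then show ?thesis by (simp add: orbit_rep_def nunip_def q_scale_n)
next
  case False
  define v where "v = (SOME v. v ^ n = x ^ n)"
  have v: "v ^ n = x ^ n" unfolding v_def by (rule someI[of _ x]) simp
  have "(v / x) ^ n = 1" using v x by (simp add: power_divide)
  then obtain k where k: "k < n" "v / x = q ^ k" using nth_roots_of_unity by auto
  then have vk: "v = q ^ k * x" using x by (simp add: field_simps)
  have "orbit_rep (q ^ i * x) = (if i = k then 1 else 0)" if "i < n" for i
  proof -
    have "q ^ i * x = v \<longleftrightarrow> i = k" using vk x q_pow_inj[OF that k(1)] by auto
    then show ?thesis using False by (simp add: orbit_rep_def q_scale_n flip: v_def)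
  qed
  then have "(\<Sum>i<n. orbit_rep (q ^ i * x)) = (\<Sum>i<n. if i = k then 1 else 0)" by (intro sum.cong) auto
  then show ?thesis using k False by (simp add: nunip_def)
qed

lemma q_scale: "(q * x) ^ n = x ^ n"
  using q_scale_n[of 1] by simp

lemma fun_simps:
  "unip x * unip x = unip x" "orbit_rep x * orbit_rep x = orbit_rep x" "nunip x * nunip x = nunip x"
  "unip (q * x) = unip x" "nunip (q * x) = nunip x" "nunip_inv (q * x) = nunip_inv x"
  "unip x * orbit_rep x = 0" "orbit_rep x * nunip x = orbit_rep x" "nunip x * unip x = 0" "unip x * nunip x = 0"
  "(x ^ n - 1) * nunip_inv x = nunip x" "nunip x + unip x = 1" "x ^ n * unip x = unip x"
  "nunip_inv x * orbit_rep x * (x ^ n - 1) = orbit_rep x"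
  by (simp_all add: unip_def nunip_def nunip_inv_def orbit_rep_def q_scale)

text \<open>The eigenspaces at orbit representatives form \<open>U\<close>; the map from the induced
  module that extends the inclusion of \<open>U\<close> is an isomorphism onto the part of
  \<open>M\<close> where \<open>y\<close> is invertible. The quotient is the part \<open>M0\<close>
  where \<open>g^n = 1\<close>, whose class is that of the module with \<open>y = 0\<close> by
  \<open>infl_res_exact\<close>.\<close>

lemma ind_infl_exact:
  assumes M: "is_module H M"
    and W0: "idem_split (res_mod M) unip W0 S0 P0" and U: "idem_split (res_mod M) orbit_rep U S P"
  shows "ract W0 (g [^] n) = 1\<^sub>m (rdim W0)"
    "frag_of (iso_class H M) - frag_of (iso_class H (ind_mod U)) - frag_of (iso_class H (infl_mod W0)) \<in> exact_relations H"
proof -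
  define W where "W = res_mod M"
  have W: "is_module KG W" unfolding W_def by (rule H_module_res[OF M])
  let ?d = "rdim M" and ?Y = "ya M"
  let ?E = "g_fun W"
  have rW: "rdim W = ?d" and aW: "ract W h = ract M (0, h)" for h by (simp_all add: W_def)
  note dM = H_module_dims[OF M]
  have W0': "is_module KG W0" "S0 \<in> Hom_mod KG W0 W" "P0 \<in> Hom_mod KG W W0" "P0 * S0 = 1\<^sub>m (rdim W0)" "S0 * P0 = ?E unip"
    using W0 unfolding idem_split_def W_def by auto
  have U': "is_module KG U" "S \<in> Hom_mod KG U W" "P \<in> Hom_mod KG W U" "P * S = 1\<^sub>m (rdim U)" "S * P = ?E orbit_rep"
    using U unfolding idem_split_def W_def by auto
  note d0 = Hom_modD(2,3)[OF W0'(2)] Hom_modD(2,3)[OF W0'(3)] Hom_modD(2,3)[OF U'(2)] Hom_modD(2,3)[OF U'(3)]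
  note d = d0[unfolded rW] dM(1,2)
  note dE = g_fun_dim(1,2)[of W, unfolded rW]
  have S0E: "?E unip * S0 = S0" unfolding W0'(5)[symmetric] using d by (simp add: mat_assoc W0'(4))
  have P0E: "P0 * ?E unip = P0" unfolding W0'(5)[symmetric] using d by (simp add: mat_absorb[OF W0'(4)])
  have SE: "?E orbit_rep * S = S" unfolding U'(5)[symmetric] using d by (simp add: mat_assoc U'(4))
  have PE: "P * ?E orbit_rep = P" unfolding U'(5)[symmetric] using d by (simp add: mat_absorb[OF U'(4)])
  note EE = g_fun_mult[OF W]
  have YE: "?Y * ?E f = ?E (\<lambda>x. f (q * x)) * ?Y" for f unfolding W_def by (rule g_fun_y[OF M])
  have Y0: "?Y * ?E unip = ?E unip * ?Y" and Y1: "?Y * ?E nunip = ?E nunip * ?Y"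
    and Yz: "?Y * ?E nunip_inv = ?E nunip_inv * ?Y"
    by (simp_all add: YE fun_simps)
  have gnE: "ract M (0, g [^] n) = ?E (\<lambda>x. x ^ n)" using g_fun_pow[OF W, of n] by (simp add: aW)
  have gn1: "ract M (0, g [^] n) - 1\<^sub>m ?d = ?E (\<lambda>x. x ^ n - 1)"
    unfolding gnE using g_fun_one[OF W] by (simp add: g_fun_diff rW)
  have g0: "ract W0 (g [^] n) = 1\<^sub>m (rdim W0)"
  proof -
    note dW0 = KG_moduleD[OF W0'(1)]
    have "ract W0 (g [^] n) = P0 * (S0 * ract W0 (g [^] n))"
      using mat_absorb[OF W0'(4), of "ract W0 (g [^] n)"] d dW0(2,3)[OF g_n_closed] by simp
    also have "S0 * ract W0 (g [^] n) = ?E (\<lambda>x. x ^ n) * S0"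
      using Hom_modD(4)[OF W0'(2), of "g [^] n"] by (simp add: aW gnE)
    also have "\<dots> = ?E (\<lambda>x. x ^ n) * (?E unip * S0)" by (simp add: S0E)
    also have "\<dots> = S0" using d dE mat_absorb[OF EE[of "\<lambda>x. x ^ n" unip], of S0] by (simp add: rW fun_simps S0E)
    finally show ?thesis by (simp add: W0'(4))
  qed
  then show "ract W0 (g [^] n) = 1\<^sub>m (rdim W0)" .
  \<comment> \<open>The compression of \<open>y\<close> to \<open>W0\<close>. It keeps the relations
    because \<open>y\<close> commutes with the projection for \<open>unip\<close>, which is
    invariant under multiplication of the eigenvalue by \<open>q\<close>.\<close>
  define M0 where "M0 = y_mod W0 (P0 * (?Y * S0))"
  have powM0: "mat_lpow (P0 * (?Y * S0)) k = P0 * (mat_lpow ?Y k * S0)" for k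
  proof (induction k)
    case 0
    then show ?case using d by (simp add: W0'(4))
  next
    case (Suc k)
    have "mat_lpow (P0 * (?Y * S0)) (Suc k) = P0 * (?Y * (S0 * P0 * (mat_lpow ?Y k * S0)))"
      using d by (simp add: Suc mat_assoc)
    also have "\<dots> = P0 * (?Y * ?E unip * (mat_lpow ?Y k * S0))"
      unfolding W0'(5) using d dE by (simp add: mat_assoc)
    also have "\<dots> = P0 * ?E unip * (?Y * (mat_lpow ?Y k * S0))"
      unfolding Y0 using d dE by (simp add: mat_assoc)
    finally show ?case using d by (simp add: P0E mat_assoc)
  qed
  have commM0: "P0 * (?Y * S0) * ract W0 h = \<chi> h \<cdot>\<^sub>m (ract W0 h * (P0 * (?Y * S0)))" if h: "h \<in> carrier G" for h
  proof -
    have 1: "S0 * ract W0 h = ract M (0, h) * S0" using Hom_modD(4)[OF W0'(2), of h] h by (simp add: aW)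
    have 2: "P0 * ract M (0, h) = ract W0 h * P0" using Hom_modD(4)[OF W0'(3), of h] h by (simp add: aW)
    note dh = dM(3,4)[OF h] KG_moduleD(2,3)[OF W0'(1) h]
    have "P0 * (?Y * S0) * ract W0 h = P0 * (?Y * ract M (0, h) * S0)" using d dh by (simp add: mat_assoc 1)
    also have "\<dots> = \<chi> h \<cdot>\<^sub>m (P0 * ract M (0, h) * (?Y * S0))"
      unfolding H_module_commute[OF M h] using d dh by (simp add: mat_assoc mat_smult_left mat_smult_right)
    finally show ?thesis unfolding 2 using d dh by (simp add: mat_assoc)
  qed
  have pown: "mat_lpow (P0 * (?Y * S0)) n = ract W0 (g [^] n) - 1\<^sub>m (rdim W0)"
  proof -
    have "S0 * ract W0 (g [^] n) = ract M (0, g [^] n) * S0" using Hom_modD(4)[OF W0'(2), of "g [^] n"] by (simp add: aW)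
    then have "ract M (0, g [^] n) * S0 = S0" using g0 d by simp
    then show ?thesis unfolding powM0 H_module_pow_n[OF M] g0
      using d dM(3,4)[OF g_n_closed] by (simp add: mat_diff_distrib_right mat_diff_self mat_zero_simps)
  qed
  have cM0: "P0 * (?Y * S0) \<in> carrier_mat (rdim W0) (rdim W0)" using d by (intro carrier_matI) simp_all
  have M0: "is_module H M0" "ya M0 = P0 * (?Y * S0)" "res_mod M0 = W0" "rdim M0 = rdim W0"
    unfolding M0_def using is_module_y_mod[OF W0'(1) cM0 commM0 pown] by simp_all
  have P0H: "P0 \<in> Hom_mod H M M0"
  proof -
    have "P0 * ?Y = P0 * ?E unip * ?Y" by (simp add: P0E)
    also have "\<dots> = P0 * (?Y * (S0 * P0))" using d dE by (simp add: mat_assoc W0'(5) Y0)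
    also have "\<dots> = ya M0 * P0" using d by (simp add: M0 mat_assoc)
    finally show ?thesis using Hom_H_iff[OF M M0(1)] W0'(3) by (simp add: M0 W_def)
  qed
  define m where "m = n - 1"
  have m: "n = Suc m" using n_ge_2 by (simp add: m_def)
  \<comment> \<open>On the part where \<open>g^n - 1\<close> is invertible this is
    \<open>y^(n-1) (g^n - 1)^(-1)\<close>, the inverse of \<open>y\<close> there; on the rest it is
    zero.\<close>
  define Z where "Z = mat_lpow ?Y m * ?E nunip_inv"
  have dZ: "dim_row Z = ?d" "dim_col Z = ?d" using d dE by (simp_all add: Z_def)
  have Yn: "mat_lpow ?Y n * ?E nunip_inv = ?E nunip"
    unfolding H_module_pow_n[OF M] gn1 by (simp add: EE fun_simps)
  have YZ: "?Y * Z = ?E nunip" using Yn d dE by (simp add: Z_def m mat_assoc)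
  have ZY: "Z * ?Y = ?E nunip"
  proof -
    have "Z * ?Y = mat_lpow ?Y m * ?Y * ?E nunip_inv" using d dE by (simp add: Z_def mat_assoc Yz)
    then show ?thesis using Yn d dE by (simp add: m mat_lpow_comm)
  qed
  have YkE: "mat_lpow ?Y k * ?E f = ?E (\<lambda>x. f (q ^ k * x)) * mat_lpow ?Y k" for k f
  proof (induction k arbitrary: f)
    case 0
    then show ?case using d dE by simp
  next
    case (Suc k)
    have "mat_lpow ?Y (Suc k) * ?E f = ?Y * ?E (\<lambda>x. f (q ^ k * x)) * mat_lpow ?Y k"
      using d dE by (simp add: mat_assoc Suc)
    then show ?case unfolding YE using d dE by (simp add: mat_assoc mult_ac)
  qed
  have ZE: "Z * ?E f = ?E (\<lambda>x. f (q ^ m * x)) * Z" for f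
  proof -
    have "Z * ?E f = mat_lpow ?Y m * (?E f * ?E nunip_inv)" using d dE by (simp add: Z_def mat_assoc EE mult.commute)
    also have "\<dots> = ?E (\<lambda>x. f (q ^ m * x)) * Z" using d dE mat_absorb[OF YkE[of m f], of "?E nunip_inv"] by (simp add: Z_def mat_assoc)
    finally show ?thesis .
  qed
  have ZkE: "mat_lpow Z k * ?E f = ?E (\<lambda>x. f (q ^ (m * k) * x)) * mat_lpow Z k" for k f
  proof (induction k arbitrary: f)
    case 0
    then show ?case using dZ dE by simp
  next
    case (Suc k)
    have "mat_lpow Z (Suc k) * ?E f = Z * ?E (\<lambda>x. f (q ^ (m * k) * x)) * mat_lpow Z k"
      using dZ dE by (simp add: mat_assoc Suc)
    then show ?case unfolding ZE using dZ dE by (simp add: mat_assoc power_add mult_ac)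
  qed
  have Yk1: "mat_lpow ?Y k * ?E f = ?E f * mat_lpow ?Y k" and Zk1: "mat_lpow Z k * ?E f = ?E f * mat_lpow Z k"
    if "f \<in> {unip, nunip}" for k f
  proof -
    have "(\<lambda>x. f (q ^ k * x)) = f" for k using that by (auto simp: unip_def nunip_def q_scale_n fun_eq_iff)
    then show "mat_lpow ?Y k * ?E f = ?E f * mat_lpow ?Y k" "mat_lpow Z k * ?E f = ?E f * mat_lpow Z k"
      unfolding YkE ZkE by simp_all
  qed
  have ZkYk: "mat_lpow Z k * (mat_lpow ?Y k * ?E nunip) = ?E nunip" for k
  proof (induction k)
    case 0
    then show ?case using d dZ dE by simp
  next
    case (Suc k)
    have "mat_lpow Z (Suc k) * (mat_lpow ?Y (Suc k) * ?E nunip) = mat_lpow Z k * (Z * ?Y) * (mat_lpow ?Y k * ?E nunip)"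
      using d dZ dE by (simp add: mat_assoc mat_absorb[OF mat_lpow_comm[of Z k]])
    also have "\<dots> = mat_lpow Z k * (?E nunip * mat_lpow ?Y k * ?E nunip)"
      unfolding ZY using d dZ dE by (simp add: mat_assoc)
    also have "?E nunip * mat_lpow ?Y k * ?E nunip = mat_lpow ?Y k * ?E nunip"
      using d dE by (simp add: mat_assoc mat_absorb[OF EE] rW fun_simps Yk1)
    finally show ?case using Suc by simp
  qed
  have YkZk: "mat_lpow ?Y k * (mat_lpow Z k * ?E nunip) = ?E nunip" for k
  proof (induction k)
    case 0
    then show ?case using d dZ dE by simp
  next
    case (Suc k)
    have "mat_lpow ?Y (Suc k) * (mat_lpow Z (Suc k) * ?E nunip) = mat_lpow ?Y k * (?Y * Z) * (mat_lpow Z k * ?E nunip)"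
      using d dZ dE by (simp add: mat_assoc mat_absorb[OF mat_lpow_comm[of ?Y k]])
    also have "\<dots> = mat_lpow ?Y k * (?E nunip * mat_lpow Z k * ?E nunip)"
      unfolding YZ using d dZ dE by (simp add: mat_assoc)
    also have "?E nunip * mat_lpow Z k * ?E nunip = mat_lpow Z k * ?E nunip"
      using dZ dE by (simp add: mat_assoc mat_absorb[OF EE] rW fun_simps Zk1)
    finally show ?case using Suc by simp
  qed
  let ?u = "rdim U"
  define \<Phi> where "\<Phi> = ind_map M ?u S"
  \<comment> \<open>The inverse of \<Phi>: to read the block of \<open>y^k\<close>, go back by the
    \<open>k\<close>-th power of the inverse of \<open>y\<close> and project to
    \<open>U\<close>.\<close>
  define \<Psi> where "\<Psi> = block_col n ?u ?d (\<lambda>k. P * mat_lpow Z k)"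
  have Sc: "S \<in> carrier_mat ?d ?u" using d by (intro carrier_matI)
  have \<Phi>H: "\<Phi> \<in> Hom_mod H (ind_mod U) M" unfolding \<Phi>_def using ind_map_Hom[OF M U'(1)] U'(2) by (simp add: W_def)
  have d\<Phi>: "dim_row \<Phi> = ?d" "dim_col \<Phi> = n * ?u" "dim_row \<Psi> = n * ?u" "dim_col \<Psi> = ?d"
    by (simp_all add: \<Phi>_def \<Psi>_def ind_map_def)
  have \<Phi>in: "\<Phi> * block_in n ?u l = mat_lpow ?Y l * S" if "l < n" for l
    unfolding \<Phi>_def by (rule ind_map_block[OF M Sc that])
  have pr\<Psi>: "block_pr n ?u l * \<Psi> = P * mat_lpow Z l" if "l < n" for l
    unfolding \<Psi>_def by (rule block_pr_col[OF _ that]) (use d dZ in \<open>auto intro!: carrier_matI\<close>)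
  have PZYS: "P * mat_lpow Z k * (mat_lpow ?Y l * S) = (if k = l then 1\<^sub>m ?u else 0\<^sub>m ?u ?u)" if kl: "k < n" "l < n" for k l
  proof (cases "k = l")
    case True
    have "?E nunip * S = ?E nunip * (?E orbit_rep * S)" by (simp add: SE)
    also have "\<dots> = S" using d dE mat_absorb[OF EE[of nunip orbit_rep], of S] by (simp add: rW fun_simps mult.commute[of "nunip _"] SE)
    finally have S1: "?E nunip * S = S" .
    have "P * mat_lpow Z k * (mat_lpow ?Y k * S) = P * (mat_lpow Z k * (mat_lpow ?Y k * ?E nunip)) * S"
      using d dZ dE by (simp add: mat_assoc S1)
    also have "\<dots> = P * S" using d dE by (simp add: ZkYk mat_assoc S1)
    finally show ?thesis using True U'(4) by simp
  next
    case False
    \<comment> \<open>As \<open>m = n - 1\<close>, this is \<open>q^(l - k)\<close>. The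
      off-diagonal block compares two members of one orbit that differ by this factor, and they
      cannot both be the representative.\<close>
    have qk: "q ^ (l + m * k) \<noteq> 1"
    proof
      assume "q ^ (l + m * k) = 1"
      then have "q ^ l * q ^ (m * k) * q ^ k = q ^ k" by (simp add: power_add)
      moreover have "q ^ (m * k) * q ^ k = 1"
        using q_pow_n by (simp add: m power_mult flip: power_mult_distrib power_Suc2)
      ultimately have "q ^ l = q ^ k" by (simp add: mult.assoc)
      then show False using q_pow_inj[OF kl] False by simp
    qed
    have "P * mat_lpow Z k * (mat_lpow ?Y l * S) = P * ?E orbit_rep * (mat_lpow Z k * (mat_lpow ?Y l * ?E orbit_rep)) * S"
      using d dZ dE by (simp add: mat_assoc SE PE)
    also have "mat_lpow Z k * (mat_lpow ?Y l * ?E orbit_rep) = mat_lpow Z k * ?E (\<lambda>x. orbit_rep (q ^ l * x)) * mat_lpow ?Y l"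
      using d dZ dE by (simp add: YkE mat_assoc)
    also have "\<dots> = ?E (\<lambda>x. orbit_rep (q ^ (l + m * k) * x)) * (mat_lpow Z k * mat_lpow ?Y l)"
      unfolding ZkE using d dZ dE by (simp add: mat_assoc power_add mult_ac)
    also have "P * ?E orbit_rep * (?E (\<lambda>x. orbit_rep (q ^ (l + m * k) * x)) * (mat_lpow Z k * mat_lpow ?Y l)) * S =
      P * (?E orbit_rep * ?E (\<lambda>x. orbit_rep (q ^ (l + m * k) * x))) * (mat_lpow Z k * mat_lpow ?Y l) * S"
      using d dZ dE by (simp add: mat_assoc)
    also have "?E orbit_rep * ?E (\<lambda>x. orbit_rep (q ^ (l + m * k) * x)) = ?E (\<lambda>x. 0)"
      unfolding EE by (rule g_fun_cong) (rule orbit_rep_unique[OF root_nonzero qk])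
    finally show ?thesis using False d dZ by (simp add: g_fun_zero rW mat_zero_simps)
  qed
  have \<Psi>\<Phi>: "\<Psi> * \<Phi> = 1\<^sub>m (n * ?u)"
  proof (rule block_eqI_left[where n = n and d = ?u])
    fix k assume k: "k < n"
    show "block_pr n ?u k * (\<Psi> * \<Phi>) = block_pr n ?u k * 1\<^sub>m (n * ?u)"
    proof (rule block_eqI[where n = n and d = ?u])
      fix l assume l: "l < n"
      have "block_pr n ?u k * (\<Psi> * \<Phi>) * block_in n ?u l = block_pr n ?u k * \<Psi> * (\<Phi> * block_in n ?u l)"
        using d\<Phi> by (simp add: mat_assoc)
      also have "\<dots> = (if k = l then 1\<^sub>m ?u else 0\<^sub>m ?u ?u)" unfolding pr\<Psi>[OF k] \<Phi>in[OF l] by (rule PZYS[OF k l])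
      finally show "block_pr n ?u k * (\<Psi> * \<Phi>) * block_in n ?u l = block_pr n ?u k * 1\<^sub>m (n * ?u) * block_in n ?u l"
        using block_pr_in[OF k l, of ?u, where 'a = 'k] by simp
    qed (use d\<Phi> in auto)
  qed (use d\<Phi> in auto)
  \<comment> \<open>The summand for \<open>l\<close> is the projection to the translate by
    \<open>q^(-l)\<close> of the representatives; together the translates exhaust all eigenvalues
    with \<open>x^n\<close> different from 1, each once.\<close>
  have \<Phi>\<Psi>: "\<Phi> * \<Psi> = ?E nunip"
  proof -
    have "\<Phi> * \<Psi> = msum ?d ?d (\<lambda>l. mat_lpow ?Y l * S * (P * mat_lpow Z l)) {..<n}"
      unfolding \<Phi>_def \<Psi>_def ind_map_def by (rule block_row_col) (use d dZ in \<open>auto intro!: carrier_matI\<close>)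
    also have "\<dots> = msum (rdim W) (rdim W) (\<lambda>l. ?E (\<lambda>x. orbit_rep (q ^ l * x))) {..<n}"
      unfolding rW
    proof (rule msum_cong[OF refl])
      fix l
      have "mat_lpow ?Y l * S * (P * mat_lpow Z l) = mat_lpow ?Y l * (S * P) * mat_lpow Z l"
        using d dZ by (simp add: mat_assoc)
      also have "S * P = ?E orbit_rep * ?E nunip" by (simp add: EE fun_simps U'(5))
      also have "mat_lpow ?Y l * (?E orbit_rep * ?E nunip) * mat_lpow Z l =
        ?E (\<lambda>x. orbit_rep (q ^ l * x)) * (mat_lpow ?Y l * (?E nunip * mat_lpow Z l))"
        using mat_absorb[OF YkE[of l orbit_rep], of "?E nunip * mat_lpow Z l"] d dZ dE by (simp add: mat_assoc)
      also have "mat_lpow ?Y l * (?E nunip * mat_lpow Z l) = ?E nunip"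
        using YkZk[of l] by (simp add: Zk1)
      also have "?E (\<lambda>x. orbit_rep (q ^ l * x)) * ?E nunip = ?E (\<lambda>x. orbit_rep (q ^ l * x))"
        unfolding EE by (rule g_fun_cong) (simp add: orbit_rep_def nunip_def q_scale_n)
      finally show "mat_lpow ?Y l * S * (P * mat_lpow Z l) = ?E (\<lambda>x. orbit_rep (q ^ l * x))" .
    qed
    also have "\<dots> = ?E nunip"
      unfolding g_fun_sum by (rule g_fun_cong) (rule orbit_rep_sum[OF root_nonzero])
    finally show ?thesis .
  qed
  have P0\<Phi>: "P0 * \<Phi> = 0\<^sub>m (rdim W0) (n * ?u)"
  proof (rule block_eqI[where n = n and d = ?u])
    fix l assume l: "l < n"
    have "P0 * \<Phi> * block_in n ?u l = P0 * ?E unip * (mat_lpow ?Y l * (?E orbit_rep * S))"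
      using d d\<Phi> by (simp add: mat_assoc \<Phi>in[OF l] SE P0E)
    also have "\<dots> = P0 * (?E unip * mat_lpow ?Y l) * (?E orbit_rep * S)" using d dE by (simp add: mat_assoc)
    also have "\<dots> = P0 * mat_lpow ?Y l * (?E unip * ?E orbit_rep) * S"
      using d dE by (simp add: mat_assoc mat_absorb[OF Yk1])
    finally show "P0 * \<Phi> * block_in n ?u l = 0\<^sub>m (rdim W0) (n * ?u) * block_in n ?u l"
      using d by (simp add: EE fun_simps g_fun_zero rW mat_zero_simps)
  qed (use d d\<Phi> in auto)
  have \<Psi>S0: "\<Psi> * S0 = 0\<^sub>m (n * ?u) (rdim W0)"
  proof (rule block_eqI_left[where n = n and d = ?u])
    fix l assume l: "l < n"
    have "block_pr n ?u l * (\<Psi> * S0) = P * ?E orbit_rep * (mat_lpow Z l * (?E unip * S0))"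
      using d d\<Phi> dZ mat_absorb[OF pr\<Psi>[OF l], of S0] by (simp add: mat_assoc S0E PE)
    also have "\<dots> = P * ?E orbit_rep * (mat_lpow Z l * ?E unip) * S0" using d dZ dE by (simp add: mat_assoc)
    also have "\<dots> = P * (?E unip * ?E orbit_rep) * mat_lpow Z l * S0"
      using d dZ dE by (simp add: mat_assoc Zk1 mat_absorb[OF EE] rW mult.commute)
    finally show "block_pr n ?u l * (\<Psi> * S0) = block_pr n ?u l * 0\<^sub>m (n * ?u) (rdim W0)"
      using d dZ by (simp add: EE fun_simps g_fun_zero rW mat_zero_simps)
  qed (use d d\<Phi> in auto)
  have "\<Phi> * \<Psi> + S0 * P0 = 1\<^sub>m ?d"
    unfolding \<Phi>\<Psi> W0'(5) using g_fun_one[OF W] by (simp add: fun_simps rW flip: g_fun_add)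
  then have "lin_split (n * ?u) ?d (rdim W0) \<Phi> \<Psi> P0 S0"
    unfolding lin_split_def using d d\<Phi> \<Psi>\<Phi> W0'(4) P0\<Phi> \<Psi>S0 by (auto intro!: carrier_matI)
  then have "short_exact H (ind_mod U) M M0"
    using short_exactI[OF \<Phi>H P0H] M0(4) by simp
  note 1 = exact_relation[OF is_module_ind(1)[OF U'(1)] M M0(1) this]
  have "ract M0 (0, g [^] n) = ract (res_mod M0) (g [^] n)" by simp
  then have 2: "frag_of (iso_class H M0) - frag_of (iso_class H (infl_mod W0)) \<in> exact_relations H"
    using infl_res_exact[OF M0(1)] g0 by (simp only: M0(3,4))
  from exact_closed(3)[OF 1 2]
  show "frag_of (iso_class H M) - frag_of (iso_class H (ind_mod U)) - frag_of (iso_class H (infl_mod W0)) \<in> exact_relations H"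
    by (simp add: algebra_simps)
qed

text \<open>\<open>g^n - 1\<close> is inverted on \<open>U\<close> by the compression of the
  function \<open>nunip_inv\<close> of \<open>g\<close>. Every simple constituent of
  \<open>U\<close> thus has a scalar other than 1 and belongs to the second kind of
  generators.\<close>

lemma idem_split_nonunipotent:
  assumes W: "is_module KG W" and U: "idem_split W orbit_rep U S P"
  obtains Q where "Q \<in> carrier_mat (rdim U) (rdim U)" "Q * (ract U (g [^] n) - 1\<^sub>m (rdim U)) = 1\<^sub>m (rdim U)"
    "(ract U (g [^] n) - 1\<^sub>m (rdim U)) * Q = 1\<^sub>m (rdim U)"
proof -
  have U': "is_module KG U" "S \<in> Hom_mod KG U W" "P \<in> Hom_mod KG W U" "P * S = 1\<^sub>m (rdim U)" "S * P = g_fun W orbit_rep"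
    using U unfolding idem_split_def by auto
  let ?E = "g_fun W" and ?C = "ract U (g [^] n) - 1\<^sub>m (rdim U)"
  note d = Hom_modD(2,3)[OF U'(2)] Hom_modD(2,3)[OF U'(3)] KG_moduleD(2,3)[OF U'(1) g_n_closed] KG_moduleD(2,3)[OF W g_n_closed]
  note EE = g_fun_mult[OF W]
  have gn1: "ract W (g [^] n) - 1\<^sub>m (rdim W) = ?E (\<lambda>x. x ^ n - 1)"
    unfolding g_fun_pow[OF W] using g_fun_one[OF W] by (simp add: g_fun_diff)
  have SC: "S * ?C = ?E (\<lambda>x. x ^ n - 1) * S"
    unfolding gn1[symmetric] using d Hom_modD(4)[OF U'(2), of "g [^] n"]
    by (simp add: mat_diff_distrib_left mat_diff_distrib_right)
  have PC: "P * ?E (\<lambda>x. x ^ n - 1) = ?C * P"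
    unfolding gn1[symmetric] using d Hom_modD(4)[OF U'(3), of "g [^] n"]
    by (simp add: mat_diff_distrib_left mat_diff_distrib_right)
  have SE: "?E orbit_rep * S = S" unfolding U'(5)[symmetric] using d by (simp add: mat_assoc U'(4))
  define Q where "Q = P * (?E nunip_inv * S)"
  have r: "nunip_inv x * (x ^ n - 1) * orbit_rep x = orbit_rep x" "(x ^ n - 1) * nunip_inv x * orbit_rep x = orbit_rep x" for x
    by (simp_all add: nunip_inv_def orbit_rep_def)
  have "Q * ?C = P * (?E nunip_inv * (S * ?C))" using d by (simp add: Q_def mat_assoc)
  also have "\<dots> = P * (?E nunip_inv * (?E (\<lambda>x. x ^ n - 1) * (?E orbit_rep * S)))" unfolding SC SE ..
  also have "\<dots> = P * (?E nunip_inv * ?E (\<lambda>x. x ^ n - 1) * ?E orbit_rep * S)" using d by (simp add: mat_assoc)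
  also have "\<dots> = P * S" unfolding EE r SE ..
  finally have 1: "Q * ?C = 1\<^sub>m (rdim U)" using U'(4) by simp
  have "?C * Q = ?C * P * (?E nunip_inv * S)" using d by (simp add: Q_def mat_assoc)
  also have "\<dots> = P * ?E (\<lambda>x. x ^ n - 1) * (?E nunip_inv * (?E orbit_rep * S))" unfolding PC SE ..
  also have "\<dots> = P * (?E (\<lambda>x. x ^ n - 1) * ?E nunip_inv * ?E orbit_rep * S)" using d by (simp add: mat_assoc)
  also have "\<dots> = P * S" unfolding EE r SE ..
  finally have 2: "?C * Q = 1\<^sub>m (rdim U)" using U'(4) by simp
  have "Q \<in> carrier_mat (rdim U) (rdim U)" using d by (intro carrier_matI) (simp_all add: Q_def)
  then show thesis using 1 2 by (rule that)
qed

text \<open>The pieces \<open>W0\<close> and \<open>U\<close> are cut out by functions of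
  \<open>g\<close> alone, so they depend only on the restriction, and both classes reduce to the
  same sum.\<close>

lemma exact_of_res_iso:
  assumes M: "is_module H M" and M': "is_module H M'" and iso: "iso_mod KG (res_mod M) (res_mod M')"
  shows "frag_of (iso_class H M) - frag_of (iso_class H M') \<in> exact_relations H"
proof -
  note rM = H_module_res[OF M] and rM' = H_module_res[OF M']
  obtain T T' where T: "T \<in> Hom_mod KG (res_mod M) (res_mod M')" "T' \<in> Hom_mod KG (res_mod M') (res_mod M)"
    "T' * T = 1\<^sub>m (rdim (res_mod M))" "T * T' = 1\<^sub>m (rdim (res_mod M'))"
    using iso unfolding iso_mod_def by auto
  obtain W0 S0 P0 where W0: "idem_split (res_mod M) unip W0 S0 P0" using ex_idem_split[OF rM fun_simps(1)] .
  obtain U S P where U: "idem_split (res_mod M) orbit_rep U S P" using ex_idem_split[OF rM fun_simps(2)] .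
  note 1 = ind_infl_exact(2)[OF M W0 U]
  note 2 = ind_infl_exact(2)[OF M' idem_split_transport[OF rM rM' W0 T] idem_split_transport[OF rM rM' U T]]
  from exact_closed(4)[OF 1 2] show ?thesis by simp
qed

end

section \<open>Dual modules\<close>

lemma sum_rotate: "(\<Sum>s\<in>A. \<Sum>q\<in>B. \<Sum>r\<in>C. f s q r) = (\<Sum>q\<in>B. \<Sum>r\<in>C. \<Sum>s\<in>A. f s q r :: 'a::comm_monoid_add)"
  by (subst sum.swap, rule sum.cong[OF refl], rule sum.swap)

lemma mat_mult_entry:
  "i < dim_row A \<Longrightarrow> j < dim_col B \<Longrightarrow> dim_col A = d \<Longrightarrow> dim_row B = d \<Longrightarrow> (A * B) $$ (i, j) = (\<Sum>k<d. A $$ (i, k) * B $$ (k, j))"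
  by (simp add: scalar_prod_def atLeast0LessThan)

context hopf_algebra
begin

lemma coassoc_sum:
  assumes a: "a \<in> hbasis A"
  shows "(\<Sum>s\<in>hbasis A. \<Sum>r\<in>hbasis A. hcomult A a (s, r) * (\<Sum>p\<in>hbasis A. \<Sum>q\<in>hbasis A. hcomult A s (p, q) * f p q r)) =
    (\<Sum>p\<in>hbasis A. \<Sum>s\<in>hbasis A. hcomult A a (p, s) * (\<Sum>q\<in>hbasis A. \<Sum>r\<in>hbasis A. hcomult A s (q, r) * f p q r))"
proof -
  have "(\<Sum>s\<in>hbasis A. \<Sum>r\<in>hbasis A. hcomult A a (s, r) * (\<Sum>p\<in>hbasis A. \<Sum>q\<in>hbasis A. hcomult A s (p, q) * f p q r)) =
    (\<Sum>r\<in>hbasis A. \<Sum>s\<in>hbasis A. \<Sum>p\<in>hbasis A. \<Sum>q\<in>hbasis A. hcomult A a (s, r) * hcomult A s (p, q) * f p q r)"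
    by (subst sum.swap) (simp only: sum_distrib_left mult.assoc)
  also have "\<dots> = (\<Sum>r\<in>hbasis A. \<Sum>p\<in>hbasis A. \<Sum>q\<in>hbasis A. (\<Sum>s\<in>hbasis A. hcomult A a (s, r) * hcomult A s (p, q)) * f p q r)"
    by (rule sum.cong[OF refl], simp only: sum_distrib_right, rule sum_rotate)
  also have "\<dots> = (\<Sum>r\<in>hbasis A. \<Sum>p\<in>hbasis A. \<Sum>q\<in>hbasis A. (\<Sum>s\<in>hbasis A. hcomult A a (p, s) * hcomult A s (q, r)) * f p q r)"
    by (intro sum.cong refl) (simp only: comult_coassoc[OF a])
  also have "\<dots> = (\<Sum>p\<in>hbasis A. \<Sum>q\<in>hbasis A. \<Sum>r\<in>hbasis A. \<Sum>s\<in>hbasis A. hcomult A a (p, s) * hcomult A s (q, r) * f p q r)"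
    by (subst sum_rotate) (simp only: sum_distrib_right)
  also have "\<dots> = (\<Sum>p\<in>hbasis A. \<Sum>s\<in>hbasis A. \<Sum>q\<in>hbasis A. \<Sum>r\<in>hbasis A. hcomult A a (p, s) * hcomult A s (q, r) * f p q r)"
    by (rule sum.cong[OF refl]) (rule sum_rotate[symmetric])
  finally show ?thesis by (simp only: sum_distrib_left mult.assoc)
qed

text \<open>The usual argument \<open>T = (R S) T = R (S T) = R\<close> in the convolution algebra
  of families of matrices, where coassociativity is the associative law.\<close>

lemma convolution_inverse_unique:
  assumes dims: "\<And>b. b \<in> hbasis A \<Longrightarrow> R b \<in> carrier_mat d d" "\<And>b. b \<in> hbasis A \<Longrightarrow> S b \<in> carrier_mat d d"
      "\<And>b. b \<in> hbasis A \<Longrightarrow> T b \<in> carrier_mat d d"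
    and RS: "\<And>b i j. b \<in> hbasis A \<Longrightarrow> i < d \<Longrightarrow> j < d \<Longrightarrow>
      (\<Sum>p\<in>hbasis A. \<Sum>q\<in>hbasis A. hcomult A b (p, q) * (R p * S q) $$ (i, j)) = (if i = j then hcounit A b else 0)"
    and ST: "\<And>b i j. b \<in> hbasis A \<Longrightarrow> i < d \<Longrightarrow> j < d \<Longrightarrow>
      (\<Sum>p\<in>hbasis A. \<Sum>q\<in>hbasis A. hcomult A b (p, q) * (S p * T q) $$ (i, j)) = (if i = j then hcounit A b else 0)"
    and a: "a \<in> hbasis A"
  shows "R a = T a"
proof (rule eq_matI)
  fix i j assume "i < dim_row (T a)" "j < dim_col (T a)"
  then have ij: "i < d" "j < d" using dims(3)[OF a] by auto
  have dR: "dim_row (R b) = d" "dim_col (R b) = d" "dim_row (S b) = d" "dim_col (S b) = d" "dim_row (T b) = d" "dim_col (T b) = d"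
    if "b \<in> hbasis A" for b using dims[OF that] by auto
  define f where "f p q r = (R p * S q * T r) $$ (i, j)" for p q r
  have f1: "f p q r = (\<Sum>k<d. (R p * S q) $$ (i, k) * T r $$ (k, j))"
    and f2: "f p q r = (\<Sum>k<d. R p $$ (i, k) * (S q * T r) $$ (k, j))"
    if "p \<in> hbasis A" "q \<in> hbasis A" "r \<in> hbasis A" for p q r
  proof -
    show "f p q r = (\<Sum>k<d. (R p * S q) $$ (i, k) * T r $$ (k, j))"
      unfolding f_def by (rule mat_mult_entry) (use dR that ij in simp_all)
    have "f p q r = (R p * (S q * T r)) $$ (i, j)" unfolding f_def using dR that by (simp add: mat_assoc)
    then show "f p q r = (\<Sum>k<d. R p $$ (i, k) * (S q * T r) $$ (k, j))"
      using mat_mult_entry[of i "R p" j "S q * T r" d] dR that ij by simp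
  qed
  have 1: "(\<Sum>p\<in>hbasis A. \<Sum>q\<in>hbasis A. hcomult A s (p, q) * f p q r) = hcounit A s * T r $$ (i, j)"
    if s: "s \<in> hbasis A" and r: "r \<in> hbasis A" for s r
  proof -
    have "(\<Sum>p\<in>hbasis A. \<Sum>q\<in>hbasis A. hcomult A s (p, q) * f p q r) =
      (\<Sum>p\<in>hbasis A. \<Sum>q\<in>hbasis A. \<Sum>k<d. hcomult A s (p, q) * (R p * S q) $$ (i, k) * T r $$ (k, j))"
      by (intro sum.cong refl) (simp add: f1 r sum_distrib_left mult.assoc)
    also have "\<dots> = (\<Sum>k<d. (\<Sum>p\<in>hbasis A. \<Sum>q\<in>hbasis A. hcomult A s (p, q) * (R p * S q) $$ (i, k)) * T r $$ (k, j))"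
      by (subst sum_rotate[symmetric]) (simp only: sum_distrib_right)
    also have "\<dots> = (\<Sum>k<d. (if i = k then hcounit A s else 0) * T r $$ (k, j))"
      by (intro sum.cong refl) (simp only: RS[OF s ij(1)] lessThan_iff)
    also have "\<dots> = (\<Sum>k<d. if k = i then hcounit A s * T r $$ (k, j) else 0)" by (intro sum.cong) auto
    finally show ?thesis using ij by simp
  qed
  have 2: "(\<Sum>q\<in>hbasis A. \<Sum>r\<in>hbasis A. hcomult A s (q, r) * f p q r) = hcounit A s * R p $$ (i, j)"
    if s: "s \<in> hbasis A" and p: "p \<in> hbasis A" for s p
  proof -
    have "(\<Sum>q\<in>hbasis A. \<Sum>r\<in>hbasis A. hcomult A s (q, r) * f p q r) =
      (\<Sum>q\<in>hbasis A. \<Sum>r\<in>hbasis A. \<Sum>k<d. R p $$ (i, k) * (hcomult A s (q, r) * (S q * T r) $$ (k, j)))"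
      by (intro sum.cong refl) (simp add: f2 p sum_distrib_left mult.left_commute)
    also have "\<dots> = (\<Sum>k<d. R p $$ (i, k) * (\<Sum>q\<in>hbasis A. \<Sum>r\<in>hbasis A. hcomult A s (q, r) * (S q * T r) $$ (k, j)))"
      by (subst sum_rotate[symmetric]) (simp only: sum_distrib_left)
    also have "\<dots> = (\<Sum>k<d. R p $$ (i, k) * (if k = j then hcounit A s else 0))"
      by (intro sum.cong refl) (simp only: ST[OF s _ ij(2)] lessThan_iff)
    also have "\<dots> = (\<Sum>k<d. if k = j then hcounit A s * R p $$ (i, k) else 0)" by (intro sum.cong) auto
    finally show ?thesis using ij by simp
  qed
  have "T a $$ (i, j) = (\<Sum>r\<in>hbasis A. (\<Sum>s\<in>hbasis A. hcounit A s * hcomult A a (s, r)) * T r $$ (i, j))"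
    by (simp add: counit_left[OF a] sum_bvec(1)[OF finite_basis a] cong: sum.cong)
  also have "\<dots> = (\<Sum>s\<in>hbasis A. \<Sum>r\<in>hbasis A. hcomult A a (s, r) * (hcounit A s * T r $$ (i, j)))"
    by (subst sum.swap) (simp add: sum_distrib_right sum_distrib_left mult_ac)
  also have "\<dots> = (\<Sum>s\<in>hbasis A. \<Sum>r\<in>hbasis A. hcomult A a (s, r) * (\<Sum>p\<in>hbasis A. \<Sum>q\<in>hbasis A. hcomult A s (p, q) * f p q r))"
    by (intro sum.cong refl) (simp add: 1)
  also have "\<dots> = (\<Sum>p\<in>hbasis A. \<Sum>s\<in>hbasis A. hcomult A a (p, s) * (\<Sum>q\<in>hbasis A. \<Sum>r\<in>hbasis A. hcomult A s (q, r) * f p q r))"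
    by (rule coassoc_sum[OF a])
  also have "\<dots> = (\<Sum>p\<in>hbasis A. \<Sum>s\<in>hbasis A. hcomult A a (p, s) * (hcounit A s * R p $$ (i, j)))"
    by (intro sum.cong refl) (simp add: 2)
  also have "\<dots> = (\<Sum>p\<in>hbasis A. (\<Sum>s\<in>hbasis A. hcomult A a (p, s) * hcounit A s) * R p $$ (i, j))"
    by (simp add: sum_distrib_right sum_distrib_left mult_ac)
  also have "\<dots> = R a $$ (i, j)"
    by (simp add: counit_right[OF a] sum_bvec(1)[OF finite_basis a] cong: sum.cong)
  finally show "R a $$ (i, j) = T a $$ (i, j)" ..
qed (use dims(1,3)[OF a] in auto)

text \<open>The antipode axiom read in a module: the action composed with the antipode is a left
  convolution inverse of the action.\<close>

lemma antipode_act: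
  assumes M: "is_module A M" and b: "b \<in> hbasis A" and ij: "i < rdim M" "j < rdim M"
  shows "(\<Sum>p\<in>hbasis A. \<Sum>q\<in>hbasis A. hcomult A b (p, q) * (act_elt A M (hantipode A p) * ract M q) $$ (i, j)) =
    (if i = j then hcounit A b else 0)"
proof -
  have u: "act_elt A M (hunit A) = 1\<^sub>m (rdim M)" using M by (simp add: is_module_def)
  have "(act_elt A M (hantipode A p) * ract M q) $$ (i, j) = (\<Sum>c\<in>hbasis A. prod_elt A (hantipode A p) (bvec q) c * ract M c $$ (i, j))"
    if "q \<in> hbasis A" for p q
    using act_elt_mult[OF M, of "hantipode A p" "bvec q"] act_elt_bvec[OF finite_basis that] M that ij
    by (simp add: is_module_def flip: act_elt_index)
  then have "(\<Sum>p\<in>hbasis A. \<Sum>q\<in>hbasis A. hcomult A b (p, q) * (act_elt A M (hantipode A p) * ract M q) $$ (i, j)) =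
    (\<Sum>p\<in>hbasis A. \<Sum>q\<in>hbasis A. \<Sum>c\<in>hbasis A. hcomult A b (p, q) * prod_elt A (hantipode A p) (bvec q) c * ract M c $$ (i, j))"
    by (intro sum.cong refl) (simp add: sum_distrib_left mult.assoc)
  also have "\<dots> = (\<Sum>c\<in>hbasis A. (\<Sum>p\<in>hbasis A. \<Sum>q\<in>hbasis A. hcomult A b (p, q) * prod_elt A (hantipode A p) (bvec q) c) * ract M c $$ (i, j))"
    by (subst sum_rotate[symmetric]) (simp only: sum_distrib_right)
  also have "\<dots> = (\<Sum>c\<in>hbasis A. (hcounit A b * hunit A c) * ract M c $$ (i, j))"
    using fun_cong[OF antipode_left[OF b]] by simp
  also have "\<dots> = hcounit A b * act_elt A M (hunit A) $$ (i, j)"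
    using ij by (simp add: act_elt_index sum_distrib_left mult.assoc)
  finally show ?thesis unfolding u using ij by simp
qed

end

text \<open>The column of all entries of \<open>C\<close>, ordered like the basis of a tensor product.\<close>

definition vec_mat :: "'a mat \<Rightarrow> 'a mat" where
  "vec_mat C = mat (dim_row C * dim_col C) 1 (\<lambda>(i, _). C $$ (i div dim_col C, i mod dim_col C))"

lemma vec_mat_dim [simp]: "dim_row (vec_mat C) = dim_row C * dim_col C" "dim_col (vec_mat C) = 1"
  by (simp_all add: vec_mat_def)

lemma vec_mat_index: "i < d \<Longrightarrow> j < e \<Longrightarrow> C \<in> carrier_mat d e \<Longrightarrow> vec_mat C $$ (i * e + j, 0) = C $$ (i, j)"
proof -
  assume *: "i < d" "j < e" "C \<in> carrier_mat d e"
  then have "i * e + j < d * e" using add_mult_distrib[of i 1 e] mult_le_mono1[of "Suc i" d e] by simp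
  then show ?thesis using * by (simp add: vec_mat_def)
qed

lemma kron_vec_mat:
  assumes "A \<in> carrier_mat d d" "B \<in> carrier_mat d d" "C \<in> carrier_mat d (d::nat)"
  shows "kron A B * vec_mat C = vec_mat (A * C * transpose_mat (B :: 'a::comm_semiring_1 mat))"
proof (rule eq_matI)
  have d: "dim_row A = d" "dim_col A = d" "dim_row B = d" "dim_col B = d" "dim_row C = d" "dim_col C = d" using assms by auto
  fix i j assume "i < dim_row (vec_mat (A * C * transpose_mat B))" "j < dim_col (vec_mat (A * C * transpose_mat B))"
  then have i: "i < d * d" and j: "j = 0" using d by auto
  note b = div_mod_bounds[OF i]
  have "(kron A B * vec_mat C) $$ (i, 0) = (\<Sum>k<d * d. A $$ (i div d, k div d) * B $$ (i mod d, k mod d) * C $$ (k div d, k mod d))"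
    using i d by (subst mat_mult_entry[where d = "d * d"]) (auto intro!: sum.cong simp: kron_index vec_mat_def)
  also have "\<dots> = (\<Sum>p<d. \<Sum>q<d. A $$ (i div d, p) * B $$ (i mod d, q) * C $$ (p, q))"
    by (rule sum_div_mod)
  also have "\<dots> = (\<Sum>q<d. (\<Sum>p<d. A $$ (i div d, p) * C $$ (p, q)) * B $$ (i mod d, q))"
    by (subst sum.swap) (simp add: sum_distrib_right sum_distrib_left mult_ac)
  also have "\<dots> = (A * C * transpose_mat B) $$ (i div d, i mod d)"
    using b d by (subst mat_mult_entry[where d = d]) (auto intro!: sum.cong simp: scalar_prod_def atLeast0LessThan)
  finally show "(kron A B * vec_mat C) $$ (i, j) = vec_mat (A * C * transpose_mat B) $$ (i, j)"
    using i j d by (simp add: vec_mat_def)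
qed (use assms in auto)

text \<open>Invariance of the canonical element, the sum of all \<open>e_i\<close> tensor
  \<open>e_i\<close>, says that the transposed action of \<open>P\<close> is a right convolution
  inverse of the action of \<open>M\<close>. A candidate for the dual can thus be recognised by an
  invariance property that is testable on generators.\<close>

lemma invariant_entries:
  assumes "hopf_algebra A" and M: "is_module A M" and P: "is_module A P" and r: "rdim P = rdim M" and a: "a \<in> hbasis A"
    and inv: "vec_mat (1\<^sub>m (rdim M)) \<in> Hom_mod A (trivial_mod A) (tensor_mod A M P)" and ij: "i < rdim M" "j < rdim M"
  shows "(\<Sum>p\<in>hbasis A. \<Sum>q\<in>hbasis A. hcomult A a (p, q) * (ract M p * transpose_mat (ract P q)) $$ (i, j)) =
    (if i = j then hcounit A a else 0)"
proof -
  interpret hopf_algebra A by fact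
  let ?d = "rdim M" and ?k = "i * rdim M + j"
  have k: "?k < ?d * ?d" using ij add_mult_distrib[of i 1 ?d] mult_le_mono1[of "Suc i" ?d ?d] by simp
  have M': "ract M p \<in> carrier_mat ?d ?d" and P': "ract P p \<in> carrier_mat ?d ?d" if "p \<in> hbasis A" for p
    using is_module_carrier[OF M that] is_module_carrier[OF P that] r by simp_all
  have "(act_tensor M P (hcomult A a) * vec_mat (1\<^sub>m ?d)) $$ (?k, 0) =
    (\<Sum>l<?d * ?d. (\<Sum>p\<in>hbasis A. \<Sum>q\<in>hbasis A. hcomult A a (p, q) * kron (ract M p) (ract P q) $$ (?k, l)) * vec_mat (1\<^sub>m ?d) $$ (l, 0))"
    using k r by (subst mat_mult_entry[where d = "?d * ?d"]) (auto intro!: sum.cong simp: act_tensor_index[OF M P])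
  also have "\<dots> = (\<Sum>l<?d * ?d. \<Sum>p\<in>hbasis A. \<Sum>q\<in>hbasis A. hcomult A a (p, q) * (kron (ract M p) (ract P q) $$ (?k, l) * vec_mat (1\<^sub>m ?d) $$ (l, 0)))"
    by (simp only: sum_distrib_right mult.assoc)
  also have "\<dots> = (\<Sum>p\<in>hbasis A. \<Sum>q\<in>hbasis A. hcomult A a (p, q) * (\<Sum>l<?d * ?d. kron (ract M p) (ract P q) $$ (?k, l) * vec_mat (1\<^sub>m ?d) $$ (l, 0)))"
    by (subst sum_rotate) (simp only: sum_distrib_left)
  also have "\<dots> = (\<Sum>p\<in>hbasis A. \<Sum>q\<in>hbasis A. hcomult A a (p, q) * (ract M p * transpose_mat (ract P q)) $$ (i, j))"
  proof (intro sum.cong refl, goal_cases)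
    case (1 p q)
    note dd = M'[OF 1(1)] P'[OF 1(2)]
    have "(\<Sum>l<?d * ?d. kron (ract M p) (ract P q) $$ (?k, l) * vec_mat (1\<^sub>m ?d) $$ (l, 0)) = (kron (ract M p) (ract P q) * vec_mat (1\<^sub>m ?d)) $$ (?k, 0)"
      using k dd by (intro mat_mult_entry[symmetric]) auto
    also have "\<dots> = (ract M p * transpose_mat (ract P q)) $$ (i, j)"
      unfolding kron_vec_mat[OF dd one_carrier_mat] using dd ij by (subst vec_mat_index[where d = ?d]) auto
    finally show ?case by simp
  qed
  finally have 1: "(act_tensor M P (hcomult A a) * vec_mat (1\<^sub>m ?d)) $$ (?k, 0) = \<dots>" .
  have "act_tensor M P (hcomult A a) * vec_mat (1\<^sub>m ?d) = vec_mat (1\<^sub>m ?d) * ract (trivial_mod A) a"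
    using Hom_modD(4)[OF inv a] by (simp add: tensor_mod_act[OF M P])
  then have "(act_tensor M P (hcomult A a) * vec_mat (1\<^sub>m ?d)) $$ (?k, 0) = (vec_mat (1\<^sub>m ?d) * mat 1 1 (\<lambda>_. hcounit A a)) $$ (?k, 0)"
    by (simp add: trivial_mod_def)
  also have "\<dots> = vec_mat (1\<^sub>m ?d) $$ (?k, 0) * hcounit A a" using k by (subst mat_mult_entry[where d = 1]) (auto simp: One_nat_def)
  also have "vec_mat (1\<^sub>m ?d) $$ (?k, 0) = (1\<^sub>m ?d $$ (i, j) :: 'b)" by (rule vec_mat_index) (use ij in auto)
  finally show ?thesis unfolding 1 using ij by simp
qed

section \<open>The dual of a module from the antipode on generators\<close>

context group_datum_closed
begin

abbreviation "kdual W \<equiv> dual_mod KG W"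

lemma kdual_act: "is_module KG W \<Longrightarrow> h \<in> carrier G \<Longrightarrow> ract (kdual W) h = transpose_mat (ract W (inv h))"
  using act_elt_bvec[of KG "inv h" W] KG_moduleD(1)[of W "inv h"] KG.finite_basis by (simp add: dual_mod_def)

lemma is_module_kdual: "is_module KG W \<Longrightarrow> is_module KG (kdual W)"
  unfolding is_module_KG[of "kdual W"]
  using KG_moduleD[of W] by (auto simp: kdual_act inv_mult_group mat_transpose_mult[symmetric] intro!: carrier_matI)

text \<open>The sign that makes the dual of a module over \<open>y\<^sup>n = g\<^sup>n - 1\<close> satisfy the same relation.\<close>

lemma q_triangle: "(-1) ^ n * q ^ (\<Sum>k<n. k) = -1"
proof -
  have s: "2 * (\<Sum>k<m. k) = m * (m - 1)" for m :: nat
  proof (induction m)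
    case (Suc m)
    then show ?case by (cases m) (auto simp: algebra_simps)
  qed simp
  show ?thesis
  proof (cases "even n")
    case True
    then obtain m where m: "n = 2 * m" by auto
    have m0: "0 < m" "m < n" using n_ge_2 m by auto
    have "(q ^ m) ^ 2 = 1" using q_pow_n by (simp add: m mult.commute flip: power_mult)
    \<comment> \<open>For even \<open>n\<close> the power \<open>q^(n/2)\<close> squares to 1 but is
      not 1, since \<open>q\<close> has order \<open>n\<close>; the exponent is an odd multiple of
      \<open>n/2\<close>.\<close>
    then have qm: "q ^ m = -1" using q_order[OF m0] by (simp add: power2_eq_1_iff)
    have "(\<Sum>k<n. k) = m * (2 * m - 1)" using s[of n] by (simp add: m)
    moreover have "odd (2 * m - 1)" using m0 by simp
    ultimately have "q ^ (\<Sum>k<n. k) = -1" by (simp add: power_mult qm)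
    then show ?thesis using True by simp
  next
    case False
    then obtain m where m: "n = 2 * m + 1" by (auto elim: oddE)
    \<comment> \<open>For odd \<open>n\<close> the exponent is a multiple of \<open>n\<close>, and
      the sign alone is left.\<close>
    have "(\<Sum>k<n. k) = n * m" using s[of n] by (simp add: m)
    then show ?thesis using False q_pow_n by (simp add: power_mult)
  qed
qed

text \<open>Moving one factor \<open>g^(-1)\<close> past \<open>y^i\<close> costs
  \<open>q^i\<close>; collecting all of them on the right multiplies these costs.\<close>

lemma twisted_pow:
  assumes M: "is_module H M"
  shows "mat_lpow (ya M * ract M (0, inv g)) k = q ^ (\<Sum>i<k. i) \<cdot>\<^sub>m (mat_lpow (ya M) k * mat_lpow (ract M (0, inv g)) k)"
proof (induction k)
  case 0
  then show ?case using H_module_dims[OF M] g_closed by (simp add: mat_smult_one)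
next
  case (Suc k)
  note d = H_module_dims(1,2)[OF M] H_module_dims(3,4)[OF M inv_closed[OF g_closed]]
  let ?Y = "ya M" and ?B = "ract M (0, inv g)"
  have c: "\<chi> (inv g) * q = 1" using char_mult[of "inv g" g] g_closed char_one by simp
  then have c': "\<chi> (inv g) ^ k * q ^ k = 1" by (simp flip: power_mult_distrib)
  have "q ^ k \<cdot>\<^sub>m (mat_lpow ?Y k * ?B) = (\<chi> (inv g) ^ k * q ^ k) \<cdot>\<^sub>m (?B * mat_lpow ?Y k)"
    using lpow_commute[OF M inv_closed[OF g_closed], of k] by (simp add: mat_smult_smult mult.commute)
  then have e: "?B * mat_lpow ?Y k = q ^ k \<cdot>\<^sub>m (mat_lpow ?Y k * ?B)" unfolding c' by (simp add: mat_smult_one)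
  have "mat_lpow (?Y * ?B) (Suc k) = q ^ (\<Sum>i<k. i) \<cdot>\<^sub>m (?Y * (?B * mat_lpow ?Y k) * mat_lpow ?B k)"
    using d by (simp add: Suc mat_assoc mat_smult_right)
  also have "\<dots> = q ^ (\<Sum>i<Suc k. i) \<cdot>\<^sub>m (mat_lpow ?Y (Suc k) * mat_lpow ?B (Suc k))"
    unfolding e using d by (simp add: mat_assoc mat_smult_right mat_smult_left mat_smult_smult power_add mult.commute)
  finally show ?case .
qed

lemma act_pow: "is_module KG W \<Longrightarrow> h \<in> carrier G \<Longrightarrow> mat_lpow (ract W h) k = ract W (h [^] k)"
proof (induction k)
  case (Suc k)
  then show ?case using nat_pow_Suc2[of h k] KG_moduleD(5)[OF Suc.prems(1), of h "h [^] k"] by simp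
qed (simp add: KG_moduleD(2,4))

lemma transpose_smult: "transpose_mat (c \<cdot>\<^sub>m B) = c \<cdot>\<^sub>m transpose_mat (B :: 'k mat)"
  by (rule eq_matI) auto

lemma lpow_transpose: "dim_row B = dim_col B \<Longrightarrow> mat_lpow (transpose_mat B) k = transpose_mat (mat_lpow B k)"
  for B :: "'k mat"
  by (induction k) (simp_all add: mat_transpose_mult[symmetric] mat_lpow_comm)

lemma lpow_smult: "dim_row B = dim_col B \<Longrightarrow> mat_lpow (c \<cdot>\<^sub>m B) k = c ^ k \<cdot>\<^sub>m mat_lpow B k" for B :: "'k mat"
  by (induction k) (simp_all add: mat_smult_left mat_smult_right mat_smult_smult mat_smult_one mult.commute)

text \<open>The transposed action of the antipode value \<open>S(y) = - y g^(-1)\<close>.\<close>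

definition dual_y :: "(nat \<times> 'g, 'k) rep \<Rightarrow> 'k mat" where
  "dual_y M = (-1) \<cdot>\<^sub>m transpose_mat (ya M * ract M (0, inv g))"

text \<open>The scalar \<open>c\<close> allows one proof for two duals: \<open>c = 1\<close> is the
  dual formed with the antipode, and \<open>c = q\<close> the one formed with its inverse.\<close>

lemma is_module_dual:
  assumes M: "is_module H M" and c: "c ^ n = 1"
  shows "is_module H (y_mod (kdual (res_mod M)) (c \<cdot>\<^sub>m dual_y M))" "ya (y_mod (kdual (res_mod M)) (c \<cdot>\<^sub>m dual_y M)) = c \<cdot>\<^sub>m dual_y M"
proof -
  note rM = H_module_res[OF M]
  let ?Y = "ya M" and ?B = "ract M (0, inv g)" and ?d = "rdim M"
  note d = H_module_dims(1,2)[OF M] H_module_dims(3,4)[OF M]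
  have gi: "inv g \<in> carrier G" using g_closed by simp
  have comm: "c \<cdot>\<^sub>m dual_y M * ract (kdual (res_mod M)) h = \<chi> h \<cdot>\<^sub>m (ract (kdual (res_mod M)) h * (c \<cdot>\<^sub>m dual_y M))"
    if h: "h \<in> carrier G" for h
  proof -
    let ?C = "ract M (0, inv h)"
    have hi: "inv h \<in> carrier G" using h by simp
    note dh = d(3,4)[OF hi] d(3,4)[OF gi]
    have cc: "\<chi> h * \<chi> (inv h) = 1" using char_mult[of h "inv h"] h char_one by simp
    have BC: "?B * ?C = ?C * ?B"
      using KG_moduleD(5)[OF rM, of "inv g" "inv h"] KG_moduleD(5)[OF rM, of "inv h" "inv g"] h g_closed g_central[OF h]
      by (simp flip: inv_mult_group)
    have "\<chi> h \<cdot>\<^sub>m (?Y * ?B * ?C) = \<chi> h \<cdot>\<^sub>m (?Y * ?C * ?B)" using d dh by (simp add: mat_assoc BC)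
    also have "\<dots> = ?C * (?Y * ?B)"
      unfolding H_module_commute[OF M hi] using d dh by (simp add: mat_assoc mat_smult_left mat_smult_smult cc mat_smult_one)
    finally have e: "?C * (?Y * ?B) = \<chi> h \<cdot>\<^sub>m (?Y * ?B * ?C)" ..
    have "transpose_mat (?Y * ?B) * transpose_mat ?C = transpose_mat (?C * (?Y * ?B))"
      using d dh by (simp add: mat_transpose_mult)
    also have "\<dots> = \<chi> h \<cdot>\<^sub>m transpose_mat (?Y * ?B * ?C)" unfolding e by (simp add: transpose_smult)
    also have "transpose_mat (?Y * ?B * ?C) = transpose_mat ?C * transpose_mat (?Y * ?B)"
      using d dh by (intro mat_transpose_mult) simp_all
    finally show ?thesis unfolding dual_y_def kdual_act[OF rM h]
      using d dh by (simp add: mat_smult_left mat_smult_right mat_smult_smult mult.commute)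
  qed
  have pow: "mat_lpow (c \<cdot>\<^sub>m dual_y M) n = ract (kdual (res_mod M)) (g [^] n) - 1\<^sub>m (rdim (kdual (res_mod M)))"
  proof -
    have gn: "inv g [^] n = inv (g [^] n)" using nat_pow_inv[OF g_closed] .
    have gg: "ract M (0, g [^] n) * ract M (0, inv (g [^] n)) = 1\<^sub>m ?d"
      using KG_moduleD(4)[OF rM] KG_moduleD(5)[OF rM, of "g [^] n" "inv (g [^] n)"] by simp
    note dg = d(3,4)[OF g_n_closed] d(3,4)[OF inv_closed[OF g_n_closed]] d(3,4)[OF gi]
    \<comment> \<open>The scalar \<open>c^n\<close> is 1, and the sign and powers of
      \<open>q\<close> combine to -1 by \<open>q_triangle\<close>. This turns
      \<open>(g^n - 1) g^(-n)\<close> into \<open>g^(-n) - 1\<close>, which is the required value on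
      the dual.\<close>
    have "mat_lpow (c \<cdot>\<^sub>m dual_y M) n = ((-1) ^ n) \<cdot>\<^sub>m transpose_mat (mat_lpow (?Y * ?B) n)"
      unfolding dual_y_def using d dg by (simp add: lpow_smult lpow_transpose mat_smult_smult power_minus[of c] c)
    also have "mat_lpow (?Y * ?B) n = q ^ (\<Sum>i<n. i) \<cdot>\<^sub>m ((ract M (0, g [^] n) - 1\<^sub>m ?d) * ract M (0, inv (g [^] n)))"
      unfolding twisted_pow[OF M] H_module_pow_n[OF M] using act_pow[OF rM gi, of n] by (simp add: gn)
    also have "(ract M (0, g [^] n) - 1\<^sub>m ?d) * ract M (0, inv (g [^] n)) = 1\<^sub>m ?d - ract M (0, inv (g [^] n))"
      using d dg by (simp add: mat_diff_distrib_right gg)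
    finally have "mat_lpow (c \<cdot>\<^sub>m dual_y M) n = (-1) \<cdot>\<^sub>m transpose_mat (1\<^sub>m ?d - ract M (0, inv (g [^] n)))"
      by (simp add: transpose_smult mat_smult_smult q_triangle)
    then show ?thesis unfolding kdual_act[OF rM g_n_closed] using dg by (auto intro!: eq_matI)
  qed
  have "c \<cdot>\<^sub>m dual_y M \<in> carrier_mat (rdim (kdual (res_mod M))) (rdim (kdual (res_mod M)))"
    unfolding dual_y_def using d d(3,4)[OF gi] by (intro carrier_matI) simp_all
  from is_module_y_mod[OF is_module_kdual[OF rM] this comm pow]
  show "is_module H (y_mod (kdual (res_mod M)) (c \<cdot>\<^sub>m dual_y M))" "ya (y_mod (kdual (res_mod M)) (c \<cdot>\<^sub>m dual_y M)) = c \<cdot>\<^sub>m dual_y M"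
    by blast+
qed

end

section \<open>Homomorphisms into dual modules\<close>

context group_datum_closed
begin

lemma dual_y_dim: "is_module H M \<Longrightarrow> dim_row (dual_y M) = rdim M" "is_module H M \<Longrightarrow> dim_col (dual_y M) = rdim M"
  using H_module_dims[of M] g_closed by (simp_all add: dual_y_def)

text \<open>\<open>dual_mod\<close> refers to the antipode of every basis vector, whereas its values
  are given on generators only. The candidate \<open>D\<close> is built from the generators; the
  canonical element of \<open>M\<close> tensor \<open>D\<close> is shown invariant on generators,
  and uniqueness of convolution inverses identifies the two actions.\<close>

lemma dual_mod_act:
  assumes M: "is_module H M" and a: "a \<in> hbasis H"
  shows "ract (dual_mod H M) a = ract (y_mod (kdual (res_mod M)) (dual_y M)) a"
proof -
  define D where "D = y_mod (kdual (res_mod M)) (dual_y M)"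
  have D: "is_module H D" "ya D = dual_y M"
    using is_module_dual[OF M, of 1] by (simp_all add: D_def mat_smult_one)
  have rD: "rdim D = rdim M" and resD: "res_mod D = kdual (res_mod M)" by (simp_all add: D_def)
  note rM = H_module_res[OF M]
  let ?d = "rdim M" and ?v = "vec_mat (1\<^sub>m (rdim M))"
  have actD: "ract D (0, h) = transpose_mat (ract M (0, inv h))" if "h \<in> carrier G" for h
    using kdual_act[OF rM that] by (simp flip: resD)
  have tr: "is_module H (trivial_mod H)" "is_module H (tensor_mod H M D)"
    using is_module_trivial is_module_tensor[OF M D(1)] .
  have vc: "?v \<in> carrier_mat (?d * ?d) 1" by (intro carrier_matI) simp_all
  have Mc: "ract M b \<in> carrier_mat ?d ?d" and Dc: "ract D b \<in> carrier_mat ?d ?d" if "b \<in> hbasis H" for b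
    using is_module_carrier[OF M that] is_module_carrier[OF D(1) that] rD by simp_all
  have th: "ract (tensor_mod H M D) (0, h) * ?v = ?v" if h: "h \<in> carrier G" for h
  proof -
    have "ract (tensor_mod H M D) (0, h) = kron (ract M (0, h)) (ract D (0, h))"
      by (simp add: tensor_mod_act[OF M D(1)] comult_emb[OF h] act_tensor_tensor_elt[OF M D(1)] H_module_act_bvec[OF M] H_module_act_bvec[OF D(1)] h)
    moreover have "ract M (0, h) * ract M (0, inv h) = 1\<^sub>m ?d"
      using KG_moduleD(5)[OF rM h inv_closed[OF h]] KG_moduleD(4)[OF rM] h by simp
    ultimately show ?thesis
      using kron_vec_mat[OF Mc Dc one_carrier_mat, of "(0, h)" "(0, h)"] H_module_dims(3,4)[OF M] h by (simp add: actD)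
  qed
  \<comment> \<open>From the coproduct \<open>y\<close> tensor \<open>g\<close> plus 1 tensor
    \<open>y\<close>, the first summand contributes \<open>y g^(-1)\<close> and the second its
    negative.\<close>
  have ty: "ract (tensor_mod H M D) (1, \<one>) * ?v = 0\<^sub>m (?d * ?d) 1"
  proof -
    let ?A = "ya M * ract M (0, inv g)"
    note dA = H_module_dims(1,2)[OF M] H_module_dims(3,4)[OF M inv_closed[OF g_closed]]
    have "ract (tensor_mod H M D) (1, \<one>) = act_tensor M D (tensor_elt (gen_y G) (emb g)) + act_tensor M D (tensor_elt (hunit H) (gen_y G))"
      unfolding tensor_mod_act[OF M D(1)] comult_y
      by (rule eq_matI) (simp_all add: act_tensor_index[OF M D(1)] distrib_right sum.distrib)
    also have "\<dots> = kron (ya M) (ract D (0, g)) + kron (1\<^sub>m ?d) (ya D)"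
      using M by (simp add: act_tensor_tensor_elt[OF M D(1)] H_module_act_bvec[OF M] H_module_act_bvec[OF D(1)] g_closed is_module_def)
    finally have "ract (tensor_mod H M D) (1, \<one>) * ?v = kron (ya M) (ract D (0, g)) * ?v + kron (1\<^sub>m ?d) (ya D) * ?v"
      using dA rD H_module_dims[OF D(1)] g_closed by (simp add: mat_distrib_right)
    also have "\<dots> = vec_mat ?A + vec_mat ((-1) \<cdot>\<^sub>m ?A)"
      using kron_vec_mat[OF Mc Dc one_carrier_mat, of "(1, \<one>)" "(0, g)"] kron_vec_mat[OF one_carrier_mat Dc one_carrier_mat, of "(1, \<one>)"] dA
      by (simp add: actD g_closed D(2) dual_y_def transpose_smult)
    also have "\<dots> = 0\<^sub>m (?d * ?d) 1"
      using dA by (intro eq_matI) (auto simp: vec_mat_def div_mod_bounds)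
    finally show ?thesis .
  qed
  have "?v \<in> Hom_mod H (trivial_mod H) (tensor_mod H M D)"
    unfolding Hom_H_iff[OF tr]
  proof
    show "?v \<in> Hom_mod KG (res_mod (trivial_mod H)) (res_mod (tensor_mod H M D))"
    proof (rule Hom_modI)
      show "?v \<in> carrier_mat (rdim (res_mod (tensor_mod H M D))) (rdim (res_mod (trivial_mod H)))"
        using vc by (simp add: rD trivial_mod_def)
      fix h assume "h \<in> hbasis (KG :: ('g, 'k) hopf_data)"
      then have h: "h \<in> carrier G" by simp
      have "ract (trivial_mod H) (0, h) = 1\<^sub>m 1" by (rule eq_matI) (simp_all add: trivial_mod_def counit_emb[OF h])
      then show "?v * ract (res_mod (trivial_mod H)) h = ract (res_mod (tensor_mod H M D)) h * ?v"
        using vc by (simp add: th[OF h])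
    qed
    have "ya (trivial_mod H) = 0\<^sub>m 1 1" by (rule eq_matI) (simp_all add: trivial_mod_def counit_y)
    then show "?v * ya (trivial_mod H) = ya (tensor_mod H M D) * ?v" by (simp add: ty mat_zero_simps)
  qed
  note inv = invariant_entries[OF hopf_algebra_axioms M D(1) rD _ this]
  have "act_elt H M (hantipode H a) = transpose_mat (ract D a)"
    by (rule convolution_inverse_unique[where S = "ract M" and d = ?d, OF _ _ _ antipode_act[OF M] inv a])
      (use Mc Dc in auto)
  then show ?thesis unfolding D_def[symmetric] by (simp add: dual_mod_def)
qed

lemma kdual_transpose_Hom:
  fixes W U :: "('g, 'k) rep"
  assumes W: "is_module KG W" and U: "is_module KG U" and T: "T \<in> Hom_mod KG W (kdual U)"
  shows "transpose_mat T \<in> Hom_mod KG U (kdual W)"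
proof (rule Hom_modI)
  note d = Hom_modD(2,3)[OF T]
  show "transpose_mat T \<in> carrier_mat (rdim (kdual W)) (rdim U)" using d by (intro carrier_matI) simp_all
  fix h assume "h \<in> hbasis (KG :: ('g, 'k) hopf_data)"
  then have h: "h \<in> carrier G" by simp
  note dh = KG_moduleD(2,3)[OF W inv_closed[OF h]] KG_moduleD(2,3)[OF U h]
  have "transpose_mat (T * ract W (inv h)) = transpose_mat (transpose_mat (ract U h) * T)"
    using Hom_modD(4)[OF T, of "inv h"] h by (simp add: kdual_act[OF U])
  then show "transpose_mat T * ract U h = ract (kdual W) h * transpose_mat T"
    using d dh by (simp add: kdual_act[OF W h] mat_transpose_mult)
qed

text \<open>The dual formed with the inverse of the antipode.\<close>

abbreviation "odual M \<equiv> y_mod (kdual (res_mod M)) (q \<cdot>\<^sub>m dual_y M)"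

lemma is_module_odual: "is_module H M \<Longrightarrow> is_module H (odual M)" "is_module H M \<Longrightarrow> ya (odual M) = q \<cdot>\<^sub>m dual_y M"
  using is_module_dual q_pow_n by blast+

text \<open>The factor \<open>q\<close> changes \<open>y g^(-1)\<close> into
  \<open>g^(-1) y\<close>, and \<open>- g^(-1) y\<close> is the value of the inverse antipode at
  \<open>y\<close>.\<close>

lemma odual_y:
  assumes M: "is_module H M"
  shows "q \<cdot>\<^sub>m dual_y M = (-1) \<cdot>\<^sub>m (transpose_mat (ya M) * transpose_mat (ract M (0, inv g)))"
proof -
  note d = H_module_dims(1,2)[OF M] H_module_dims(3,4)[OF M inv_closed[OF g_closed]]
  have "q * \<chi> (inv g) = 1" using char_mult[of g "inv g"] g_closed char_one by simp
  then show ?thesis unfolding dual_y_def H_module_commute[OF M inv_closed[OF g_closed]]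
    using d by (simp add: transpose_smult mat_smult_smult mat_transpose_mult mult.commute)
qed

text \<open>A homomorphism into a dual is an invariant pairing, which can be read from either
  argument. Because the antipode is not an involution, the reading from the other side uses its
  inverse, hence \<open>odual\<close>.\<close>

lemma dual_transpose_iff:
  assumes M: "is_module H M" and P: "is_module H P"
  shows "T \<in> Hom_mod H M (dual_mod H P) \<longleftrightarrow> transpose_mat T \<in> Hom_mod H P (odual M)"
proof -
  define D where "D = y_mod (kdual (res_mod P)) (dual_y P)"
  have D: "is_module H D" "ya D = dual_y P"
    using is_module_dual[OF P, of 1] by (simp_all add: D_def mat_smult_one)
  have rD: "res_mod D = kdual (res_mod P)" "rdim D = rdim P" by (simp_all add: D_def)
  have HD: "Hom_mod H M (dual_mod H P) = Hom_mod H M D"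
    unfolding Hom_mod_def rD dual_mod_rdim using dual_mod_act[OF P] by (simp add: D_def)
  note rM = H_module_res[OF M] and rP = H_module_res[OF P]
  let ?E = "transpose_mat T" and ?Y = "ya M" and ?A = "ya P" and ?B = "ract P (0, inv g)" and ?C = "ract P (0, g)"
    and ?Bm = "ract M (0, inv g)"
  have gi: "inv g \<in> carrier G" using g_closed by simp
  note d = H_module_dims(1,2)[OF M] H_module_dims(1,2)[OF P] H_module_dims(3,4)[OF P gi] H_module_dims(3,4)[OF P g_closed]
    H_module_dims(3,4)[OF M gi] dual_y_dim[OF P] dual_y_dim[OF M]
  have 1: "T \<in> Hom_mod KG (res_mod M) (res_mod D) \<longleftrightarrow> ?E \<in> Hom_mod KG (res_mod P) (res_mod (odual M))"
    unfolding rD res_y_mod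
    using kdual_transpose_Hom[OF rM rP, of T] kdual_transpose_Hom[OF rP rM, of ?E] by auto
  have 2: "T * ?Y = ya D * T \<longleftrightarrow> ?E * ?A = ya (odual M) * ?E" if T: "T \<in> Hom_mod KG (res_mod M) (res_mod D)"
  proof -
    have dT: "dim_row T = rdim P" "dim_col T = rdim M" using Hom_modD(2,3)[OF T] by (simp_all add: rD)
    have E: "?E \<in> Hom_mod KG (res_mod P) (kdual (res_mod M))" using T 1 by simp
    have BE: "transpose_mat ?Bm * ?E = ?E * ?C"
      using Hom_modD(4)[OF E, of g] g_closed by (simp add: kdual_act[OF rM])
    have BC: "?B * ?C = 1\<^sub>m (rdim P)" "?C * ?B = 1\<^sub>m (rdim P)"
      using KG_moduleD(5)[OF rP, of "inv g" g] KG_moduleD(5)[OF rP, of g "inv g"] KG_moduleD(4)[OF rP] g_closed by simp_all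
    have "T * ?Y = ya D * T \<longleftrightarrow> transpose_mat (T * ?Y) = transpose_mat (ya D * T)" by simp
    also have "\<dots> \<longleftrightarrow> transpose_mat ?Y * ?E = (-1) \<cdot>\<^sub>m (?E * ?A * ?B)"
      unfolding D(2) dual_y_def using d dT by (simp add: mat_transpose_mult mat_smult_left transpose_smult mat_assoc)
    \<comment> \<open>Multiplication by \<open>g\<close> or \<open>g^(-1)\<close> on the right moves
      the group element from one side of the equation to the other.\<close>
    also have "\<dots> \<longleftrightarrow> ?E * ?A = (-1) \<cdot>\<^sub>m (transpose_mat ?Y * (?E * ?C))"
    proof
      assume *: "transpose_mat ?Y * ?E = (-1) \<cdot>\<^sub>m (?E * ?A * ?B)"
      have "transpose_mat ?Y * (?E * ?C) = transpose_mat ?Y * ?E * ?C" using d dT by (simp add: mat_assoc)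
      also have "\<dots> = (-1) \<cdot>\<^sub>m (?E * ?A)" unfolding * using d dT by (simp add: mat_smult_left mat_assoc BC)
      finally show "?E * ?A = (-1) \<cdot>\<^sub>m (transpose_mat ?Y * (?E * ?C))" by (simp add: mat_smult_smult mat_smult_one)
    next
      assume *: "?E * ?A = (-1) \<cdot>\<^sub>m (transpose_mat ?Y * (?E * ?C))"
      show "transpose_mat ?Y * ?E = (-1) \<cdot>\<^sub>m (?E * ?A * ?B)"
        unfolding * using d dT by (simp add: mat_smult_left mat_assoc BC mat_smult_smult mat_smult_one)
    qed
    also have "\<dots> \<longleftrightarrow> ?E * ?A = ya (odual M) * ?E"
      unfolding trans[OF is_module_odual(2)[OF M] odual_y[OF M]] using d dT by (simp add: mat_smult_left mat_assoc BE)
    finally show ?thesis .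
  qed
  show ?thesis unfolding HD Hom_H_iff[OF M D(1)] Hom_H_iff[OF P is_module_odual(1)[OF M]] using 1 2 by blast
qed

lemma block_in_Hom:
  assumes U: "is_module KG U"
  shows "block_in n (rdim U) 0 \<in> Hom_mod KG U (res_mod (ind_mod U))"
proof (rule Hom_modI)
  fix h assume "h \<in> hbasis (KG :: ('g, 'k) hopf_data)"
  then show "block_in n (rdim U) 0 * ract U h = ract (res_mod (ind_mod U)) h * block_in n (rdim U) 0"
    using ind_act_block[OF U, of h 0] n_ge_2 unfolding res_ind by (simp add: mat_smult_one)
qed (auto intro!: carrier_matI)

text \<open>The uniqueness half of Frobenius reciprocity: block 0 generates the induced module under
  powers of \<open>y\<close>.\<close>

lemma ind_Hom_eqI:
  assumes U: "is_module KG U" and M: "is_module H M" and T: "T \<in> Hom_mod H (ind_mod U) M" and T': "T' \<in> Hom_mod H (ind_mod U) M"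
    and eq: "T * block_in n (rdim U) 0 = T' * block_in n (rdim U) 0"
  shows "T = T'"
proof (rule block_eqI)
  note dT = Hom_modD(2,3)[OF T] Hom_modD(2,3)[OF T']
  note dM = H_module_dims(1,2)[OF M]
  show "dim_row T = dim_row T'" "dim_col T = n * rdim U" "dim_col T' = n * rdim U" using dT by simp_all
  fix l assume l: "l < n"
  have *: "R * block_in n (rdim U) l = mat_lpow (ya M) l * (R * block_in n (rdim U) 0)" if R: "R \<in> Hom_mod H (ind_mod U) M" for R
  proof -
    note dR = Hom_modD(2,3)[OF R]
    have "R * ind_y U = ya M * R" using Hom_H_iff[OF is_module_ind(1)[OF U] M] R by (simp add: is_module_ind(2)[OF U])
    then have "R * mat_lpow (ind_y U) l = mat_lpow (ya M) l * R"
      using dR dM by (intro mat_lpow_intertwine) simp_all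
    then show ?thesis using mat_absorb[of R "mat_lpow (ind_y U) l" _ "block_in n (rdim U) 0"] dR dM
      by (simp add: ind_y_pow_block[OF U l] mat_assoc)
  qed
  show "T * block_in n (rdim U) l = T' * block_in n (rdim U) l" by (simp add: *[OF T] *[OF T'] eq)
qed

text \<open>Three bijections are combined: transposition into \<open>odual M\<close>, Frobenius
  reciprocity, and transposition over the group. Their composite is the single linear map
  \<open>?f\<close>, restriction of functionals to block 0, so only its injectivity and its image
  are at issue.\<close>

lemma dim_Hom_dual_ind:
  assumes M: "is_module H M" and U: "is_module KG U"
  shows "dim_Hom H M (dual_mod H (ind_mod U)) = dim_Hom KG (res_mod M) (kdual U)"
proof -
  let ?P = "ind_mod U" and ?b = "block_in n (rdim U) 0 :: 'k mat"
  let ?S = "Hom_mod H M (dual_mod H ?P)" and ?S' = "Hom_mod KG (res_mod M) (kdual U)"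
  let ?f = "\<lambda>T. transpose_mat ?b * T"
  note P = is_module_ind(1)[OF U]
  note iff = dual_transpose_iff[OF M P]
  note rM = H_module_res[OF M] and oM = is_module_odual(1)[OF M]
  have b: "?b \<in> Hom_mod KG U (res_mod ?P)" by (rule block_in_Hom[OF U])
  have fT: "transpose_mat (?f T) = transpose_mat T * ?b" if "T \<in> ?S" for T
    using Hom_modD(2)[OF that] by (simp add: mat_transpose_mult)
  have into: "?f T \<in> ?S'" if T: "T \<in> ?S" for T
  proof -
    have "transpose_mat T \<in> Hom_mod KG (res_mod ?P) (kdual (res_mod M))"
      using res_Hom[OF P oM] T iff by simp
    from Hom_mod_comp[OF U H_module_res[OF P] is_module_kdual[OF rM] b this]
    have "transpose_mat (?f T) \<in> Hom_mod KG U (kdual (res_mod M))" unfolding fT[OF T] .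
    from kdual_transpose_Hom[OF U rM this] show ?thesis by simp
  qed
  have onto: "R \<in> ?f ` ?S" if R: "R \<in> ?S'" for R
  proof -
    have R': "transpose_mat R \<in> Hom_mod KG U (res_mod (odual M))" using kdual_transpose_Hom[OF rM U R] by simp
    let ?E = "ind_map (odual M) (rdim U) (transpose_mat R)"
    have T: "transpose_mat ?E \<in> ?S" using ind_map_Hom[OF oM U R'] iff[of "transpose_mat ?E"] by simp
    have "transpose_mat R \<in> carrier_mat (rdim (odual M)) (rdim U)" using Hom_modD(1)[OF R'] by simp
    then have "?E * ?b = transpose_mat R"
      using ind_map_block[OF oM, of "transpose_mat R" "rdim U" 0] n_ge_2 Hom_modD(2,3)[OF R'] H_module_dims(1,2)[OF oM] by simp
    then have "transpose_mat (?f (transpose_mat ?E)) = transpose_mat R" unfolding fT[OF T] by simp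
    then have "R = ?f (transpose_mat ?E)" by (metis transpose_transpose)
    with T show ?thesis by blast
  qed
  have inj: "inj_on ?f ?S"
  proof (rule inj_onI)
    fix T T' assume T: "T \<in> ?S" "T' \<in> ?S" and eq: "?f T = ?f T'"
    have "transpose_mat T * ?b = transpose_mat T' * ?b" using eq fT[OF T(1)] fT[OF T(2)] by simp
    from ind_Hom_eqI[OF U oM _ _ this] T iff have "transpose_mat T = transpose_mat T'" by blast
    then show "T = T'" by (metis transpose_transpose)
  qed
  have sS: "mat_subspace (rdim ?P) (rdim M) ?S"
    using Hom_subspace[OF rep_dims_module[OF M] rep_dims_dual, of ?P] by simp
  have sS': "mat_subspace (rdim U) (rdim M) ?S'"
    using Hom_subspace[OF rep_dims_module[OF rM] rep_dims_dual, of U] by simp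
  have "transpose_mat ?b \<in> carrier_mat (rdim U) (rdim ?P)" by (intro carrier_matI) simp_all
  then have "mat_linear ?f ?S ?S'"
    by (rule mat_linear_mult_left) (use sS into in \<open>auto simp: mat_subspace_def\<close>)
  note dim = mat_dim_injective[OF sS sS' this inj]
  have "?f ` ?S = ?S'"
  proof (rule subset_antisym)
    show "?f ` ?S \<subseteq> ?S'" by (rule image_subsetI) (rule into)
    show "?S' \<subseteq> ?f ` ?S" by (rule subsetI) (rule onto)
  qed
  with dim have "mat_dim (rdim U) (rdim M) ?S' = mat_dim (rdim ?P) (rdim M) ?S" by (simp only:)
  then show ?thesis unfolding dim_Hom_def by simp
qed

end

section \<open>Projective modules and the perpendicular space\<close>

lemma projective_retract:
  assumes P: "projective_mod A P" and L: "is_module A L" and i: "S \<in> Hom_mod A L P" and r: "R \<in> Hom_mod A P L" and ri: "R * S = 1\<^sub>m (rdim L)"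
  shows "projective_mod A L"
  unfolding projective_mod_def
proof (intro conjI allI ballI impI L)
  fix M M' T U assume T: "T \<in> Hom_mod A M M'" and U: "U \<in> Hom_mod A L M'" and "is_module A M \<and> is_module A M' \<and> surj_hom T"
  then have M: "is_module A M" "is_module A M'" and sur: "surj_hom T" by auto
  have PM: "is_module A P" using P by (simp add: projective_mod_def)
  have "U * R \<in> Hom_mod A P M'" by (rule Hom_mod_comp[OF PM L M(2) r U])
  then obtain V where V: "V \<in> Hom_mod A P M" "T * V = U * R" using P M sur T unfolding projective_mod_def by blast
  note d = Hom_modD(2,3)[OF T] Hom_modD(2,3)[OF U] Hom_modD(2,3)[OF i] Hom_modD(2,3)[OF r] Hom_modD(2,3)[OF V(1)]
  have "T * (V * S) = U" using d mat_absorb[OF V(2), of S] by (simp add: mat_assoc ri)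
  then show "\<exists>V\<in>Hom_mod A L M. T * V = U" using Hom_mod_comp[OF L PM M(1) i V(1)] by blast
qed

lemma surj_homI: "R * S = 1\<^sub>m (dim_row R) \<Longrightarrow> dim_row S = dim_col R \<Longrightarrow> dim_col S = dim_row R \<Longrightarrow> surj_hom (R :: 'k::field mat)"
  unfolding surj_hom_iff_right_inverse[OF carrier_matI[OF refl refl]] by (auto intro!: carrier_matI)

context hopf_algebra
begin

lemma dim_Hom_dual_iso:
  assumes M: "is_module A M" and L: "is_module A L" "is_module A L'" and iso: "iso_mod A L L'"
  shows "dim_Hom A M (dual_mod A L) = dim_Hom A M (dual_mod A L')"
  by (rule iso_dim_Hom_right[OF rep_dims_module[OF M] rep_dims_dual rep_dims_dual iso_mod_dual[OF L iso]])

lemma dim_Hom_dual_dsum: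
  assumes M: "is_module A M" and L: "is_module A L" "is_module A L'"
  shows "dim_Hom A M (dual_mod A (dsum_mod L L')) = dim_Hom A M (dual_mod A L) + dim_Hom A M (dual_mod A L')"
  by (rule dim_Hom_split_right[OF rep_dims_module[OF M] rep_dims_dual rep_dims_dual rep_dims_dual
        mod_split_dual[OF L(1) is_module_dsum[OF L] L(2) mod_split_dsum[OF L]]])

lemma dim_Hom_dual_zero:
  assumes M: "is_module A M" and L: "is_module A L" "rdim L = 0"
  shows "dim_Hom A M (dual_mod A L) = 0"
proof -
  have "x = 0\<^sub>m 0 (rdim M)" if "x \<in> carrier_mat 0 (rdim M)" for x :: "'k mat"
    by (rule eq_matI) (use that in auto)
  then have "Hom_mod A M (dual_mod A L) = {0\<^sub>m 0 (rdim M)}"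
    using Hom_subspace[OF rep_dims_module[OF M] rep_dims_dual, of L] L(2) by (auto simp: mat_subspace_def)
  then show ?thesis unfolding dim_Hom_def using L(2) by (simp add: mat_dim_zero)
qed

text \<open>A projective module is cut into smaller projective summands until these are
  indecomposable, and Hom dimensions into duals add up along the way.\<close>

lemma dim_Hom_eq_of_indecomposable:
  assumes M: "is_module A M" "is_module A M'"
    and eq: "\<And>P. indecomposable_mod A P \<Longrightarrow> projective_mod A P \<Longrightarrow> dim_Hom A M (dual_mod A P) = dim_Hom A M' (dual_mod A P)"
    and P: "projective_mod A P"
  shows "dim_Hom A M (dual_mod A P) = dim_Hom A M' (dual_mod A P)"
  using P
proof (induction "rdim P" arbitrary: P rule: less_induct)
  case less
  have P: "is_module A P" using less.prems by (simp add: projective_mod_def)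
  consider "rdim P = 0" | "indecomposable_mod A P"
    | L K where "is_module A L" "is_module A K" "iso_mod A P (dsum_mod L K)" "rdim L \<noteq> 0" "rdim K \<noteq> 0"
    using P unfolding indecomposable_mod_def by blast
  then show ?case
  proof cases
    case 1
    then show ?thesis by (simp add: dim_Hom_dual_zero[OF M(1) P] dim_Hom_dual_zero[OF M(2) P])
  next
    case 2
    then show ?thesis by (rule eq[OF _ less.prems])
  next
    case (3 L K)
    note D = is_module_dsum[OF 3(1,2)]
    obtain T T' where T: "T \<in> Hom_mod A P (dsum_mod L K)" "T' \<in> Hom_mod A (dsum_mod L K) P" "T * T' = 1\<^sub>m (rdim (dsum_mod L K))" "T' * T = 1\<^sub>m (rdim P)"
      using 3(3) unfolding iso_mod_def by auto
    note s = mod_split_dsum[OF 3(1,2), unfolded mod_split_def]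
    note l = lin_splitD(13,14)[OF s[THEN conjunct2, THEN conjunct2, THEN conjunct2, THEN conjunct2]]
    have retr: "projective_mod A C" if C: "is_module A C" "S \<in> Hom_mod A C (dsum_mod L K)" "R \<in> Hom_mod A (dsum_mod L K) C" "R * S = 1\<^sub>m (rdim C)" for C S R
    proof (rule projective_retract[OF less.prems C(1) Hom_mod_comp[OF C(1) D P C(2) T(2)] Hom_mod_comp[OF P D C(1) T(1) C(3)]])
      note d = Hom_modD(2,3)[OF T(1)] Hom_modD(2,3)[OF T(2)] Hom_modD(2,3)[OF C(2)] Hom_modD(2,3)[OF C(3)]
      show "R * T * (T' * S) = 1\<^sub>m (rdim C)" using d by (simp add: mat_assoc mat_absorb[OF T(3)] C(4) del: dsum_mod_rdim)
    qed
    have pL: "projective_mod A L" by (rule retr[OF 3(1) _ _ l(1)]) (use s in blast)+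
    have pK: "projective_mod A K" by (rule retr[OF 3(2) _ _ l(2)]) (use s in blast)+
    have r: "rdim P = rdim L + rdim K" using iso_mod_rdim[OF 3(3)] by simp
    have "dim_Hom A M (dual_mod A L) = dim_Hom A M' (dual_mod A L)" by (rule less.hyps[OF _ pL]) (use r 3(5) in simp)
    moreover have "dim_Hom A M (dual_mod A K) = dim_Hom A M' (dual_mod A K)" by (rule less.hyps[OF _ pK]) (use r 3(4) in simp)
    ultimately show ?thesis
      by (simp add: dim_Hom_dual_iso[OF M(1) P D 3(3)] dim_Hom_dual_iso[OF M(2) P D 3(3)] dim_Hom_dual_dsum[OF M(1) 3(1,2)] dim_Hom_dual_dsum[OF M(2) 3(1,2)])
  qed
qed

lemma free_form_exact:
  assumes f: "f \<in> exact_relations A" and P: "is_module A P"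
    and add: "\<And>L M K. is_module A L \<Longrightarrow> is_module A M \<Longrightarrow> is_module A K \<Longrightarrow> short_exact A L M K \<Longrightarrow>
      dim_Hom A M (dual_mod A P) = dim_Hom A L (dual_mod A P) + dim_Hom A K (dual_mod A P)"
  shows "free_form A f (frag_of (iso_class A P)) = 0"
  using f exact_gens_carrier unfolding exact_relations_def
proof (induction f rule: generate_induct)
  case (gen y)
  then obtain L M K where m: "is_module A L" "is_module A M" "is_module A K" and e: "short_exact A L M K"
    and y: "y = frag_of (iso_class A M) - frag_of (iso_class A L) - frag_of (iso_class A K)" by auto
  show ?case unfolding y free_form_diff_left using add[OF m e] by (simp add: free_form_class m P)
qed (simp_all add: free_form_diff_left)

end

section \<open>Projectivity of induced modules and orthogonality\<close>

context group_datum_closed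
begin

text \<open>By semisimplicity the surjection \<open>T\<close> has a section over the group. Lifting
  the restriction of \<open>B\<close> to block 0 along it and extending to the induced module gives
  the lift.\<close>

lemma ind_projective:
  assumes U: "is_module KG U"
  shows "projective_mod H (ind_mod U)"
  unfolding projective_mod_def
proof (intro conjI allI ballI impI is_module_ind(1)[OF U])
  fix M M' T B assume T: "T \<in> Hom_mod H M M'" and B: "B \<in> Hom_mod H (ind_mod U) M'" and "is_module H M \<and> is_module H M' \<and> surj_hom T"
  then have M: "is_module H M" and M': "is_module H M'" and sur: "surj_hom T" by auto
  let ?b = "block_in n (rdim U) 0 :: 'k mat"
  note rM = H_module_res[OF M] and rM' = H_module_res[OF M'] and P = is_module_ind(1)[OF U]
  have rT: "T \<in> Hom_mod KG (res_mod M) (res_mod M')" by (rule res_Hom[OF M M' T])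
  obtain T1 where T1: "T1 \<in> carrier_mat (rdim M) (rdim M')" "T * T1 = 1\<^sub>m (rdim M')"
    using sur surj_hom_iff_right_inverse[OF Hom_modD(1)[OF T]] by blast
  obtain K S S' where K: "is_module KG K" "S \<in> Hom_mod KG K (res_mod M)" "lin_split (rdim K) (rdim (res_mod M)) (rdim (res_mod M')) S S' T T1"
    by (rule ex_kernel[OF rM rM' rT]) (use T1 in auto)
  from maschke[OF K(1) rM rM' K(2) rT K(3)] obtain S2 T' where "mod_split KG K (res_mod M) (res_mod M') S S2 T T'" .
  then have T': "T' \<in> Hom_mod KG (res_mod M') (res_mod M)" "T * T' = 1\<^sub>m (rdim M')"
    unfolding mod_split_def by (auto dest: lin_splitD)
  note d = Hom_modD(2,3)[OF T] Hom_modD(2,3)[OF B] Hom_modD(2,3)[OF T'(1)]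
  have "B * ?b \<in> Hom_mod KG U (res_mod M')"
    by (rule Hom_mod_comp[OF U H_module_res[OF P] rM' block_in_Hom[OF U] res_Hom[OF P M' B]])
  then have c: "T' * (B * ?b) \<in> Hom_mod KG U (res_mod M)" by (rule Hom_mod_comp[OF U rM' rM _ T'(1)])
  let ?V = "ind_map M (rdim U) (T' * (B * ?b))"
  have V: "?V \<in> Hom_mod H (ind_mod U) M" by (rule ind_map_Hom[OF M U c])
  have "T' * (B * ?b) \<in> carrier_mat (rdim M) (rdim U)" using Hom_modD(1)[OF c] by simp
  then have "?V * ?b = T' * (B * ?b)"
    using ind_map_block[OF M, of "T' * (B * ?b)" "rdim U" 0] n_ge_2 H_module_dims(1,2)[OF M] d by simp
  then have "T * ?V * ?b = B * ?b" using d Hom_modD(2,3)[OF V] by (simp add: mat_assoc mat_absorb[OF T'(2)])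
  then have "T * ?V = B" by (rule ind_Hom_eqI[OF U M' Hom_mod_comp[OF P M M' V T] B])
  then show "\<exists>V\<in>Hom_mod H (ind_mod U) M. T * V = B" using V by blast
qed

text \<open>The extension \<open>R\<close> of the identity of the restriction of \<open>P\<close> is
  onto, since it is the identity on block 0. Projectivity splits it, and the idempotent
  \<open>S * R\<close> cuts out a copy of \<open>P\<close>.\<close>

lemma projective_summand:
  assumes P: "projective_mod H P"
  obtains Q where "is_module H Q" "iso_mod H (ind_mod (res_mod P)) (dsum_mod P Q)"
proof -
  have PM: "is_module H P" using P by (simp add: projective_mod_def)
  let ?d = "rdim P" and ?b = "block_in n (rdim P) 0 :: 'k mat"
  note rP = H_module_res[OF PM]
  define B where "B = ind_mod (res_mod P)"
  have B: "is_module H B" unfolding B_def by (rule is_module_ind(1)[OF rP])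
  define R where "R = ind_map P ?d (1\<^sub>m ?d)"
  have R: "R \<in> Hom_mod H B P" unfolding R_def B_def using ind_map_Hom[OF PM rP Hom_mod_one[OF rP]] by simp
  have Rb: "R * ?b = 1\<^sub>m ?d" unfolding R_def
    using ind_map_block[OF PM one_carrier_mat, of 0] n_ge_2 H_module_dims(1,2)[OF PM] by simp
  have rB: "rdim B = n * ?d" by (simp add: B_def)
  have "surj_hom R" by (rule surj_homI[of R ?b]) (use Rb Hom_modD(2,3)[OF R] rB in simp_all)
  then obtain S where S: "S \<in> Hom_mod H P B" "R * S = 1\<^sub>m ?d"
    using P R Hom_mod_one[OF PM] B PM unfolding projective_mod_def by blast
  note d = Hom_modD(2,3)[OF R] Hom_modD(2,3)[OF S(1)]
  have e: "S * R \<in> Hom_mod H B B" by (rule Hom_mod_comp[OF B PM B R S(1)])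
  have ee: "S * R * (S * R) = S * R" using d by (simp add: mat_assoc mat_absorb[OF S(2)])
  from mod_split_idempotent[OF B e ee] obtain L Q S1 S1' T1 T1' where L: "is_module H L" "is_module H Q"
    and ms: "mod_split H L B Q S1 S1' T1 T1'" and SS: "S1 * S1' = S * R" .
  have h: "S1 \<in> Hom_mod H L B" "S1' \<in> Hom_mod H B L" "S1' * S1 = 1\<^sub>m (rdim L)"
    using ms unfolding mod_split_def by (auto dest: lin_splitD(13))
  note d1 = Hom_modD(2,3)[OF h(1)] Hom_modD(2,3)[OF h(2)]
  have 1: "R * S1 \<in> Hom_mod H L P" "S1' * S \<in> Hom_mod H P L"
    by (rule Hom_mod_comp[OF L(1) B PM h(1) R], rule Hom_mod_comp[OF PM B L(1) S(1) h(2)])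
  have "R * S1 * (S1' * S) = 1\<^sub>m ?d" using d d1 by (simp add: mat_assoc mat_absorb[OF SS] mat_absorb[OF S(2)] S(2))
  moreover have "S1' * S * (R * S1) = 1\<^sub>m (rdim L)"
  proof -
    have "S1' * S * (R * S1) = S1' * (S * R * S1)" using d d1 by (simp add: mat_assoc)
    also have "\<dots> = 1\<^sub>m (rdim L)" unfolding SS[symmetric] using d1 by (simp add: mat_assoc h(3))
    finally show ?thesis .
  qed
  ultimately have iso: "iso_mod H L P" unfolding iso_mod_def using 1 by blast
  have "iso_mod H B (dsum_mod P Q)"
    by (rule iso_mod_trans[OF B is_module_dsum[OF L] is_module_dsum[OF PM L(2)] mod_split_iso_dsum[OF L(1) B L(2) ms]
          iso_mod_dsum[OF L(1) PM L(2) L(2) iso iso_mod_refl[OF L(2)]]])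
  then show thesis unfolding B_def by (rule that[OF L(2)])
qed

text \<open>For \<open>P\<close> and its complement \<open>Q\<close> left exactness gives two
  inequalities. Their sum is an equality, because the dimensions for the induced module are computed
  over the semisimple group algebra; hence each inequality is an equality.\<close>

lemma dim_Hom_projective_exact:
  assumes P: "projective_mod H P" and m: "is_module H L" "is_module H M" "is_module H K" and e: "short_exact H L M K"
  shows "dim_Hom H M (dual_mod H P) = dim_Hom H L (dual_mod H P) + dim_Hom H K (dual_mod H P)"
proof -
  have PM: "is_module H P" using P by (simp add: projective_mod_def)
  obtain Q where Q: "is_module H Q" "iso_mod H (ind_mod (res_mod P)) (dsum_mod P Q)" by (rule projective_summand[OF P])
  note rP = H_module_res[OF PM] and r = m[THEN H_module_res]
  have ind: "dim_Hom H C (dual_mod H P) + dim_Hom H C (dual_mod H Q) = dim_Hom KG (res_mod C) (kdual (res_mod P))" if C: "is_module H C" for C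
    using dim_Hom_dual_iso[OF C is_module_ind(1)[OF rP] is_module_dsum[OF PM Q(1)] Q(2)] dim_Hom_dual_dsum[OF C PM Q(1)]
      dim_Hom_dual_ind[OF C rP] by simp
  have sum: "dim_Hom KG (res_mod M) (kdual (res_mod P)) = dim_Hom KG (res_mod L) (kdual (res_mod P)) + dim_Hom KG (res_mod K) (kdual (res_mod P))"
    by (rule dim_Hom_KG_exact[OF r res_short_exact[OF m e] rep_dims_dual])
  obtain S S' T T' where s: "S \<in> Hom_mod H L M" "T \<in> Hom_mod H M K" "lin_split (rdim L) (rdim M) (rdim K) S S' T T'"
    by (rule short_exactE[OF e])
  have le: "dim_Hom H M (dual_mod H C) \<le> dim_Hom H L (dual_mod H C) + dim_Hom H K (dual_mod H C)" for C
    by (rule dim_Hom_exact(1)[OF m[THEN rep_dims_module] rep_dims_dual s])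
  show ?thesis using le[of P] le[of Q] ind[OF m(1)] ind[OF m(2)] ind[OF m(3)] sum by linarith
qed

lemma exact_of_res_dim:
  assumes f: "f \<in> carrier F" and M: "is_module H M" "is_module H M'"
    and fM: "f - (frag_of (iso_class H M) - frag_of (iso_class H M')) \<in> split_relations H"
    and eq: "\<And>W. is_module KG W \<Longrightarrow> dim_Hom KG (res_mod M) W = dim_Hom KG (res_mod M') W"
  shows "f \<in> exact_relations H"
proof -
  have "iso_mod KG (res_mod M) (res_mod M')" by (rule iso_of_dim_Hom[OF M[THEN H_module_res] eq])
  from exact_closed(3)[OF subsetD[OF split_subset_exact fM] exact_of_res_iso[OF M this]] show ?thesis by simp
qed

text \<open>For the converse, vanishing on indecomposable projectives extends to all projectives, in
  particular to induced modules. These measure every \<open>Hom\<close> from the restriction to a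
  group module and so determine the restriction.\<close>

lemma exact_iff_projective_perp:
  assumes f: "f \<in> carrier F"
  shows "f \<in> exact_relations H \<longleftrightarrow> (\<forall>P. indecomposable_mod H P \<and> projective_mod H P \<longrightarrow> free_form H f (frag_of (iso_class H P)) = 0)"
proof
  assume "f \<in> exact_relations H"
  then show "\<forall>P. indecomposable_mod H P \<and> projective_mod H P \<longrightarrow> free_form H f (frag_of (iso_class H P)) = 0"
    using free_form_exact[of f] dim_Hom_projective_exact by (simp add: projective_mod_def)
next
  assume perp: "\<forall>P. indecomposable_mod H P \<and> projective_mod H P \<longrightarrow> free_form H f (frag_of (iso_class H P)) = 0"
  obtain M M' where M: "is_module H M" "is_module H M'"
    and fM: "f - (frag_of (iso_class H M) - frag_of (iso_class H M')) \<in> split_relations H"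
    by (rule free_difference[OF f])
  have ind: "dim_Hom H M (dual_mod H P) = dim_Hom H M' (dual_mod H P)" if P: "indecomposable_mod H P" "projective_mod H P" for P
  proof -
    have PM: "is_module H P" using P by (simp add: projective_mod_def)
    show ?thesis
      using free_form_split(1)[OF fM, of "frag_of (iso_class H P)"] perp P PM
      by (simp add: free_form_diff_left free_form_class M)
  qed
  show "f \<in> exact_relations H"
  proof (rule exact_of_res_dim[OF f M fM])
    fix W :: "('g, 'k) rep" assume W: "is_module KG W"
    \<comment> \<open>Every test module is a dual up to isomorphism, so inducing its dual yields a
      projective module that detects it.\<close>
    have "iso_mod KG W (kdual (kdual W))"
      by (rule iso_mod_by_eq[OF W]) (simp_all add: kdual_act is_module_kdual W)
    then have "dim_Hom KG (res_mod C) W = dim_Hom H C (dual_mod H (ind_mod (kdual W)))" if "is_module H C" for C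
      unfolding dim_Hom_dual_ind[OF that is_module_kdual[OF W]]
      by (rule iso_dim_Hom_right[OF rep_dims_module[OF H_module_res[OF that]] rep_dims_module[OF W] rep_dims_dual])
    then show "dim_Hom KG (res_mod M) W = dim_Hom KG (res_mod M') W"
      using dim_Hom_eq_of_indecomposable[OF M ind ind_projective[OF is_module_kdual[OF W]]] M by simp
  qed
qed

text \<open>Together with \<open>natural_map_kernel\<close> this is the equality of the kernel with
  the orthogonal space.\<close>

lemma projective_perp_exact: "projective_perp H = scos ` exact_relations H"
proof (rule subset_antisym)
  show "projective_perp H \<subseteq> scos ` exact_relations H"
  proof
    fix x assume x: "x \<in> projective_perp H"
    then obtain f where f: "f \<in> carrier F" "x = scos f" unfolding projective_perp_def carrier_green by blast
    then have "f \<in> exact_relations H" using x projective_perp_cos[OF f(1)] exact_iff_projective_perp[OF f(1)] by simp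
    then show "x \<in> scos ` exact_relations H" unfolding f(2) by (rule imageI)
  qed
  show "scos ` exact_relations H \<subseteq> projective_perp H"
  proof (rule image_subsetI)
    fix f assume f: "f \<in> exact_relations H"
    then have c: "f \<in> carrier F" using exact_closed(5) by blast
    then show "scos f \<in> projective_perp H" using f projective_perp_cos[OF c] exact_iff_projective_perp[OF c] by simp
  qed
qed

text \<open>Equality of classes in the Green ring of the group algebra gives equality of all Hom
  dimensions, because the form there is well defined. This makes restriction injective on the
  Grothendieck ring.\<close>

lemma exact_iff_res_class:
  assumes f: "f \<in> carrier F"
  shows "f \<in> exact_relations H \<longleftrightarrow> res_class f \<in> split_relations KG"
proof
  assume "f \<in> exact_relations H"
  from res_class_exact[OF this] KG_exact_subset_split show "res_class f \<in> split_relations KG" by blast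
next
  assume rf: "res_class f \<in> split_relations KG"
  obtain M M' where M: "is_module H M" "is_module H M'"
    and fM: "f - (frag_of (iso_class H M) - frag_of (iso_class H M')) \<in> split_relations H"
    by (rule free_difference[OF f])
  have "res_class (f - (frag_of (iso_class H M) - frag_of (iso_class H M'))) \<in> split_relations KG"
    using res_class_exact[OF subsetD[OF split_subset_exact fM]] KG_exact_subset_split by blast
  from KG.split_closed(4)[OF rf this]
  have "frag_of (iso_class KG (res_mod M)) - frag_of (iso_class KG (res_mod M')) \<in> split_relations KG"
    by (simp add: res_class_diff res_class_of M)
  note sp = this
  show "f \<in> exact_relations H"
  proof (rule exact_of_res_dim[OF f M fM])
    fix W :: "('g, 'k) rep" assume W: "is_module KG W"
    have iso: "iso_mod KG W (kdual (kdual W))"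
      by (rule iso_mod_by_eq[OF W]) (simp_all add: kdual_act is_module_kdual W)
    have "dim_Hom KG C W = dim_Hom KG C (kdual (kdual W))" if "is_module KG C" for C
      by (rule iso_dim_Hom_right[OF rep_dims_module[OF that] rep_dims_module[OF W] rep_dims_dual iso])
    then show "dim_Hom KG (res_mod M) W = dim_Hom KG (res_mod M') W"
      using KG.free_form_split(1)[OF sp, of "frag_of (iso_class KG (kdual W))"] is_module_kdual[OF W] M[THEN H_module_res]
      by (simp add: free_form_diff_left free_form_class)
  qed
qed

end

context hopf_algebra
begin

section \<open>The image in the Green ring of the group algebra\<close>

lemma green_class_closed [simp]: "is_module A M \<Longrightarrow> green_class A M \<in> carrier (green_ring A)"
  by (auto simp: green_class_cos carrier_green)

lemma green_class_iso: "is_module A M \<Longrightarrow> is_module A L \<Longrightarrow> iso_mod A M L \<Longrightarrow> green_class A M = green_class A L"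
  by (simp add: green_class_def iso_class_eqI)

lemma green_class_tensor:
  assumes "is_module A M" "is_module A L"
  shows "green_class A (tensor_mod A M L) = green_class A M \<otimes>\<^bsub>green_ring A\<^esub> green_class A L"
  unfolding green_class_cos free_mult_class[OF assms, symmetric]
  by (rule ring_hom_mult[OF scos_hom]) (use assms in auto)

lemma green_class_sum:
  assumes "is_module A M" "is_module A L" "is_module A K"
    and "frag_of (iso_class A M) - frag_of (iso_class A L) - frag_of (iso_class A K) \<in> split_relations A"
  shows "green_class A M = green_class A L \<oplus>\<^bsub>green_ring A\<^esub> green_class A K"
proof -
  have "scos (frag_of (iso_class A M)) = scos (frag_of (iso_class A L) + frag_of (iso_class A K))"
    using assms by (subst cos_eq_iff(1)) (auto simp: free_carrier_add algebra_simps)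
  also have "\<dots> = scos (frag_of (iso_class A L)) \<oplus>\<^bsub>green_ring A\<^esub> scos (frag_of (iso_class A K))"
    using ring_hom_add[OF scos_hom, of "frag_of (iso_class A L)" "frag_of (iso_class A K)"] assms by (simp add: free_add)
  finally show ?thesis by (simp only: green_class_cos)
qed

lemma green_class_dsum:
  assumes "is_module A M" "is_module A L" "is_module A K" "iso_mod A M (dsum_mod L K)"
  shows "green_class A M = green_class A L \<oplus>\<^bsub>green_ring A\<^esub> green_class A K"
  by (rule green_class_sum[OF assms(1-3) split_relation[OF assms(2,3,1,4)]])

lemma zero_green: "\<zero>\<^bsub>green_ring A\<^esub> = scos 0"
  unfolding ring_hom_zero[OF scos_hom ring_free ring_green, symmetric] by (simp add: free_zero)

lemma one_green: "\<one>\<^bsub>green_ring A\<^esub> = green_class A (trivial_mod A)"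
  unfolding ring_hom_one[OF scos_hom, symmetric] by (simp add: free_one green_class_cos)

end

lemma sum_lessThan_group: "f \<in> {..<Suc m} \<rightarrow> carrier R \<Longrightarrow> ring R \<Longrightarrow> finsum R f {..<Suc m} = finsum R f {..<m} \<oplus>\<^bsub>R\<^esub> f m"
proof -
  assume f: "f \<in> {..<Suc m} \<rightarrow> carrier R" and "ring R"
  then interpret ring R by simp
  have "f \<in> {..<m} \<rightarrow> carrier R" "f m \<in> carrier R" using f by auto
  then show ?thesis by (simp add: lessThan_Suc a_comm)
qed

section \<open>Restriction and the generators of its image\<close>

context group_datum_closed
begin

lemma KG_module_by_eq:
  "is_module KG M \<Longrightarrow> rdim L = rdim M \<Longrightarrow> (\<And>h. h \<in> carrier G \<Longrightarrow> ract L h = ract M h) \<Longrightarrow> is_module KG L"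
  unfolding is_module_KG by simp

text \<open>A zero module has an empty composition series, so its class is an exact relation, and
  over the group algebra exact relations are split.\<close>

lemma green_class_zero:
  assumes "is_module KG (W :: ('g, 'k) rep)" "rdim W = 0"
  shows "green_class KG W = \<zero>\<^bsub>green_ring KG\<^esub>"
proof -
  have "frag_of (iso_class KG W) \<in> split_relations KG"
    using KG.composition_series_class(3)[OF composition_series.zero_dim[OF assms]] KG_exact_subset_split by auto
  then show ?thesis
    unfolding KG.green_class_cos KG.zero_green using assms by (subst KG.cos_eq_iff(1)) (auto simp: free_carrier)
qed

text \<open>Simple quotients are split off one at a time. The property \<open>A\<close> records a
  condition on the eigenvalues of \<open>g^n\<close>; it is assumed to pass to every submodule so
  that it reaches the simple summands.\<close>

lemma semisimple_induct:
  fixes W :: "('g, 'k) rep"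
  assumes "is_module KG W" "A W"
    and hereditary: "\<And>M L S R. is_module KG M \<Longrightarrow> is_module KG L \<Longrightarrow> A M \<Longrightarrow> S \<in> Hom_mod KG L M \<Longrightarrow>
      R \<in> carrier_mat (rdim L) (rdim M) \<Longrightarrow> R * S = 1\<^sub>m (rdim L) \<Longrightarrow> A L"
    and zero: "\<And>M. is_module KG M \<Longrightarrow> rdim M = 0 \<Longrightarrow> B M"
    and simple: "\<And>M. simple_mod KG M \<Longrightarrow> A M \<Longrightarrow> B M"
    and dsum: "\<And>M L K. is_module KG M \<Longrightarrow> is_module KG L \<Longrightarrow> is_module KG K \<Longrightarrow> iso_mod KG M (dsum_mod L K) \<Longrightarrow> B L \<Longrightarrow> B K \<Longrightarrow> B M"
  shows "B W"
  using assms(1,2)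
proof (induction "rdim W" arbitrary: W rule: less_induct)
  case (less W)
  note W = less.prems(1)
  show ?case
  proof (cases "rdim W = 0")
    case True
    then show ?thesis by (rule zero[OF W])
  next
    case False
    obtain L K where L: "is_module KG L" and K: "simple_mod KG K" and e: "short_exact KG L W K"
      by (rule ex_simple_quotient[OF W False])
    have Km: "is_module KG K" and K0: "rdim K \<noteq> 0" using K by (simp_all add: simple_mod_def)
    obtain S U T T' where s: "S \<in> Hom_mod KG L W" "T \<in> Hom_mod KG W K" "lin_split (rdim L) (rdim W) (rdim K) S U T T'"
      by (rule short_exactE[OF e])
    obtain S' R where ms: "mod_split KG L W K S S' T R" by (rule maschke[OF L W Km s])
    then have h: "R \<in> Hom_mod KG K W" and l: "lin_split (rdim L) (rdim W) (rdim K) S S' T R" by (auto simp: mod_split_def)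
    note l = lin_splitD[OF l]
    have AL: "A L" by (rule hereditary[OF W L less.prems(2) s(1) l(2) l(13)])
    have AK: "A K" by (rule hereditary[OF W Km less.prems(2) h l(3) l(14)])
    have "rdim L < rdim W" using lin_split_dim[OF s(3)] K0 by simp
    from less.hyps[OF this L AL] show ?thesis
      by (rule dsum[OF W L Km mod_split_iso_dsum[OF L W Km ms] _ simple[OF K AK]])
  qed
qed

definition power_mod :: "nat \<Rightarrow> ('g, 'k) rep" where
  "power_mod k = \<lparr>rdim = 1, ract = (\<lambda>h. inverse (\<chi> h) ^ k \<cdot>\<^sub>m 1\<^sub>m 1)\<rparr>"

text \<open>The direct sum of the first \<open>m\<close> powers of the inverse character. For
  general \<open>m\<close> it permits an induction that ends, at \<open>m = n\<close>, with
  \<open>char_mod\<close>.\<close>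

definition powers_mod :: "nat \<Rightarrow> ('g, 'k) rep" where
  "powers_mod m = \<lparr>rdim = m, ract = (\<lambda>h. mat m m (\<lambda>(i, j). if i = j then inverse (\<chi> h) ^ i else 0))\<rparr>"

lemma is_module_power: "is_module KG (power_mod k)"
  unfolding is_module_KG
  by (auto simp: power_mod_def char_one char_mult mat_smult_left mat_smult_right mat_smult_smult mat_smult_one power_mult_distrib mult.commute)

lemma inv_char_act: "ract (inv_char_mod \<chi>) h = inverse (\<chi> h) \<cdot>\<^sub>m 1\<^sub>m 1"
  by (rule eq_matI) (auto simp: inv_char_mod_def)

lemma is_module_inv_char: "is_module KG (inv_char_mod \<chi>)"
  by (rule KG_module_by_eq[OF is_module_power[of 1]]) (simp_all add: inv_char_act power_mod_def, simp add: inv_char_mod_def)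

abbreviation "gr \<equiv> green_ring (KG :: ('g, 'k) hopf_data)"
abbreviation "gcls \<equiv> green_class (KG :: ('g, 'k) hopf_data)"

lemma ring_gr: "ring gr" by (rule KG.ring_green)

lemma green_power: "gcls (inv_char_mod \<chi>) [^]\<^bsub>gr\<^esub> k = gcls (power_mod k)"
proof (induction k)
  case 0
  have "iso_mod KG (trivial_mod KG) (power_mod 0)"
    by (rule iso_mod_by_eq[OF KG.is_module_trivial]) (auto simp: trivial_mod_def power_mod_def intro!: eq_matI)
  then show ?case by (simp add: KG.one_green KG.green_class_iso[OF KG.is_module_trivial is_module_power])
next
  case (Suc k)
  have t: "is_module KG (tensor_mod KG (power_mod k) (inv_char_mod \<chi>))"
    by (rule KG.is_module_tensor[OF is_module_power is_module_inv_char])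
  have "iso_mod KG (tensor_mod KG (power_mod k) (inv_char_mod \<chi>)) (power_mod (Suc k))"
  proof (rule iso_mod_by_eq[OF t])
    fix h assume "h \<in> hbasis (KG :: ('g, 'k) hopf_data)"
    then have h: "h \<in> carrier G" by simp
    show "ract (power_mod (Suc k)) h = ract (tensor_mod KG (power_mod k) (inv_char_mod \<chi>)) h"
      unfolding tensor_mod_KG[OF is_module_power is_module_inv_char h] inv_char_act
      by (simp add: power_mod_def kron_smult_left kron_smult_right kron_one mat_smult_smult mult.commute)
  qed (simp add: power_mod_def inv_char_mod_def)
  from KG.green_class_iso[OF t is_module_power this] show ?case
    by (simp add: Suc KG.green_class_tensor[OF is_module_power is_module_inv_char])
qed

lemma powers_Suc:
  assumes "is_module KG (powers_mod m)"
  shows "is_module KG (powers_mod (Suc m))" "iso_mod KG (powers_mod (Suc m)) (dsum_mod (powers_mod m) (power_mod m))"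
proof -
  note D = is_module_dsum[OF assms is_module_power]
  have r: "rdim (powers_mod (Suc m)) = rdim (dsum_mod (powers_mod m) (power_mod m))" by (simp add: powers_mod_def power_mod_def)
  have a: "ract (powers_mod (Suc m)) h = ract (dsum_mod (powers_mod m) (power_mod m)) h" for h
  proof -
    have "i = m" if "\<not> i < m" "i < m + 1" for i using that by simp
    note im = this
    show ?thesis by (intro eq_matI) (auto simp: powers_mod_def power_mod_def dsum_mod_def dest: im)
  qed
  show "is_module KG (powers_mod (Suc m))" by (rule KG_module_by_eq[OF D r a])
  then show "iso_mod KG (powers_mod (Suc m)) (dsum_mod (powers_mod m) (power_mod m))"
    by (rule iso_mod_by_eq[OF _ r[symmetric] a[symmetric]])
qed

lemma green_powers:
  "is_module KG (powers_mod m) \<and> gcls (powers_mod m) = (\<Oplus>\<^bsub>gr\<^esub>k\<in>{..<m}. gcls (inv_char_mod \<chi>) [^]\<^bsub>gr\<^esub> k)"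
proof (induction m)
  case 0
  interpret gr: ring gr by (rule ring_gr)
  have "is_module KG (powers_mod 0)" unfolding is_module_KG by (auto simp: powers_mod_def intro!: eq_matI)
  moreover from green_class_zero[OF this] have "gcls (powers_mod 0) = \<zero>\<^bsub>gr\<^esub>" by (simp add: powers_mod_def)
  ultimately show ?case by simp
next
  case (Suc m)
  note m = powers_Suc[OF conjunct1[OF Suc]]
  have "(\<lambda>k. gcls (inv_char_mod \<chi>) [^]\<^bsub>gr\<^esub> k) \<in> {..<Suc m} \<rightarrow> carrier gr"
    unfolding green_power using is_module_power by simp
  from sum_lessThan_group[OF this ring_gr] show ?case
    using KG.green_class_dsum[OF m(1) conjunct1[OF Suc] is_module_power m(2)] Suc m(1) by (simp add: green_power)
qed

lemma green_char_mod: "gcls char_mod = (\<Oplus>\<^bsub>gr\<^esub>k\<in>{..<n}. gcls (inv_char_mod \<chi>) [^]\<^bsub>gr\<^esub> k)"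
  using green_powers[of n] by (simp add: powers_mod_def char_mod_def)

definition restriction :: "((nat \<times> 'g, 'k) rep set \<Rightarrow>\<^sub>0 int) \<Rightarrow> (('g, 'k) rep set \<Rightarrow>\<^sub>0 int) set" where
  "restriction f = KG.scos (res_class f)"

lemma restriction_class: "is_module H M \<Longrightarrow> restriction (frag_of (iso_class H M)) = gcls (res_mod M)"
  by (simp add: restriction_def res_class_of KG.green_class_cos)

lemma restriction_hom: "restriction \<in> Ring.ring_hom F gr"
  using ring_hom_trans[OF res_class_hom KG.scos_hom] by (simp add: restriction_def[abs_def] comp_def)

lemma subring_generators_eq:
  "subring_generators G \<chi> n \<Omega> V lam = {gcls (V i) | i. i \<in> \<Omega> \<and> lam i = 1} \<union>
    {gcls char_mod \<otimes>\<^bsub>gr\<^esub> gcls (V j) | j. j \<in> \<Omega> \<and> lam j \<noteq> 1}"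
  unfolding subring_generators_def Let_def green_char_mod ..

text \<open>The number 1 is not an eigenvalue of \<open>g^n\<close>. In the form of a left inverse
  the condition passes to submodules.\<close>

definition nonunipotent :: "('g, 'k) rep \<Rightarrow> bool" where
  "nonunipotent W \<longleftrightarrow> (\<exists>Q\<in>carrier_mat (rdim W) (rdim W). Q * (ract W (g [^] n) - 1\<^sub>m (rdim W)) = 1\<^sub>m (rdim W))"

lemma unipotent_sub:
  assumes M: "is_module KG M" and L: "is_module KG L" and "ract M (g [^] n) = 1\<^sub>m (rdim M)"
    and S: "S \<in> Hom_mod KG L M" and R: "R \<in> carrier_mat (rdim L) (rdim M)" "R * S = 1\<^sub>m (rdim L)"
  shows "ract L (g [^] n) = 1\<^sub>m (rdim L)"
proof -
  note d = Hom_modD(2,3)[OF S] KG_moduleD(2,3)[OF L g_n_closed] KG_moduleD(2,3)[OF M g_n_closed]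
  have dR: "dim_row R = rdim L" "dim_col R = rdim M" using R(1) by auto
  have "S * ract L (g [^] n) = S" using Hom_modD(4)[OF S, of "g [^] n"] assms(3) d by simp
  then show ?thesis using mat_absorb[OF R(2), of "ract L (g [^] n)"] d dR R(2) by simp
qed

lemma nonunipotent_sub:
  assumes M: "is_module KG M" and L: "is_module KG L" and "nonunipotent M"
    and S: "S \<in> Hom_mod KG L M" and R: "R \<in> carrier_mat (rdim L) (rdim M)" "R * S = 1\<^sub>m (rdim L)"
  shows "nonunipotent L"
proof -
  note d = Hom_modD(2,3)[OF S] KG_moduleD(2,3)[OF L g_n_closed] KG_moduleD(2,3)[OF M g_n_closed]
  have dR: "dim_row R = rdim L" "dim_col R = rdim M" using R(1) by auto
  obtain Q where Q: "Q \<in> carrier_mat (rdim M) (rdim M)" "Q * (ract M (g [^] n) - 1\<^sub>m (rdim M)) = 1\<^sub>m (rdim M)"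
    using assms(3) unfolding nonunipotent_def by blast
  have dQ: "dim_row Q = rdim M" "dim_col Q = rdim M" using Q(1) by auto
  have "S * (ract L (g [^] n) - 1\<^sub>m (rdim L)) = (ract M (g [^] n) - 1\<^sub>m (rdim M)) * S"
    using Hom_modD(4)[OF S, of "g [^] n"] d by (simp add: mat_diff_distrib_left mat_diff_distrib_right)
  then have "R * Q * S * (ract L (g [^] n) - 1\<^sub>m (rdim L)) = 1\<^sub>m (rdim L)"
    using mat_absorb[OF Q(2), of S] d dR dQ R(2) by (simp add: mat_assoc)
  moreover have "R * Q * S \<in> carrier_mat (rdim L) (rdim L)" using d dR by (intro carrier_matI) simp_all
  ultimately show ?thesis unfolding nonunipotent_def by blast
qed

text \<open>A restriction has the class \<open>(1 + a + ... + a^(n-1)) [U] + [W0]\<close>;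
  decomposing \<open>U\<close> and \<open>W0\<close> into simples expresses it by generators of the
  two kinds. Conversely, each generator is the restriction of a module with \<open>y = 0\<close> or
  of an induced module, and the image is a subring.\<close>

lemma image_restriction:
  assumes V: "complete_simples KG \<Omega> V"
    and lam: "\<And>i. i \<in> \<Omega> \<Longrightarrow> ract (V i) (g [^] n) = lam i \<cdot>\<^sub>m 1\<^sub>m (rdim (V i))"
  shows "restriction ` carrier F = generate_ring gr (subring_generators G \<chi> n \<Omega> V lam)"
proof -
  interpret gr: ring gr by (rule ring_gr)
  interpret res: ring_hom_ring F gr restriction by (rule ring_hom_ringI2[OF ring_free ring_gr restriction_hom])
  define Y where "Y = subring_generators G \<chi> n \<Omega> V lam"
  note Y = Y_def[unfolded subring_generators_eq]
  have simple: "simple_mod KG (V i)" if "i \<in> \<Omega>" for i using V that by (simp add: complete_simples_def)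
  have Vm: "is_module KG (V i)" and V0: "rdim (V i) \<noteq> 0" if "i \<in> \<Omega>" for i
    using simple[OF that] by (simp_all add: simple_mod_def)
  have Yc: "Y \<subseteq> carrier gr" unfolding Y using Vm is_module_char_mod by auto
  have cases: "\<exists>i\<in>\<Omega>. iso_mod KG M (V i)" if "simple_mod KG M" for M using V that unfolding complete_simples_def by blast
  have retr: "\<exists>S\<in>Hom_mod KG (V i) M. \<exists>R\<in>carrier_mat (rdim (V i)) (rdim M). R * S = 1\<^sub>m (rdim (V i))"
    if "iso_mod KG M (V i)" for M i
    using that Hom_modD(1) unfolding iso_mod_def by blast
  have uni: "gcls W \<in> generate_ring gr Y" if W: "is_module KG W" "ract W (g [^] n) = 1\<^sub>m (rdim W)" for W
  proof (rule semisimple_induct[where A = "\<lambda>W. ract W (g [^] n) = 1\<^sub>m (rdim W)", OF W])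
    show "gcls M \<in> generate_ring gr Y" if sM: "simple_mod KG M" and uM: "ract M (g [^] n) = 1\<^sub>m (rdim M)" for M
    proof -
      obtain i where i: "i \<in> \<Omega>" "iso_mod KG M (V i)" using cases[OF sM] by blast
      have M: "is_module KG M" using sM by (simp add: simple_mod_def)
      obtain S R where "S \<in> Hom_mod KG (V i) M" "R \<in> carrier_mat (rdim (V i)) (rdim M)" "R * S = 1\<^sub>m (rdim (V i))"
        using retr[OF i(2)] by blast
      from unipotent_sub[OF M Vm[OF i(1)] uM this] have "lam i \<cdot>\<^sub>m 1\<^sub>m (rdim (V i)) = 1\<^sub>m (rdim (V i))"
        unfolding lam[OF i(1)] .
      \<comment> \<open>A simple module has positive dimension, so the scalar is visible in the
        first entry of the matrix.\<close>
      from arg_cong[OF this, of "\<lambda>B. B $$ (0, 0)"] have "lam i = 1" using V0[OF i(1)] by simp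
      then have "gcls (V i) \<in> Y" unfolding Y using i(1) by blast
      then show ?thesis unfolding KG.green_class_iso[OF M Vm[OF i(1)] i(2)] by (rule generate_ring.incl)
    qed
  qed (use unipotent_sub gr.zero_in_generate in \<open>auto simp: green_class_zero KG.green_class_dsum intro: generate_ring.eng_add\<close>)
  have nonuni: "gcls char_mod \<otimes>\<^bsub>gr\<^esub> gcls W \<in> generate_ring gr Y" if W: "is_module KG W" "nonunipotent W" for W
  proof (rule semisimple_induct[where A = nonunipotent, OF W])
    show "gcls char_mod \<otimes>\<^bsub>gr\<^esub> gcls M \<in> generate_ring gr Y" if sM: "simple_mod KG M" and uM: "nonunipotent M" for M
    proof -
      obtain i where i: "i \<in> \<Omega>" "iso_mod KG M (V i)" using cases[OF sM] by blast
      have M: "is_module KG M" using sM by (simp add: simple_mod_def)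
      obtain S R where "S \<in> Hom_mod KG (V i) M" "R \<in> carrier_mat (rdim (V i)) (rdim M)" "R * S = 1\<^sub>m (rdim (V i))"
        using retr[OF i(2)] by blast
      from nonunipotent_sub[OF M Vm[OF i(1)] uM this] obtain Q where
        Q: "Q \<in> carrier_mat (rdim (V i)) (rdim (V i))" "Q * (lam i \<cdot>\<^sub>m 1\<^sub>m (rdim (V i)) - 1\<^sub>m (rdim (V i))) = 1\<^sub>m (rdim (V i))"
        unfolding nonunipotent_def lam[OF i(1)] by blast
      have "lam i \<noteq> 1"
      proof
        assume "lam i = 1"
        then have "1\<^sub>m (rdim (V i)) = (0\<^sub>m (rdim (V i)) (rdim (V i)) :: 'k mat)"
          using Q by (simp add: mat_smult_one mat_diff_self[of _ "rdim (V i)" "rdim (V i)"] mat_zero_simps)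
        then show False using V0[OF i(1)] by (simp add: one_mat_eq_zero_iff)
      qed
      then have "gcls char_mod \<otimes>\<^bsub>gr\<^esub> gcls (V i) \<in> Y" unfolding Y using i(1) by blast
      then show ?thesis unfolding KG.green_class_iso[OF M Vm[OF i(1)] i(2)] by (rule generate_ring.incl)
    qed
  next
    fix M L K :: "('g, 'k) rep"
    assume M: "is_module KG M" "is_module KG L" "is_module KG K" "iso_mod KG M (dsum_mod L K)"
      and B: "gcls char_mod \<otimes>\<^bsub>gr\<^esub> gcls L \<in> generate_ring gr Y" "gcls char_mod \<otimes>\<^bsub>gr\<^esub> gcls K \<in> generate_ring gr Y"
    show "gcls char_mod \<otimes>\<^bsub>gr\<^esub> gcls M \<in> generate_ring gr Y"
      using generate_ring.eng_add[OF B] M is_module_char_mod by (simp add: KG.green_class_dsum[OF M] gr.r_distr)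
  next
    fix M :: "('g, 'k) rep" assume "is_module KG M" "rdim M = 0"
    then show "gcls char_mod \<otimes>\<^bsub>gr\<^esub> gcls M \<in> generate_ring gr Y"
      using gr.zero_in_generate[of Y] is_module_char_mod by (simp add: green_class_zero)
  qed (rule nonunipotent_sub)
  have mod: "restriction (frag_of (iso_class H M)) \<in> generate_ring gr Y" if M: "is_module H M" for M
  proof -
    note rM = H_module_res[OF M]
    obtain W0 S0 P0 where W0: "idem_split (res_mod M) unip W0 S0 P0" using ex_idem_split[OF rM fun_simps(1)] .
    obtain U S P where U: "idem_split (res_mod M) orbit_rep U S P" using ex_idem_split[OF rM fun_simps(2)] .
    have m: "is_module KG W0" "is_module KG U" using W0 U by (simp_all add: idem_split_def)
    note e = ind_infl_exact[OF M W0 U]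
    have t: "is_module KG (tensor_mod KG char_mod U)" by (rule KG.is_module_tensor[OF is_module_char_mod m(2)])
    have "frag_of (iso_class KG (res_mod M)) - frag_of (iso_class KG (tensor_mod KG char_mod U)) - frag_of (iso_class KG W0) \<in> split_relations KG"
      using subsetD[OF KG_exact_subset_split res_class_exact[OF e(2)]] M is_module_ind(1)[OF m(2)] is_module_infl(1)[OF m(1) e(1)]
      by (simp add: res_class_diff res_class_of)
    from KG.green_class_sum[OF rM t m(1) this] have "gcls (res_mod M) = gcls char_mod \<otimes>\<^bsub>gr\<^esub> gcls U \<oplus>\<^bsub>gr\<^esub> gcls W0"
      by (simp add: KG.green_class_tensor[OF is_module_char_mod m(2)])
    moreover have "nonunipotent U" using idem_split_nonunipotent[OF rM U] unfolding nonunipotent_def by blast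
    ultimately show ?thesis
      unfolding restriction_class[OF M] using generate_ring.eng_add[OF nonuni[OF m(2)] uni[OF m(1) e(1)]] by simp
  qed
  have "restriction ` carrier F \<subseteq> generate_ring gr Y"
  proof (rule image_subsetI)
    fix f assume "f \<in> carrier F"
    then have "f \<in> carrier F \<and> restriction f \<in> generate_ring gr Y"
    proof (induction f rule: free_class_induct)
      case zero
      then show ?case using gr.zero_in_generate[of Y] res.hom_zero by (simp add: free_zero free_carrier)
    next
      case (cls M)
      then show ?case using mod by simp
    next
      case (diff a b)
      then have c: "a \<in> carrier F" "b \<in> carrier F" by auto
      have "restriction (a - b) = restriction a \<oplus>\<^bsub>gr\<^esub> \<ominus>\<^bsub>gr\<^esub> restriction b"
        using res.hom_add[OF c(1) F.a_inv_closed[OF c(2)]] res.hom_a_inv[OF c(2)] by (simp add: free_add F_inv[OF c(2)])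
      then show ?case using diff c by (auto simp: free_carrier_diff intro: generate_ring.eng_add generate_ring.a_inv)
    qed
    then show "restriction f \<in> generate_ring gr Y" ..
  qed
  moreover have "generate_ring gr Y \<subseteq> restriction ` carrier F"
  proof (rule gr.generate_ring_min_subring1[OF Yc])
    show "subring (restriction ` carrier F) gr" by (rule res.img_is_subring[OF F.carrier_is_subring])
    show "Y \<subseteq> restriction ` carrier F"
    proof
      fix x assume "x \<in> Y"
      then consider i where "i \<in> \<Omega>" "lam i = 1" "x = gcls (V i)" | j where "j \<in> \<Omega>" "x = gcls char_mod \<otimes>\<^bsub>gr\<^esub> gcls (V j)"
        unfolding Y by blast
      then show "x \<in> restriction ` carrier F"
      proof cases
        case (1 i)
        have "is_module H (infl_mod (V i))" by (rule is_module_infl(1)[OF Vm[OF 1(1)]]) (simp add: lam[OF 1(1)] 1(2) mat_smult_one)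
        then show ?thesis using restriction_class[of "infl_mod (V i)"] 1(3) by (intro image_eqI[of _ _ "frag_of (iso_class H (infl_mod (V i)))"]) simp_all
      next
        case (2 j)
        note I = is_module_ind(1)[OF Vm[OF 2(1)]]
        show ?thesis using restriction_class[OF I] I
          by (intro image_eqI[of _ _ "frag_of (iso_class H (ind_mod (V j)))"]) (simp_all add: 2(2) KG.green_class_tensor[OF is_module_char_mod Vm[OF 2(1)]])
      qed
    qed
  qed
  ultimately show ?thesis unfolding Y_def by (rule subset_antisym)
qed

text \<open>By \<open>exact_iff_res_class\<close> the kernel of restriction on the free ring is
  exactly the ideal that defines the Grothendieck ring, so the homomorphism theorem applies to its
  image.\<close>

lemma grothendieck_iso_subring:
  assumes V: "complete_simples KG \<Omega> V"
    and lam: "\<And>i. i \<in> \<Omega> \<Longrightarrow> ract (V i) (g [^] n) = lam i \<cdot>\<^sub>m 1\<^sub>m (rdim (V i))"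
  shows "is_ring_iso (grothendieck_ring H) (gr\<lparr>carrier := generate_ring gr (subring_generators G \<chi> n \<Omega> V lam)\<rparr>)"
proof -
  interpret gr: ring gr by (rule ring_gr)
  interpret res: ring_hom_ring F gr restriction by (rule ring_hom_ringI2[OF ring_free ring_gr restriction_hom])
  let ?S = "restriction ` carrier F"
  have S: "ring (gr\<lparr>carrier := ?S\<rparr>)" by (rule gr.subring_is_ring[OF res.img_is_subring[OF F.carrier_is_subring]])
  have "restriction \<in> Ring.ring_hom F (gr\<lparr>carrier := ?S\<rparr>)"
    using restriction_hom by (auto simp: Ring.ring_hom_def)
  from ring_hom_ringI2[OF ring_free S this] interpret r: ring_hom_ring F "gr\<lparr>carrier := ?S\<rparr>" restriction .
  have ker: "restriction f = \<zero>\<^bsub>gr\<^esub> \<longleftrightarrow> f \<in> exact_relations H" if "f \<in> carrier F" for f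
    unfolding exact_iff_res_class[OF that] restriction_def KG.zero_green
    using KG.cos_eq_iff(1)[OF res_class_closed[OF that], of 0] by (simp add: free_carrier)
  have "{f \<in> carrier F. restriction f = \<zero>\<^bsub>gr\<^esub>} = exact_relations H"
  proof (rule subset_antisym; rule subsetI)
    fix f assume "f \<in> {f \<in> carrier F. restriction f = \<zero>\<^bsub>gr\<^esub>}"
    then show "f \<in> exact_relations H" using ker[of f] by simp
  next
    fix f assume "f \<in> exact_relations H"
    then show "f \<in> {f \<in> carrier F. restriction f = \<zero>\<^bsub>gr\<^esub>}"
      using ker[of f] subsetD[OF exact_closed(5), of f] by simp
  qed
  then have "a_kernel F (gr\<lparr>carrier := ?S\<rparr>) restriction = exact_relations H"
    unfolding a_kernel_def' ring.simps(1) by simp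
  then have "is_ring_iso (F Quot exact_relations H) (gr\<lparr>carrier := ?S\<rparr>)"
    using r.FactRing_iso by simp
  moreover have "?S = generate_ring gr (subring_generators G \<chi> n \<Omega> V lam)"
    by (rule image_restriction[OF V]) (rule lam)
  ultimately show ?thesis unfolding grothendieck_ring_def by simp
qed

end

theorem proposition5p2:
  fixes G :: "('g, 'm) monoid_scheme"
    and \<chi> :: "'g \<Rightarrow> 'k::{alg_closed_field, field_char_0}"
    and g :: 'g
    and n :: nat
    and H :: "(nat \<times> 'g, 'k) hopf_data"
    and \<Omega> :: "'i set"
    and V :: "'i \<Rightarrow> ('g, 'k) rep"
    and lam :: "'i \<Rightarrow> 'k"
  assumes H: "group_datum_hopf G \<chi> g n H"
    and V: "complete_simples (group_algebra G) \<Omega> V"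
    and lam: "\<And>i. i \<in> \<Omega> \<Longrightarrow> ract (V i) (g [^]\<^bsub>G\<^esub> n) = lam i \<cdot>\<^sub>m 1\<^sub>m (rdim (V i))"
  shows "(natural_map H \<in> Ring.ring_hom (green_ring H) (grothendieck_ring H) \<and>
      natural_map H ` carrier (green_ring H) = carrier (grothendieck_ring H) \<and>
      a_kernel (green_ring H) (grothendieck_ring H) (natural_map H) = projective_perp H \<and>
      ideal (projective_perp H) (green_ring H) \<and>
      is_ring_iso (grothendieck_ring H) (green_ring H Quot projective_perp H)) \<and>
    is_ring_iso (grothendieck_ring H)
      ((green_ring (group_algebra G))
        \<lparr>carrier := generate_ring (green_ring (group_algebra G)) (subring_generators G \<chi> n \<Omega> V lam)\<rparr>)"
proof -
  interpret group_datum_closed G \<chi> g n H by (rule group_datum_closed.intro[OF H])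
  have "is_ring_iso (grothendieck_ring H) ((green_ring (group_algebra G))
    \<lparr>carrier := generate_ring (green_ring (group_algebra G)) (subring_generators G \<chi> n \<Omega> V lam)\<rparr>)"
    by (rule grothendieck_iso_subring[OF V]) (rule lam)
  then show ?thesis unfolding projective_perp_exact
    by (intro conjI natural_map_hom natural_map_surj natural_map_kernel grothendieck_iso_quotient)
qed

end
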